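(* For every odd $d\ge5$ we have that $$\sigma_p(\mathbf L)\cap\{\lambda\in\mathbb C:\operatorname{Re}\lambda\ge0\}=\{1\}.$$
   Context: $\mathbb B^n$ is the unit ball of $\mathbb R^n$. $H^k_r(\mathbb B^n)=\{u:(0,1)\to\mathbb C:\ u(|\cdot|)\in H^k(\mathbb B^n)\}$ with the inherited norm; $\mathcal H=H_r^{\frac{d+1}2}\times H_r^{\frac{d-1}2}(\mathbb B^{d+2})$ (Hilbert space with the product inner product). $C^\infty_e[0,1]=\{u\in C^\infty[0,1]:u^{(2k+1)}(0)=0,\ k\in\mathbb N_0\}$. On the domain $C_e^\infty[0,1]^2\subset\mathcal H$ define $$\widetilde{\mathbf L}_0\mathbf u(\rho)=\begin{pmatrix}u_2(\rho)-\rho u_1'(\rho)-2u_1(\rho)\\ u_1''(\rho)+\frac{d+1}\rho u_1'(\rho)-\rho u_2'(\rho)-3u_2(\rho)\end{pmatrix};$$ this operator is closable in $\mathcal H$ and $\mathbf L_0$ denotes its closure. Let $$\alpha(d)=2\Big(1+\sqrt{\tfrac{d-4}{3(d-2)}}\Big),\quad \beta(d)=\tfrac13\big(2d-8+\sqrt{3(d-2)(d-4)}\big),$$ $$V_d(\rho)=\frac{3(d-2)\alpha(d)\big(2\beta(d)-(\alpha(d)-2)\rho^2\big)}{(\rho^2+\beta(d))^2},\qquad \mathbf L'\mathbf u=\begin{pmatrix}0\\ V_d u_1\end{pmatrix},$$ a bounded operator on $\mathcal H$, and $\mathbf L=\mathbf L_0+\mathbf L'$ with $\mathcal D(\mathbf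 L)=\mathcal D(\mathbf L_0)$. $\sigma_p(\mathbf L)$ denotes the point spectrum (set of eigenvalues) of $\mathbf L$ on $\mathcal H$. *)

theory Defs
  imports "HOL-Analysis.Analysis"
begin

section \<open>Smooth functions and Sobolev spaces of integer order\<close>

definition partial_deriv :: "'n::finite \<Rightarrow> (real ^ 'n \<Rightarrow> real) \<Rightarrow> real ^ 'n \<Rightarrow> real" where
  "partial_deriv i f x = frechet_derivative f (at x) (axis i 1)"

primrec iter_partial :: "'n::finite list \<Rightarrow> (real ^ 'n \<Rightarrow> real) \<Rightarrow> real ^ 'n \<Rightarrow> real" where
  "iter_partial [] f = f"
| "iter_partial (i # js) f = partial_deriv i (iter_partial js f)"

text \<open>The space \<open>C\<^sub>c\<^sup>\<infinity>(\<Omega>)\<close>, for open \<open>\<Omega>\<close>. Frechet differentiability of all iterated partial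
  derivatives makes all of them continuous, so this is smoothness in the usual sense.\<close>

definition test_function :: "(real ^ 'n::finite) set \<Rightarrow> (real ^ 'n \<Rightarrow> real) \<Rightarrow> bool" where
  "test_function \<Omega> \<phi> \<longleftrightarrow>
     (\<forall>js x. iter_partial js \<phi> differentiable (at x)) \<and>
     compact (closure {x. \<phi> x \<noteq> 0}) \<and> closure {x. \<phi> x \<noteq> 0} \<subseteq> \<Omega>"

definition locally_integrable :: "(real ^ 'n::finite) set \<Rightarrow> (real ^ 'n \<Rightarrow> complex) \<Rightarrow> bool" where
  "locally_integrable \<Omega> u \<longleftrightarrow> (\<forall>K. compact K \<and> K \<subseteq> \<Omega> \<longrightarrow> integrable (lebesgue_on K) u)"

definition weak_derivative ::
  "(real ^ 'n::finite) set \<Rightarrow> 'n list \<Rightarrow> (real ^ 'n \<Rightarrow> complex) \<Rightarrow> (real ^ 'n \<Rightarrow> complex) \<Rightarrow> bool" where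
  "weak_derivative \<Omega> js u v \<longleftrightarrow>
     locally_integrable \<Omega> u \<and> locally_integrable \<Omega> v \<and>
     (\<forall>\<phi>. test_function \<Omega> \<phi> \<longrightarrow>
        (LINT x|lebesgue_on \<Omega>. iter_partial js \<phi> x *\<^sub>R u x) =
        (- 1) ^ length js * (LINT x|lebesgue_on \<Omega>. \<phi> x *\<^sub>R v x))"

definition square_integrable :: "(real ^ 'n::finite) set \<Rightarrow> (real ^ 'n \<Rightarrow> complex) \<Rightarrow> bool" where
  "square_integrable \<Omega> u \<longleftrightarrow>
     u \<in> borel_measurable (lebesgue_on \<Omega>) \<and> integrable (lebesgue_on \<Omega>) (\<lambda>x. (cmod (u x))\<^sup>2)"

definition sobolev :: "nat \<Rightarrow> (real ^ 'n::finite) set \<Rightarrow> (real ^ 'n \<Rightarrow> complex) \<Rightarrow> bool" where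
  "sobolev k \<Omega> u \<longleftrightarrow> square_integrable \<Omega> u \<and>
     (\<forall>js. length js \<le> k \<longrightarrow> (\<exists>v. square_integrable \<Omega> v \<and> weak_derivative \<Omega> js u v))"

text \<open>The norm given by the sum over \<open>j \<le> k\<close> of the squared \<open>L\<^sup>2\<close> norms of the tensors \<open>D\<^sup>j u\<close>; the
  components of \<open>D\<^sup>j u\<close> are indexed by lists of \<open>j\<close> directions, so a mixed derivative is counted once
  for each order of differentiation. Weak derivatives are unique almost everywhere, so the
  integrals do not depend on the chosen representatives.\<close>

definition sobolev_norm :: "nat \<Rightarrow> (real ^ 'n::finite) set \<Rightarrow> (real ^ 'n \<Rightarrow> complex) \<Rightarrow> real" where
  "sobolev_norm k \<Omega> u = sqrt (\<Sum>js | length js \<le> k.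
     LINT x|lebesgue_on \<Omega>. (cmod ((SOME v. square_integrable \<Omega> v \<and> weak_derivative \<Omega> js u v) x))\<^sup>2)"

section \<open>The radial energy space\<close>

text \<open>A function on \<open>(0,1)\<close> is represented by a function on the reals, whose values outside \<open>(0,1)\<close>
  are irrelevant. The type argument fixes the dimension \<open>CARD('n)\<close> of the underlying ball.\<close>

type_synonym radial_pair = "(real \<Rightarrow> complex) \<times> (real \<Rightarrow> complex)"

definition radial_lift :: "'n::finite itself \<Rightarrow> (real \<Rightarrow> complex) \<Rightarrow> real ^ 'n \<Rightarrow> complex" where
  "radial_lift T u x = u (norm x)"

definition radial_sobolev :: "'n::finite itself \<Rightarrow> nat \<Rightarrow> (real \<Rightarrow> complex) set" where
  "radial_sobolev T k = {u. sobolev k (ball 0 1) (radial_lift T u)}"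

definition radial_sobolev_norm :: "'n::finite itself \<Rightarrow> nat \<Rightarrow> (real \<Rightarrow> complex) \<Rightarrow> real" where
  "radial_sobolev_norm T k u = sobolev_norm k (ball 0 1) (radial_lift T u)"

text \<open>For odd \<open>d\<close> both divisions by 2 are exact.\<close>

definition energy_space :: "'n::finite itself \<Rightarrow> nat \<Rightarrow> radial_pair set" where
  "energy_space T d = radial_sobolev T ((d + 1) div 2) \<times> radial_sobolev T ((d - 1) div 2)"

definition energy_dist :: "'n::finite itself \<Rightarrow> nat \<Rightarrow> radial_pair \<Rightarrow> radial_pair \<Rightarrow> real" where
  "energy_dist T d u v = sqrt (
     (radial_sobolev_norm T ((d + 1) div 2) (\<lambda>\<rho>. fst u \<rho> - fst v \<rho>))\<^sup>2 +
     (radial_sobolev_norm T ((d - 1) div 2) (\<lambda>\<rho>. snd u \<rho> - snd v \<rho>))\<^sup>2)"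

text \<open>Elements of the energy space are classes of functions modulo equality almost everywhere on
  the ball; this is the equality of the classes.\<close>

definition energy_eq :: "'n::finite itself \<Rightarrow> radial_pair \<Rightarrow> radial_pair \<Rightarrow> bool" where
  "energy_eq T u v \<longleftrightarrow> (AE x in lebesgue_on (ball 0 1).
     radial_lift T (fst u) x = radial_lift T (fst v) x \<and>
     radial_lift T (snd u) x = radial_lift T (snd v) x)"

section \<open>The operators\<close>

text \<open>Derivatives on \<open>[0,1]\<close>, one-sided at the end points.\<close>

definition deriv01 :: "(real \<Rightarrow> complex) \<Rightarrow> real \<Rightarrow> complex" where
  "deriv01 u t = vector_derivative u (at t within {0..1})"

definition smooth_even01 :: "(real \<Rightarrow> complex) set" where
  "smooth_even01 = {u.
     (\<forall>k. \<forall>t\<in>{0..1}. (deriv01 ^^ k) u differentiable (at t within {0..1})) \<and>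
     (\<forall>k. (deriv01 ^^ (2 * k + 1)) u 0 = 0)}"

definition L0_tilde :: "nat \<Rightarrow> radial_pair \<Rightarrow> radial_pair" where
  "L0_tilde d = (\<lambda>(u1, u2).
     (\<lambda>\<rho>. u2 \<rho> - of_real \<rho> * deriv01 u1 \<rho> - 2 * u1 \<rho>,
      \<lambda>\<rho>. deriv01 (deriv01 u1) \<rho> + of_real ((real d + 1) / \<rho>) * deriv01 u1 \<rho>
           - of_real \<rho> * deriv01 u2 \<rho> - 3 * u2 \<rho>))"

text \<open>Unbounded operators are given by their graphs, here as sets of pairs of representatives. The
  closure of an operator has as its graph the closure of the graph in the product of the energy
  space with itself.\<close>

definition L0_graph :: "'n::finite itself \<Rightarrow> nat \<Rightarrow> (radial_pair \<times> radial_pair) set" where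
  "L0_graph T d = {(u, f). u \<in> energy_space T d \<and> f \<in> energy_space T d \<and>
     (\<exists>w :: nat \<Rightarrow> radial_pair. (\<forall>m. w m \<in> smooth_even01 \<times> smooth_even01) \<and>
        (\<lambda>m. energy_dist T d (w m) u) \<longlonglongrightarrow> 0 \<and>
        (\<lambda>m. energy_dist T d (L0_tilde d (w m)) f) \<longlonglongrightarrow> 0)}"

definition alpha :: "nat \<Rightarrow> real" where
  "alpha d = 2 * (1 + sqrt ((real d - 4) / (3 * (real d - 2))))"

definition beta :: "nat \<Rightarrow> real" where
  "beta d = (1 / 3) * (2 * real d - 8 + sqrt (3 * (real d - 2) * (real d - 4)))"

definition V :: "nat \<Rightarrow> real \<Rightarrow> real" where
  "V d \<rho> = 3 * (real d - 2) * alpha d * (2 * beta d - (alpha d - 2) * \<rho>\<^sup>2) / (\<rho>\<^sup>2 + beta d)\<^sup>2"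

definition L_prime :: "nat \<Rightarrow> radial_pair \<Rightarrow> radial_pair" where
  "L_prime d = (\<lambda>(u1, u2). (\<lambda>\<rho>. 0, \<lambda>\<rho>. of_real (V d \<rho>) * u1 \<rho>))"

definition L_graph :: "'n::finite itself \<Rightarrow> nat \<Rightarrow> (radial_pair \<times> radial_pair) set" where
  "L_graph T d = {(u, (\<lambda>\<rho>. fst f \<rho> + fst (L_prime d u) \<rho>, \<lambda>\<rho>. snd f \<rho> + snd (L_prime d u) \<rho>)) | u f.
     (u, f) \<in> L0_graph T d}"

definition point_spectrum :: "'n::finite itself \<Rightarrow> (radial_pair \<times> radial_pair) set \<Rightarrow> complex set" where
  "point_spectrum T G = {z. \<exists>u f. (u, f) \<in> G \<and>
     \<not> energy_eq T u (\<lambda>\<rho>. 0, \<lambda>\<rho>. 0) \<and>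
     energy_eq T f (\<lambda>\<rho>. z * fst u \<rho>, \<lambda>\<rho>. z * snd u \<rho>)}"

end

(* An eigenfunction is, by passage to the limit along the smooth approximants, almost everywhere a
   classical solution of the radial second-order equation on (0,1), and square integrability near 0
   selects the solution that is regular there. In s = rho^2 and after multiplication by
   (s + beta)^2 this solution is a power series whose coefficients satisfy a three-term recurrence.
   For Re z >= 0, z ~= 1, a continued-fraction estimate shows that the ratios of consecutive
   coefficients follow the dominant branch of the recurrence, so that the coefficients grow like
   those of a constant multiple, with nonzero factor, of a function that is singular at the light
   cone s = 1. Applying the Euler field x . grad (d-1)/2 times, as Sobolev regularity permits,
   turns the singularity into a pole that is not square integrable. The eigenvalue 1 has an explicit
   eigenfunction with first component 1 / (rho^2 + beta)^2. *)
theory Submission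
  imports Defs "HOL-Real_Asymp.Real_Asymp"
begin

section \<open>Three-term recurrences and the ratio of consecutive coefficients\<close>

text \<open>In \<open>s\<close> the equation has the singular points 0, 1, -beta and infinity, so
  there is no Gauss connection formula from 0 to 1. With b = 1/beta the limiting characteristic
  equation of the recurrence is t^2 = (1 - b) t + b; its roots 1 and -b belong to the singular
  points 1 and -beta, and beta > 1. The spectral question thus becomes the exclusion of the
  recessive root -b, for all z of the half plane and all odd d at once. The exponents at s = 1 are 0
  and (d - 3)/2 - z. Their difference may be an integer, and a Frobenius argument would then have to
  deal with logarithms; the growth of the coefficients decides all cases alike, and the Euler field
  is the derivative that acts diagonally on them. After (d - 1)/2 applications the exponent (d -
  3)/2 - z has become -1 - z, which is beyond square integrability for every Re z \<ge> 0. The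
  factor (s + beta)^2 is the reciprocal of the eigenfunction for z = 1, so at z = 1 the series would
  reduce to the constant 1; this is why z = 1 shows up below as the vanishing of the factor \<mu> -
  1/2.\<close>

fun coef :: "real \<Rightarrow> real \<Rightarrow> complex \<Rightarrow> nat \<Rightarrow> complex" where
  "coef b c \<mu> 0 = 1"
| "coef b c \<mu> (Suc 0) = (\<mu> - 1/2) * (\<mu> + 3) / of_real c"
| "coef b c \<mu> (Suc (Suc k)) =
     (((of_nat (Suc k) + \<mu> - 1/2) * (of_nat (Suc k) + \<mu> + 3)
        - of_real (b * real (Suc k) * (real (Suc k) + c - 5))) * coef b c \<mu> (Suc k)
      + of_real b * (of_nat (Suc k) + \<mu> - 3/2) * (of_nat (Suc k) + \<mu> - 2) * coef b c \<mu> k)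
     / of_real ((real (Suc k) + 1) * (real (Suc k) + c))"

lemma Re_nz: "Re z > 0 \<Longrightarrow> z \<noteq> 0" by auto

text \<open>Inversion maps the half plane Re w \<ge> x into the disc with diameter [0, 1/x]. The
  terms of the continued fraction are estimated through this: a reciprocal has nonnegative real part
  and small modulus.\<close>

lemma inverse_right_half_plane:
  fixes w :: complex
  assumes "Re w \<ge> x" "x > 0"
  shows "0 \<le> Re (1/w)" "Re (1/w) \<le> 1/x" "cmod (1/w) \<le> 1/x" "w \<noteq> 0"
proof -
  show w: "w \<noteq> 0" using assms by auto
  have "x \<le> cmod w" using assms complex_Re_le_cmod[of w] by linarith
  then show n: "cmod (1/w) \<le> 1/x" using assms w by (simp add: norm_divide frac_le)
  show "0 \<le> Re (1/w)" using assms by (simp add: Re_divide)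
  show "Re (1/w) \<le> 1/x" using n complex_Re_le_cmod[of "1/w"] by linarith
qed

text \<open>In the application \<open>b = 1 / beta d\<close>, \<open>c = (d + 2) / 2\<close> and
  \<open>\<mu> = z / 2\<close>. At b = 0 the recurrence is that of the Gauss series F(\<mu> - 1/2,
  \<mu> + 3; c; s); the perturbation is not small, since b equals 3/5 at d = 5. The bound on
  \<open>b * (c - 3)\<close> is uniform although c grows with d, so that one argument serves all
  dimensions.\<close>

locale perturbed_hypergeometric =
  fixes b c :: real and \<mu> :: complex
  assumes b0: "0 < b" and b1: "b \<le> 3/5" and c: "7/2 \<le> c" and bc: "b * (c - 3) \<le> 41/100"
    and mu: "Re \<mu> \<ge> 0" and mu12: "\<mu> \<noteq> 1/2"
begin

abbreviation a :: "nat \<Rightarrow> complex" where "a \<equiv> coef b c \<mu>"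

lemma a_rec:
  assumes "n \<ge> 1"
  shows "of_nat (n+1) * (of_nat n + of_real c) * a (n+1) =
    ((of_nat n + \<mu> - 1/2) * (of_nat n + \<mu> + 3) - of_real b * of_nat n * (of_nat n + of_real c - 5)) * a n
    + of_real b * (of_nat n + \<mu> - 3/2) * (of_nat n + \<mu> - 2) * a (n-1)"
proof -
  obtain k where n: "n = Suc k" using assms by (cases n) auto
  define D where "D = complex_of_real ((real n + 1) * (real n + c))"
  have D: "D = of_nat (n+1) * (of_nat n + of_real c)" unfolding D_def by simp
  have "(real n + 1) * (real n + c) > 0" using c by (intro mult_pos_pos) auto
  then have nz: "D \<noteq> 0" unfolding D_def by (simp only: of_real_eq_0_iff)
  have "a (n+1) = a (Suc (Suc k))" using n by simp
  also have "\<dots> = (((of_nat n + \<mu> - 1/2) * (of_nat n + \<mu> + 3)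
        - of_real (b * real n * (real n + c - 5))) * a n
      + of_real b * (of_nat n + \<mu> - 3/2) * (of_nat n + \<mu> - 2) * a k) / D"
    unfolding D_def n by (rule coef.simps(3))
  also have "of_real (b * real n * (real n + c - 5)) = of_real b * of_nat n * (of_nat n + of_real c - 5)" by simp
  also have "k = n - 1" using n by simp
  finally have "D * a (n+1) = ((of_nat n + \<mu> - 1/2) * (of_nat n + \<mu> + 3) - of_real b * of_nat n * (of_nat n + of_real c - 5)) * a n
    + of_real b * (of_nat n + \<mu> - 3/2) * (of_nat n + \<mu> - 2) * a (n-1)"
    using nz by (simp only: nonzero_mult_div_cancel_left times_divide_eq_right not_False_eq_True)
  then show ?thesis unfolding D .
qed

lemma a1: "a 1 = (\<mu> - 1/2) * (\<mu> + 3) / of_real c" "a 1 \<noteq> 0"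
proof -
  show e: "a 1 = (\<mu> - 1/2) * (\<mu> + 3) / of_real c" by simp
  have "\<mu> + 3 \<noteq> 0" using mu by (auto intro!: Re_nz)
  moreover have "\<mu> - 1/2 \<noteq> 0" using mu12 by simp
  ultimately show "a 1 \<noteq> 0" unfolding e using c by (simp only: divide_eq_0_iff mult_eq_0_iff of_real_eq_0_iff) simp
qed

text \<open>This is the ratio of a_2 to a_1 times 2 (1 + c) / (\<mu> + 1/2). It replaces
  \<open>tau 1\<close> of the general pattern, whose denominator contains \<mu> and vanishes when z
  = 0.\<close>

definition tau1 :: complex where
  "tau1 = \<mu> + 4 + of_real (b * (4 - c)) / (\<mu> + 1/2) + of_real (b * c) * (\<mu> - 1) / ((\<mu> + 1/2) * (\<mu> + 3))"

lemma a2: "a 2 = a 1 * (tau1 * (\<mu> + 1/2) / (2 * (1 + of_real c)))"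
proof -
  have nz: "\<mu> + 3 \<noteq> 0" "\<mu> + 1/2 \<noteq> 0" using mu by (auto intro!: Re_nz)
  have nc: "1 + complex_of_real c \<noteq> 0" "complex_of_real c \<noteq> 0" using c by (auto intro!: Re_nz)
  have t: "tau1 * (\<mu> + 1/2) = (\<mu> + 4) * (\<mu> + 1/2) + of_real (b * (4 - c)) + of_real (b*c) * (\<mu> - 1) / (\<mu> + 3)"
  proof -
    have "x / (p * q) * p = x / q" if "p \<noteq> 0" for x p q :: complex using that by simp
    from this[OF nz(2), of "of_real (b * c) * (\<mu> - 1)" "\<mu> + 3"] show ?thesis
      unfolding tau1_def distrib_right[of _ _ "\<mu> + 1/2"] using nz(2)
      by (simp only: nonzero_divide_eq_eq[symmetric] nonzero_eq_divide_eq[symmetric] times_divide_eq_left nonzero_mult_div_cancel_right) simp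
  qed
  define p where "p = \<mu> + 1/2"
  have mup: "\<mu> = p - 1/2" unfolding p_def by simp
  have A1: "a 1 * of_real c = (p - 1) * (\<mu> + 3)" unfolding a1 mup using nc by simp
  have "2 * (1 + of_real c) * a 2 =
    ((1 + \<mu> - 1/2) * (1 + \<mu> + 3) - of_real b * (1 + of_real c - 5)) * a 1
    + of_real b * (1 + \<mu> - 3/2) * (1 + \<mu> - 2)"
    using a_rec[of 1] by (simp add: numeral_2_eq_2)
  also have "of_real b * (1 + \<mu> - 3/2) * (1 + \<mu> - 2) = a 1 * of_real c * (of_real b * (\<mu> - 1) / (\<mu> + 3))"
    unfolding A1 using nz by (simp add: mup)
  also have "((1 + \<mu> - 1/2) * (1 + \<mu> + 3) - of_real b * (1 + of_real c - 5)) =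
      (\<mu> + 4) * (\<mu> + 1/2) + of_real (b * (4 - c))" by (simp add: mup algebra_simps)
  finally have E: "2 * (1 + of_real c) * a 2 = ((\<mu> + 4) * (\<mu> + 1/2) + of_real (b * (4 - c))) * a 1
     + a 1 * of_real c * (of_real b * (\<mu> - 1) / (\<mu> + 3))" .
  have "2 * (1 + of_real c) * a 2 = a 1 * (tau1 * (\<mu> + 1/2))"
  proof -
    have "of_real (b*c) * (\<mu> - 1) / (\<mu> + 3) = of_real c * (of_real b * (\<mu> - 1) / (\<mu> + 3))" by simp
    then show ?thesis
      unfolding E t by (simp only: distrib_left mult_ac)
  qed
  moreover have "2 * (1 + of_real c) \<noteq> (0::complex)"
    using mult_eq_0_iff[of 2 "1 + complex_of_real c"] nc(1) by simp
  moreover have "x = y * (z / k)" if "k * x = y * z" "k \<noteq> 0" for x y z k :: complex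
    using that by (simp add: divide_simps mult_ac)
  ultimately show ?thesis by blast
qed

lemma Re_tau1: "Re tau1 \<ge> 17/10"
proof -
  have nz: "\<mu> + 3 \<noteq> 0" "\<mu> + 1/2 \<noteq> 0" using mu by (auto intro!: Re_nz)
  define P where "P = 4 * b - 8/5 * (b*c)"
  define i where "i = 1/(\<mu>+1/2)"
  define j where "j = 1/(\<mu>+3)"
  \<comment> \<open>Partial fractions: each reciprocal then stands alone and falls under
    \<open>inverse_right_half_plane\<close>.\<close>
  have e1: "(\<mu> - 1) / ((\<mu> + 1/2) * (\<mu> + 3)) = - 3/5 * i + 8/5 * j"
  proof -
    have i: "i * (\<mu> + 1/2) = 1" and j: "j * (\<mu> + 3) = 1" unfolding i_def j_def using nz by auto
    have "(- 3/5 * i + 8/5 * j) * ((\<mu> + 1/2) * (\<mu> + 3)) =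
       - 3/5 * (i * (\<mu> + 1/2)) * (\<mu> + 3) + 8/5 * (j * (\<mu> + 3)) * (\<mu> + 1/2)" by (simp add: algebra_simps add_divide_distrib)
    also have "\<dots> = \<mu> - 1" unfolding i j by (simp add: field_simps)
    finally show ?thesis using nz by (simp add: eq_divide_eq divide_eq_eq)
  qed
  have "tau1 = \<mu> + 4 + of_real (b * (4 - c)) * i + of_real (b * c) * ((\<mu> - 1) / ((\<mu> + 1/2) * (\<mu> + 3)))"
    unfolding tau1_def i_def by simp
  also have "\<dots> = \<mu> + 4 + of_real P * i + of_real (8/5 * (b*c)) * j"
    unfolding e1 P_def by (simp add: algebra_simps)
  finally have "Re tau1 = Re \<mu> + 4 + P * Re i + 8/5 * (b*c) * Re j" by simp
  moreover have "Re i \<ge> 0" "Re i \<le> 2" "Re j \<ge> 0"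
    using inverse_right_half_plane[of "1/2" "\<mu>+1/2"] inverse_right_half_plane[of "3" "\<mu>+3"] mu
    unfolding i_def j_def by auto
  \<comment> \<open>From \<open>b * c \<le> 41/100 + 3 * b\<close> follows P \<ge> -656/1000 - 4/5
    b, and b \<le> 3/5 gives -1136/1000. Doubled and taken from 4 this leaves 1728/1000.\<close>
  moreover have "P \<ge> - 1136/1000" using bc b1 unfolding P_def by (simp add: algebra_simps)
  moreover have "8/5 * (b*c) * Re j \<ge> 0" using b0 c \<open>Re j \<ge> 0\<close> by simp
  moreover have "P * Re i \<ge> - 1136/1000 * 2"
  proof -
    have "P * Re i \<ge> - 1136/1000 * Re i" using \<open>Re i \<ge> 0\<close> \<open>P \<ge> - 1136/1000\<close> by (rule mult_right_mono[rotated])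
    then show ?thesis using \<open>Re i \<le> 2\<close> by linarith
  qed
  ultimately show ?thesis using mu by linarith
qed

text \<open>Dividing by n + \<mu> - 1 lets the factor n + \<mu> - 2 in the last coefficient of the
  recurrence cancel against the one in \<open>tau (n - 1)\<close>. What remains of that coefficient
  is (n + \<mu> - 3/2) / (n + \<mu> - 1), that is 1 minus half a reciprocal.\<close>

definition tau :: "nat \<Rightarrow> complex" where
  "tau n = a (n+1) * of_nat (n+1) * (of_nat n + of_real c) / ((of_nat n + \<mu> - 1) * a n)"

lemma tau2: "a 2 \<noteq> 0" "Re (tau 2) \<ge> 2"
proof -
  have nz: "\<mu> + 3 \<noteq> 0" "\<mu> + 1/2 \<noteq> 0" "\<mu> + 1 \<noteq> 0" "tau1 \<noteq> 0"
    using mu Re_tau1 by (auto intro!: Re_nz)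
  have nc: "1 + complex_of_real c \<noteq> 0" using c by (auto intro!: Re_nz)
  have nc2: "2 * (1 + complex_of_real c) \<noteq> 0"
    using mult_eq_0_iff[of 2 "1 + complex_of_real c"] nc by simp
  have nz_quot: "x * (y * z / k) \<noteq> 0" if "x \<noteq> 0" "y \<noteq> 0" "z \<noteq> 0" "k \<noteq> 0" for x y z k :: complex
    using that by simp
  show a2nz: "a 2 \<noteq> 0" unfolding a2 by (rule nz_quot[OF a1(2) nz(4,2) nc2])
  define i where "i = 1/(1+\<mu>)"
  define j where "j = 1/tau1"
  have "of_nat 3 * (2 + of_real c) * a 3 =
    ((2 + \<mu> - 1/2) * (2 + \<mu> + 3) - of_real b * 2 * (2 + of_real c - 5)) * a 2
    + of_real b * (2 + \<mu> - 3/2) * (2 + \<mu> - 2) * a 1"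
    using a_rec[of 2] by (simp add: numeral_3_eq_3 numeral_2_eq_2)
  also have "a 1 = a 2 * (2 * (1 + of_real c) / (tau1 * (\<mu> + 1/2)))"
  proof -
    have "x = x * (y * z / k) * (k / (y * z))" if "y \<noteq> 0" "z \<noteq> 0" "k \<noteq> 0" for x y z k :: complex
      using that by simp
    from this[OF nz(4,2) nc2, of "a 1"] show ?thesis unfolding a2 .
  qed
  finally have E: "of_nat 3 * (2 + of_real c) * a 3 = a 2 *
     ((2 + \<mu> - 1/2) * (2 + \<mu> + 3) - of_real b * 2 * (2 + of_real c - 5) +
      of_real b * (2 + \<mu> - 3/2) * \<mu> * (2 * (1 + of_real c) / (tau1 * (\<mu> + 1/2))))"
    by (simp only: distrib_left mult_ac diff_add_cancel add_diff_cancel_left')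
  have T: "tau 2 = a 3 * of_nat 3 * (2 + of_real c) / ((\<mu>+1) * a 2)"
  proof -
    have "2 + 1 = (3::nat)" "of_nat 2 + \<mu> - 1 = \<mu> + 1" "of_nat 2 + complex_of_real c = 2 + of_real c" by simp_all
    then show ?thesis unfolding tau_def by (simp only:)
  qed
  have "tau 2 = ((2 + \<mu> - 1/2) * (2 + \<mu> + 3) - of_real b * 2 * (2 + of_real c - 5) +
      of_real b * (2 + \<mu> - 3/2) * \<mu> * (2 * (1 + of_real c) / (tau1 * (\<mu> + 1/2)))) / (\<mu>+1)"
  proof -
    have "x * l * k / (w * y) = z / w" if "l * k * x = y * z" "y \<noteq> 0" for x y z w k l :: complex
      using that by (simp add: mult_ac)
    from this[OF E a2nz] show ?thesis unfolding T .
  qed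
  \<comment> \<open>The factor \<mu> + 1/2 of the recurrence cancels the one in the normalisation of
    \<open>tau1\<close>, which was chosen for this purpose.\<close>
  moreover have "of_real b * (2 + \<mu> - 3/2) * \<mu> * (2 * (1 + of_real c) / (tau1 * (\<mu> + 1/2)))
     = of_real (2 * b * (1 + c)) * \<mu> * j"
  proof -
    have "x * p * m * (2 * k / (t * p)) = 2 * x * k * m * (1/t)" if "p \<noteq> 0" for x p m k t :: complex
      using that by simp
    from this[OF nz(2), of "of_real b" \<mu> "1 + of_real c" tau1] show ?thesis unfolding j_def
      by (simp add: algebra_simps)
  qed
  ultimately have "tau 2 = ((2 + \<mu> - 1/2) * (2 + \<mu> + 3) - of_real b * 2 * (2 + of_real c - 5) +
       of_real (2 * b * (1 + c)) * \<mu> * j) / (\<mu>+1)" by simp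
  also have "\<dots> = \<mu> + 11/2 + of_real (2 - 2 * (b * (c-3))) * i + of_real (2 * b * (1 + c)) * ((\<mu> * i) * j)"
  proof -
    have distr: "q * (x + r * i + s * ((m * i) * j)) = q * x + r * (q * i) + s * (m * (q * i) * j)"
      for q x r s m i j :: complex by (simp add: algebra_simps)
    have i: "(\<mu>+1) * i = 1" unfolding i_def using nz by (simp add: add.commute)
    have "(\<mu>+1) * (\<mu> + 11/2 + of_real (2 - 2 * (b * (c-3))) * i + of_real (2 * b * (1 + c)) * ((\<mu> * i) * j))
      = (\<mu>+1) * (\<mu> + 11/2) + of_real (2 - 2 * (b * (c-3))) * ((\<mu>+1) * i) + of_real (2 * b * (1 + c)) * (\<mu> * ((\<mu>+1) * i) * j)"
      by (rule distr)
    also have "\<dots> = (2 + \<mu> - 1/2) * (2 + \<mu> + 3) - of_real b * 2 * (2 + of_real c - 5) +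
       of_real (2 * b * (1 + c)) * \<mu> * j" unfolding i by (simp add: algebra_simps add_divide_distrib)
    finally have F: "(\<mu>+1) * (\<mu> + 11/2 + of_real (2 - 2 * (b * (c-3))) * i + of_real (2 * b * (1 + c)) * ((\<mu> * i) * j))
      = (2 + \<mu> - 1/2) * (2 + \<mu> + 3) - of_real b * 2 * (2 + of_real c - 5) + of_real (2 * b * (1 + c)) * \<mu> * j" .
    have "y / q = x" if "q * x = y" "q \<noteq> 0" for x y q :: complex using that by auto
    from this[OF F nz(3)] show ?thesis .
  qed
  finally have "Re (tau 2) = Re \<mu> + 11/2 + (2 - 2 * (b * (c-3))) * Re i + 2 * b * (1 + c) * Re ((\<mu> * i) * j)"
    by simp
  moreover have "Re i \<ge> 0" using inverse_right_half_plane[of 1 "1+\<mu>"] mu unfolding i_def by auto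
  \<comment> \<open>For Re \<mu> \<ge> 0 adding 1 does not decrease the modulus, so
    \<open>\<mu> * i\<close> lies in the closed unit disc. Nothing is known about the argument of
    its product with j, hence the estimate by moduli.\<close>
  moreover have "cmod \<mu> \<le> cmod (1 + \<mu>)" unfolding cmod_def using mu by (auto intro!: real_sqrt_le_mono power_mono)
  then have "cmod (\<mu> * i) \<le> 1" unfolding i_def using nz by (simp add: norm_divide norm_mult divide_simps add.commute)
  moreover have "cmod j \<le> 10/17" using inverse_right_half_plane(3)[of "17/10" tau1] Re_tau1 unfolding j_def by simp
  ultimately have *: "cmod ((\<mu> * i) * j) \<le> 1 * (10/17)" unfolding norm_mult[of "\<mu> * i"]
    by (intro mult_mono) auto
  have "Re ((\<mu> * i) * j) \<ge> - (10/17)" using * abs_Re_le_cmod[of "(\<mu> * i) * j"] by linarith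
  \<comment> \<open>Since \<open>2 * b * (1 + c) = 2 * (b * (c - 3)) + 8 * b\<close>, the bound is
    82/100 + 480/100. Times 10/17 it stays below 331/100, so that 11/2 leaves more than 2.\<close>
  moreover have "0 \<le> 2 * b * (1 + c)" "2 * b * (1+c) \<le> 562/100" using bc b1 b0 c by (auto simp: algebra_simps)
  ultimately have "2 * b * (1 + c) * Re ((\<mu> * i) * j) \<ge> 562/100 * - (10/17)"
  proof -
    assume k: "0 \<le> 2 * b * (1 + c)" "2 * b * (1+c) \<le> 562/100" and r: "Re ((\<mu> * i) * j) \<ge> - (10/17)"
    have "2 * b * (1 + c) * Re ((\<mu> * i) * j) \<ge> 2 * b * (1 + c) * - (10/17)" using k r by (intro mult_left_mono) auto
    moreover have "2 * b * (1 + c) * - (10/17) \<ge> 562/100 * - (10/17)" using k by linarith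
    ultimately show ?thesis by linarith
  qed
  moreover have "(2 - 2 * (b * (c-3))) * Re i \<ge> 0" using bc \<open>Re i \<ge> 0\<close> by simp
  ultimately show "Re (tau 2) \<ge> 2" using mu \<open>Re (tau 2) = _\<close> by linarith
qed

text \<open>The continued fraction maps the half plane Re t \<ge> 2 into itself. Only two terms can
  lower the real part, by at most R / (n - 1) and K / (4 (n - 1)), and R + K/4 grows at most like
  (3/5 + 3/20) n^2; the leading term gains n (n - 1), which is more.\<close>

lemma tau_step:
  fixes n :: nat and t :: complex
  assumes n: "n \<ge> 3" and t: "Re t \<ge> 2"
  shows "Re ((of_nat n + \<mu>) + 7/2 + of_real (2 - b * n * (n + c - 5)) * (1 / (of_nat n + \<mu> - 1))
       + of_real (b * n * (n + c - 1)) * (1 - 1/2 * (1 / (of_nat n + \<mu> - 1))) * (1/t)) \<ge> 2"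
proof -
  define i where "i = 1 / (of_nat n + \<mu> - 1)"
  define j where "j = 1/t"
  define R where "R = b * n * (n + c - 5) - 2"
  define K where "K = b * n * (n + c - 1)"
  have n3: "real n \<ge> 3" using n by simp
  have i: "Re i \<ge> 0" "Re i \<le> 1/(real n - 1)" "cmod i \<le> 1/(real n - 1)"
    using inverse_right_half_plane[of "real n - 1" "of_nat n + \<mu> - 1"] mu n3 unfolding i_def by auto
  have j: "Re j \<ge> 0" "cmod j \<le> 1/2" using inverse_right_half_plane[of 2 t] t unfolding j_def by auto
  have K0: "K \<ge> 0" unfolding K_def using b0 c n3 by simp
  have "cmod (i*j) \<le> 1/(real n - 1) * (1/2)" unfolding norm_mult using i j n3 by (intro mult_mono) auto
  then have ij: "Re (i*j) \<le> 1/(real n - 1) * (1/2)" using complex_Re_le_cmod[of "i*j"] by linarith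
  have Rb: "R \<le> 41/100 * n + 3/5 * n * (real n - 2) - 2"
  proof -
    have "b * (c-3) * n \<le> 41/100 * n" using bc by (intro mult_right_mono) auto
    moreover have "b * (n * (real n - 2)) \<le> 3/5 * (n * (real n - 2))" using b1 n3 by (intro mult_right_mono) auto
    ultimately have "b * (c-3) * n + b * (n * (real n - 2)) \<le> 41/100 * n + 3/5 * (n * (real n - 2))" by (rule add_mono)
    moreover have "R = b * (c-3) * n + b * (n * (real n - 2)) - 2" unfolding R_def by (simp add: algebra_simps)
    ultimately show ?thesis by simp
  qed
  have Kb: "K \<le> 41/100 * n + 3/5 * n * (real n + 2)"
  proof -
    have "b * (c-3) * n \<le> 41/100 * n" using bc by (intro mult_right_mono) auto
    moreover have "b * (n * (real n + 2)) \<le> 3/5 * (n * (real n + 2))" using b1 n3 by (intro mult_right_mono) auto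
    ultimately have "b * (c-3) * n + b * (n * (real n + 2)) \<le> 41/100 * n + 3/5 * (n * (real n + 2))" by (rule add_mono)
    moreover have "K = b * (c-3) * n + b * (n * (real n + 2))" unfolding K_def by (simp add: algebra_simps)
    ultimately show ?thesis by simp
  qed
  \<comment> \<open>The maximum with 0 covers a negative R, for which the upper bound on
    \<open>Re i\<close> could not be inserted.\<close>
  have main: "max R 0 + K/4 \<le> (real n + 3/2) * (real n - 1)"
  proof -
    have sq: "real n * real n \<ge> 3 * real n" using n3 by (intro mult_right_mono) auto
    have e: "(real n + 3/2) * (real n - 1) = real n * real n + real n / 2 - 3/2" by (simp add: field_simps)
    have eR: "3/5 * n * (real n - 2) = 3/5 * (real n * real n) - 6/5 * real n" by (simp add: field_simps)
    have eK: "3/5 * n * (real n + 2) = 3/5 * (real n * real n) + 6/5 * real n" by (simp add: field_simps)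
    have "R + K/4 \<le> (real n + 3/2) * (real n - 1)" using Rb Kb sq n3 unfolding e eR eK by linarith
    moreover have "K/4 \<le> (real n + 3/2) * (real n - 1)" using Kb sq n3 unfolding e eK by linarith
    ultimately show ?thesis by (simp add: max_def)
  qed
  have "Re ((of_nat n + \<mu>) + 7/2 + of_real (- R) * i + of_real K * (1 - 1/2 * i) * j)
     = n + Re \<mu> + 7/2 - R * Re i + K * Re j - K/2 * Re (i * j)"
    by (simp add: field_simps)
  moreover have "K * Re j \<ge> 0" using K0 j by simp
  moreover have "K/2 * Re (i*j) \<le> K/2 * (1/(real n - 1) * (1/2))" using ij K0 by (intro mult_left_mono) auto
  moreover have "R * Re i \<le> max R 0 * (1/(real n - 1))"
  proof -
    have "R * Re i \<le> max R 0 * Re i" using i by (intro mult_right_mono) auto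
    also have "\<dots> \<le> max R 0 * (1/(real n - 1))" using i by (intro mult_left_mono) auto
    finally show ?thesis .
  qed
  moreover have "max R 0 * (1/(real n - 1)) + K/2 * (1/(real n - 1) * (1/2)) \<le> real n + 3/2"
  proof -
    have "(max R 0 + K/4) / (real n - 1) \<le> real n + 3/2" using main n3 by (subst pos_divide_le_eq) auto
    then show ?thesis by (simp add: add_divide_distrib)
  qed
  ultimately have "Re ((of_nat n + \<mu>) + 7/2 + of_real (- R) * i + of_real K * (1 - 1/2 * i) * j) \<ge> 2"
    using mu by linarith
  then show ?thesis unfolding R_def K_def i_def j_def by (simp add: algebra_simps)
qed

text \<open>Nonvanishing of \<open>a n\<close> is carried along because \<open>tau n\<close> divides
  by it; conversely \<open>tau n \<noteq> 0\<close> yields \<open>a (Suc n) \<noteq> 0\<close>. The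
  recurrence at index m, divided by (m + \<mu> - 1) a_m, is the continued fraction of
  \<open>tau_step\<close>.\<close>

lemma Re_tau: "n \<ge> 2 \<Longrightarrow> a n \<noteq> 0 \<and> Re (tau n) \<ge> 2"
proof (induction n rule: dec_induct)
  case base
  then show ?case using tau2 by simp
next
  case (step n)
  define m where "m = Suc n"
  have m3: "m \<ge> 3" using step m_def by simp
  have nm: "n = m - 1" "of_nat n = (of_nat m - 1 :: complex)" unfolding m_def by auto
  have an: "a n \<noteq> 0" and tn: "Re (tau n) \<ge> 2" using step by auto
  then have tnz: "tau n \<noteq> 0" by auto
  have "real m \<ge> 3" using m3 by simp
  then have N: "of_nat m + \<mu> - 1 \<noteq> 0" "of_nat m + \<mu> - 2 \<noteq> 0" using mu by (intro Re_nz; simp)+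
  have mc: "of_nat m + of_real c - 1 \<noteq> (0::complex)" "of_nat m \<noteq> (0::complex)" "of_nat m + of_real c \<noteq> (0::complex)"
    "of_nat (m+1) \<noteq> (0::complex)"
    using m3 c by (auto intro!: Re_nz simp: m_def)
  have tn_eq: "tau n * (of_nat m + \<mu> - 2) * a n = a m * of_nat m * (of_nat m + of_real c - 1)"
  proof -
    have "n + 1 = m" unfolding m_def by simp
    moreover have "of_nat n + \<mu> - 1 = of_nat m + \<mu> - 2" unfolding nm(2) by simp
    ultimately show ?thesis unfolding tau_def nm(2) using an N by simp
  qed
  then have amnz: "a m \<noteq> 0" using tnz N mc an by auto
  have an_eq: "a n = a m * of_nat m * (of_nat m + of_real c - 1) / (tau n * (of_nat m + \<mu> - 2))"
    unfolding tn_eq[symmetric] using tnz N by simp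
  define M where "M = of_nat m + \<mu>"
  have "of_nat (m+1) * (of_nat m + of_real c) * a (m+1) =
    ((M - 1/2) * (M + 3) - of_real b * of_nat m * (of_nat m + of_real c - 5)) * a m
    + of_real b * (M - 3/2) * (M - 2) * a n"
    using a_rec[of m] m3 unfolding M_def nm(1) by simp
  also have "\<dots> = a m * (((M - 1/2) * (M + 3) - of_real b * of_nat m * (of_nat m + of_real c - 5))
      + of_real b * (M - 3/2) * of_nat m * (of_nat m + of_real c - 1) / tau n)"
    unfolding an_eq M_def using tnz N by (simp add: divide_simps) (simp add: algebra_simps)
  finally have E: "of_nat (m+1) * (of_nat m + of_real c) * a (m+1) =
     a m * (((M - 1/2) * (M + 3) - of_real b * of_nat m * (of_nat m + of_real c - 5))
      + of_real b * (M - 3/2) * of_nat m * (of_nat m + of_real c - 1) / tau n)" .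
  have "tau m = (((M - 1/2) * (M + 3) - of_real b * of_nat m * (of_nat m + of_real c - 5))
      + of_real b * (M - 3/2) * of_nat m * (of_nat m + of_real c - 1) / tau n) / (M - 1)"
  proof -
    have "x * l * k / (w * y) = z / w" if "l * k * x = y * z" "y \<noteq> 0" for x y z w k l :: complex
      using that by (simp add: mult_ac)
    from this[OF E amnz] show ?thesis unfolding tau_def[of m] M_def[symmetric] .
  qed
  also have "\<dots> = M + 7/2 + of_real (2 - b * m * (m + c - 5)) * (1 / (M - 1))
       + of_real (b * m * (m + c - 1)) * (1 - 1/2 * (1 / (M - 1))) * (1/tau n)"
    using N(1) tnz unfolding M_def[symmetric] by (simp add: divide_simps) (simp add: algebra_simps)
  finally have "Re (tau m) \<ge> 2" using tau_step[OF m3 tn] unfolding M_def by simp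
  then show ?case using amnz unfolding m_def by simp
qed

lemma a_nz: "a n \<noteq> 0"
  using Re_tau[of n] a1(2) by (cases "n \<ge> 2"; cases "n = 0") (auto simp: not_le less_Suc_eq numeral_2_eq_2)

end

text \<open>A contraction with factor 4/5 forgets its initial value geometrically, so the decay is
  that of the forcing term.\<close>

lemma contraction_inverse_square:
  fixes x :: "nat \<Rightarrow> real"
  assumes N0: "\<And>n. n \<ge> N0 \<Longrightarrow> 0 \<le> x n \<and> x (Suc n) \<le> 4/5 * x n + M / (real (Suc n))\<^sup>2"
  shows "\<exists>M'. \<forall>n\<ge>max N0 20. x n \<le> M' / (real n)\<^sup>2"
proof -
  define N where "N = max N0 20"
  define M' where "M' = max (10 * M) (x N * (real N)\<^sup>2)"
  have N: "N \<ge> N0" "N \<ge> 20" unfolding N_def by auto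
  have "x n \<le> M' / (real n)\<^sup>2" if "n \<ge> N" for n
    using that
  proof (induction n rule: dec_induct)
    case base
    have "x N * (real N)\<^sup>2 \<le> M'" unfolding M'_def by simp
    then show ?case using N by (simp add: field_simps)
  next
    case (step n)
    have n: "n \<ge> 20" "n \<ge> N0" using step N by auto
    have "x N \<ge> 0" using N0 N by auto
    then have "M' \<ge> 0" unfolding M'_def by (simp add: le_max_iff_disj)
    \<comment> \<open>The ratio 9/8 is chosen because 4/5 * 9/8 = 9/10: the remaining tenth of
      \<open>M'\<close> takes up M, which explains the factor 10 in \<open>M'\<close> and the
      threshold 20.\<close>
    have "8 * (real (Suc n))\<^sup>2 \<le> 9 * (real n)\<^sup>2"
    proof -
      have "real n * real n \<ge> 20 * real n" using n by (intro mult_right_mono) auto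
      moreover have "8 * (real (Suc n))\<^sup>2 = 8 * (real n * real n) + 16 * real n + 8"
        by (simp add: power2_eq_square algebra_simps)
      moreover have "9 * (real n)\<^sup>2 = 9 * (real n * real n)" by (simp add: power2_eq_square)
      moreover have "real n \<ge> 20" using n by simp
      ultimately show ?thesis by linarith
    qed
    then have "4/5 * (M' / (real n)\<^sup>2) \<le> 9/10 * (M' / (real (Suc n))\<^sup>2)"
    proof -
      have "M' * (8 * (real (Suc n))\<^sup>2) \<le> M' * (9 * (real n)\<^sup>2)"
        using \<open>M' \<ge> 0\<close> \<open>8 * _ \<le> _\<close> by (intro mult_left_mono)
      then have "M' * 8 / (real n)\<^sup>2 \<le> M' * 9 / (real (Suc n))\<^sup>2" using n
        by (simp add: divide_simps mult_ac del: of_nat_Suc)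
      then have "1/10 * (M' * 8 / (real n)\<^sup>2) \<le> 1/10 * (M' * 9 / (real (Suc n))\<^sup>2)" by (rule mult_left_mono) simp
      moreover have "4/5 * (M' / (real n)\<^sup>2) = 1/10 * (M' * 8 / (real n)\<^sup>2)" by simp
      moreover have "9/10 * (M' / (real (Suc n))\<^sup>2) = 1/10 * (M' * 9 / (real (Suc n))\<^sup>2)" by simp
      ultimately show ?thesis by linarith
    qed
    moreover have "M / (real (Suc n))\<^sup>2 \<le> (M'/10) / (real (Suc n))\<^sup>2"
      unfolding M'_def by (intro divide_right_mono) auto
    moreover have "x (Suc n) \<le> 4/5 * x n + M / (real (Suc n))\<^sup>2" using N0 n by auto
    moreover have "(M'/10) / (real (Suc n))\<^sup>2 = 1/10 * (M' / (real (Suc n))\<^sup>2)" by simp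
    ultimately show ?case using step.IH by linarith
  qed
  then show ?thesis unfolding N_def by blast
qed

section \<open>Convergence of the normalised ratios to the dominant fixed point\<close>

context perturbed_hypergeometric
begin

text \<open>The ratio of consecutive coefficients of the Gauss series at b = 0. Measured against it,
  the true ratio \<open>w\<close> has the polynomial growth of the coefficients already removed, so
  that w - 1 can be summable.\<close>

definition q :: "nat \<Rightarrow> complex" where
  "q n = (of_nat n + \<mu> - 1/2) * (of_nat n + \<mu> + 3) / (of_nat (n+1) * (of_nat n + of_real c))"

definition w :: "nat \<Rightarrow> complex" where "w n = a (n+1) / (q n * a n)"

text \<open>With \<open>eps\<close> and \<open>kap\<close> the recurrence reads w_n = 1 + eps_n -
  kap_n + kap_n / w_(n-1). Without \<open>eps\<close> the value 1 is an exact fixed point whatever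
  kap_n is. Hence only \<open>eps\<close>, of order n^(-2), drives w away from 1, while for
  \<open>kap\<close> mere convergence to b is enough.\<close>

definition eps :: "nat \<Rightarrow> complex" where
  "eps n = 4 * of_real b * of_nat n * (\<mu> + 3 - of_real c) /
     ((of_nat n + \<mu> + 2) * (of_nat n + \<mu> - 1/2) * (of_nat n + \<mu> + 3))"

definition kap :: "nat \<Rightarrow> complex" where
  "kap n = of_real b * of_nat n * (of_nat n + of_real c - 1) * (of_nat n + \<mu> - 2) /
     ((of_nat n + \<mu> + 2) * (of_nat n + \<mu> - 1/2) * (of_nat n + \<mu> + 3))"

lemma shift_nz: "of_nat n + \<mu> - 1/2 \<noteq> 0" "of_nat n + \<mu> + 3 \<noteq> 0" "of_nat n + \<mu> + 2 \<noteq> 0"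
  "of_nat n + complex_of_real c \<noteq> 0"
proof -
  show "of_nat n + \<mu> - 1/2 \<noteq> 0"
  proof (cases "n = 0")
    case False
    then have "real n \<ge> 1" by simp
    then show ?thesis using mu by (intro Re_nz) simp
  qed (use mu12 in simp)
qed (use mu c in \<open>(intro Re_nz; simp add: add_nonneg_pos)+\<close>)

lemma q_nz: "q n \<noteq> 0"
  unfolding q_def using shift_nz of_nat_neq_0[of n] by (simp del: of_nat_add of_nat_Suc)

lemma w_nz: "w n \<noteq> 0"
  unfolding w_def using a_nz[of "n+1"] a_nz[of n] q_nz by simp

lemma a_Suc: "a (n+1) = q n * w n * a n"
  unfolding w_def using q_nz a_nz[of n] by simp

lemma w_rec:
  assumes "n \<ge> 2"
  shows "w n * w (n-1) = (1 + eps n - kap n) * w (n-1) + kap n"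
proof -
  define N where "N = of_nat n + \<mu>"
  define k where "k = n - 1"
  have k: "n = k + 1" "of_nat k = (of_nat n - 1 :: complex)" using assms unfolding k_def by auto
  have nz: "N - 1/2 \<noteq> 0" "N + 3 \<noteq> 0" "N + 2 \<noteq> 0" "of_nat n + complex_of_real c \<noteq> 0" unfolding N_def by (rule shift_nz)+
  have nz2: "N - 3/2 \<noteq> 0" "of_nat n + complex_of_real c - 1 \<noteq> 0"
    using shift_nz(1)[of k] shift_nz(4)[of k] unfolding N_def k(2) by (auto simp: algebra_simps)
  define R where "R = of_nat n * (of_nat n + complex_of_real c - 1)"
  define Q where "Q = of_nat (n+1) * (of_nat n + complex_of_real c)"
  have QR: "R \<noteq> 0" "Q \<noteq> 0" unfolding R_def Q_def using nz nz2 assms of_nat_neq_0[of n]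
    by (auto simp del: of_nat_add of_nat_Suc)
  have qk: "q k = (N - 3/2) * (N + 2) / R"
    unfolding q_def R_def N_def k(2) k(1)[symmetric] by (simp add: algebra_simps)
  have qn: "q n = (N - 1/2) * (N + 3) / Q" unfolding q_def Q_def N_def ..
  have an: "a n = q k * w k * a k" using a_Suc[of k] unfolding k(1) .
  have "Q * (q n * w n * a n) = ((N - 1/2) * (N + 3) - of_real b * of_nat n * (of_nat n + of_real c - 5)) * a n
    + of_real b * (N - 3/2) * (N - 2) * a k"
    using a_rec[of n] assms unfolding a_Suc N_def Q_def k_def by simp
  moreover have "Q * (q n * w n * a n) = (N - 1/2) * (N + 3) * w n * a n" unfolding qn using QR by simp
  ultimately have "(N - 1/2) * (N + 3) * w n * a n = ((N - 1/2) * (N + 3) - of_real b * of_nat n * (of_nat n + of_real c - 5)) * a n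
    + of_real b * (N - 3/2) * (N - 2) * a k" by simp
  then have "(N - 1/2) * (N + 3) * w n * (q k * w k) * a k =
    (((N - 1/2) * (N + 3) - of_real b * of_nat n * (of_nat n + of_real c - 5)) * (q k * w k)
    + of_real b * (N - 3/2) * (N - 2)) * a k" unfolding an by (simp add: algebra_simps)
  then have "(N - 1/2) * (N + 3) * w n * (q k * w k) =
    ((N - 1/2) * (N + 3) - of_real b * of_nat n * (of_nat n + of_real c - 5)) * (q k * w k)
    + of_real b * (N - 3/2) * (N - 2)" using a_nz[of k] by simp
  moreover have "of_real b * (N - 3/2) * (N - 2) = q k * (of_real b * R * (N - 2) / (N + 2))"
    unfolding qk using nz QR by simp
  ultimately have "q k * ((N - 1/2) * (N + 3) * (w n * w k)) =
     q k * (((N - 1/2) * (N + 3) - of_real b * of_nat n * (of_nat n + of_real c - 5)) * w k + of_real b * R * (N - 2) / (N + 2))"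
    by (simp add: algebra_simps)
  then have E: "(N - 1/2) * (N + 3) * (w n * w k) =
     ((N - 1/2) * (N + 3) - of_real b * of_nat n * (of_nat n + of_real c - 5)) * w k + of_real b * R * (N - 2) / (N + 2)"
    using q_nz[of k] by simp
  define D where "D = (N + 2) * (N - 1/2) * (N + 3)"
  have D: "D \<noteq> 0" unfolding D_def using nz by simp
  have ek: "eps n * D = 4 * of_real b * of_nat n * (\<mu> + 3 - of_real c)" "kap n * D = of_real b * R * (N - 2)"
    unfolding eps_def kap_def N_def[symmetric] D_def[symmetric] R_def using D by (simp_all add: mult.assoc)
  have "D * (w n * w k) = (N+2) * ((N - 1/2) * (N + 3) * (w n * w k))" unfolding D_def by (simp add: mult_ac)
  also have "\<dots> = (D - of_real b * of_nat n * (of_nat n + of_real c - 5) * (N + 2)) * w k + of_real b * R * (N - 2)"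
  proof -
    have e: "(N+2) * (X * y + Y / (N+2)) = ((N+2) * X) * y + Y" for X y Y using nz(3) by (simp add: distrib_left)
    show ?thesis unfolding E D_def e by (simp add: algebra_simps)
  qed
  \<comment> \<open>In (n + c - 1) (N - 2) - (n + c - 5) (N + 2) = 4 (\<mu> + 3 - c) all powers of n
    cancel. This is the origin of \<open>eps\<close> and the reason for its decay.\<close>
  also have "D - of_real b * of_nat n * (of_nat n + of_real c - 5) * (N + 2) = D * (1 + eps n - kap n)"
  proof -
    have "D * (1 + eps n - kap n) = D + eps n * D - kap n * D" by (simp add: algebra_simps)
    also have "\<dots> = D - of_real b * of_nat n * (of_nat n + of_real c - 5) * (N + 2)"
      unfolding ek R_def N_def by (simp add: algebra_simps)
    finally show ?thesis ..
  qed
  also have "of_real b * R * (N - 2) = D * kap n" using ek by (simp add: mult.commute)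
  finally have "D * (w n * w k) = D * ((1 + eps n - kap n) * w k + kap n)" by (simp add: algebra_simps)
  then show ?thesis using D unfolding k_def by simp
qed

lemma norm_shift_ge: "n \<ge> 2 \<Longrightarrow> real n \<le> cmod (of_nat n + \<mu> + 2)" "n \<ge> 2 \<Longrightarrow> real n \<le> cmod (of_nat n + \<mu> + 3)"
   "n \<ge> 2 \<Longrightarrow> real n / 2 \<le> cmod (of_nat n + \<mu> - 1/2)"
proof -
  assume n: "n \<ge> 2"
  then have "real n \<ge> 2" by simp
  then show "real n \<le> cmod (of_nat n + \<mu> + 2)" "real n \<le> cmod (of_nat n + \<mu> + 3)" "real n / 2 \<le> cmod (of_nat n + \<mu> - 1/2)"
    using complex_Re_le_cmod[of "of_nat n + \<mu> + 2"] complex_Re_le_cmod[of "of_nat n + \<mu> + 3"] complex_Re_le_cmod[of "of_nat n + \<mu> - 1/2"] mu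
    by simp_all
qed

lemma eps_bound:
  assumes n: "n \<ge> 2"
  shows "cmod (eps n) \<le> 8 * b * cmod (\<mu> + 3 - of_real c) / (real n)\<^sup>2"
proof -
  have n0: "real n > 0" using n by simp
  have "real n * (real n / 2) * real n \<le> cmod (of_nat n + \<mu> + 2) * cmod (of_nat n + \<mu> - 1/2) * cmod (of_nat n + \<mu> + 3)"
    using norm_shift_ge[OF n] n by (intro mult_mono) auto
  then have "cmod (eps n) \<le> 4 * b * real n * cmod (\<mu> + 3 - of_real c) / (real n * (real n / 2) * real n)"
    unfolding eps_def norm_divide norm_mult using b0 n0
    by (intro frac_le) (auto simp: norm_mult)
  also have "\<dots> = 8 * b * cmod (\<mu> + 3 - of_real c) / (real n)\<^sup>2" using n0 by (simp add: power2_eq_square)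
  finally show ?thesis .
qed

lemma tendsto_shift_ratio: "(\<lambda>n. (of_nat n + z) / of_nat n) \<longlonglongrightarrow> (1::complex)"
proof -
  have "(\<lambda>n. 1 + z / of_nat n) \<longlonglongrightarrow> 1 + 0"
    by (intro tendsto_add tendsto_const tendsto_divide_0[OF tendsto_const] tendsto_of_nat)
  moreover have "eventually (\<lambda>n. 1 + z / of_nat n = (of_nat n + z) / of_nat n) sequentially"
    using eventually_gt_at_top[of 0] by eventually_elim (simp add: add_divide_distrib)
  ultimately show ?thesis by (simp add: tendsto_cong)
qed

lemma kap_lim: "kap \<longlonglongrightarrow> of_real b"
proof -
  define g :: "complex \<Rightarrow> nat \<Rightarrow> complex" where "g z n = (of_nat n + z) / of_nat n" for z n
  have g: "g z \<longlonglongrightarrow> 1" for z unfolding g_def by (rule tendsto_shift_ratio)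
  have "(\<lambda>n. of_real b * (g (of_real c - 1) n * g (\<mu> - 2) n) / (g (\<mu> + 2) n * g (\<mu> - 1/2) n * g (\<mu> + 3) n)) \<longlonglongrightarrow>
     of_real b * (1 * 1) / (1 * 1 * 1)"
    by (intro tendsto_intros g) auto
  moreover have "eventually (\<lambda>n. of_real b * (g (of_real c - 1) n * g (\<mu> - 2) n) / (g (\<mu> + 2) n * g (\<mu> - 1/2) n * g (\<mu> + 3) n) = kap n) sequentially"
    using eventually_gt_at_top[of 0]
    by eventually_elim (simp add: g_def kap_def add.assoc add_diff_eq)
  ultimately show ?thesis by (simp add: tendsto_cong)
qed

text \<open>Separation from the recessive fixed point -b. One has u (w + b) = tau + b u, where both
  summands lie in the right half plane: the real part is at least b n, whereas |u| \<le> 2 n as soon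
  as n \<ge> |\<mu>| + 6.\<close>

lemma w_plus_b:
  assumes n: "n \<ge> 2" "real n \<ge> cmod \<mu> + 6"
  shows "cmod (w n + of_real b) \<ge> b / 2"
proof -
  define N where "N = of_nat n + \<mu>"
  have nz: "N - 1/2 \<noteq> 0" "N + 3 \<noteq> 0" unfolding N_def by (rule shift_nz)+
  have nr: "real n \<ge> 2" using n by simp
  then have nz1: "N - 1 \<noteq> 0" using mu by (intro Re_nz) (simp add: N_def)
  define v where "v = (N - 1) / ((N - 1/2) * (N + 3))"
  \<comment> \<open>The reciprocal of v, by polynomial division: (N - 1/2) (N + 3) = (N - 1) (N +
    7/2) + 2.\<close>
  define u where "u = N + 7/2 + 2 * (1 / (N - 1))"
  have "(N - 1) * u = (N - 1) * (N + 7/2) + 2 * ((N - 1) * (1/(N-1)))" unfolding u_def by (simp only: distrib_left mult_ac)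
  also have "\<dots> = (N - 1/2) * (N + 3)" using nz1 by (simp add: field_simps)
  finally have u: "(N - 1) * u = (N - 1/2) * (N + 3)" .
  have vu: "v * u = 1" unfolding v_def using u nz by (simp add: mult.commute)
  have i: "0 \<le> Re (1/(N-1))" "cmod (1/(N-1)) \<le> 1"
    using inverse_right_half_plane(1,3)[of 1 "N-1"] mu nr unfolding N_def by auto
  have Ru: "Re u \<ge> real n" proof -
    have "Re u = Re N + 7/2 + 2 * Re (1/(N-1))" unfolding u_def by (simp del: one_divide_eq_0_iff add: Re_divide)
    then show ?thesis using i mu by (simp add: N_def)
  qed
  have "cmod u \<le> cmod N + 7/2 + 2 * 1" unfolding u_def
    using norm_triangle_ineq[of "N + 7/2" "2 * (1/(N-1))"] norm_triangle_ineq[of N "7/2"] i(2)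
    by (simp only: norm_mult norm_numeral norm_divide)
  also have "cmod N \<le> real n + cmod \<mu>" unfolding N_def using norm_triangle_ineq[of "of_nat n" \<mu>] by simp
  finally have cu: "cmod u \<le> 2 * real n" using n(2) by linarith
  have wt: "w n = tau n * v"
  proof -
    have "x / (A * B / (l * k) * y) = x * l * k / (p * y) * (p / (A * B))" if "p \<noteq> 0" for x A B l k y p :: complex
      using that by (simp add: mult_ac)
    from this[OF nz1] show ?thesis unfolding w_def tau_def q_def v_def N_def[symmetric] by blast
  qed
  have "real n * b \<le> Re (tau n + of_real b * u)" using Re_tau[OF n(1)] Ru b0 by (simp add: add_increasing)
  also have "\<dots> \<le> cmod (tau n + of_real b * u)" by (rule complex_Re_le_cmod)
  also have "tau n + of_real b * u = u * (w n + of_real b)"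
  proof -
    have "u * (w n + of_real b) = tau n * (v * u) + of_real b * u" unfolding wt by (simp only: distrib_left mult_ac)
    then show ?thesis unfolding vu by simp
  qed
  also have "cmod \<dots> \<le> 2 * real n * cmod (w n + of_real b)" unfolding norm_mult using cu by (intro mult_right_mono) auto
  finally have "real n * b \<le> real n * (2 * cmod (w n + of_real b))" by (simp add: mult_ac)
  then show ?thesis using nr by (simp add: mult_le_cancel_left)
qed

text \<open>In the limit the recurrence is w -> (1 - b) + b / w, a Moebius map with fixed points 1
  and -b; in the coordinate (w - 1) / (w + b) it is multiplication by -b. The modulus of this
  coordinate is the \<open>x\<close> below. \<open>w_plus_b\<close> keeps it finite, and the
  perturbation raises its factor from b \<le> 3/5 to at most 4/5.\<close>

lemma w_minus_1: "\<exists>M N0. \<forall>n\<ge>N0. cmod (w n - 1) \<le> M / (real n)\<^sup>2"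
proof -
  \<comment> \<open>The summand 2 / b dominates the constant 1, and 3 dominates |w| \<le> |w + b| +
    b; both rest on |w + b| \<ge> b / 2.\<close>
  define K where "K = 2 / b + 3"
  define E where "E = 8 * b * cmod (\<mu> + 3 - of_real c)"
  have K0: "K > 0" unfolding K_def using b0 by (simp add: add_pos_pos)
  have E0: "E \<ge> 0" unfolding E_def using b0 by simp
  define x where "x n = cmod (w n - 1) / cmod (w n + of_real b)" for n
  have e0: "eps \<longlonglongrightarrow> 0"
  proof (rule Lim_null_comparison)
    show "eventually (\<lambda>n. norm (eps n) \<le> E / (real n)\<^sup>2) sequentially"
      using eventually_ge_at_top[of 2] by eventually_elim (use eps_bound in \<open>simp add: E_def\<close>)
    show "(\<lambda>n. E / (real n)\<^sup>2) \<longlonglongrightarrow> 0" by real_asymp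
  qed
  have "(\<lambda>n. K * (cmod (eps n) + 2 * cmod (kap n - of_real b))) \<longlonglongrightarrow> K * (cmod 0 + 2 * cmod (of_real b - of_real b))"
    by (intro tendsto_intros e0 kap_lim)
  \<comment> \<open>The thresholds 1/8 here and 7/10 for \<open>kap\<close> are chosen so that 7/10
    divided by 1 - 1/8 is 4/5; the second is available because the limit b is at most 3/5.\<close>
  then have ev1: "eventually (\<lambda>n. K * (cmod (eps n) + 2 * cmod (kap n - of_real b)) < 1/8) sequentially"
    by (rule order_tendstoD) auto
  have "(\<lambda>n. cmod (kap n)) \<longlonglongrightarrow> cmod (of_real b)" by (intro tendsto_intros kap_lim)
  then have ev2: "eventually (\<lambda>n. cmod (kap n) < 7/10) sequentially"
    by (rule order_tendstoD) (use b0 b1 in auto)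
  from ev1 ev2 obtain N1 where N1: "\<And>n. n \<ge> N1 \<Longrightarrow> K * (cmod (eps n) + 2 * cmod (kap n - of_real b)) < 1/8 \<and> cmod (kap n) < 7/10"
    unfolding eventually_sequentially by (metis (no_types) max.bounded_iff)
  obtain N2 where N2: "real N2 \<ge> cmod \<mu> + 6" using real_arch_simple by blast
  define N0 where "N0 = max (max N1 N2) 2"
  have wb: "cmod (w n + of_real b) \<ge> b/2" "1 \<le> K * cmod (w n + of_real b)" "cmod (w n) \<le> K * cmod (w n + of_real b)" if "n \<ge> N0" for n
  proof -
    have "real N2 \<le> real n" using that unfolding N0_def by simp
    then show wb: "cmod (w n + of_real b) \<ge> b/2" using that N2 by (intro w_plus_b) (auto simp: N0_def)
    then have "2/b * cmod (w n + of_real b) \<ge> 1" using b0 by (simp add: field_simps)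
    moreover have "cmod (w n) \<le> cmod (w n + of_real b) + b"
      using norm_triangle_ineq4[of "w n + of_real b" "of_real b"] b0 by simp
    ultimately show "1 \<le> K * cmod (w n + of_real b)" "cmod (w n) \<le> K * cmod (w n + of_real b)"
      unfolding K_def distrib_right using wb b0 by linarith+
  qed
  have step: "0 \<le> x n \<and> x (Suc n) \<le> 4/5 * x n + (2 * K * E) / (real (Suc n))\<^sup>2" if n: "n \<ge> N0" for n
  proof -
    define m where "m = Suc n"
    have m: "m \<ge> N0" "m \<ge> 2" "m - 1 = n" "m \<ge> N1" using n unfolding m_def N0_def by auto
    define e where "e = cmod (eps m)"
    define k where "k = cmod (kap m - of_real b)"
    define W where "W = cmod (w n + of_real b)"
    have W: "W > 0" using wb(1)[OF n] b0 unfolding W_def by linarith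
    have N1m: "K * (e + 2 * k) < 1/8" "cmod (kap m) < 7/10" using N1[OF m(4)] unfolding e_def k_def by auto
    have rec: "w m * w n = (1 + eps m - kap m) * w n + kap m" using w_rec[OF m(2)] m(3) by simp
    \<comment> \<open>Here \<open>kap m\<close> multiplies w - 1 as a whole, so its deviation from b
      affects the contraction factor but adds no forcing term.\<close>
    have "(w m - 1) * w n = eps m * w n - kap m * (w n - 1)" using rec by (simp add: algebra_simps)
    then have "cmod (w m - 1) * cmod (w n) \<le> cmod (eps m * w n) + cmod (kap m * (w n - 1))"
      by (metis norm_mult norm_triangle_ineq4)
    also have "\<dots> \<le> e * (K * W) + 7/10 * cmod (w n - 1)"
      unfolding norm_mult e_def W_def using wb(3)[OF n] N1m by (intro add_mono mult_mono) auto
    finally have up: "cmod (w m - 1) * cmod (w n) \<le> e * (K * W) + 7/10 * cmod (w n - 1)" .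
    have "(w m + of_real b) * w n = (w n + of_real b) - (- (eps m - (kap m - of_real b)) * w n - (kap m - of_real b))"
      using rec by (simp add: algebra_simps)
    then have "cmod (w m + of_real b) * cmod (w n) \<ge> W - cmod (- (eps m - (kap m - of_real b)) * w n - (kap m - of_real b))"
      unfolding W_def by (metis norm_mult norm_triangle_ineq2)
    moreover have "cmod (- (eps m - (kap m - of_real b)) * w n - (kap m - of_real b)) \<le> (e + k) * (K * W) + k * (K * W)"
    proof -
      have "cmod (- (eps m - (kap m - of_real b)) * w n - (kap m - of_real b)) \<le> cmod (eps m - (kap m - of_real b)) * cmod (w n) + k * 1"
        using norm_triangle_ineq4[of "- (eps m - (kap m - of_real b)) * w n" "kap m - of_real b"] unfolding k_def norm_mult norm_minus_cancel by simp
      also have "\<dots> \<le> (e + k) * (K * W) + k * (K * W)"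
        unfolding e_def k_def W_def using wb(2,3)[OF n] norm_triangle_ineq4[of "eps m" "kap m - of_real b"]
        by (intro add_mono mult_mono) auto
      finally show ?thesis .
    qed
    moreover have "(e + k) * (K * W) + k * (K * W) = K * (e + 2 * k) * W" by (simp add: algebra_simps)
    moreover have "K * (e + 2 * k) * W \<le> 1/8 * W" using N1m W by (intro mult_right_mono) auto
    ultimately have low: "cmod (w m + of_real b) * cmod (w n) \<ge> 7/8 * W" by linarith
    have wm: "cmod (w m + of_real b) > 0" "cmod (w n) > 0" using wb(1)[OF m(1)] b0 w_nz[of n] by auto
    have "x m = (cmod (w m - 1) * cmod (w n)) / (cmod (w m + of_real b) * cmod (w n))"
      unfolding x_def using wm by simp
    also have "\<dots> \<le> (e * (K * W) + 7/10 * cmod (w n - 1)) / (7/8 * W)"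
      using up low W K0 by (intro frac_le) (auto simp: e_def intro!: add_nonneg_nonneg mult_nonneg_nonneg)
    also have "\<dots> = 8/7 * K * e + 4/5 * x n" unfolding x_def W_def[symmetric] using W by (simp add: field_simps)
    also have "8/7 * K * e \<le> 2 * K * (E / (real m)\<^sup>2)"
      using eps_bound[OF m(2)] K0 E0 unfolding e_def E_def[symmetric] by (intro mult_mono) auto
    finally show ?thesis unfolding m_def[symmetric] x_def by simp
  qed
  obtain M' where M': "\<And>n. n \<ge> max N0 20 \<Longrightarrow> x n \<le> M' / (real n)\<^sup>2"
    using contraction_inverse_square[OF step] by blast
  have "(\<lambda>n. M' / (real n)\<^sup>2) \<longlonglongrightarrow> 0" by real_asymp
  then have "eventually (\<lambda>n. M' / (real n)\<^sup>2 < 1/2) sequentially" by (rule order_tendstoD) auto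
  then obtain N3 where N3: "\<And>n. n \<ge> N3 \<Longrightarrow> M' / (real n)\<^sup>2 < 1/2" unfolding eventually_sequentially by blast
  \<comment> \<open>Back from the coordinate to w: since x < 1/2, the part x |w - 1| of the bound is
    absorbed by the left side.\<close>
  have "cmod (w n - 1) \<le> (2 * (1 + b) * M') / (real n)\<^sup>2" if "n \<ge> max (max N0 20) N3" for n
  proof -
    have xn: "x n \<le> M' / (real n)\<^sup>2" "x n < 1/2" using M'[of n] N3[of n] that by (auto simp del: divide_less_eq_numeral1 less_divide_eq_numeral1)
    have "cmod (w n + of_real b) > 0" using wb(1)[of n] b0 that by auto
    then have e: "cmod (w n - 1) = x n * cmod (w n + of_real b)" unfolding x_def by simp
    also have "\<dots> \<le> x n * (cmod (w n - 1) + (1 + b))"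
    proof (rule mult_left_mono)
      show "cmod (w n + of_real b) \<le> cmod (w n - 1) + (1 + b)"
        using norm_triangle_ineq[of "w n - 1" "1 + of_real b"] norm_triangle_ineq[of 1 "complex_of_real b"] b0
        by simp
    qed (simp add: x_def)
    finally have "cmod (w n - 1) * (1 - x n) \<le> x n * (1 + b)" by (simp add: algebra_simps)
    moreover have "cmod (w n - 1) * (1/2) \<le> cmod (w n - 1) * (1 - x n)" using xn by (intro mult_left_mono) auto
    moreover have "x n * (1 + b) \<le> M' / (real n)\<^sup>2 * (1 + b)" using xn b0 by (intro mult_right_mono) auto
    moreover have "2 * (1 + b) * M' / (real n)\<^sup>2 = 2 * (M' / (real n)\<^sup>2 * (1 + b))" by simp
    ultimately show ?thesis by linarith
  qed
  then show ?thesis by blast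
qed

end

section \<open>Singularities of power series on the circle of convergence\<close>

text \<open>Gauss's product before the limit: quotients of Pochhammer symbols become quotients of
  convergent factors times explicit powers of n.\<close>

lemma pochhammer_rGamma_series:
  "pochhammer z (n+1) = rGamma_series z n * fact n * exp (z * of_real (ln (of_nat n)))" for z :: complex
  unfolding rGamma_series_def by simp

lemma rGamma_nz: "Re z > -1 \<Longrightarrow> z \<noteq> 0 \<Longrightarrow> rGamma z \<noteq> 0"
proof -
  assume z: "Re z > -1" "z \<noteq> 0"
  have "z \<notin> \<int>\<^sub>\<le>\<^sub>0"
  proof
    assume "z \<in> \<int>\<^sub>\<le>\<^sub>0"
    then obtain n where n: "z = - of_nat n" by (rule nonpos_Ints_cases')
    then have "real n < 1" using z by simp
    then show False using n z by simp
  qed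
  then show "rGamma z \<noteq> 0" by (simp add: rGamma_eq_zero_iff)
qed

text \<open>The quotient of the symbols for l and for Re l is a convergent sequence times n^(i Im
  l), of modulus 1. The positive coefficients for Re l can therefore majorise error terms. The
  maximum with 1 in the constant accounts for n = 0, which Gauss's product does not reach.\<close>

lemma pochhammer_ratio_bounded:
  assumes "Re l \<ge> 0"
  shows "\<exists>K>0. \<forall>n. cmod (pochhammer (l + 1) n / fact n) \<le> K * (pochhammer (Re l + 1) n / fact n)"
proof -
  define s where "s = complex_of_real (Re l)"
  define r where "r n = rGamma_series (l + 1) n / rGamma_series (s + 1) n" for n
  have "rGamma (s + 1) \<noteq> 0" using assms by (intro rGamma_nz) (auto simp: s_def complex_eq_iff)
  then have "r \<longlonglongrightarrow> rGamma (l+1) / rGamma (s+1)" unfolding r_def by (intro tendsto_intros)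
  then have "Bseq r" by (intro convergent_imp_Bseq) (auto simp: convergent_def)
  then obtain K where K: "K > 0" "\<And>n. cmod (r n) \<le> K" unfolding Bseq_def by blast
  have "cmod (pochhammer (l + 1) n / fact n) \<le> max K 1 * (pochhammer (Re l + 1) n / fact n)" for n
  proof (cases n)
    case (Suc k)
    have pos: "pochhammer (Re l + 1) n > 0" using assms by (intro pochhammer_pos) auto
    have ps: "pochhammer (s + 1) n = of_real (pochhammer (Re l + 1) n)"
      unfolding s_def by (metis of_real_1 of_real_add pochhammer_of_real)
    have nz: "pochhammer (s + 1) n \<noteq> 0" using pos unfolding ps by simp
    have "pochhammer (l+1) n / pochhammer (s+1) n = r k * exp ((l - s) * of_real (ln (of_nat k)))"
      unfolding Suc Suc_eq_plus1 pochhammer_rGamma_series r_def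
      by (simp add: exp_diff left_diff_distrib distrib_right exp_add)
    moreover have "cmod (exp ((l - s) * of_real (ln (of_nat k)))) = 1" unfolding s_def by simp
    ultimately have "cmod (pochhammer (l+1) n / pochhammer (s+1) n) \<le> max K 1" using K(2)[of k]
      by (simp only: norm_mult mult_1_right)
    then have "cmod (pochhammer (l+1) n) \<le> max K 1 * pochhammer (Re l + 1) n"
      unfolding ps using pos by (simp add: norm_divide divide_le_eq)
    then show ?thesis by (simp add: norm_divide divide_right_mono)
  qed auto
  then show ?thesis using K(1) by (intro exI[of _ "max K 1"]) auto
qed

lemma pochhammer_series_sums:
  fixes l :: complex
  assumes "0 \<le> s" "s < 1"
  shows "(\<lambda>n. pochhammer (l+1) n / fact n * of_real s ^ n) sums (of_real (1 - s) powr (- (l + 1)))"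
proof -
  have "(\<lambda>n. (- (l+1) gchoose n) * (- of_real s) ^ n) sums (1 + - of_real s) powr (- (l+1))"
    using assms by (intro gen_binomial_complex) auto
  moreover have "(- (l+1) gchoose n) * (- of_real s) ^ n = pochhammer (l+1) n / fact n * of_real s ^ n" for n
  proof -
    have "(- 1) ^ n * (- of_real s) ^ n = (of_real s ^ n :: complex)" by (simp flip: power_mult_distrib)
    moreover have "- (- (l+1)) = l + 1" by simp
    moreover have "x * p / f * y = p / f * (x * y)" for x p f y :: complex by simp
    ultimately show ?thesis unfolding gbinomial_pochhammer by metis
  qed
  ultimately show ?thesis by simp
qed

text \<open>Here \<open>pochhammer (l+1) n / fact n\<close> is the \<open>n\<close>-th coefficient of \<open>(1-s) powr (-l-1)\<close>.\<close>

lemma power_series_singular_at_1: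
  fixes u :: "nat \<Rightarrow> complex"
  assumes l: "Re l \<ge> 0" and lim: "(\<lambda>n. u n / (pochhammer (l+1) n / fact n)) \<longlonglongrightarrow> L" and L: "L \<noteq> 0"
  shows "\<exists>C>0. \<exists>s0<1. \<forall>s. s0 < s \<and> 0 \<le> s \<and> s < 1 \<longrightarrow> cmod (\<Sum>n. u n * of_real s ^ n) \<ge> C / (1 - s)"
proof -
  define h where "h n = pochhammer (l+1) n / fact n" for n
  define H where "H n = pochhammer (Re l + 1) n / fact n" for n
  obtain K where K: "K > 0" "\<And>n. cmod (h n) \<le> K * H n"
    using pochhammer_ratio_bounded[OF l] unfolding h_def H_def by blast
  have hnz: "h n \<noteq> 0" for n
  proof -
    have "l + 1 + of_nat k \<noteq> 0" for k using l by (intro Re_nz) (simp add: add_pos_nonneg)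
    then have "l + 1 \<noteq> - of_nat k" for k by (metis add.left_inverse)
    then show ?thesis unfolding h_def by (simp add: pochhammer_eq_0_iff)
  qed
  have H0: "H n \<ge> 0" for n unfolding H_def using l by (simp add: pochhammer_nonneg)
  define dl where "dl n = u n / h n - L" for n
  have u: "u n = L * h n + dl n * h n" for n unfolding dl_def using hnz[of n] by (simp add: algebra_simps)
  have "dl \<longlonglongrightarrow> 0" using tendsto_diff[OF lim tendsto_const[of L]] unfolding dl_def h_def by simp
  \<comment> \<open>A quarter of the main term is granted to the tail, where |dl n| < e and |h n|
    \<le> K * H n; \<open>s0\<close> is chosen so that the initial segment costs at most another
    quarter. Half of |L| remains as the constant.\<close>
  define e where "e = cmod L / (4 * K)"
  have e: "e > 0" unfolding e_def using L K by simp
  have "eventually (\<lambda>n. cmod (dl n) < e) sequentially"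
    using \<open>dl \<longlonglongrightarrow> 0\<close> e by (auto simp: tendsto_iff)
  then obtain N where N: "\<And>n. n \<ge> N \<Longrightarrow> cmod (dl n) < e" unfolding eventually_sequentially by blast
  define M where "M = (\<Sum>n<N. cmod (dl n * h n))"
  have M0: "M \<ge> 0" unfolding M_def by (simp add: sum_nonneg)
  define g where "g n = (if n < N then cmod (dl n * h n) else 0)" for n
  define s0 where "s0 = 1 - cmod L / (4 * (M + 1))"
  have "cmod (\<Sum>n. u n * of_real s ^ n) \<ge> (cmod L / 2) / (1 - s)" if s: "s0 < s" "0 \<le> s" "s < 1" for s
  proof -
    define X where "X = (1 - s) powr (- (Re l + 1))"
    have "(\<lambda>n. complex_of_real (H n * s ^ n)) sums (of_real X)"
    proof -
      have "(\<lambda>n. pochhammer (of_real (Re l) + 1) n / fact n * of_real s ^ n) sums (of_real (1 - s) powr (- (of_real (Re l) + 1)) :: complex)"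
        using s by (intro pochhammer_series_sums) auto
      moreover have "pochhammer (of_real (Re l) + 1) n / fact n * of_real s ^ n = complex_of_real (H n * s ^ n)" for n
        unfolding H_def by (simp flip: pochhammer_of_real)
      moreover have "of_real (1 - s) powr (- (of_real (Re l) + 1)) = complex_of_real X"
        unfolding X_def using s powr_of_real[of "1-s" "- (Re l + 1)"] by simp
      ultimately show ?thesis by simp
    qed
    then have HX: "(\<lambda>n. H n * s ^ n) sums X" unfolding sums_of_real_iff .
    have hs: "(\<lambda>n. h n * of_real s ^ n) sums (of_real (1 - s) powr (- (l + 1)))"
      unfolding h_def using s by (intro pochhammer_series_sums) auto
    have gs: "(\<lambda>n. g n * s ^ n) sums (\<Sum>n<N. g n * s ^ n)"
      by (rule sums_finite) (auto simp: g_def)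
    have bound: "cmod (dl n * h n * of_real s ^ n) \<le> g n * s ^ n + e * K * (H n * s ^ n)" for n
    proof -
      have sn: "cmod (of_real s ^ n) = s ^ n" using s by (simp add: norm_power)
      show ?thesis
      proof (cases "n < N")
        case True
        then show ?thesis using sn s e K(1) H0[of n] by (simp add: g_def norm_mult)
      next
        case False
        have "cmod (dl n) * cmod (h n) \<le> e * (K * H n)" using N[of n] K(2)[of n] False e by (intro mult_mono) auto
        then have "cmod (dl n) * cmod (h n) * s ^ n \<le> e * (K * H n) * s ^ n" using s by (intro mult_right_mono) auto
        then show ?thesis using False sn by (simp add: g_def norm_mult mult_ac)
      qed
    qed
    have gH: "(\<lambda>n. g n * s ^ n + e * K * (H n * s ^ n)) sums ((\<Sum>n<N. g n * s ^ n) + e * K * X)"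
      by (intro sums_add gs sums_mult HX)
    have sm: "summable (\<lambda>n. cmod (dl n * h n * of_real s ^ n))"
      by (rule summable_comparison_test[OF _ sums_summable[OF gH]]) (use bound in auto)
    have "cmod (\<Sum>n. dl n * h n * of_real s ^ n) \<le> (\<Sum>n. cmod (dl n * h n * of_real s ^ n))"
      by (rule summable_norm[OF sm])
    also have "\<dots> \<le> (\<Sum>n. g n * s ^ n + e * K * (H n * s ^ n))"
      by (rule suminf_le[OF bound sm sums_summable[OF gH]])
    also have "\<dots> = (\<Sum>n<N. g n * s ^ n) + e * K * X" using gH by (simp add: sums_iff)
    also have "(\<Sum>n<N. g n * s ^ n) \<le> M" unfolding M_def
    proof (rule sum_mono)
      fix n assume "n \<in> {..<N}"
      moreover have "s ^ n \<le> 1" using s by (simp add: power_le_one)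
      ultimately show "g n * s ^ n \<le> cmod (dl n * h n)" unfolding g_def by (simp add: mult_left_le)
    qed
    finally have err: "cmod (\<Sum>n. dl n * h n * of_real s ^ n) \<le> M + cmod L / 4 * X" unfolding e_def using K by simp
    have "(\<lambda>n. L * (h n * of_real s ^ n) + dl n * h n * of_real s ^ n) sums
       (L * (of_real (1 - s) powr (- (l + 1))) + (\<Sum>n. dl n * h n * of_real s ^ n))"
      by (intro sums_add sums_mult hs summable_sums summable_norm_cancel[OF sm])
    then have "(\<Sum>n. u n * of_real s ^ n) = L * (of_real (1 - s) powr (- (l + 1))) + (\<Sum>n. dl n * h n * of_real s ^ n)"
      unfolding u by (simp add: sums_iff algebra_simps)
    moreover have "cmod (L * (of_real (1 - s) powr (- (l + 1)))) = cmod L * X"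
    proof -
      have "cmod (of_real (1 - s) powr (- (l + 1))) = X"
        unfolding X_def using s by (subst norm_powr_real_powr) auto
      then show ?thesis by (simp add: norm_mult)
    qed
    ultimately have "cmod (\<Sum>n. u n * of_real s ^ n) \<ge> cmod L * X - (M + cmod L / 4 * X)"
      using err unfolding \<open>(\<Sum>n. u n * of_real s ^ n) = _\<close> using norm_diff_ineq[of "L * (of_real (1 - s) powr (- (l + 1)))" "\<Sum>n. dl n * h n * of_real s ^ n"] by linarith
    \<comment> \<open>Re l \<ge> 0 makes the exponent at most -1. In the application l = z, and the
      closed right half plane is thus what guarantees growth of order 1 / (1 - s).\<close>
    moreover have X1: "X \<ge> 1 / (1 - s)"
    proof -
      have "(1 - s) powr (-1) \<le> (1 - s) powr (- (Re l + 1))" using s l by (intro powr_mono') auto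
      then show ?thesis unfolding X_def using s by (simp add: powr_minus inverse_eq_divide)
    qed
    moreover have "M \<le> cmod L / 4 * X"
    proof -
      have "1 - s < cmod L / (4 * (M + 1))" using s unfolding s0_def by simp
      then have "M + 1 \<le> cmod L / 4 * (1 / (1 - s))" using s M0 by (simp add: field_simps)
      also have "\<dots> \<le> cmod L / 4 * X" using X1 by (intro mult_left_mono) auto
      finally show ?thesis by simp
    qed
    moreover have "cmod L / 2 * X \<ge> cmod L / 2 * (1 / (1 - s))" using X1 by (intro mult_left_mono) auto
    moreover have "cmod L / 2 * (1 / (1 - s)) = cmod L / 2 / (1 - s)" by simp
    ultimately show ?thesis by linarith
  qed
  moreover have "s0 < 1" unfolding s0_def using L M0 by simp
  ultimately show ?thesis using L by (intro exI[of _ "cmod L / 2"] conjI exI[of _ s0]) auto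
qed

section \<open>Growth of the coefficients and the differential equation of their generating
  function\<close>

context perturbed_hypergeometric
begin

text \<open>By the bound of order n^(-2) the product converges absolutely, and a convergent product
  of nonzero factors has a nonzero limit. P compares the connection constant at s = 1 with that of
  the Gauss series.\<close>

lemma w_prod_lim: "\<exists>P. P \<noteq> 0 \<and> (\<lambda>n. \<Prod>k<n. w k) \<longlonglongrightarrow> P"
proof -
  obtain M N0 where M: "\<And>n. n \<ge> N0 \<Longrightarrow> cmod (w n - 1) \<le> M / (real n)\<^sup>2" using w_minus_1 by blast
  have "summable (\<lambda>n. M * inverse ((real n)\<^sup>2))" by (intro summable_mult inverse_power_summable) simp
  then have "summable (\<lambda>n. norm (w n - 1))"
    by (rule summable_comparison_test_ev[rotated])
       (use M in \<open>auto simp: eventually_sequentially divide_inverse intro!: exI[of _ N0]\<close>)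
  then have cp: "convergent_prod w"
    by (intro abs_convergent_prod_imp_convergent_prod summable_imp_abs_convergent_prod)
  then obtain P where P: "(\<lambda>n. \<Prod>k\<le>n. w k) \<longlonglongrightarrow> P"
    using convergent_prod_imp_convergent convergent_def by blast
  moreover have "P \<noteq> 0"
    using convergent_prod_to_zero_iff[OF cp] w_nz P by blast
  moreover have "(\<lambda>n. \<Prod>k<n. w k) \<longlonglongrightarrow> P"
    using P by (subst LIMSEQ_lessThan_iff_atMost)
  ultimately show ?thesis by blast
qed

lemma a_prod: "a n = (\<Prod>k<n. w k) * (pochhammer (\<mu> - 1/2) n * pochhammer (\<mu> + 3) n / (fact n * pochhammer (of_real c) n))"
proof (induction n)
  case (Suc n)
  have "a (Suc n) = q n * w n * a n" using a_Suc[of n] by simp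
  also have "q n = (\<mu> - 1/2 + of_nat n) * (\<mu> + 3 + of_nat n) / ((1 + of_nat n) * (of_real c + of_nat n))"
    unfolding q_def by (simp add: add_ac)
  finally show ?case unfolding Suc.IH pochhammer_Suc fact_Suc prod.lessThan_Suc
    by (simp add: mult_ac)
qed simp

text \<open>The Pochhammer quotient in \<open>a_prod\<close> grows like n^(2\<mu> + 3/2 - c) and the
  comparison coefficient like n^(2\<mu>). For c = m + 3/2 the factor n^m closes the gap; m Euler
  derivatives of the series will produce it.\<close>

lemma a_asymp:
  assumes m: "c = real m + 3/2"
  shows "\<exists>L. L \<noteq> 0 \<and> (\<lambda>n. of_nat n ^ m * a n / (pochhammer (2 * \<mu> + 1) n / fact n)) \<longlonglongrightarrow> L"
proof -
  obtain P where P: "P \<noteq> 0" "(\<lambda>n. \<Prod>k<n. w k) \<longlonglongrightarrow> P" using w_prod_lim by blast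
  define L where "L = P * 1 ^ m * (rGamma (\<mu> - 1/2) * rGamma (\<mu> + 3) / (rGamma (of_real c) * rGamma (2 * \<mu> + 1)))"
  have rnz: "rGamma (\<mu> - 1/2) \<noteq> 0" "rGamma (\<mu> + 3) \<noteq> 0" "rGamma (complex_of_real c) \<noteq> 0" "rGamma (2 * \<mu> + 1) \<noteq> 0"
  proof -
    \<comment> \<open>For Re \<mu> \<ge> 0 this factor vanishes at \<mu> = 1/2 only, that is at z =
      1: the exceptional eigenvalue is visible as a zero of the limit constant.\<close>
    show "rGamma (\<mu> - 1/2) \<noteq> 0" using mu mu12 by (intro rGamma_nz) auto
    show "rGamma (\<mu> + 3) \<noteq> 0" using mu by (intro rGamma_nz) (auto intro!: Re_nz)
    show "rGamma (complex_of_real c) \<noteq> 0" using c by (intro rGamma_nz) auto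
    show "rGamma (2 * \<mu> + 1) \<noteq> 0" using mu by (intro rGamma_nz) (auto intro!: Re_nz)
  qed
  \<comment> \<open>Taken at index n + 1, to which the finite form of Gauss's product applies; the
    quotient (n + 1) / n adjusts the power of n.\<close>
  have "(\<lambda>n. (\<Prod>k<Suc n. w k) * ((of_nat n + 1) / of_nat n) ^ m *
     (rGamma_series (\<mu> - 1/2) n * rGamma_series (\<mu> + 3) n / (rGamma_series (of_real c) n * rGamma_series (2 * \<mu> + 1) n))) \<longlonglongrightarrow> L"
    unfolding L_def using rnz P(2)
    by (intro tendsto_intros tendsto_shift_ratio filterlim_compose[OF P(2) filterlim_Suc]) auto
  moreover have "eventually (\<lambda>n. (\<Prod>k<Suc n. w k) * ((of_nat n + 1) / of_nat n) ^ m *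
     (rGamma_series (\<mu> - 1/2) n * rGamma_series (\<mu> + 3) n / (rGamma_series (of_real c) n * rGamma_series (2 * \<mu> + 1) n))
     = of_nat (Suc n) ^ m * a (Suc n) / (pochhammer (2 * \<mu> + 1) (Suc n) / fact (Suc n))) sequentially"
    using eventually_gt_at_top[of 0]
  proof eventually_elim
    case (elim n)
    define x where "x = complex_of_real (ln (real n))"
    have en: "exp (of_nat m * x) = of_nat n ^ m"
      unfolding x_def exp_of_nat_mult using elim by (simp add: exp_of_real)
    \<comment> \<open>The powers of n balance: (\<mu> - 1/2) + (\<mu> + 3) + m = c + (2\<mu> + 1)
      when c = m + 3/2.\<close>
    have ee: "exp ((\<mu> - 1/2) * x) * exp ((\<mu> + 3) * x) * exp (of_nat m * x) = exp (of_real c * x) * exp ((2 * \<mu> + 1) * x)"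
      unfolding m exp_add[symmetric] by (rule arg_cong[of _ _ exp]) (simp add: algebra_simps)
    have alg: "W * (n1 / n0) ^ m * (r1 * r2 / (r3 * r4)) =
      n1 ^ m * (W * ((r1 * f * e1) * (r2 * f * e2) / (F * (r3 * f * e3)))) / ((r4 * f * e4) / F)"
      if "e1 * e2 * n0 ^ m = e3 * e4" "e1 \<noteq> 0" "e2 \<noteq> 0" "e3 \<noteq> 0" "e4 \<noteq> 0" "n0 \<noteq> 0" "f \<noteq> 0" "F \<noteq> 0"
      for W n1 n0 r1 r2 r3 r4 f F e1 e2 e3 e4 :: complex
    proof -
      have "n1 ^ m * (W * ((r1 * f * e1) * (r2 * f * e2) / (F * (r3 * f * e3)))) / ((r4 * f * e4) / F)
        = n1 ^ m * W * (r1 * r2) / (r3 * r4) * ((e1 * e2) / (e3 * e4))"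
        using that(7,8) by (simp add: mult_ac)
      also have "(e1 * e2) / (e3 * e4) = 1 / n0 ^ m" using that(1)[symmetric] that(2-6) by simp
      finally have E: "n1 ^ m * (W * ((r1 * f * e1) * (r2 * f * e2) / (F * (r3 * f * e3)))) / ((r4 * f * e4) / F)
        = n1 ^ m * W * (r1 * r2) / (r3 * r4) * (1 / n0 ^ m)" .
      show ?thesis unfolding E by (simp add: power_divide mult_ac)
    qed
    show ?case
      unfolding Suc_eq_plus1 a_prod[of "n+1"] pochhammer_rGamma_series x_def[symmetric] of_nat_add of_nat_1
      by (rule alg) (use ee en elim in \<open>auto simp del: fact_Suc\<close>)
  qed
  ultimately have "(\<lambda>n. of_nat (Suc n) ^ m * a (Suc n) / (pochhammer (2 * \<mu> + 1) (Suc n) / fact (Suc n))) \<longlonglongrightarrow> L"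
    by (rule Lim_transform_eventually)
  then have "(\<lambda>n. of_nat n ^ m * a n / (pochhammer (2 * \<mu> + 1) n / fact n)) \<longlonglongrightarrow> L"
    by (rule LIMSEQ_imp_Suc)
  moreover have "L \<noteq> 0" unfolding L_def using P rnz by simp
  ultimately show ?thesis by blast
qed

lemma w_lim: "w \<longlonglongrightarrow> 1"
proof -
  obtain M N0 where M: "\<And>n. n \<ge> N0 \<Longrightarrow> cmod (w n - 1) \<le> M / (real n)\<^sup>2" using w_minus_1 by blast
  have "(\<lambda>n. w n - 1) \<longlonglongrightarrow> 0"
  proof (rule Lim_null_comparison)
    show "eventually (\<lambda>n. norm (w n - 1) \<le> M / (real n)\<^sup>2) sequentially"
      using M by (auto simp: eventually_sequentially)
    show "(\<lambda>n. M / (real n)\<^sup>2) \<longlonglongrightarrow> 0" by real_asymp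
  qed
  then show ?thesis by (simp add: LIM_zero_iff)
qed

lemma q_lim: "q \<longlonglongrightarrow> 1"
proof -
  define g :: "complex \<Rightarrow> nat \<Rightarrow> complex" where "g z n = (of_nat n + z) / of_nat n" for z n
  have g: "g z \<longlonglongrightarrow> 1" for z unfolding g_def by (rule tendsto_shift_ratio)
  have "(\<lambda>n. g (\<mu> - 1/2) n * g (\<mu> + 3) n / (g 1 n * g (of_real c) n)) \<longlonglongrightarrow> 1 * 1 / (1 * 1)"
    by (intro tendsto_intros g) auto
  moreover have "eventually (\<lambda>n. g (\<mu> - 1/2) n * g (\<mu> + 3) n / (g 1 n * g (of_real c) n) = q n) sequentially"
    using eventually_gt_at_top[of 0]
    by eventually_elim (simp add: g_def q_def add.assoc add_diff_eq add.commute[of 1])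
  ultimately show ?thesis by (simp add: tendsto_cong)
qed

definition F :: "complex fps" where "F = Abs_fps a"

lemma F_nth [simp]: "fps_nth F n = a n" unfolding F_def by simp

lemma F_radius: "fps_conv_radius F = 1"
  unfolding fps_conv_radius_def
proof (rule conv_radius_ratio_limit_nonzero)
  have "(\<lambda>n. norm (1 / (q n * w n))) \<longlonglongrightarrow> norm (1 / (1 * 1 :: complex))"
    by (intro tendsto_intros q_lim w_lim) auto
  moreover have "norm (1 / (q n * w n)) = norm (fps_nth F n) / norm (fps_nth F (Suc n))" for n
    using a_Suc[of n] a_nz[of n] by (simp add: norm_divide norm_mult)
  ultimately show "(\<lambda>n. norm (fps_nth F n) / norm (fps_nth F (Suc n))) \<longlonglongrightarrow> 1" by simp
qed (simp_all add: one_ereal_def)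

text \<open>Coefficients of the Heun equation P2 Y'' + P1 Y' - P0 Y = 0. The factorisation P2 = s (1
  - s) (1 + b s) exhibits the finite singular points 0, 1 and -1/b = -beta.\<close>

definition P2 :: "complex poly" where "P2 = [:0, 1, of_real b - 1, - of_real b:]"
definition P1 :: "complex poly" where
  "P1 = [:of_real c, of_real c * of_real b - (2*\<mu> + 7/2) - 4 * of_real b, 4 * of_real b - (2*\<mu> + 7/2) * of_real b:]"
definition P0 :: "complex poly" where "P0 = [:(\<mu> - 1/2) * (\<mu> + 3), (\<mu> - 1/2) * (\<mu> - 1) * of_real b:]"

lemma fps_ode: "fps_of_poly P2 * fps_deriv (fps_deriv F) + fps_of_poly P1 * fps_deriv F - fps_of_poly P0 * F = 0"
proof (rule fps_ext)
  fix n :: nat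
  have X: "fps_nth (fps_of_poly [:x0, x1, x2, x3:] * G) n =
      x0 * fps_nth G n + (if n \<ge> 1 then x1 * fps_nth G (n-1) else 0)
      + (if n \<ge> 2 then x2 * fps_nth G (n-2) else 0) + (if n \<ge> 3 then x3 * fps_nth G (n-3) else 0)"
    for x0 x1 x2 x3 and G :: "complex fps" and n
  proof -
    have "fps_of_poly [:x0, x1, x2, x3:] * G = fps_const x0 * G + fps_const x1 * (fps_X ^ 1 * G)
       + fps_const x2 * (fps_X ^ 2 * G) + fps_const x3 * (fps_X ^ 3 * G)"
      by (simp add: fps_of_poly_pCons algebra_simps power2_eq_square power3_eq_cube)
    then show ?thesis by (simp only: fps_add_nth fps_mult_left_const_nth fps_X_power_mult_nth) auto
  qed
  have p1: "P1 = [:of_real c, of_real c * of_real b - (2*\<mu> + 7/2) - 4 * of_real b, 4 * of_real b - (2*\<mu> + 7/2) * of_real b, 0:]"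
    and p0: "P0 = [:(\<mu> - 1/2) * (\<mu> + 3), (\<mu> - 1/2) * (\<mu> - 1) * of_real b, 0, 0:]" unfolding P1_def P0_def by simp_all
  \<comment> \<open>Multiplication by P2 shifts coefficients by up to three places, so small n are
    evaluated separately. Index 0 stands apart: there the equation is the definition of a_1, and
    \<open>a_rec\<close> starts at 1.\<close>
  have z: "n = 0 \<or> n = 1 \<or> n = 2 \<or> (\<exists>k. n = k + 3)" by presburger
  show "fps_nth (fps_of_poly P2 * fps_deriv (fps_deriv F) + fps_of_poly P1 * fps_deriv F - fps_of_poly P0 * F) n = fps_nth 0 n"
  proof (cases "n = 0")
    case True
    then show ?thesis unfolding P2_def p1 p0 using c by (simp add: X)
  next
    case False
    have e: "fps_nth (fps_of_poly P2 * fps_deriv (fps_deriv F) + fps_of_poly P1 * fps_deriv F - fps_of_poly P0 * F) n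
      = of_nat (n+1) * (of_nat n + of_real c) * a (n+1) - (((of_nat n + \<mu> - 1/2) * (of_nat n + \<mu> + 3) - of_real b * of_nat n * (of_nat n + of_real c - 5)) * a n
    + of_real b * (of_nat n + \<mu> - 3/2) * (of_nat n + \<mu> - 2) * a (n-1))"
      using z False unfolding P2_def p1 p0 fps_add_nth fps_sub_nth X
      by (elim disjE exE) (simp_all add: field_simps numeral_2_eq_2 numeral_3_eq_3 del: coef.simps)
    show ?thesis unfolding e using a_rec[of n] False by simp
  qed
qed

end

section \<open>Smooth functions and test functions\<close>

definition smooth :: "(real ^ 'n::finite \<Rightarrow> real) \<Rightarrow> bool" where
  "smooth f \<longleftrightarrow> (\<forall>js x. iter_partial js f differentiable (at x))"

text \<open>Smoothness is the largest class of differentiable functions that is stable under partial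
  derivatives; an invariant P thus replaces formulas for iterated derivatives.\<close>

lemma smooth_coinduct:
  assumes "P f" and "\<And>f. P f \<Longrightarrow> (\<forall>x. f differentiable (at x)) \<and> (\<forall>i. P (partial_deriv i f))"
  shows "smooth f"
proof -
  have "P (iter_partial js f)" for js by (induction js) (use assms in auto)
  then show ?thesis unfolding smooth_def using assms(2) by blast
qed

lemma smooth_differentiable: "smooth f \<Longrightarrow> f differentiable (at x)"
  unfolding smooth_def by (metis iter_partial.simps(1))

lemma iter_partial_append: "iter_partial (js @ ks) f = iter_partial js (iter_partial ks f)"
  by (induction js) auto

lemma smooth_iter_partial: "smooth f \<Longrightarrow> smooth (iter_partial js f)"
  unfolding smooth_def by (metis iter_partial_append)

lemma smooth_partial_deriv: "smooth f \<Longrightarrow> smooth (partial_deriv i f)"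
  using smooth_iter_partial[of f "[i]"] by simp

lemma partial_deriv_eq:
  "(f has_derivative f') (at x) \<Longrightarrow> partial_deriv i f x = f' (axis i 1)"
  unfolding partial_deriv_def by (metis frechet_derivative_at)

lemma differentiable_has_frechet:
  "f differentiable (at x) \<Longrightarrow> (f has_derivative frechet_derivative f (at x)) (at x)"
  by (simp add: frechet_derivative_works)

lemma partial_deriv_add:
  "(\<And>x. f differentiable (at x)) \<Longrightarrow> (\<And>x. g differentiable (at x)) \<Longrightarrow>
   partial_deriv i (\<lambda>x. f x + g x) = (\<lambda>x. partial_deriv i f x + partial_deriv i g x)"
  by (rule ext, subst partial_deriv_eq)
     (auto intro!: has_derivative_add differentiable_has_frechet simp: partial_deriv_def)

lemma partial_deriv_mult:
  assumes "\<And>x. f differentiable (at x)" "\<And>x. g differentiable (at x)"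
  shows "partial_deriv i (\<lambda>x. f x * g x) = (\<lambda>x. f x * partial_deriv i g x + partial_deriv i f x * g x)"
  by (rule ext, subst partial_deriv_eq[OF has_derivative_mult[OF differentiable_has_frechet differentiable_has_frechet]])
     (auto simp: partial_deriv_def assms)

lemma partial_deriv_const [simp]: "partial_deriv i (\<lambda>x. c) = (\<lambda>x. 0)"
  by (rule ext, subst partial_deriv_eq) (auto intro!: derivative_intros)

lemma partial_deriv_coord: "partial_deriv i (\<lambda>x. x $ j) = (\<lambda>x. if i = j then 1 else 0)"
  by (rule ext, subst partial_deriv_eq[OF bounded_linear_imp_has_derivative[OF bounded_linear_vec_nth]]) (auto simp: axis_def)

lemma partial_deriv_compose:
  assumes "\<And>x. f differentiable (at x)" "\<And>t. (h has_real_derivative h' t) (at t)"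
  shows "partial_deriv i (\<lambda>x. h (f x)) = (\<lambda>x. h' (f x) * partial_deriv i f x)"
proof
  fix x
  have "(f has_derivative frechet_derivative f (at x)) (at x)" using assms by (intro differentiable_has_frechet)
  moreover have "(h has_derivative (\<lambda>y. h' (f x) * y)) (at (f x))" using assms(2) by (simp add: has_field_derivative_def)
  ultimately have "((h \<circ> f) has_derivative ((\<lambda>y. h' (f x) * y) \<circ> frechet_derivative f (at x))) (at x)"
    by (rule diff_chain_at)
  then show "partial_deriv i (\<lambda>x. h (f x)) x = h' (f x) * partial_deriv i f x"
    using partial_deriv_eq[of "h \<circ> f" _ x i] by (simp add: o_def partial_deriv_def)
qed

text \<open>An invariant for \<open>smooth_coinduct\<close>: by the sum and product rules the
  generated algebra is stable under partial derivatives as soon as the derivatives of its generators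
  lie in it.\<close>

inductive_set alg_span :: "(real ^ 'n::finite \<Rightarrow> real) set \<Rightarrow> (real ^ 'n \<Rightarrow> real) set" for S where
  base: "f \<in> S \<Longrightarrow> f \<in> alg_span S"
| add: "f \<in> alg_span S \<Longrightarrow> g \<in> alg_span S \<Longrightarrow> (\<lambda>x. f x + g x) \<in> alg_span S"
| mult: "f \<in> alg_span S \<Longrightarrow> g \<in> alg_span S \<Longrightarrow> (\<lambda>x. f x * g x) \<in> alg_span S"

lemma smooth_alg_span:
  assumes S: "\<And>f. f \<in> S \<Longrightarrow> (\<forall>x. f differentiable (at x)) \<and> (\<forall>i. partial_deriv i f \<in> alg_span S)"
    and "f \<in> alg_span S"
  shows "smooth f"
proof (rule smooth_coinduct[of "\<lambda>f. f \<in> alg_span S"])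
  show "(\<forall>x. g differentiable (at x)) \<and> (\<forall>i. partial_deriv i g \<in> alg_span S)" if "g \<in> alg_span S" for g
    using that
  proof induction
    case (add f g)
    then have d: "\<And>x. f differentiable (at x)" "\<And>x. g differentiable (at x)" by blast+
    show ?case unfolding partial_deriv_add[OF d]
    proof (intro conjI allI)
      show "(\<lambda>x. f x + g x) differentiable (at x)" for x by (rule differentiable_add[OF d])
      show "(\<lambda>x. partial_deriv i f x + partial_deriv i g x) \<in> alg_span S" for i
        by (rule alg_span.add) (use add in blast)+
    qed
  next
    case (mult f g)
    then have d: "\<And>x. f differentiable (at x)" "\<And>x. g differentiable (at x)" by blast+
    show ?case unfolding partial_deriv_mult[OF d]
    proof (intro conjI allI)
      show "(\<lambda>x. f x * g x) differentiable (at x)" for x by (rule differentiable_mult[OF d])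
      show "(\<lambda>x. f x * partial_deriv i g x + partial_deriv i f x * g x) \<in> alg_span S" for i
        by (rule alg_span.add; rule alg_span.mult) (use mult in blast)+
    qed
  qed (rule S)
qed fact

lemma smooth_add_mult:
  assumes "smooth f" "smooth g"
  shows smooth_add: "smooth (\<lambda>x. f x + g x)" and smooth_mult: "smooth (\<lambda>x. f x * g x)"
proof -
  have "f \<in> alg_span {f. smooth f}" "g \<in> alg_span {f. smooth f}" using assms by (auto intro: alg_span.base)
  then have *: "(\<lambda>x. f x + g x) \<in> alg_span {f. smooth f}" "(\<lambda>x. f x * g x) \<in> alg_span {f. smooth f}"
    by (rule alg_span.add, rule alg_span.mult)
  have S: "(\<forall>x. f differentiable (at x)) \<and> (\<forall>i. partial_deriv i f \<in> alg_span {f. smooth f})"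
    if "f \<in> {f. smooth f}" for f :: "real ^ 'a \<Rightarrow> real"
    using that by (auto intro: alg_span.base smooth_differentiable smooth_partial_deriv)
  show "smooth (\<lambda>x. f x + g x)" "smooth (\<lambda>x. f x * g x)" using smooth_alg_span[OF S] * by blast+
qed

lemma smooth_const [simp]: "smooth (\<lambda>x. c)"
  by (rule smooth_coinduct[of "\<lambda>f. \<exists>c. f = (\<lambda>x. c)"]) auto

lemma smooth_coord [simp]: "smooth (\<lambda>x::real ^ 'n::finite. x $ j)"
proof (rule smooth_alg_span[of "insert (\<lambda>x::real ^ 'n. x $ j) {f. smooth f}"])
  show "(\<lambda>x. x $ j) \<in> alg_span (insert (\<lambda>x::real ^ 'n. x $ j) {f. smooth f})" by (rule alg_span.base) simp
next
  fix f :: "real ^ 'n \<Rightarrow> real" assume f: "f \<in> insert (\<lambda>x::real ^ 'n. x $ j) {f. smooth f}"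
  then have "f differentiable (at x)" for x
    by (auto intro: smooth_differentiable bounded_linear_imp_differentiable bounded_linear_vec_nth)
  moreover have "partial_deriv i f \<in> alg_span (insert (\<lambda>x::real ^ 'n. x $ j) {f. smooth f})" for i
    using f by (intro alg_span.base) (auto simp: partial_deriv_coord intro: smooth_partial_deriv)
  ultimately show "(\<forall>x. f differentiable (at x)) \<and> (\<forall>i. partial_deriv i f \<in> alg_span (insert (\<lambda>x. x $ j) {f. smooth f}))"
    by blast
qed

lemma smooth_diff: "smooth f \<Longrightarrow> smooth g \<Longrightarrow> smooth (\<lambda>x. f x - g x)"
  using smooth_add[of f "\<lambda>x. (-1) * g x"] smooth_mult[of "\<lambda>x. -1" g] by simp

lemma smooth_sum: "finite I \<Longrightarrow> (\<And>i. i \<in> I \<Longrightarrow> smooth (f i)) \<Longrightarrow> smooth (\<lambda>x. \<Sum>i\<in>I. f i x)"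
  by (induction I rule: finite_induct) (auto intro: smooth_add)

lemma smooth_prod: "finite I \<Longrightarrow> (\<And>i. i \<in> I \<Longrightarrow> smooth (f i)) \<Longrightarrow> smooth (\<lambda>x. \<Prod>i\<in>I. f i x)"
  by (induction I rule: finite_induct) (auto intro: smooth_mult)

text \<open>The family \<open>h\<close> lists the successive derivatives of one function. With all
  smooth functions and all compositions of some \<open>h k\<close> with f as generators, the chain
  rule does not leave the algebra.\<close>

lemma smooth_compose:
  fixes h :: "nat \<Rightarrow> real \<Rightarrow> real"
  assumes h: "\<And>k t. (h k has_real_derivative h (Suc k) t) (at t)" and f: "smooth f"
  shows "smooth (\<lambda>x. h k (f x))"
proof -
  define S where "S = {f. smooth f} \<union> range (\<lambda>k x. h k (f x))"
  show ?thesis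
  proof (rule smooth_alg_span[of S])
    show "(\<lambda>x. h k (f x)) \<in> alg_span S" unfolding S_def by (rule alg_span.base) auto
  next
    fix g assume "g \<in> S"
    then consider "smooth g" | k where "g = (\<lambda>x. h k (f x))" unfolding S_def by auto
    then show "(\<forall>x. g differentiable (at x)) \<and> (\<forall>i. partial_deriv i g \<in> alg_span S)"
    proof cases
      case 1
      then show ?thesis unfolding S_def by (auto intro!: alg_span.base smooth_differentiable smooth_partial_deriv)
    next
      case 2
      have "g differentiable (at x)" for x
        unfolding 2 using h[of k "f x"] smooth_differentiable[OF f, of x]
        by (metis differentiable_def has_field_derivative_def differentiable_compose)
      moreover have "partial_deriv i g \<in> alg_span S" for i
        unfolding 2 partial_deriv_compose[OF smooth_differentiable[OF f] h]
        by (intro alg_span.mult alg_span.base) (auto simp: S_def smooth_partial_deriv[OF f])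
      ultimately show ?thesis by blast
    qed
  qed
qed

section \<open>Bump functions on boxes\<close>

lemma poly_div_exp_tendsto_0: "((\<lambda>x. poly p x / exp x) \<longlongrightarrow> 0) at_top" for p :: "real poly"
proof -
  have "((\<lambda>x. \<Sum>i\<le>degree p. coeff p i * (x ^ i / exp x)) \<longlongrightarrow> (\<Sum>i\<le>degree p. coeff p i * 0)) at_top"
    by (intro tendsto_intros tendsto_power_div_exp_0)
  then show ?thesis by (simp add: poly_altdef sum_divide_distrib)
qed

text \<open>The family is closed under differentiation, p being replaced by X^2 (p - p'). This
  provides the whole chain of derivatives of exp (-1/t) that \<open>smooth_compose\<close> asks
  for.\<close>

definition flat :: "real poly \<Rightarrow> real \<Rightarrow> real" where
  "flat p t = (if t > 0 then poly p (1/t) * exp (- 1/t) else 0)"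

lemma flat_deriv: "(flat p has_real_derivative flat ([:0,0,1:] * (p - pderiv p)) t) (at t)"
proof -
  consider "t > 0" | "t < 0" | "t = 0" by linarith
  then show ?thesis
  proof cases
    case 1
    have "((\<lambda>t. poly p (1/t) * exp (- 1/t)) has_real_derivative flat ([:0,0,1:] * (p - pderiv p)) t) (at t)"
    proof -
      have i: "((\<lambda>t. 1/t) has_real_derivative - (1/t)\<^sup>2) (at t)"
        using 1 by (auto intro!: derivative_eq_intros simp: power2_eq_square)
      have "((\<lambda>t. poly p (1/t)) has_real_derivative poly (pderiv p) (1/t) * (- (1/t)\<^sup>2)) (at t)"
        by (rule DERIV_chain2[OF poly_DERIV i])
      moreover have "((\<lambda>t. exp (- 1/t)) has_real_derivative exp (- 1/t) * (1/t)\<^sup>2) (at t)"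
        using DERIV_chain2[OF DERIV_exp DERIV_minus[OF i]] by simp
      ultimately have "((\<lambda>t. poly p (1/t) * exp (- 1/t)) has_real_derivative
         (poly (pderiv p) (1/t) * (- (1/t)\<^sup>2)) * exp (- 1/t) + (exp (- 1/t) * (1/t)\<^sup>2) * poly p (1/t)) (at t)"
        by (rule DERIV_mult)
      moreover have "(poly (pderiv p) (1/t) * (- (1/t)\<^sup>2)) * exp (- 1/t) + (exp (- 1/t) * (1/t)\<^sup>2) * poly p (1/t)
         = flat ([:0,0,1:] * (p - pderiv p)) t"
        unfolding flat_def using 1 by (simp add: power2_eq_square left_diff_distrib right_diff_distrib diff_divide_distrib mult_ac)
      ultimately show ?thesis by simp
    qed
    then show ?thesis
      by (rule has_field_derivative_transform_within_open[of _ _ _ "{0<..}"]) (use 1 in \<open>auto simp: flat_def\<close>)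
  next
    case 2
    have "((\<lambda>t. 0) has_real_derivative flat ([:0,0,1:] * (p - pderiv p)) t) (at t)"
      unfolding flat_def using 2 by auto
    then show ?thesis
      by (rule has_field_derivative_transform_within_open[of _ _ _ "{..<0}"]) (use 2 in \<open>auto simp: flat_def\<close>)
  next
    case 3
    have "((\<lambda>t. flat p t / t) \<longlongrightarrow> 0) (at_left 0)"
      by (rule tendsto_eventually) (auto simp: flat_def eventually_at_filter)
    moreover have "((\<lambda>t. flat p t / t) \<longlongrightarrow> 0) (at_right 0)"
    proof -
      \<comment> \<open>The difference quotient at 0 divides by t, that is, it multiplies p by one
        more power of 1/t; the exponential still wins.\<close>
      have "((\<lambda>t. poly (pCons 0 p) (inverse t) / exp (inverse t)) \<longlongrightarrow> 0) (at_right (0::real))"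
        by (rule filterlim_compose[OF poly_div_exp_tendsto_0 filterlim_inverse_at_top_right])
      moreover have "eventually (\<lambda>t. poly (pCons 0 p) (inverse t) / exp (inverse t) = flat p t / t) (at_right 0)"
        unfolding eventually_at_filter by (auto simp: flat_def exp_minus field_simps)
      ultimately show ?thesis by (rule Lim_transform_eventually)
    qed
    ultimately have "((\<lambda>t. flat p t / t) \<longlongrightarrow> 0) (at 0)" by (simp add: filterlim_at_split)
    then show ?thesis unfolding 3 by (simp add: has_field_derivative_iff flat_def)
  qed
qed

definition bump :: "real \<Rightarrow> real" where "bump = flat 1"

lemma bump: "bump t = (if t > 0 then exp (- 1/t) else 0)"
  unfolding bump_def flat_def by simp

lemma smooth_bump: "smooth f \<Longrightarrow> smooth (\<lambda>x. bump (f x))"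
proof -
  assume f: "smooth f"
  define pp :: "nat \<Rightarrow> real poly" where "pp = rec_nat 1 (\<lambda>_ p. [:0,0,1:] * (p - pderiv p))"
  have "smooth (\<lambda>x. (\<lambda>k. flat (pp k)) 0 (f x))"
    by (rule smooth_compose[OF _ f]) (use flat_deriv in \<open>simp add: pp_def\<close>)
  then show ?thesis by (simp add: pp_def bump_def)
qed

text \<open>In each coordinate the quadratic is positive exactly between the two faces, which
  confines the support to the box. The factor \<open>Suc k\<close> sends exp (-1 / (k t)) to 1 at
  interior points, so the limit is the indicator of the open box.\<close>

definition box_bump :: "real ^ 'n \<Rightarrow> real ^ 'n \<Rightarrow> nat \<Rightarrow> real ^ 'n::finite \<Rightarrow> real" where
  "box_bump a b k x = (\<Prod>i\<in>UNIV. bump (real (Suc k) * ((x $ i - a $ i) * (b $ i - x $ i))))"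

lemma mult_pos_between: "a \<le> b \<Longrightarrow> (x - a) * (b - x) > 0 \<longleftrightarrow> a < x \<and> x < b" for a b x :: real
  by (auto simp: zero_less_mult_iff)

lemma box_bump_nz:
  assumes "\<And>i. a $ i \<le> b $ i"
  shows "box_bump a b k x \<noteq> 0 \<longleftrightarrow> x \<in> box a b"
proof -
  have "bump (real (Suc k) * ((x $ i - a $ i) * (b $ i - x $ i))) \<noteq> 0 \<longleftrightarrow> a $ i < x $ i \<and> x $ i < b $ i" for i
    using mult_pos_between[OF assms[of i], of "x $ i"] unfolding bump by (auto simp: zero_less_mult_iff)
  then show ?thesis unfolding box_bump_def by (auto simp: mem_box_cart)
qed

lemma box_bump_range: "0 \<le> box_bump a b k x" "box_bump a b k x \<le> 1"
  unfolding box_bump_def by (auto intro!: prod_nonneg prod_le_1 simp: bump)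

lemma test_box_bump:
  assumes ab: "\<And>i. a $ i \<le> b $ i" and sub: "cbox a b \<subseteq> \<Omega>"
  shows "test_function \<Omega> (box_bump a b k)"
proof -
  have "smooth (box_bump a b k)"
    unfolding box_bump_def[abs_def] by (intro smooth_prod smooth_bump smooth_mult smooth_diff smooth_const smooth_coord) auto
  moreover have "closure {x. box_bump a b k x \<noteq> 0} \<subseteq> cbox a b"
    unfolding box_bump_nz[OF ab] by (intro closure_minimal) (auto simp: box_subset_cbox)
  ultimately show ?thesis unfolding test_function_def smooth_def using sub
    by (auto intro: bounded_subset[OF bounded_cbox] simp: compact_eq_bounded_closed)
qed

lemma box_bump_lim:
  assumes ab: "\<And>i. a $ i \<le> b $ i"
  shows "(\<lambda>k. box_bump a b k x) \<longlonglongrightarrow> indicator (box a b) x"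
proof (cases "x \<in> box a b")
  case True
  have "(\<lambda>k. bump (real (Suc k) * s)) \<longlonglongrightarrow> 1" if "s > 0" for s
  proof -
    have "(\<lambda>k. 1 / real (Suc k)) \<longlonglongrightarrow> 0" by real_asymp
    then have "(\<lambda>k. exp (- (1/s) * (1 / real (Suc k)))) \<longlonglongrightarrow> exp (- (1/s) * 0)" by (intro tendsto_intros)
    then have "(\<lambda>k. exp (- 1 / (real (Suc k) * s))) \<longlonglongrightarrow> 1" using that by (simp add: field_simps)
    then show ?thesis unfolding bump using that by simp
  qed
  then have "(\<lambda>k. box_bump a b k x) \<longlonglongrightarrow> (\<Prod>i\<in>(UNIV::'a set). 1)"
    unfolding box_bump_def using True by (intro tendsto_prod) (auto simp: mem_box_cart)
  then show ?thesis using True by simp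
next
  case False
  then have "box_bump a b k x = 0" for k using box_bump_nz[OF ab] by blast
  then show ?thesis using False by simp
qed

section \<open>The fundamental lemma of the calculus of variations\<close>

lemma AE_zero_lborel:
  fixes f :: "real ^ 'n::finite \<Rightarrow> real"
  assumes f: "integrable lborel f" and z: "\<And>a b. (\<integral>x. indicator (box a b) x * f x \<partial>lborel) = 0"
  shows "AE x in lborel. f x = 0"
proof -
  define M1 where "M1 = density lborel (\<lambda>x. ennreal (f x))"
  define M2 where "M2 = density lborel (\<lambda>x. ennreal (- f x))"
  have fm [measurable]: "f \<in> borel_measurable borel" using f by simp
  have i1: "integrable lborel (\<lambda>x. max 0 (f x))" and i2: "integrable lborel (\<lambda>x. max 0 (- f x))" using f by auto
  have e1: "emeasure M1 (box a b) = ennreal (\<integral>x. indicator (box a b) x * max 0 (f x) \<partial>lborel)" for a b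
  proof -
    have "emeasure M1 (box a b) = (\<integral>\<^sup>+x. ennreal (f x) * indicator (box a b) x \<partial>lborel)"
      unfolding M1_def by (rule emeasure_density) auto
    also have "\<dots> = (\<integral>\<^sup>+x. ennreal (indicator (box a b) x * max 0 (f x)) \<partial>lborel)"
      by (rule nn_integral_cong) (auto simp: indicator_def ennreal_max_0)
    also have "\<dots> = ennreal (\<integral>x. indicator (box a b) x * max 0 (f x) \<partial>lborel)"
      by (rule nn_integral_eq_integral) (use integrable_mult_indicator[OF _ i1, of "box a b"] in \<open>auto simp: indicator_def\<close>)
    finally show ?thesis .
  qed
  have e2: "emeasure M2 (box a b) = ennreal (\<integral>x. indicator (box a b) x * max 0 (- f x) \<partial>lborel)" for a b
  proof -
    have "emeasure M2 (box a b) = (\<integral>\<^sup>+x. ennreal (- f x) * indicator (box a b) x \<partial>lborel)"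
      unfolding M2_def by (rule emeasure_density) auto
    also have "\<dots> = (\<integral>\<^sup>+x. ennreal (indicator (box a b) x * max 0 (- f x)) \<partial>lborel)"
      by (rule nn_integral_cong) (auto simp: indicator_def ennreal_max_0)
    also have "\<dots> = ennreal (\<integral>x. indicator (box a b) x * max 0 (- f x) \<partial>lborel)"
      by (rule nn_integral_eq_integral) (use integrable_mult_indicator[OF _ i2, of "box a b"] in \<open>auto simp: indicator_def\<close>)
    finally show ?thesis .
  qed
  have e: "emeasure M1 (box a b) = emeasure M2 (box a b)" for a b
  proof -
    have "(\<integral>x. indicator (box a b) x * max 0 (f x) \<partial>lborel) - (\<integral>x. indicator (box a b) x * max 0 (- f x) \<partial>lborel)
      = (\<integral>x. indicator (box a b) x * max 0 (f x) - indicator (box a b) x * max 0 (- f x) \<partial>lborel)"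
      by (rule Bochner_Integration.integral_diff[symmetric])
        (use integrable_mult_indicator[OF _ i1, of "box a b"] integrable_mult_indicator[OF _ i2, of "box a b"] in auto)
    also have "\<dots> = (\<integral>x. indicator (box a b) x * f x \<partial>lborel)"
      by (rule Bochner_Integration.integral_cong) (auto simp: indicator_def)
    finally show ?thesis unfolding e1 e2 using z[of a b] by simp
  qed
  \<comment> \<open>Boxes form an intersection-stable generator on which the positive and the
    negative part of f have the same mass. Equal measures have densities that agree a.e., and the
    two parts of f can only agree where f = 0.\<close>
  have "M1 = M2"
  proof (rule measure_eqI_generator_eq)
    let ?E = "range (\<lambda>(a, b). box a b :: (real ^ 'n) set)"
    show "Int_stable ?E"
      by (auto simp: Int_stable_def box_Int_box)
    show "?E \<subseteq> Pow UNIV" "sets M1 = sigma_sets UNIV ?E" "sets M2 = sigma_sets UNIV ?E"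
      by (simp_all add: borel_eq_box M1_def M2_def)
    let ?A = "\<lambda>n::nat. box (- (real n *\<^sub>R One)) (real n *\<^sub>R One) :: (real ^ 'n) set"
    show "range ?A \<subseteq> ?E" "(\<Union>i. ?A i) = UNIV"
      unfolding UN_box_eq_UNIV by auto
    { fix i show "emeasure M1 (?A i) \<noteq> \<infinity>" unfolding e1 by simp }
    { fix X assume "X \<in> ?E" then show "emeasure M1 X = emeasure M2 X" using e by auto }
  qed
  then have "AE x in lborel. ennreal (f x) = ennreal (- f x)"
    unfolding M1_def M2_def by (subst (asm) sigma_finite_measure.density_unique_iff[OF lborel.sigma_finite_measure_axioms]) auto
  then show ?thesis
  proof eventually_elim
    case (elim x)
    then show ?case by (cases "f x \<ge> 0") (auto simp: ennreal_neg ennreal_eq_0_iff)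
  qed
qed

lemma AE_zero_lebesgue:
  fixes f :: "real ^ 'n::finite \<Rightarrow> real"
  assumes f: "integrable lebesgue f" and z: "\<And>a b. (\<integral>x. indicator (box a b) x * f x \<partial>lebesgue) = 0"
  shows "AE x in lebesgue. f x = 0"
proof -
  obtain g where g: "g \<in> borel_measurable lborel" "AE x in lborel. f x = g x"
    using completion_ex_borel_measurable_real[of f lborel] f by auto
  have ae: "AE x in lebesgue. f x = g x" using g(2) by (rule AE_completion)
  have gl: "g \<in> borel_measurable lebesgue" using g(1) by (rule measurable_completion)
  have "integrable lebesgue g" using integrable_cong_AE[OF borel_measurable_integrable[OF f] gl ae] f by simp
  then have ig: "integrable lborel g" using g(1) by (subst (asm) integrable_completion) auto
  have "(\<integral>x. indicator (box a b) x * g x \<partial>lborel) = 0" for a b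
  proof -
    have "(\<integral>x. indicator (box a b) x * g x \<partial>lborel) = (\<integral>x. indicator (box a b) x * g x \<partial>lebesgue)"
      using g(1) by (subst integral_completion) auto
    also have "\<dots> = (\<integral>x. indicator (box a b) x * f x \<partial>lebesgue)"
    proof (rule integral_cong_AE)
      show "(\<lambda>x. indicat_real (box a b) x * g x) \<in> borel_measurable lebesgue"
        by (intro borel_measurable_times borel_measurable_indicator gl) auto
      show "(\<lambda>x. indicat_real (box a b) x * f x) \<in> borel_measurable lebesgue"
        using f by (intro borel_measurable_times borel_measurable_indicator) auto
    qed (use ae in auto)
    finally show ?thesis using z by simp
  qed
  from AE_completion[OF AE_zero_lborel[OF ig this]] ae show ?thesis by eventually_elim simp
qed

lemma AE_zero_lebesgue_complex:
  fixes f :: "real ^ 'n::finite \<Rightarrow> complex"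
  assumes f: "integrable lebesgue f" and z: "\<And>a b. (\<integral>x. indicator (box a b) x *\<^sub>R f x \<partial>lebesgue) = 0"
  shows "AE x in lebesgue. f x = 0"
proof -
  have i: "integrable lebesgue (\<lambda>x. indicator (box a b) x *\<^sub>R f x)" for a b
    by (rule integrable_mult_indicator[OF _ f]) auto
  have "AE x in lebesgue. Re (f x) = 0"
  proof (rule AE_zero_lebesgue)
    show "(\<integral>x. indicator (box a b) x * Re (f x) \<partial>lebesgue) = 0" for a b
      using integral_Re[OF i, of a b] z[of a b] by simp
  qed (use f in auto)
  moreover have "AE x in lebesgue. Im (f x) = 0"
  proof (rule AE_zero_lebesgue)
    show "(\<integral>x. indicator (box a b) x * Im (f x) \<partial>lebesgue) = 0" for a b
      using integral_Im[OF i, of a b] z[of a b] by simp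
  qed (use f in auto)
  ultimately show ?thesis by eventually_elim (simp add: complex_eq_iff)
qed

lemma test_function_smooth: "test_function \<Omega> \<phi> \<Longrightarrow> smooth \<phi>"
  unfolding test_function_def smooth_def by blast

lemma smooth_continuous: "smooth f \<Longrightarrow> continuous_on A f"
  by (intro continuous_at_imp_continuous_on ballI differentiable_imp_continuous_within smooth_differentiable)

lemma smooth_borel: "smooth f \<Longrightarrow> f \<in> borel_measurable lebesgue"
  using borel_measurable_continuous_onI[OF smooth_continuous[of f UNIV]] by (simp add: measurable_completion)

lemma test_function_bounded:
  assumes "test_function \<Omega> \<phi>"
  shows "\<exists>B. \<forall>x. \<bar>\<phi> x\<bar> \<le> B"
proof -
  have "compact (\<phi> ` closure {x. \<phi> x \<noteq> 0})"
    by (rule compact_continuous_image[OF smooth_continuous[OF test_function_smooth[OF assms]]])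
       (use assms in \<open>simp add: test_function_def\<close>)
  then have "bounded (\<phi> ` closure {x. \<phi> x \<noteq> 0})" by (rule compact_imp_bounded)
  then obtain B where "\<forall>y\<in>\<phi> ` closure {x. \<phi> x \<noteq> 0}. norm y \<le> B"
    unfolding bounded_iff by (rule exE)
  then have B: "norm (\<phi> x) \<le> B" if "x \<in> closure {x. \<phi> x \<noteq> 0}" for x
    using that by (rule bspec[OF _ imageI])
  have "\<bar>\<phi> x\<bar> \<le> max B 0" for x
  proof (cases "\<phi> x = 0")
    case False
    then have "x \<in> closure {x. \<phi> x \<noteq> 0}" by (intro subsetD[OF closure_subset]) simp
    then have "norm (\<phi> x) \<le> B" by (rule B)
    then show ?thesis by (simp add: le_max_iff_disj)
  qed (simp add: le_max_iff_disj)
  then show ?thesis by blast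
qed

lemma locally_integrable_indicator:
  "locally_integrable \<Omega> u \<Longrightarrow> compact K \<Longrightarrow> K \<subseteq> \<Omega> \<Longrightarrow> integrable lebesgue (\<lambda>x. indicator K x *\<^sub>R u x)"
  unfolding locally_integrable_def by (subst integrable_restrict_space[symmetric]) (auto simp: lmeasurable_compact fmeasurableD)

lemma test_integrable:
  assumes \<Omega>: "open \<Omega>" and t: "test_function \<Omega> \<phi>" and u: "locally_integrable \<Omega> u"
  shows "integrable (lebesgue_on \<Omega>) (\<lambda>x. \<phi> x *\<^sub>R u x)"
proof -
  define K where "K = closure {x. \<phi> x \<noteq> 0}"
  have K: "compact K" "K \<subseteq> \<Omega>" using t unfolding K_def test_function_def by auto
  have z: "\<phi> x = 0" if "x \<notin> K" for x
    using that subsetD[OF closure_subset, of x "{x. \<phi> x \<noteq> 0}"] unfolding K_def by auto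
  obtain B where B: "\<And>x. \<bar>\<phi> x\<bar> \<le> B" using test_function_bounded[OF t] by blast
  have i: "integrable lebesgue (\<lambda>x. indicator K x *\<^sub>R u x)" by (rule locally_integrable_indicator[OF u K])
  have "integrable lebesgue (\<lambda>x. \<phi> x *\<^sub>R (indicator K x *\<^sub>R u x))"
  proof (rule Bochner_Integration.integrable_bound)
    show "integrable lebesgue (\<lambda>x. B *\<^sub>R (indicator K x *\<^sub>R u x))" using i by (rule integrable_scaleR_right)
    show "(\<lambda>x. \<phi> x *\<^sub>R (indicator K x *\<^sub>R u x)) \<in> borel_measurable lebesgue"
      by (rule borel_measurable_scaleR[OF smooth_borel[OF test_function_smooth[OF t]] borel_measurable_integrable[OF i]])
    show "AE x in lebesgue. norm (\<phi> x *\<^sub>R (indicator K x *\<^sub>R u x)) \<le> norm (B *\<^sub>R (indicator K x *\<^sub>R u x))"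
    proof (intro AE_I2)
      fix x
      have "\<bar>\<phi> x\<bar> \<le> \<bar>B\<bar>" using B[of x] by linarith
      then show "norm (\<phi> x *\<^sub>R (indicator K x *\<^sub>R u x)) \<le> norm (B *\<^sub>R (indicator K x *\<^sub>R u x))"
        unfolding norm_scaleR[of "\<phi> x"] norm_scaleR[of B] by (intro mult_right_mono) auto
    qed
  qed
  also have "(\<lambda>x. \<phi> x *\<^sub>R (indicator K x *\<^sub>R u x)) = (\<lambda>x. indicator \<Omega> x *\<^sub>R (\<phi> x *\<^sub>R u x))"
    using z K by (auto simp: fun_eq_iff indicator_def)
  finally show ?thesis using \<Omega> by (subst integrable_restrict_space) auto
qed

text \<open>Bumps converge boundedly to the indicator of a box, so v has integral 0 over every box
  whose closure lies in \<Omega>, and vanishes a.e. on each such closed box; countably many of them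
  cover \<Omega>.\<close>

lemma fundamental_lemma:
  assumes \<Omega>: "open \<Omega>" and v: "locally_integrable \<Omega> v"
    and z: "\<And>\<phi>. test_function \<Omega> \<phi> \<Longrightarrow> (LINT x|lebesgue_on \<Omega>. \<phi> x *\<^sub>R v x) = 0"
  shows "AE x in lebesgue_on \<Omega>. v x = 0"
proof -
  have bx: "(\<integral>x. indicator (box a b) x *\<^sub>R v x \<partial>lebesgue) = 0" if ab: "\<And>i. a $ i \<le> b $ i" and sub: "cbox a b \<subseteq> \<Omega>" for a b
  proof -
    define g where "g x = indicator (cbox a b) x *\<^sub>R v x" for x
    have g: "integrable lebesgue g" unfolding g_def by (rule locally_integrable_indicator[OF v _ sub]) simp
    have gm: "g \<in> borel_measurable lebesgue" using g by simp
    have eq: "(\<integral>x. box_bump a b k x *\<^sub>R g x \<partial>lebesgue) = 0" for k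
    proof -
      have "box_bump a b k x *\<^sub>R g x = indicator \<Omega> x *\<^sub>R (box_bump a b k x *\<^sub>R v x)" for x
        using box_bump_nz[OF ab, of k x] box_subset_cbox[of a b] sub by (auto simp: g_def indicator_def)
      then have "(\<integral>x. box_bump a b k x *\<^sub>R g x \<partial>lebesgue) = (LINT x|lebesgue_on \<Omega>. box_bump a b k x *\<^sub>R v x)"
        using \<Omega> by (subst integral_restrict_space) auto
      then show ?thesis using z[OF test_box_bump[OF ab sub]] by simp
    qed
    have "(\<lambda>k. \<integral>x. box_bump a b k x *\<^sub>R g x \<partial>lebesgue) \<longlonglongrightarrow> (\<integral>x. indicator (box a b) x *\<^sub>R g x \<partial>lebesgue)"
    proof (rule integral_dominated_convergence)
      show "integrable lebesgue (\<lambda>x. norm (g x))" using g by simp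
      show "AE x in lebesgue. (\<lambda>k. box_bump a b k x *\<^sub>R g x) \<longlonglongrightarrow> indicator (box a b) x *\<^sub>R g x"
        by (intro AE_I2 tendsto_scaleR box_bump_lim[OF ab] tendsto_const)
      show "AE x in lebesgue. norm (box_bump a b k x *\<^sub>R g x) \<le> norm (g x)" for k
        using box_bump_range[of a b k] by (intro AE_I2) (simp add: mult_left_le_one_le)
      show "(\<lambda>x. indicator (box a b) x *\<^sub>R g x) \<in> borel_measurable lebesgue"
        by (intro borel_measurable_scaleR gm borel_measurable_indicator) auto
      show "(\<lambda>x. box_bump a b k x *\<^sub>R g x) \<in> borel_measurable lebesgue" for k
        by (intro borel_measurable_scaleR gm smooth_borel test_function_smooth[OF test_box_bump[OF ab sub]])
    qed
    then have "(\<integral>x. indicator (box a b) x *\<^sub>R g x \<partial>lebesgue) = 0" unfolding eq by (simp add: LIMSEQ_const_iff)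
    moreover have "indicator (box a b) x *\<^sub>R g x = indicator (box a b) x *\<^sub>R v x" for x
      using box_subset_cbox[of a b] by (auto simp: g_def indicator_def)
    ultimately show ?thesis by simp
  qed
  have cb: "AE x in lebesgue. x \<in> cbox a b \<longrightarrow> v x = 0" if sub: "cbox a b \<subseteq> \<Omega>" for a b
  proof -
    define g where "g x = indicator (cbox a b) x *\<^sub>R v x" for x
    define g' where "g' x = indicator (box a b) x *\<^sub>R v x" for x
    have g: "integrable lebesgue g" unfolding g_def by (rule locally_integrable_indicator[OF v _ sub]) simp
    have "g' = (\<lambda>x. indicator (box a b) x *\<^sub>R g x)"
      using box_subset_cbox[of a b] by (auto simp: g_def g'_def indicator_def fun_eq_iff)
    then have g': "integrable lebesgue g'" using integrable_mult_indicator[OF _ g, of "box a b"] by simp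
    have "AE x in lebesgue. g' x = 0"
    proof (rule AE_zero_lebesgue_complex[OF g'])
      fix c e :: "real ^ 'a"
      \<comment> \<open>The intersection of two boxes is a box. When it is empty the integrand
        vanishes; otherwise its corners are ordered as \<open>bx\<close> demands.\<close>
      define l where "l = (\<chi> i. max (a $ i) (c $ i))"
      define r where "r = (\<chi> i. min (b $ i) (e $ i))"
      have br: "box l r = box a b \<inter> box c e" by (auto simp: l_def r_def mem_box_cart)
      show "(\<integral>x. indicator (box c e) x *\<^sub>R g' x \<partial>lebesgue) = 0"
      proof (cases "box l r = {}")
        case True
        then have "indicator (box c e) x *\<^sub>R g' x = 0" for x unfolding br by (auto simp: g'_def indicator_def)
        then show ?thesis by (intro integral_eq_zero_AE AE_I2)
      next
        case False
        then obtain y where "y \<in> box l r" by blast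
        then have "l $ i < r $ i" for i by (meson mem_box_cart(1) less_trans)
        moreover have "cbox l r \<subseteq> \<Omega>" using sub by (auto simp: l_def r_def mem_box_cart subset_iff)
        ultimately have "(\<integral>x. indicator (box l r) x *\<^sub>R v x \<partial>lebesgue) = 0" by (intro bx) (auto intro: less_imp_le)
        moreover have "indicator (box c e) x *\<^sub>R g' x = indicator (box l r) x *\<^sub>R v x" for x
          unfolding br by (auto simp: g'_def indicator_def)
        ultimately show ?thesis by simp
      qed
    qed
    moreover have "negligible (cbox a b - box a b)" by (rule negligible_frontier_interval)
    then have "AE x in lebesgue. x \<notin> cbox a b - box a b"
      by (intro AE_not_in) (simp add: negligible_iff_null_sets)
    ultimately show ?thesis by eventually_elim (auto simp: g'_def)
  qed
  obtain D where D: "countable D" "\<And>X. X \<in> D \<Longrightarrow> X \<subseteq> \<Omega>" "\<And>X. X \<in> D \<Longrightarrow> \<exists>a b. X = cbox a b" "\<Union>D = \<Omega>"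
    using open_countable_Union_open_cbox[OF \<Omega>] by (metis PowD subsetD)
  have "AE x in lebesgue. \<forall>X\<in>D. x \<in> X \<longrightarrow> v x = 0"
    unfolding AE_ball_countable[OF D(1)] using D(2,3) cb by metis
  then have "AE x in lebesgue. x \<in> \<Omega> \<longrightarrow> v x = 0" using D(4) by (auto elim: eventually_mono)
  then show ?thesis using \<Omega> by (subst AE_restrict_space_iff) auto
qed

section \<open>Integration by parts against test functions\<close>

lemma not_in_closure_support: "x \<notin> closure {x. \<phi> x \<noteq> 0} \<Longrightarrow> \<phi> x = 0"
  by (rule ccontr) (simp add: subsetD[OF closure_subset])

text \<open>Translation invariance of the measure takes the place of Fubini: difference quotients of
  \<psi> have integral 0, are bounded through the mean value inequality, and converge to D.\<close>

lemma integral_directional_derivative: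
  fixes \<psi> D :: "real ^ 'n::finite \<Rightarrow> complex" and e :: "real ^ 'n"
  assumes c\<psi>: "continuous_on UNIV \<psi>" and cD: "continuous_on UNIV D"
    and der: "\<And>x. ((\<lambda>t. \<psi> (x + t *\<^sub>R e)) has_vector_derivative D x) (at 0)"
    and K: "compact K" "\<And>x. x \<notin> K \<Longrightarrow> \<psi> x = 0"
  shows "(\<integral>x. D x \<partial>lborel) = 0"
proof -
  have D0: "D x = 0" if x: "x \<notin> K" for x
  proof -
    have "open (- K)" using K(1) by (simp add: compact_imp_closed open_Compl)
    then have "open ((\<lambda>t. x + t *\<^sub>R e) -` (- K))" by (rule open_vimage) (intro continuous_intros)
    then have "((\<lambda>t. 0) has_vector_derivative D x) (at 0)"
      by (rule has_vector_derivative_transform_within_open[OF der[of x]]) (use K(2) x in auto)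
    from vector_derivative_unique_at[OF this has_vector_derivative_const] show ?thesis .
  qed
  obtain R where R: "\<And>x. x \<in> K \<Longrightarrow> norm x \<le> R" using compact_imp_bounded[OF K(1)] unfolding bounded_iff by blast
  have "bounded (D ` K)" by (intro compact_imp_bounded compact_continuous_image K continuous_on_subset[OF cD]) auto
  then obtain B0 where B0: "\<forall>y\<in>D ` K. norm y \<le> B0" unfolding bounded_iff by (rule exE)
  define B where "B = max B0 0"
  have B: "norm (D x) \<le> B" for x
    using bspec[OF B0 imageI, of x] D0[of x] unfolding B_def by (cases "x \<in> K") (auto simp: le_max_iff_disj)
  have B': "B \<ge> 0" unfolding B_def by simp
  have dert: "((\<lambda>t. \<psi> (x + t *\<^sub>R e)) has_vector_derivative D (x + t *\<^sub>R e)) (at t)" for x t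
  proof -
    have "((\<lambda>s. \<psi> ((x + t *\<^sub>R e) + (s - t) *\<^sub>R e)) has_vector_derivative D (x + t *\<^sub>R e)) (at t)"
    proof -
      have "((\<lambda>s. s - t) has_vector_derivative 1) (at t)" by (auto intro!: derivative_eq_intros)
      moreover have "((\<lambda>s. \<psi> ((x + t *\<^sub>R e) + s *\<^sub>R e)) has_vector_derivative D (x + t *\<^sub>R e)) (at (t - t))"
        using der[of "x + t *\<^sub>R e"] by simp
      ultimately show ?thesis 
        using vector_diff_chain_at[of "\<lambda>s. s - t" 1 t "\<lambda>s. \<psi> ((x + t *\<^sub>R e) + s *\<^sub>R e)" "D (x + t *\<^sub>R e)"]
        by (simp add: o_def)
    qed
    then show ?thesis by (simp add: algebra_simps)
  qed
  have incr: "norm (\<psi> (x + h *\<^sub>R e) - \<psi> x) \<le> B * h" if "h \<ge> 0" for x h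
  proof -
    have "norm (\<psi> (x + h *\<^sub>R e) - \<psi> (x + 0 *\<^sub>R e)) \<le> B * norm (h - 0)"
    proof (rule differentiable_bound[of "{0..h}" "\<lambda>t. \<psi> (x + t *\<^sub>R e)" "\<lambda>t s. s *\<^sub>R D (x + t *\<^sub>R e)"])
      show "((\<lambda>t. \<psi> (x + t *\<^sub>R e)) has_derivative (\<lambda>s. s *\<^sub>R D (x + t *\<^sub>R e))) (at t within {0..h})" for t
        using dert[of x t] unfolding has_vector_derivative_def by (rule has_derivative_at_withinI)
      show "onorm (\<lambda>s. s *\<^sub>R D (x + t *\<^sub>R e)) \<le> B" for t
        by (rule onorm_le) (simp, metis B mult.commute mult_right_mono abs_ge_zero)
    qed (use that in auto)
    then show ?thesis using that by simp
  qed
  have i\<psi>: "integrable lborel \<psi>"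
  proof -
    have "integrable lborel (\<lambda>x. indicator K x *\<^sub>R \<psi> x)"
      by (intro borel_integrable_compact K continuous_on_subset[OF c\<psi>]) auto
    moreover have "(\<lambda>x. indicator K x *\<^sub>R \<psi> x) = \<psi>" using K(2) by (auto simp: indicator_def fun_eq_iff)
    ultimately show ?thesis by simp
  qed
  have m\<psi> [measurable]: "\<psi> \<in> borel_measurable borel" by (rule borel_measurable_continuous_onI[OF c\<psi>])
  have mD [measurable]: "D \<in> borel_measurable borel" by (rule borel_measurable_continuous_onI[OF cD])
  have shift: "integrable lborel (\<lambda>x. \<psi> (c + x))" "(\<integral>x. \<psi> (c + x) \<partial>lborel) = (\<integral>x. \<psi> x \<partial>lborel)" for c
  proof -
    show "integrable lborel (\<lambda>x. \<psi> (c + x))"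
      using integrable_distr_eq[of "(+) c" lborel borel \<psi>] i\<psi> by (simp add: lborel_distr_plus)
    show "(\<integral>x. \<psi> (c + x) \<partial>lborel) = (\<integral>x. \<psi> x \<partial>lborel)"
      using integral_distr[of "(+) c" lborel borel \<psi>] by (simp add: lborel_distr_plus)
  qed
  define s where "s n x = real (Suc n) *\<^sub>R (\<psi> (x + (1 / real (Suc n)) *\<^sub>R e) - \<psi> x)" for n x
  have "(\<lambda>n. \<integral>x. s n x \<partial>lborel) \<longlonglongrightarrow> (\<integral>x. D x \<partial>lborel)"
  proof (rule integral_dominated_convergence)
    \<comment> \<open>Step lengths are at most 1, so all difference quotients vanish outside the
      ball of radius R + |e|.\<close>
    show "integrable lborel (\<lambda>x. indicator (cball 0 (R + norm e)) x *\<^sub>R B)"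
      by (intro borel_integrable_compact) auto
    show "D \<in> borel_measurable lborel" "s n \<in> borel_measurable lborel" for n unfolding s_def by measurable
    show "AE x in lborel. (\<lambda>n. s n x) \<longlonglongrightarrow> D x"
    proof (rule AE_I2)
      fix x
      have "((\<lambda>h. (\<psi> (x + h *\<^sub>R e) - \<psi> x) /\<^sub>R h) \<longlongrightarrow> D x) (at 0)"
      proof -
        have "(\<lambda>h. norm (\<psi> (x + h *\<^sub>R e) - \<psi> x - h *\<^sub>R D x) / norm h) \<midarrow>0\<rightarrow> 0"
          using der[of x] unfolding has_vector_derivative_def has_derivative_at by simp
        moreover have "eventually (\<lambda>h. norm (\<psi> (x + h *\<^sub>R e) - \<psi> x - h *\<^sub>R D x) / norm h =
          norm ((\<psi> (x + h *\<^sub>R e) - \<psi> x) /\<^sub>R h - D x)) (at 0)"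
          unfolding eventually_at_filter
        proof (intro always_eventually allI impI)
          fix h :: real assume h: "h \<noteq> 0"
          have "(\<psi> (x + h *\<^sub>R e) - \<psi> x) /\<^sub>R h - D x = (\<psi> (x + h *\<^sub>R e) - \<psi> x - h *\<^sub>R D x) /\<^sub>R h"
            using h by (simp add: scaleR_diff_right)
          then show "norm (\<psi> (x + h *\<^sub>R e) - \<psi> x - h *\<^sub>R D x) / norm h = norm ((\<psi> (x + h *\<^sub>R e) - \<psi> x) /\<^sub>R h - D x)"
            by (simp only: norm_scaleR) (simp add: divide_inverse_commute)
        qed
        ultimately have "((\<lambda>h. norm ((\<psi> (x + h *\<^sub>R e) - \<psi> x) /\<^sub>R h - D x)) \<longlongrightarrow> 0) (at 0)"
          by (rule Lim_transform_eventually)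
        then show ?thesis by (intro LIM_zero_cancel[of _ "D x"]) (simp add: tendsto_norm_zero_iff)
      qed
      moreover have "filterlim (\<lambda>n. 1 / real (Suc n)) (at 0) sequentially"
        unfolding filterlim_at by (intro conjI always_eventually allI; (real_asymp | simp))
      ultimately have "(\<lambda>n. (\<psi> (x + (1 / real (Suc n)) *\<^sub>R e) - \<psi> x) /\<^sub>R (1 / real (Suc n))) \<longlonglongrightarrow> D x"
        by (rule filterlim_compose)
      then show "(\<lambda>n. s n x) \<longlonglongrightarrow> D x" unfolding s_def by simp
    qed
    show "AE x in lborel. norm (s n x) \<le> indicator (cball 0 (R + norm e)) x *\<^sub>R B" for n
    proof (rule AE_I2)
      fix x
      have h: "0 \<le> 1 / real (Suc n)" "1 / real (Suc n) \<le> 1" by auto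
      show "norm (s n x) \<le> indicator (cball 0 (R + norm e)) x *\<^sub>R B"
      proof (cases "x \<in> cball 0 (R + norm e)")
        case True
        have "norm (s n x) \<le> real (Suc n) * (B * (1 / real (Suc n)))"
          unfolding s_def norm_scaleR using incr[OF h(1), of x] by (intro mult_mono) auto
        then show ?thesis using True by simp
      next
        case False
        have "norm ((1 / real (Suc n)) *\<^sub>R e) \<le> norm e"
          unfolding norm_scaleR real_norm_def abs_of_nonneg[OF h(1)] by (rule mult_left_le_one_le[OF norm_ge_zero h])
        moreover have "norm x > R + norm e" using False by simp
        ultimately have "norm (x + (1 / real (Suc n)) *\<^sub>R e) > R" "norm x > R"
          using norm_diff_ineq[of x "(1 / real (Suc n)) *\<^sub>R e"] norm_ge_zero[of e] by linarith+
        then have "\<psi> (x + (1 / real (Suc n)) *\<^sub>R e) = 0" "\<psi> x = 0" using K(2) R by (meson not_le)+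
        then show ?thesis unfolding s_def using False by simp
      qed
    qed
  qed
  moreover have "(\<integral>x. s n x \<partial>lborel) = 0" for n
  proof -
    have "(\<integral>x. \<psi> ((1 / real (Suc n)) *\<^sub>R e + x) - \<psi> x \<partial>lborel) = 0"
      using Bochner_Integration.integral_diff[OF shift(1) i\<psi>, of "(1 / real (Suc n)) *\<^sub>R e"]
        shift(2)[of "(1 / real (Suc n)) *\<^sub>R e"] by (simp only: diff_self)
    then show ?thesis unfolding s_def integral_scaleR_right by (simp only: add.commute scaleR_zero_right)
  qed
  ultimately show ?thesis by (simp add: LIMSEQ_const_iff)
qed

text \<open>Two open sets cover the space: \<Omega>, where the function is g, and the complement of
  K, where it is 0.\<close>

lemma continuous_on_extend_zero:
  fixes g :: "'a::topological_space \<Rightarrow> 'b::real_normed_vector"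
  assumes "open \<Omega>" "closed K" "K \<subseteq> \<Omega>" "continuous_on \<Omega> g" "\<And>x. x \<in> \<Omega> - K \<Longrightarrow> g x = 0"
  shows "continuous_on UNIV (\<lambda>x. if x \<in> \<Omega> then g x else 0)"
proof -
  have "continuous_on \<Omega> (\<lambda>x. if x \<in> \<Omega> then g x else 0)" using assms(4) by (rule continuous_on_eq) simp
  moreover have "continuous_on (- K) (\<lambda>x. if x \<in> \<Omega> then g x else 0)"
    by (rule continuous_on_eq[OF continuous_on_const[of _ 0]]) (use assms(5) in auto)
  ultimately have "continuous_on (\<Omega> \<union> - K) (\<lambda>x. if x \<in> \<Omega> then g x else 0)"
    using assms(1,2) by (intro continuous_on_open_Un) auto
  moreover have "\<Omega> \<union> - K = UNIV" using assms(3) by blast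
  ultimately show ?thesis by simp
qed

lemma partial_deriv_has_vector_derivative:
  assumes "smooth f"
  shows "((\<lambda>t. f (x + t *\<^sub>R axis i 1)) has_real_derivative partial_deriv i f x) (at 0)"
proof -
  define f' where "f' = frechet_derivative f (at x)"
  have f': "(f has_derivative f') (at (x + 0 *\<^sub>R axis i 1))"
    using differentiable_has_frechet[OF smooth_differentiable[OF assms, of x]] unfolding f'_def by simp
  have "((\<lambda>t. x + t *\<^sub>R axis i 1) has_derivative (\<lambda>t. t *\<^sub>R axis i 1)) (at 0)"
    by (auto intro!: derivative_eq_intros)
  from diff_chain_at[OF this f'] have "((\<lambda>t. f (x + t *\<^sub>R axis i 1)) has_derivative (\<lambda>t. f' (t *\<^sub>R axis i 1))) (at 0)"
    by (simp add: o_def)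
  moreover have "f' (t *\<^sub>R axis i 1) = partial_deriv i f x * t" for t
    using linear_scale[OF has_derivative_linear[OF f'], of t] by (simp add: partial_deriv_def f'_def)
  ultimately show ?thesis by (simp add: has_field_derivative_def)
qed

lemma test_function_partial:
  assumes "test_function \<Omega> \<phi>"
  shows "test_function \<Omega> (partial_deriv i \<phi>)" "\<And>x. x \<notin> closure {x. \<phi> x \<noteq> 0} \<Longrightarrow> partial_deriv i \<phi> x = 0"
proof -
  define K where "K = closure {x. \<phi> x \<noteq> 0}"
  have \<phi>0: "\<phi> x = 0" if "x \<notin> K" for x
    using that unfolding K_def by (rule not_in_closure_support)
  show z: "partial_deriv i \<phi> x = 0" if "x \<notin> closure {x. \<phi> x \<noteq> 0}" for x
  proof -
    have "(\<phi> has_derivative (\<lambda>h. 0)) (at x)"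
    proof (rule has_derivative_transform_within_open[OF has_derivative_const[of 0], where s = "- K"])
      show "open (- K)" unfolding K_def by (rule open_Compl[OF closed_closure])
      show "x \<in> - K" using that unfolding K_def Compl_iff .
      show "0 = \<phi> y" if "y \<in> - K" for y using \<phi>0 that by (metis ComplD)
    qed
    then show ?thesis by (simp add: partial_deriv_eq)
  qed
  have sub: "closure {x. partial_deriv i \<phi> x \<noteq> 0} \<subseteq> K"
  proof (rule closure_minimal)
    show "{x. partial_deriv i \<phi> x \<noteq> 0} \<subseteq> K" using z unfolding K_def by blast
  qed (simp add: K_def)
  have K: "compact K" "K \<subseteq> \<Omega>" using assms unfolding test_function_def K_def by auto
  have "compact (closure {x. partial_deriv i \<phi> x \<noteq> 0})"
    using bounded_subset[OF compact_imp_bounded[OF K(1)] sub] by (simp add: compact_eq_bounded_closed)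
  then show "test_function \<Omega> (partial_deriv i \<phi>)"
    using smooth_partial_deriv[OF test_function_smooth[OF assms]] sub K(2)
    unfolding test_function_def smooth_def by blast
qed

lemma test_function_iter: "test_function \<Omega> \<phi> \<Longrightarrow> test_function \<Omega> (iter_partial js \<phi>)"
  by (induction js) (auto intro: test_function_partial)

lemma test_function_mult:
  assumes "test_function \<Omega> \<phi>" "smooth f"
  shows "test_function \<Omega> (\<lambda>x. \<phi> x * f x)"
proof -
  define K where "K = closure {x. \<phi> x \<noteq> 0}"
  have K: "compact K" "K \<subseteq> \<Omega>" using assms unfolding test_function_def K_def by auto
  have sub: "closure {x. \<phi> x * f x \<noteq> 0} \<subseteq> K" unfolding K_def by (rule closure_mono) auto
  have "compact (closure {x. \<phi> x * f x \<noteq> 0})"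
    using bounded_subset[OF compact_imp_bounded[OF K(1)] sub] by (simp add: compact_eq_bounded_closed)
  then show ?thesis
    using smooth_mult[OF test_function_smooth[OF assms(1)] assms(2)] sub K(2)
    unfolding test_function_def smooth_def by blast
qed

lemma continuous_locally_integrable:
  assumes "continuous_on \<Omega> u"
  shows "locally_integrable \<Omega> u"
  unfolding locally_integrable_def
proof (intro allI impI)
  fix K assume K: "compact K \<and> K \<subseteq> \<Omega>"
  then have i: "integrable lborel (\<lambda>x. indicator K x *\<^sub>R u x)"
    by (intro borel_integrable_compact continuous_on_subset[OF assms]) auto
  then have "integrable lebesgue (\<lambda>x. indicator K x *\<^sub>R u x)"
    by (subst integrable_completion) auto
  then show "integrable (lebesgue_on K) u"
    using K by (subst integrable_restrict_space) (auto simp: lmeasurable_compact fmeasurableD)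
qed

text \<open>The product of a test function with u, extended by zero, has a continuous derivative
  along the axis, whose integral vanishes by \<open>integral_directional_derivative\<close>. Through
  this lemma the classical derivatives of the power series enter the weak setting.\<close>

lemma weak_derivative_C1:
  assumes \<Omega>: "open \<Omega>" and cu: "continuous_on \<Omega> u" and cD: "continuous_on \<Omega> D"
    and der: "\<And>x. x \<in> \<Omega> \<Longrightarrow> ((\<lambda>t. u (x + t *\<^sub>R axis i 1)) has_vector_derivative D x) (at 0)"
  shows "weak_derivative \<Omega> [i] u D"
  unfolding weak_derivative_def
proof (intro conjI allI impI)
  show lu: "locally_integrable \<Omega> u" and lD: "locally_integrable \<Omega> D"
    using cu cD by (auto intro: continuous_locally_integrable)
  fix \<phi> assume t: "test_function \<Omega> \<phi>"
  define K where "K = closure {x. \<phi> x \<noteq> 0}"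
  have K: "compact K" "closed K" "K \<subseteq> \<Omega>" using t unfolding test_function_def K_def by auto
  have \<phi>0: "\<phi> x = 0" if "x \<notin> K" for x
    using that unfolding K_def by (rule not_in_closure_support)
  have p0: "partial_deriv i \<phi> x = 0" if "x \<notin> K" for x using test_function_partial(2)[OF t] that unfolding K_def by blast
  have sm: "smooth \<phi>" "smooth (partial_deriv i \<phi>)" using test_function_smooth[OF t] smooth_partial_deriv by auto
  define \<psi> where "\<psi> x = (if x \<in> \<Omega> then \<phi> x *\<^sub>R u x else 0)" for x
  define E where "E x = (if x \<in> \<Omega> then partial_deriv i \<phi> x *\<^sub>R u x + \<phi> x *\<^sub>R D x else 0)" for x
  have cE: "continuous_on UNIV E"
    unfolding E_def by (rule continuous_on_extend_zero[OF \<Omega> K(2,3)])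
      (auto intro!: continuous_intros smooth_continuous sm cu cD simp: \<phi>0 p0)
  have c\<psi>: "continuous_on UNIV \<psi>"
    unfolding \<psi>_def by (rule continuous_on_extend_zero[OF \<Omega> K(2,3)])
      (auto intro!: continuous_intros smooth_continuous sm cu cD simp: \<phi>0)
  have zero: "(\<integral>x. E x \<partial>lborel) = 0"
  proof (rule integral_directional_derivative[OF c\<psi> cE _ K(1)])
    show "\<psi> x = 0" if "x \<notin> K" for x using \<phi>0[OF that] unfolding \<psi>_def by simp
    fix x
    have op: "open ((\<lambda>t. x + t *\<^sub>R axis i 1) -` S)" if "open S" for S :: "(real ^ 'a) set"
      using that by (rule open_vimage) (intro continuous_intros)
    show "((\<lambda>t. \<psi> (x + t *\<^sub>R axis i 1)) has_vector_derivative E x) (at 0)"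
    proof (cases "x \<in> \<Omega>")
      case True
      have "((\<lambda>t. \<phi> (x + t *\<^sub>R axis i 1) *\<^sub>R u (x + t *\<^sub>R axis i 1)) has_vector_derivative
          (\<phi> (x + 0 *\<^sub>R axis i 1) *\<^sub>R D x + partial_deriv i \<phi> x *\<^sub>R u (x + 0 *\<^sub>R axis i 1))) (at 0)"
        by (intro has_vector_derivative_scaleR partial_deriv_has_vector_derivative sm der True)
      then have "((\<lambda>t. \<phi> (x + t *\<^sub>R axis i 1) *\<^sub>R u (x + t *\<^sub>R axis i 1)) has_vector_derivative E x) (at 0)"
        using True by (simp add: E_def add.commute)
      then show ?thesis
        by (rule has_vector_derivative_transform_within_open[OF _ op[OF \<Omega>]]) (use True in \<open>auto simp: \<psi>_def\<close>)
    next
      case False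
      have "((\<lambda>t. 0) has_vector_derivative E x) (at 0)" using False by (simp add: E_def)
      then show ?thesis
        by (rule has_vector_derivative_transform_within_open[OF _ op[of "- K"]]) (use False K \<phi>0 in \<open>auto simp: \<psi>_def\<close>)
    qed
  qed
  have i1: "integrable (lebesgue_on \<Omega>) (\<lambda>x. partial_deriv i \<phi> x *\<^sub>R u x)"
    by (rule test_integrable[OF \<Omega> test_function_partial(1)[OF t] lu])
  have i2: "integrable (lebesgue_on \<Omega>) (\<lambda>x. \<phi> x *\<^sub>R D x)" by (rule test_integrable[OF \<Omega> t lD])
  have "(LINT x|lebesgue_on \<Omega>. partial_deriv i \<phi> x *\<^sub>R u x) + (LINT x|lebesgue_on \<Omega>. \<phi> x *\<^sub>R D x)
     = (LINT x|lebesgue_on \<Omega>. partial_deriv i \<phi> x *\<^sub>R u x + \<phi> x *\<^sub>R D x)"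
    by (rule Bochner_Integration.integral_add[symmetric, OF i1 i2])
  also have "\<dots> = (\<integral>x. E x \<partial>lebesgue)"
    using \<Omega> by (subst integral_restrict_space) (auto simp: E_def indicator_def intro!: Bochner_Integration.integral_cong)
  also have "\<dots> = 0" using zero borel_measurable_continuous_onI[OF cE] by (subst integral_completion) auto
  finally show "(LINT x|lebesgue_on \<Omega>. iter_partial [i] \<phi> x *\<^sub>R u x) = (- 1) ^ length [i] * (LINT x|lebesgue_on \<Omega>. \<phi> x *\<^sub>R D x)"
    by (simp add: add_eq_0_iff2)
qed

section \<open>Sobolev spaces\<close>

lemma square_integrable_locally:
  assumes "open \<Omega>" "square_integrable \<Omega> u"
  shows "locally_integrable \<Omega> u"
  unfolding locally_integrable_def
proof (intro allI impI)
  fix K assume K: "compact K \<and> K \<subseteq> \<Omega>"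
  have m: "u \<in> borel_measurable (lebesgue_on K)"
    using assms(2) K unfolding square_integrable_def by (auto intro: measurable_restrict_mono)
  have Ks: "K \<in> sets lebesgue" "K \<in> lmeasurable" using K lmeasurable_compact fmeasurableD by blast+
  have sq: "integrable lebesgue (\<lambda>x. indicator \<Omega> x *\<^sub>R (cmod (u x))\<^sup>2)"
    using assms by (subst integrable_restrict_space[symmetric]) (auto simp: square_integrable_def)
  have m': "(\<lambda>x. indicator K x *\<^sub>R u x) \<in> borel_measurable lebesgue"
    using m Ks by (subst (asm) borel_measurable_restrict_space_iff) auto
  have "integrable lebesgue (\<lambda>x. indicator K x *\<^sub>R u x)"
  proof (rule Bochner_Integration.integrable_bound[OF _ m'])
    show "integrable lebesgue (\<lambda>x. indicator K x + indicator \<Omega> x *\<^sub>R (cmod (u x))\<^sup>2)"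
      using Ks sq by (intro Bochner_Integration.integrable_add) (auto simp: fmeasurable_def)
    show "AE x in lebesgue. norm (indicator K x *\<^sub>R u x) \<le> norm (indicator K x + indicator \<Omega> x *\<^sub>R (cmod (u x))\<^sup>2)"
    proof (rule AE_I2)
      fix x
      have "t \<le> 1 + t\<^sup>2" for t :: real using sum_power2_ge_zero[of "t - 1/2" 0] by (simp add: power2_eq_square algebra_simps)
      then show "norm (indicator K x *\<^sub>R u x) \<le> norm (indicator K x + indicator \<Omega> x *\<^sub>R (cmod (u x))\<^sup>2)"
        using K by (auto simp: indicator_def)
    qed
  qed
  then show "integrable (lebesgue_on K) u" using Ks by (subst integrable_restrict_space) auto
qed

lemma locally_integrable_diff:
  "locally_integrable \<Omega> u \<Longrightarrow> locally_integrable \<Omega> v \<Longrightarrow> locally_integrable \<Omega> (\<lambda>x. u x - v x)"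
  unfolding locally_integrable_def by auto

lemma weak_derivative_locally:
  "weak_derivative \<Omega> js u v \<Longrightarrow> locally_integrable \<Omega> u"
  "weak_derivative \<Omega> js u v \<Longrightarrow> locally_integrable \<Omega> v"
  by (simp_all add: weak_derivative_def)

lemma weak_derivative_eq:
  "weak_derivative \<Omega> js u v \<Longrightarrow> test_function \<Omega> \<phi> \<Longrightarrow>
    (LINT x|lebesgue_on \<Omega>. iter_partial js \<phi> x *\<^sub>R u x) = (- 1) ^ length js * (LINT x|lebesgue_on \<Omega>. \<phi> x *\<^sub>R v x)"
  by (simp add: weak_derivative_def)

lemma weak_derivative_unique:
  assumes \<Omega>: "open \<Omega>" and v: "weak_derivative \<Omega> js u v" and v': "weak_derivative \<Omega> js u v'"
  shows "AE x in lebesgue_on \<Omega>. v x = v' x"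
proof -
  have l: "locally_integrable \<Omega> v" "locally_integrable \<Omega> v'" by (rule weak_derivative_locally[OF v] weak_derivative_locally[OF v'])+
  have "AE x in lebesgue_on \<Omega>. v x - v' x = 0"
  proof (rule fundamental_lemma[OF \<Omega> locally_integrable_diff[OF l]])
    fix \<phi> assume t: "test_function \<Omega> \<phi>"
    have "(- 1) ^ length js * (LINT x|lebesgue_on \<Omega>. \<phi> x *\<^sub>R v x) = (- 1) ^ length js * (LINT x|lebesgue_on \<Omega>. \<phi> x *\<^sub>R v' x)"
      unfolding weak_derivative_eq[OF v t, symmetric] weak_derivative_eq[OF v' t, symmetric] ..
    then have "(LINT x|lebesgue_on \<Omega>. \<phi> x *\<^sub>R v x) = (LINT x|lebesgue_on \<Omega>. \<phi> x *\<^sub>R v' x)" by simp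
    then show "(LINT x|lebesgue_on \<Omega>. \<phi> x *\<^sub>R (v x - v' x)) = 0"
      unfolding scaleR_diff_right
      by (subst Bochner_Integration.integral_diff[OF test_integrable[OF \<Omega> t l(1)] test_integrable[OF \<Omega> t l(2)]]) simp
  qed
  then show ?thesis by eventually_elim simp
qed

lemma weak_derivative_Nil: "locally_integrable \<Omega> u \<Longrightarrow> weak_derivative \<Omega> [] u u"
  unfolding weak_derivative_def by simp

lemma weak_derivative_cong:
  assumes \<Omega>: "open \<Omega>" and u: "weak_derivative \<Omega> js u w" and v: "locally_integrable \<Omega> v"
    and ae: "AE x in lebesgue_on \<Omega>. u x = v x"
  shows "weak_derivative \<Omega> js v w"
  unfolding weak_derivative_def
proof (intro conjI allI impI)
  show "locally_integrable \<Omega> v" "locally_integrable \<Omega> w" by (rule v weak_derivative_locally[OF u])+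
  fix \<phi> assume t: "test_function \<Omega> \<phi>"
  have lu: "locally_integrable \<Omega> u" by (rule weak_derivative_locally[OF u])
  have "(LINT x|lebesgue_on \<Omega>. iter_partial js \<phi> x *\<^sub>R v x) = (LINT x|lebesgue_on \<Omega>. iter_partial js \<phi> x *\<^sub>R u x)"
    by (rule integral_cong_AE[OF borel_measurable_integrable[OF test_integrable[OF \<Omega> test_function_iter[OF t] v]]
        borel_measurable_integrable[OF test_integrable[OF \<Omega> test_function_iter[OF t] lu]]])
       (use ae in eventually_elim, simp)
  then show "(LINT x|lebesgue_on \<Omega>. iter_partial js \<phi> x *\<^sub>R v x) = (- 1) ^ length js * (LINT x|lebesgue_on \<Omega>. \<phi> x *\<^sub>R w x)"
    unfolding weak_derivative_eq[OF u t] .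
qed

lemma square_integrable_cong:
  assumes "square_integrable \<Omega> u" "v \<in> borel_measurable (lebesgue_on \<Omega>)" "AE x in lebesgue_on \<Omega>. u x = v x"
  shows "square_integrable \<Omega> v"
proof -
  have "u \<in> borel_measurable (lebesgue_on \<Omega>)" "integrable (lebesgue_on \<Omega>) (\<lambda>x. (cmod (u x))\<^sup>2)"
    using assms(1) unfolding square_integrable_def by auto
  moreover from this assms have "integrable (lebesgue_on \<Omega>) (\<lambda>x. (cmod (u x))\<^sup>2) = integrable (lebesgue_on \<Omega>) (\<lambda>x. (cmod (v x))\<^sup>2)"
    by (intro integrable_cong_AE) (auto elim!: eventually_mono)
  ultimately show ?thesis using assms(2) unfolding square_integrable_def by simp
qed

lemma sobolev_cong:
  assumes "open \<Omega>" "sobolev k \<Omega> u" "v \<in> borel_measurable (lebesgue_on \<Omega>)" "AE x in lebesgue_on \<Omega>. u x = v x"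
  shows "sobolev k \<Omega> v"
proof -
  have sv: "square_integrable \<Omega> v" using assms square_integrable_cong unfolding sobolev_def by blast
  then have "locally_integrable \<Omega> v" by (rule square_integrable_locally[OF assms(1)])
  then show ?thesis using sv assms weak_derivative_cong[OF assms(1) _ _ assms(4)] unfolding sobolev_def by meson
qed

lemma sobolev_square: "sobolev k \<Omega> u \<Longrightarrow> square_integrable \<Omega> u"
  unfolding sobolev_def by blast

lemma sobolev_0: "open \<Omega> \<Longrightarrow> square_integrable \<Omega> u \<Longrightarrow> sobolev 0 \<Omega> u"
  unfolding sobolev_def using weak_derivative_Nil[OF square_integrable_locally] by auto

lemma sobolev_mono: "sobolev k \<Omega> u \<Longrightarrow> j \<le> k \<Longrightarrow> sobolev j \<Omega> u"
  unfolding sobolev_def by auto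

text \<open>In \<open>iter_partial\<close> the head of the list is the outermost derivative. Hence
  the derivative along \<open>i # js\<close> amounts to inserting
  \<open>iter_partial js \<phi>\<close> as test function into the equation of v, without any
  exchange of partial derivatives. Together with the converse \<open>sobolev_SucI\<close> this
  allows induction on the Sobolev order.\<close>

lemma sobolev_SucD:
  assumes "sobolev (Suc k) \<Omega> u"
  shows "\<exists>v. sobolev k \<Omega> v \<and> weak_derivative \<Omega> [i] u v"
proof -
  obtain v where v: "square_integrable \<Omega> v" "weak_derivative \<Omega> [i] u v"
    using assms unfolding sobolev_def by (metis One_nat_def Suc_le_mono le0 length_Cons list.size(3))
  have "\<exists>w. square_integrable \<Omega> w \<and> weak_derivative \<Omega> js v w" if js: "length js \<le> k" for js
  proof -
    obtain w where w: "square_integrable \<Omega> w" "weak_derivative \<Omega> (i # js) u w"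
      using assms js unfolding sobolev_def by (metis Suc_le_mono length_Cons)
    have "weak_derivative \<Omega> js v w"
      unfolding weak_derivative_def
    proof (intro conjI allI impI)
      show "locally_integrable \<Omega> v" "locally_integrable \<Omega> w" using weak_derivative_locally v(2) w(2) by blast+
      fix \<phi> assume t: "test_function \<Omega> \<phi>"
      have "(LINT x|lebesgue_on \<Omega>. iter_partial [i] (iter_partial js \<phi>) x *\<^sub>R u x) = - (LINT x|lebesgue_on \<Omega>. iter_partial js \<phi> x *\<^sub>R v x)"
        using weak_derivative_eq[OF v(2) test_function_iter[OF t]] by simp
      moreover have "(LINT x|lebesgue_on \<Omega>. iter_partial (i # js) \<phi> x *\<^sub>R u x) = (- 1) ^ Suc (length js) * (LINT x|lebesgue_on \<Omega>. \<phi> x *\<^sub>R w x)"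
        using weak_derivative_eq[OF w(2) t] by simp
      ultimately show "(LINT x|lebesgue_on \<Omega>. iter_partial js \<phi> x *\<^sub>R v x) = (- 1) ^ length js * (LINT x|lebesgue_on \<Omega>. \<phi> x *\<^sub>R w x)"
        by (simp add: minus_equation_iff)
    qed
    then show ?thesis using w by blast
  qed
  then show ?thesis using v unfolding sobolev_def by blast
qed

lemma sobolev_SucI:
  assumes \<Omega>: "open \<Omega>" and u: "square_integrable \<Omega> u" and d: "\<And>i. \<exists>v. sobolev k \<Omega> v \<and> weak_derivative \<Omega> [i] u v"
  shows "sobolev (Suc k) \<Omega> u"
  unfolding sobolev_def
proof (intro conjI allI impI)
  fix js :: "'a list" assume js: "length js \<le> Suc k"
  show "\<exists>v. square_integrable \<Omega> v \<and> weak_derivative \<Omega> js u v"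
  proof (cases js)
    case Nil
    then show ?thesis using u weak_derivative_Nil[OF square_integrable_locally[OF \<Omega> u]] by auto
  next
    case (Cons i ks)
    obtain v where v: "sobolev k \<Omega> v" "weak_derivative \<Omega> [i] u v" using d by blast
    obtain w where w: "square_integrable \<Omega> w" "weak_derivative \<Omega> ks v w"
      using v(1) js Cons unfolding sobolev_def by auto
    have "weak_derivative \<Omega> js u w"
      unfolding weak_derivative_def
    proof (intro conjI allI impI)
      show "locally_integrable \<Omega> u" "locally_integrable \<Omega> w" using weak_derivative_locally v(2) w(2) by blast+
      fix \<phi> assume t: "test_function \<Omega> \<phi>"
      have "(LINT x|lebesgue_on \<Omega>. iter_partial [i] (iter_partial ks \<phi>) x *\<^sub>R u x) = - (LINT x|lebesgue_on \<Omega>. iter_partial ks \<phi> x *\<^sub>R v x)"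
        using weak_derivative_eq[OF v(2) test_function_iter[OF t]] by simp
      moreover have "(LINT x|lebesgue_on \<Omega>. iter_partial ks \<phi> x *\<^sub>R v x) = (- 1) ^ length ks * (LINT x|lebesgue_on \<Omega>. \<phi> x *\<^sub>R w x)"
        using weak_derivative_eq[OF w(2) t] by simp
      ultimately show "(LINT x|lebesgue_on \<Omega>. iter_partial js \<phi> x *\<^sub>R u x) = (- 1) ^ length js * (LINT x|lebesgue_on \<Omega>. \<phi> x *\<^sub>R w x)"
        unfolding Cons by simp
    qed
    then show ?thesis using w by blast
  qed
qed (rule u)

section \<open>Sums and smooth multiples in Sobolev spaces\<close>

lemma square_integrable_add:
  assumes "square_integrable \<Omega> u" "square_integrable \<Omega> v"
  shows "square_integrable \<Omega> (\<lambda>x. u x + v x)"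
proof -
  have m: "u \<in> borel_measurable (lebesgue_on \<Omega>)" "v \<in> borel_measurable (lebesgue_on \<Omega>)"
    and i: "integrable (lebesgue_on \<Omega>) (\<lambda>x. (cmod (u x))\<^sup>2)" "integrable (lebesgue_on \<Omega>) (\<lambda>x. (cmod (v x))\<^sup>2)"
    using assms unfolding square_integrable_def by auto
  have "integrable (lebesgue_on \<Omega>) (\<lambda>x. (cmod (u x + v x))\<^sup>2)"
  proof (rule Bochner_Integration.integrable_bound)
    show "integrable (lebesgue_on \<Omega>) (\<lambda>x. 2 * (cmod (u x))\<^sup>2 + 2 * (cmod (v x))\<^sup>2)" using i by auto
    show "(\<lambda>x. (cmod (u x + v x))\<^sup>2) \<in> borel_measurable (lebesgue_on \<Omega>)" using m by auto
    show "AE x in lebesgue_on \<Omega>. norm ((cmod (u x + v x))\<^sup>2) \<le> norm (2 * (cmod (u x))\<^sup>2 + 2 * (cmod (v x))\<^sup>2)"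
    proof (rule AE_I2)
      fix x
      have "(cmod (u x + v x))\<^sup>2 \<le> (cmod (u x) + cmod (v x))\<^sup>2" by (intro power_mono norm_triangle_ineq) auto
      also have "\<dots> \<le> 2 * (cmod (u x))\<^sup>2 + 2 * (cmod (v x))\<^sup>2"
        using zero_le_power2[of "cmod (u x) - cmod (v x)"] by (simp add: power2_eq_square algebra_simps)
      finally show "norm ((cmod (u x + v x))\<^sup>2) \<le> norm (2 * (cmod (u x))\<^sup>2 + 2 * (cmod (v x))\<^sup>2)" by simp
    qed
  qed
  then show ?thesis using m unfolding square_integrable_def by auto
qed

lemma square_integrable_mult:
  assumes u: "square_integrable \<Omega> u" and g: "g \<in> borel_measurable (lebesgue_on \<Omega>)" and B: "\<And>x. x \<in> \<Omega> \<Longrightarrow> cmod (g x) \<le> B"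
    and \<Omega>: "open \<Omega>"
  shows "square_integrable \<Omega> (\<lambda>x. g x * u x)"
proof -
  have m: "u \<in> borel_measurable (lebesgue_on \<Omega>)" and i: "integrable (lebesgue_on \<Omega>) (\<lambda>x. (cmod (u x))\<^sup>2)"
    using u unfolding square_integrable_def by auto
  have "integrable (lebesgue_on \<Omega>) (\<lambda>x. (cmod (g x * u x))\<^sup>2)"
  proof (rule Bochner_Integration.integrable_bound)
    show "integrable (lebesgue_on \<Omega>) (\<lambda>x. B\<^sup>2 * (cmod (u x))\<^sup>2)" using i by auto
    show "(\<lambda>x. (cmod (g x * u x))\<^sup>2) \<in> borel_measurable (lebesgue_on \<Omega>)" using m g by auto
    show "AE x in lebesgue_on \<Omega>. norm ((cmod (g x * u x))\<^sup>2) \<le> norm (B\<^sup>2 * (cmod (u x))\<^sup>2)"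
    proof (rule AE_I2)
      fix x assume "x \<in> space (lebesgue_on \<Omega>)"
      then have "cmod (g x) \<le> B" using B by (simp add: space_restrict_space)
      then have "(cmod (g x))\<^sup>2 * (cmod (u x))\<^sup>2 \<le> B\<^sup>2 * (cmod (u x))\<^sup>2" by (intro mult_right_mono power_mono) auto
      then show "norm ((cmod (g x * u x))\<^sup>2) \<le> norm (B\<^sup>2 * (cmod (u x))\<^sup>2)" by (simp add: norm_mult power_mult_distrib)
    qed
  qed
  then show ?thesis using m g unfolding square_integrable_def by auto
qed

lemma square_integrable_cmult: "square_integrable \<Omega> u \<Longrightarrow> square_integrable \<Omega> (\<lambda>x. c * u x)"
  unfolding square_integrable_def by (auto simp: norm_mult power_mult_distrib)

lemma smooth_lebesgue_on: "open \<Omega> \<Longrightarrow> smooth f \<Longrightarrow> f \<in> borel_measurable (lebesgue_on \<Omega>)"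
  using smooth_borel[of f] by (intro measurable_restrict_space1)

lemma square_integrable_smooth_mult:
  assumes \<Omega>: "open \<Omega>" "bounded \<Omega>" and f: "smooth f" and u: "square_integrable \<Omega> u"
  shows "square_integrable \<Omega> (\<lambda>x. f x *\<^sub>R u x)"
proof -
  have "compact (f ` closure \<Omega>)"
    by (rule compact_continuous_image[OF smooth_continuous[OF f]]) (use \<Omega> in simp)
  then have "bounded (f ` closure \<Omega>)" by (rule compact_imp_bounded)
  then obtain B where B: "\<forall>y\<in>f ` closure \<Omega>. norm y \<le> B" unfolding bounded_iff by (rule exE)
  have "square_integrable \<Omega> (\<lambda>x. complex_of_real (f x) * u x)"
  proof (rule square_integrable_mult[OF u _ _ \<Omega>(1)])
    show "(\<lambda>x. complex_of_real (f x)) \<in> borel_measurable (lebesgue_on \<Omega>)" using smooth_lebesgue_on[OF \<Omega>(1) f] by auto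
    fix x assume "x \<in> \<Omega>"
    then have "x \<in> closure \<Omega>" by (rule subsetD[OF closure_subset])
    then show "cmod (complex_of_real (f x)) \<le> B" using bspec[OF B imageI] by simp
  qed
  then show ?thesis by (simp add: scaleR_conv_of_real)
qed

lemma weak_derivative_add:
  assumes \<Omega>: "open \<Omega>" and u: "weak_derivative \<Omega> js u u'" and v: "weak_derivative \<Omega> js v v'"
  shows "weak_derivative \<Omega> js (\<lambda>x. u x + v x) (\<lambda>x. u' x + v' x)"
proof -
  have l: "locally_integrable \<Omega> u" "locally_integrable \<Omega> u'" "locally_integrable \<Omega> v" "locally_integrable \<Omega> v'"
    by (rule weak_derivative_locally[OF u] weak_derivative_locally[OF v])+
  show ?thesis unfolding weak_derivative_def
  proof (intro conjI allI impI)
    show "locally_integrable \<Omega> (\<lambda>x. u x + v x)" "locally_integrable \<Omega> (\<lambda>x. u' x + v' x)"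
      using l unfolding locally_integrable_def by auto
    fix \<phi> assume t: "test_function \<Omega> \<phi>"
    show "(LINT x|lebesgue_on \<Omega>. iter_partial js \<phi> x *\<^sub>R (u x + v x)) = (- 1) ^ length js * (LINT x|lebesgue_on \<Omega>. \<phi> x *\<^sub>R (u' x + v' x))"
      unfolding scaleR_add_right
        Bochner_Integration.integral_add[OF test_integrable[OF \<Omega> test_function_iter[OF t] l(1)] test_integrable[OF \<Omega> test_function_iter[OF t] l(3)]]
        Bochner_Integration.integral_add[OF test_integrable[OF \<Omega> t l(2)] test_integrable[OF \<Omega> t l(4)]]
      unfolding weak_derivative_eq[OF u t] weak_derivative_eq[OF v t] by (simp only: distrib_left)
  qed
qed

lemma weak_derivative_cmult:
  assumes \<Omega>: "open \<Omega>" and u: "weak_derivative \<Omega> js u u'"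
  shows "weak_derivative \<Omega> js (\<lambda>x. c * u x) (\<lambda>x. c * u' x)"
proof -
  have l: "locally_integrable \<Omega> u" "locally_integrable \<Omega> u'" by (rule weak_derivative_locally[OF u])+
  show ?thesis unfolding weak_derivative_def
  proof (intro conjI allI impI)
    show "locally_integrable \<Omega> (\<lambda>x. c * u x)" "locally_integrable \<Omega> (\<lambda>x. c * u' x)"
      using l unfolding locally_integrable_def by auto
    fix \<phi> assume t: "test_function \<Omega> \<phi>"
    show "(LINT x|lebesgue_on \<Omega>. iter_partial js \<phi> x *\<^sub>R (c * u x)) = (- 1) ^ length js * (LINT x|lebesgue_on \<Omega>. \<phi> x *\<^sub>R (c * u' x))"
      unfolding mult_scaleR_right[symmetric] integral_mult_right_zero weak_derivative_eq[OF u t] by simp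
  qed
qed

text \<open>The product of \<phi> and f is again a test function; inserting it into the equation of
  u and expanding by the product rule gives the claim.\<close>

lemma weak_derivative_smooth_mult:
  assumes \<Omega>: "open \<Omega>" and u: "weak_derivative \<Omega> [i] u u'" and f: "smooth f"
    and l: "locally_integrable \<Omega> (\<lambda>x. f x *\<^sub>R u x)" "locally_integrable \<Omega> (\<lambda>x. f x *\<^sub>R u' x)"
      "locally_integrable \<Omega> (\<lambda>x. partial_deriv i f x *\<^sub>R u x)"
  shows "weak_derivative \<Omega> [i] (\<lambda>x. f x *\<^sub>R u x) (\<lambda>x. f x *\<^sub>R u' x + partial_deriv i f x *\<^sub>R u x)"
  unfolding weak_derivative_def
proof (intro conjI allI impI)
  have lu: "locally_integrable \<Omega> u" "locally_integrable \<Omega> u'" by (rule weak_derivative_locally[OF u])+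
  show "locally_integrable \<Omega> (\<lambda>x. f x *\<^sub>R u x)" by (rule l)
  show "locally_integrable \<Omega> (\<lambda>x. f x *\<^sub>R u' x + partial_deriv i f x *\<^sub>R u x)"
    using l unfolding locally_integrable_def by auto
  fix \<phi> assume t: "test_function \<Omega> \<phi>"
  have tf: "test_function \<Omega> (\<lambda>x. \<phi> x * f x)" by (rule test_function_mult[OF t f])
  have pd: "partial_deriv i (\<lambda>x. \<phi> x * f x) = (\<lambda>x. \<phi> x * partial_deriv i f x + partial_deriv i \<phi> x * f x)"
    by (rule partial_deriv_mult) (use smooth_differentiable test_function_smooth[OF t] f in auto)
  note i1 = test_integrable[OF \<Omega> test_function_partial(1)[OF t, of i] l(1)]
  note i2 = test_integrable[OF \<Omega> t l(3)]
  note i3 = test_integrable[OF \<Omega> t l(2)]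
  have "(LINT x|lebesgue_on \<Omega>. partial_deriv i \<phi> x *\<^sub>R (f x *\<^sub>R u x)) + (LINT x|lebesgue_on \<Omega>. \<phi> x *\<^sub>R (partial_deriv i f x *\<^sub>R u x))
    = (LINT x|lebesgue_on \<Omega>. partial_deriv i (\<lambda>x. \<phi> x * f x) x *\<^sub>R u x)"
    unfolding Bochner_Integration.integral_add[OF i1 i2, symmetric] pd by (simp add: scaleR_add_left add.commute)
  also have "\<dots> = - (LINT x|lebesgue_on \<Omega>. (\<phi> x * f x) *\<^sub>R u' x)" using weak_derivative_eq[OF u tf] by simp
  also have "\<dots> = - (LINT x|lebesgue_on \<Omega>. \<phi> x *\<^sub>R (f x *\<^sub>R u' x))" by simp
  finally have "(LINT x|lebesgue_on \<Omega>. partial_deriv i \<phi> x *\<^sub>R (f x *\<^sub>R u x)) =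
     - ((LINT x|lebesgue_on \<Omega>. \<phi> x *\<^sub>R (f x *\<^sub>R u' x)) + (LINT x|lebesgue_on \<Omega>. \<phi> x *\<^sub>R (partial_deriv i f x *\<^sub>R u x)))"
    by (simp add: algebra_simps)
  then show "(LINT x|lebesgue_on \<Omega>. iter_partial [i] \<phi> x *\<^sub>R (f x *\<^sub>R u x)) =
     (- 1) ^ length [i] * (LINT x|lebesgue_on \<Omega>. \<phi> x *\<^sub>R (f x *\<^sub>R u' x + partial_deriv i f x *\<^sub>R u x))"
    unfolding scaleR_add_right Bochner_Integration.integral_add[OF i3 i2] by simp
qed

lemma sobolev_add:
  assumes \<Omega>: "open \<Omega>"
  shows "sobolev k \<Omega> u \<Longrightarrow> sobolev k \<Omega> v \<Longrightarrow> sobolev k \<Omega> (\<lambda>x. u x + v x)"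
proof (induction k arbitrary: u v)
  case 0
  then show ?case using \<Omega> by (intro sobolev_0 square_integrable_add) (auto dest: sobolev_square)
next
  case (Suc k)
  show ?case
  proof (rule sobolev_SucI[OF \<Omega>])
    show "square_integrable \<Omega> (\<lambda>x. u x + v x)" using Suc.prems by (intro square_integrable_add) (auto dest: sobolev_square)
    fix i
    obtain u' v' where "sobolev k \<Omega> u'" "weak_derivative \<Omega> [i] u u'" "sobolev k \<Omega> v'" "weak_derivative \<Omega> [i] v v'"
      using Suc.prems sobolev_SucD by meson
    then show "\<exists>w. sobolev k \<Omega> w \<and> weak_derivative \<Omega> [i] (\<lambda>x. u x + v x) w"
      using Suc.IH weak_derivative_add[OF \<Omega>] by meson
  qed
qed

lemma sobolev_cmult:
  assumes \<Omega>: "open \<Omega>"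
  shows "sobolev k \<Omega> u \<Longrightarrow> sobolev k \<Omega> (\<lambda>x. c * u x)"
  unfolding sobolev_def by (metis weak_derivative_cmult[OF \<Omega>] square_integrable_cmult)

lemma sobolev_smooth_mult:
  assumes \<Omega>: "open \<Omega>" "bounded \<Omega>"
  shows "smooth f \<Longrightarrow> sobolev k \<Omega> u \<Longrightarrow> sobolev k \<Omega> (\<lambda>x. f x *\<^sub>R u x)"
proof (induction k arbitrary: u f)
  case 0
  then show ?case using \<Omega> by (intro sobolev_0 square_integrable_smooth_mult) (auto dest: sobolev_square)
next
  case (Suc k)
  have su: "sobolev k \<Omega> u" using Suc.prems(2) by (rule sobolev_mono) simp
  show ?case
  proof (rule sobolev_SucI[OF \<Omega>(1)])
    show "square_integrable \<Omega> (\<lambda>x. f x *\<^sub>R u x)"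
      using Suc.prems \<Omega> by (intro square_integrable_smooth_mult) (auto dest: sobolev_square)
    fix i
    obtain u' where u': "sobolev k \<Omega> u'" "weak_derivative \<Omega> [i] u u'" using Suc.prems(2) sobolev_SucD by meson
    have *: "sobolev k \<Omega> (\<lambda>x. f x *\<^sub>R u x)" "sobolev k \<Omega> (\<lambda>x. f x *\<^sub>R u' x)" "sobolev k \<Omega> (\<lambda>x. partial_deriv i f x *\<^sub>R u x)"
      using Suc.IH Suc.prems(1) su u'(1) smooth_partial_deriv by auto
    then have "weak_derivative \<Omega> [i] (\<lambda>x. f x *\<^sub>R u x) (\<lambda>x. f x *\<^sub>R u' x + partial_deriv i f x *\<^sub>R u x)"
      by (intro weak_derivative_smooth_mult[OF \<Omega>(1) u'(2) Suc.prems(1)] square_integrable_locally[OF \<Omega>(1)] sobolev_square)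
    then show "\<exists>w. sobolev k \<Omega> w \<and> weak_derivative \<Omega> [i] (\<lambda>x. f x *\<^sub>R u x) w"
      using sobolev_add[OF \<Omega>(1) *(2,3)] by blast
  qed
qed

lemma square_integrable_const:
  assumes "open \<Omega>" "bounded \<Omega>"
  shows "square_integrable \<Omega> (\<lambda>x. c)"
proof -
  have "\<Omega> \<in> lmeasurable" using assms by (simp add: bounded_set_imp_lmeasurable)
  then have "integrable (lebesgue_on \<Omega>) (\<lambda>x. (cmod c)\<^sup>2)"
    using finite_measure.integrable_const[OF finite_measure_lebesgue_on] by blast
  then show ?thesis unfolding square_integrable_def by simp
qed

lemma sobolev_const:
  assumes \<Omega>: "open \<Omega>" "bounded \<Omega>"
  shows "sobolev k \<Omega> (\<lambda>x. c)"
proof (induction k arbitrary: c)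
  case 0
  show ?case using square_integrable_const[OF \<Omega>] \<Omega> by (intro sobolev_0)
next
  case (Suc k)
  have "weak_derivative \<Omega> [i] (\<lambda>x. c) (\<lambda>x. 0)" for i
    by (rule weak_derivative_C1[OF \<Omega>(1)]) (auto intro!: continuous_intros derivative_eq_intros)
  then show ?case using square_integrable_const[OF \<Omega>] Suc by (intro sobolev_SucI[OF \<Omega>(1)]) blast+
qed

lemma sobolev_smooth:
  assumes "open \<Omega>" "bounded \<Omega>" "smooth f"
  shows "sobolev k \<Omega> (\<lambda>x. complex_of_real (f x))"
  using sobolev_smooth_mult[OF assms sobolev_const[OF assms(1,2), of k 1]] by (simp add: scaleR_conv_of_real)

lemma sobolev_sum:
  assumes \<Omega>: "open \<Omega>" "bounded \<Omega>" and "finite I" "\<And>i. i \<in> I \<Longrightarrow> sobolev k \<Omega> (u i)"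
  shows "sobolev k \<Omega> (\<lambda>x. \<Sum>i\<in>I. u i x)"
  using assms(3,4) by (induction I rule: finite_induct) (auto intro: sobolev_add[OF \<Omega>(1)] sobolev_const[OF \<Omega>])

text \<open>By uniqueness of weak derivatives the classical derivatives D i agree a.e. with weak
  ones of regularity k and inherit that regularity; the coordinates are smooth multipliers.\<close>

lemma sobolev_euler:
  assumes \<Omega>: "open \<Omega>" "bounded \<Omega>" and u: "sobolev (Suc k) \<Omega> u" "continuous_on \<Omega> u"
    and D: "\<And>i. continuous_on \<Omega> (D i)" "\<And>i x. x \<in> \<Omega> \<Longrightarrow> ((\<lambda>t. u (x + t *\<^sub>R axis i 1)) has_vector_derivative D i x) (at 0)"
  shows "sobolev k \<Omega> (\<lambda>x. \<Sum>i\<in>UNIV. (x $ i) *\<^sub>R D i x)"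
proof (intro sobolev_sum[OF \<Omega>] sobolev_smooth_mult[OF \<Omega> smooth_coord])
  fix i
  obtain v where v: "sobolev k \<Omega> v" "weak_derivative \<Omega> [i] u v" using sobolev_SucD[OF u(1)] by blast
  have "weak_derivative \<Omega> [i] u (D i)" by (rule weak_derivative_C1[OF \<Omega>(1) u(2) D])
  then have "AE x in lebesgue_on \<Omega>. v x = D i x" by (rule weak_derivative_unique[OF \<Omega>(1) v(2)])
  moreover have "D i \<in> borel_measurable (lebesgue_on \<Omega>)"
    by (rule continuous_imp_measurable_on_sets_lebesgue[OF D(1)]) (use \<Omega>(1) in simp)
  ultimately show "sobolev k \<Omega> (D i)" by (intro sobolev_cong[OF \<Omega>(1) v(1)])
qed simp

text \<open>\<open>sobolev_norm\<close> selects derivatives by \<open>SOME\<close>, so even for a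
  null function its summands are known only through uniqueness. The lemma serves to compare
  functions that agree on (0,1) but not on all reals.\<close>

lemma sobolev_norm_zero:
  assumes \<Omega>: "open \<Omega>" "bounded \<Omega>" and u: "u \<in> borel_measurable (lebesgue_on \<Omega>)" "AE x in lebesgue_on \<Omega>. u x = 0"
  shows "sobolev_norm k \<Omega> u = 0"
proof -
  have ae: "AE x in lebesgue_on \<Omega>. 0 = u x" using u(2) by eventually_elim simp
  have "square_integrable \<Omega> u" by (rule square_integrable_cong[OF square_integrable_const[OF \<Omega>] u(1) ae])
  then have lu: "locally_integrable \<Omega> u" by (rule square_integrable_locally[OF \<Omega>(1)])
  have "(LINT x|lebesgue_on \<Omega>. (cmod ((SOME v. square_integrable \<Omega> v \<and> weak_derivative \<Omega> js u v) x))\<^sup>2) = 0" for js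
  proof -
    have l0: "locally_integrable \<Omega> (\<lambda>x. 0)" by (rule square_integrable_locally[OF \<Omega>(1) square_integrable_const[OF \<Omega>]])
    then have "weak_derivative \<Omega> js (\<lambda>x. 0) (\<lambda>x. 0)" unfolding weak_derivative_def by simp
    then have z: "weak_derivative \<Omega> js u (\<lambda>x. 0)" by (rule weak_derivative_cong[OF \<Omega>(1) _ lu ae])
    define v where "v = (SOME v. square_integrable \<Omega> v \<and> weak_derivative \<Omega> js u v)"
    have "square_integrable \<Omega> v \<and> weak_derivative \<Omega> js u v"
      unfolding v_def by (rule someI[of _ "\<lambda>x. 0"]) (use z square_integrable_const[OF \<Omega>] in blast)
    then have "AE x in lebesgue_on \<Omega>. v x = 0" using weak_derivative_unique[OF \<Omega>(1) _ z] by blast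
    then have "(LINT x|lebesgue_on \<Omega>. (cmod (v x))\<^sup>2) = 0" by (intro integral_eq_zero_AE) (auto elim: eventually_mono)
    then show ?thesis unfolding v_def .
  qed
  then show ?thesis unfolding sobolev_norm_def by simp
qed

text \<open>The summand of the empty list is the squared L^2 norm. The exclusion of eigenvalues
  takes only this from convergence in the energy norm; the regularity of an eigenfunction is taken
  from its membership in the energy space.\<close>

lemma sobolev_norm_ge_L2:
  assumes \<Omega>: "open \<Omega>" and u: "square_integrable \<Omega> u"
  shows "(LINT x|lebesgue_on \<Omega>. (cmod (u x))\<^sup>2) \<le> (sobolev_norm k \<Omega> u)\<^sup>2"
proof -
  define f where "f js = (LINT x|lebesgue_on \<Omega>. (cmod ((SOME v. square_integrable \<Omega> v \<and> weak_derivative \<Omega> js u v) x))\<^sup>2)" for js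
  have f0: "f js \<ge> 0" for js unfolding f_def by simp
  have fin: "finite {js :: 'a list. length js \<le> k}" using finite_lists_length_le[of "UNIV :: 'a set" k] by simp
  have z: "weak_derivative \<Omega> [] u u" by (rule weak_derivative_Nil[OF square_integrable_locally[OF assms]])
  define v where "v = (SOME v. square_integrable \<Omega> v \<and> weak_derivative \<Omega> [] u v)"
  have v: "square_integrable \<Omega> v \<and> weak_derivative \<Omega> [] u v" unfolding v_def by (rule someI[of _ u]) (use z u in blast)
  then have ae: "AE x in lebesgue_on \<Omega>. v x = u x" using weak_derivative_unique[OF \<Omega> _ z] by blast
  have "f [] = (LINT x|lebesgue_on \<Omega>. (cmod (u x))\<^sup>2)"
    unfolding f_def v_def[symmetric] using u v
    by (intro integral_cong_AE) (use ae in \<open>auto simp: square_integrable_def elim: eventually_mono\<close>)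
  moreover have "f [] \<le> (\<Sum>js | length js \<le> k. f js)" by (rule member_le_sum) (use f0 fin in auto)
  moreover have "(sobolev_norm k \<Omega> u)\<^sup>2 = (\<Sum>js | length js \<le> k. f js)"
    unfolding sobolev_norm_def f_def[symmetric] by (intro real_sqrt_pow2 sum_nonneg f0)
  ultimately show ?thesis by simp
qed

section \<open>Radial functions\<close>

abbreviation ball_vol :: "'n::finite itself \<Rightarrow> real" where
  "ball_vol T \<equiv> unit_ball_vol (real CARD('n))"

lemma ball_vol_pos: "ball_vol TYPE('n::finite) > 0"
  by (simp add: unit_ball_vol_pos)

text \<open>Polar coordinates for radial functions. The two measures are compared on half-lines,
  where the volume of a ball is the antiderivative of the density.\<close>

lemma distr_norm:
  "distr lborel borel (norm :: real ^ 'n::finite \<Rightarrow> real) =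
   density lborel (\<lambda>r. ennreal (real CARD('n) * ball_vol TYPE('n) * r ^ (CARD('n) - 1)) * indicator {0..} r)"
  (is "?M = ?N")
proof (rule measure_eqI_generator_eq)
  let ?E = "range (\<lambda>a::real. {..a})"
  show "Int_stable ?E" by (auto simp: Int_stable_def)
  show "?E \<subseteq> Pow UNIV" by auto
  show "sets ?M = sigma_sets UNIV ?E" "sets ?N = sigma_sets UNIV ?E"
    by (simp_all add: borel_eq_atMost)
  show "range (\<lambda>i::nat. {..real i}) \<subseteq> ?E" by auto
  show "(\<Union>i::nat. {..real i}) = UNIV" using real_arch_simple by auto
  have M: "emeasure ?M {..a} = (if a \<ge> 0 then ennreal (ball_vol TYPE('n) * a ^ CARD('n)) else 0)" for a
  proof -
    have "emeasure ?M {..a} = emeasure lborel (norm -` {..a} \<inter> space lborel :: (real ^ 'n) set)"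
      by (rule emeasure_distr) auto
    also have "norm -` {..a} \<inter> space lborel = (if a \<ge> 0 then cball 0 a else ({} :: (real ^ 'n) set))"
      using order_trans[OF norm_ge_zero, of _ a] by (auto simp: dist_norm)
    also have "emeasure lborel \<dots> = (if a \<ge> 0 then ennreal (ball_vol TYPE('n) * a ^ CARD('n)) else 0)"
      using emeasure_cball[of a "0 :: real ^ 'n"] by simp
    finally show ?thesis .
  qed
  have N: "emeasure ?N {..a} = (if a \<ge> 0 then ennreal (ball_vol TYPE('n) * a ^ CARD('n)) else 0)" for a
  proof -
    have "emeasure ?N {..a} = (\<integral>\<^sup>+r. ennreal (real CARD('n) * ball_vol TYPE('n) * r ^ (CARD('n) - 1)) * indicator {0..} r * indicator {..a} r \<partial>lborel)"
      by (subst emeasure_density) auto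
    also have "\<dots> = (\<integral>\<^sup>+r. ennreal (real CARD('n) * ball_vol TYPE('n) * r ^ (CARD('n) - 1)) * indicator {0..a} r \<partial>lborel)"
      by (intro nn_integral_cong) (auto simp: indicator_def)
    also have "\<dots> = (if a \<ge> 0 then ennreal (ball_vol TYPE('n) * a ^ CARD('n)) else 0)"
    proof (cases "a \<ge> 0")
      case True
      have "(\<integral>\<^sup>+r. ennreal (real CARD('n) * ball_vol TYPE('n) * r ^ (CARD('n) - 1)) * indicator {0..a} r \<partial>lborel)
        = ennreal (ball_vol TYPE('n) * a ^ CARD('n) - ball_vol TYPE('n) * 0 ^ CARD('n))"
        by (rule nn_integral_FTC_Icc) (use True in \<open>auto intro!: derivative_eq_intros\<close>)
      then show ?thesis using True by simp
    qed simp
    finally show ?thesis .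
  qed
  show "emeasure ?M {..real i} \<noteq> \<infinity>" for i unfolding M by simp
  show "emeasure ?M X = emeasure ?N X" if "X \<in> ?E" for X using that M N by auto
qed

lemma radial_nn_integral:
  assumes [measurable]: "g \<in> borel_measurable borel"
  shows "(\<integral>\<^sup>+x. g (norm (x :: real ^ 'n::finite)) \<partial>lborel) =
    (\<integral>\<^sup>+r. ennreal (real CARD('n) * ball_vol TYPE('n) * r ^ (CARD('n) - 1)) * indicator {0..} r * g r \<partial>lborel)"
proof -
  have "(\<integral>\<^sup>+x. g (norm (x :: real ^ 'n)) \<partial>lborel) = (\<integral>\<^sup>+r. g r \<partial>distr lborel borel (norm :: real ^ 'n \<Rightarrow> real))"
    by (subst nn_integral_distr) auto
  also have "\<dots> = (\<integral>\<^sup>+r. ennreal (real CARD('n) * ball_vol TYPE('n) * r ^ (CARD('n) - 1)) * indicator {0..} r * g r \<partial>lborel)"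
    unfolding distr_norm by (subst nn_integral_density) auto
  finally show ?thesis .
qed

abbreviation unit_ball :: "'n::finite itself \<Rightarrow> (real ^ 'n) set" where "unit_ball T \<equiv> ball 0 1"

definition L2norm2 :: "'n::finite itself \<Rightarrow> (real \<Rightarrow> complex) \<Rightarrow> real" where
  "L2norm2 T h = (LINT x|lebesgue_on (unit_ball T). (cmod (radial_lift T h x))\<^sup>2)"

lemma square_integrable_radial:
  fixes T :: "'n::finite itself"
  assumes c: "continuous_on {0<..<1} h" and B: "\<And>r. r \<in> {0<..<1} \<Longrightarrow> cmod (h r) \<le> B"
  shows "square_integrable (unit_ball T) (radial_lift T h)"
proof -
  \<comment> \<open>The origin is split off because h is assumed continuous on the open interval
    only; its value at 0 is arbitrary.\<close>
  define S where "S = unit_ball T - {0}"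
  define g where "g x = indicator S x *\<^sub>R h (norm x)" for x
  have "open S" unfolding S_def by (intro open_Diff) auto
  have "continuous_on S (\<lambda>x. h (norm x))"
    by (rule continuous_on_compose2[OF c]) (auto simp: S_def intro!: continuous_intros)
  then have "g \<in> borel_measurable borel"
    unfolding g_def using \<open>open S\<close> by (intro borel_measurable_continuous_on_indicator) auto
  then have gl: "g \<in> borel_measurable lebesgue" by (simp add: measurable_completion)
  have m: "radial_lift T h \<in> borel_measurable (lebesgue_on (unit_ball T))"
  proof -
    have "(\<lambda>x. g x + indicator {0} x *\<^sub>R h 0) \<in> borel_measurable (lebesgue_on (unit_ball T))"
      by (intro measurable_restrict_space1 borel_measurable_add gl borel_measurable_scaleR borel_measurable_indicator) auto
    moreover have "radial_lift T h x = g x + indicator {0} x *\<^sub>R h 0" if "x \<in> space (lebesgue_on (unit_ball T))" for x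
    proof (cases "x = 0")
      case False
      then have "x \<in> S" using that by (simp add: S_def space_restrict_space)
      then show ?thesis using False by (simp add: radial_lift_def g_def)
    qed (simp add: radial_lift_def g_def S_def)
    then have "(radial_lift T h \<in> borel_measurable (lebesgue_on (unit_ball T))) =
       ((\<lambda>x. g x + indicator {0} x *\<^sub>R h 0) \<in> borel_measurable (lebesgue_on (unit_ball T)))"
      by (rule measurable_cong)
    ultimately show ?thesis by simp
  qed
  define B' where "B' = max B (cmod (h 0))"
  have bd: "cmod (radial_lift T h x) \<le> B'" if "x \<in> unit_ball T" for x
    using B[of "norm x"] that unfolding radial_lift_def B'_def by (cases "x = 0") (auto simp: le_max_iff_disj)
  have "square_integrable (unit_ball T) (\<lambda>x. radial_lift T h x * 1)"
    by (rule square_integrable_mult[OF square_integrable_const m bd]) auto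
  then show ?thesis by simp
qed

lemma L2norm2_nonneg: "L2norm2 T h \<ge> 0"
  unfolding L2norm2_def by simp

lemma L2norm2_nn:
  fixes T :: "'n::finite itself"
  assumes "square_integrable (unit_ball T) (radial_lift T h)"
  shows "ennreal (L2norm2 T h) = (\<integral>\<^sup>+x. indicator (unit_ball T) x * ennreal ((cmod (h (norm x)))\<^sup>2) \<partial>lebesgue)"
proof -
  have "ennreal (L2norm2 T h) = (\<integral>\<^sup>+x. ennreal ((cmod (radial_lift T h x))\<^sup>2) \<partial>lebesgue_on (unit_ball T))"
    unfolding L2norm2_def using assms by (subst nn_integral_eq_integral) (auto simp: square_integrable_def)
  also have "\<dots> = (\<integral>\<^sup>+x. indicator (unit_ball T) x * ennreal ((cmod (h (norm x)))\<^sup>2) \<partial>lebesgue)"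
    by (subst nn_integral_restrict_space) (auto simp: radial_lift_def mult.commute)
  finally show ?thesis .
qed

text \<open>On [a, b] the radial weight r^(n-1) is at least a^(n-1) > 0, so the norm on the ball
  controls one-dimensional integrals away from the origin.\<close>

lemma L2_interval_bound:
  fixes T :: "'n::finite itself"
  assumes ab: "0 < a" "b < 1" and c: "continuous_on {a..b} h"
    and sq: "square_integrable (unit_ball T) (radial_lift T h)"
  shows "integral {a..b} (\<lambda>r. (cmod (h r))\<^sup>2) * (real CARD('n) * ball_vol T * a ^ (CARD('n) - 1)) \<le> L2norm2 T h"
proof -
  define \<kappa> where "\<kappa> = real CARD('n) * ball_vol T * a ^ (CARD('n) - 1)"
  have \<kappa>: "\<kappa> > 0" unfolding \<kappa>_def using ab ball_vol_pos by simp
  define g where "g r = indicator {a..b} r *\<^sub>R (cmod (h r))\<^sup>2" for r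
  have gm [measurable]: "g \<in> borel_measurable borel"
    unfolding g_def by (intro borel_measurable_continuous_on_indicator continuous_intros c) auto
  have gi: "integrable lborel g" unfolding g_def by (intro borel_integrable_compact continuous_intros c) auto
  have g0: "g r \<ge> 0" for r unfolding g_def by simp
  have "ennreal \<kappa> * (\<integral>\<^sup>+r. ennreal (g r) \<partial>lborel) = (\<integral>\<^sup>+r. ennreal \<kappa> * ennreal (g r) \<partial>lborel)"
    by (rule nn_integral_cmult[symmetric]) auto
  also have "\<dots> \<le> (\<integral>\<^sup>+r. ennreal (real CARD('n) * ball_vol T * r ^ (CARD('n) - 1)) * indicator {0..} r * ennreal (g r) \<partial>lborel)"
  proof (rule nn_integral_mono)
    fix r
    show "ennreal \<kappa> * ennreal (g r) \<le> ennreal (real CARD('n) * ball_vol T * r ^ (CARD('n) - 1)) * indicator {0..} r * ennreal (g r)"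
    proof (cases "r \<in> {a..b}")
      case True
      then have "\<kappa> \<le> real CARD('n) * ball_vol T * r ^ (CARD('n) - 1)"
        unfolding \<kappa>_def using ab ball_vol_pos[where 'n='n] by (intro mult_left_mono power_mono) auto
      then show ?thesis using True ab by (auto intro!: mult_right_mono ennreal_leI)
    qed (simp add: g_def)
  qed
  also have "\<dots> = (\<integral>\<^sup>+x. ennreal (g (norm (x :: real ^ 'n))) \<partial>lborel)"
    by (rule radial_nn_integral[symmetric]) measurable
  also have "\<dots> = (\<integral>\<^sup>+x. ennreal (g (norm (x :: real ^ 'n))) \<partial>lebesgue)"
    by (rule nn_integral_completion[symmetric])
  also have "\<dots> \<le> (\<integral>\<^sup>+x. indicator (unit_ball T) x * ennreal ((cmod (h (norm x)))\<^sup>2) \<partial>lebesgue)"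
    by (rule nn_integral_mono) (use ab in \<open>auto simp: g_def indicator_def\<close>)
  also have "\<dots> = ennreal (L2norm2 T h)" by (rule L2norm2_nn[OF sq, symmetric])
  also have "(\<integral>\<^sup>+r. ennreal (g r) \<partial>lborel) = ennreal (integral\<^sup>L lborel g)"
    by (rule nn_integral_eq_integral[OF gi]) (use g0 in auto)
  finally have "\<kappa> * integral\<^sup>L lborel g \<le> L2norm2 T h"
    using \<kappa> L2norm2_nonneg[of T h] by (simp add: ennreal_mult'[symmetric])
  moreover have "integral\<^sup>L lborel g = integral {a..b} (\<lambda>r. (cmod (h r))\<^sup>2)"
  proof -
    have "(g has_integral integral\<^sup>L lborel g) UNIV" by (rule has_integral_integral_lborel[OF gi])
    moreover have "g = (\<lambda>r. if r \<in> {a..b} then (cmod (h r))\<^sup>2 else 0)" by (auto simp: g_def indicator_def fun_eq_iff)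
    ultimately have "((\<lambda>r. (cmod (h r))\<^sup>2) has_integral integral\<^sup>L lborel g) {a..b}"
      using has_integral_restrict_UNIV by metis
    then show ?thesis by (simp add: integral_unique)
  qed
  ultimately show ?thesis unfolding \<kappa>_def by (simp add: mult.commute)
qed

text \<open>The inequality t \<le> \<delta> + t^2 / \<delta> stands in for Cauchy-Schwarz. It
  matters that \<eta> is chosen before h.\<close>

lemma L1_interval_small:
  fixes T :: "'n::finite itself"
  assumes ab: "0 < a" "a \<le> b" "b < 1" and e: "e > 0"
  shows "\<exists>\<eta>>0. \<forall>h. continuous_on {a..b} h \<longrightarrow> square_integrable (unit_ball T) (radial_lift T h) \<longrightarrow>
    L2norm2 T h < \<eta> \<longrightarrow> integral {a..b} (\<lambda>r. cmod (h r)) < e"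
proof -
  define \<kappa> where "\<kappa> = real CARD('n) * ball_vol T * a ^ (CARD('n) - 1)"
  have \<kappa>: "\<kappa> > 0" unfolding \<kappa>_def using ab ball_vol_pos by simp
  define \<delta> where "\<delta> = e / (2 * (b - a + 1))"
  have \<delta>: "\<delta> > 0" "\<delta> * (b - a) < e / 2" unfolding \<delta>_def using e ab by (auto simp: field_simps)
  have "integral {a..b} (\<lambda>r. cmod (h r)) < e"
    if c: "continuous_on {a..b} h" and sq: "square_integrable (unit_ball T) (radial_lift T h)" and N: "L2norm2 T h < \<delta> * \<kappa> * (e/2)" for h
  proof -
    have "integral {a..b} (\<lambda>r. cmod (h r)) \<le> integral {a..b} (\<lambda>r. \<delta> + (1/\<delta>) * (cmod (h r))\<^sup>2)"
    proof (rule integral_le)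
      show "(\<lambda>r. cmod (h r)) integrable_on {a..b}" "(\<lambda>r. \<delta> + (1/\<delta>) * (cmod (h r))\<^sup>2) integrable_on {a..b}"
        using \<delta>(1) by (auto intro!: integrable_continuous_real continuous_intros c)
      fix r
      have "t \<le> \<delta> + (1/\<delta>) * t\<^sup>2" if "t \<ge> 0" for t
      proof (cases "t \<le> \<delta>")
        case True
        moreover have "(1/\<delta>) * t\<^sup>2 \<ge> 0" using \<delta> by simp
        ultimately show ?thesis by linarith
      next
        case False
        then have "t * \<delta> \<le> t * t" using that by (intro mult_left_mono) auto
        then have "t \<le> (1/\<delta>) * t\<^sup>2" using \<delta> by (simp add: power2_eq_square pos_le_divide_eq)
        then show ?thesis using \<delta> by linarith
      qed
      then show "cmod (h r) \<le> \<delta> + (1/\<delta>) * (cmod (h r))\<^sup>2" by simp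
    qed
    also have "\<dots> = \<delta> * (b - a) + (1/\<delta>) * integral {a..b} (\<lambda>r. (cmod (h r))\<^sup>2)"
      using ab \<delta>(1) by (subst integral_add) (auto intro!: integrable_continuous_real continuous_intros c)
    also have "(1/\<delta>) * integral {a..b} (\<lambda>r. (cmod (h r))\<^sup>2) \<le> e/2"
    proof -
      have "integral {a..b} (\<lambda>r. (cmod (h r))\<^sup>2) * \<kappa> \<le> (\<delta> * (e/2)) * \<kappa>"
      proof -
        have "integral {a..b} (\<lambda>r. (cmod (h r))\<^sup>2) * \<kappa> \<le> L2norm2 T h"
          unfolding \<kappa>_def by (rule L2_interval_bound[OF ab(1,3) c sq])
        moreover have "\<delta> * \<kappa> * (e/2) = (\<delta> * (e/2)) * \<kappa>" by simp
        ultimately show ?thesis using N by linarith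
      qed
      then have "integral {a..b} (\<lambda>r. (cmod (h r))\<^sup>2) \<le> \<delta> * (e/2)" using \<kappa> by simp
      then show ?thesis using \<delta> by (simp add: divide_le_eq mult.commute)
    qed
    finally show ?thesis using \<delta>(2) by simp
  qed
  moreover have "\<delta> * \<kappa> * (e/2) > 0" using \<delta> \<kappa> e by simp
  ultimately show ?thesis by blast
qed

lemma L2norm2_triangle:
  fixes T :: "'n::finite itself"
  assumes "square_integrable (unit_ball T) (radial_lift T f)" "square_integrable (unit_ball T) (radial_lift T g)"
  shows "L2norm2 T (\<lambda>r. f r - g r) \<le> 2 * L2norm2 T f + 2 * L2norm2 T g"
proof -
  have i: "integrable (lebesgue_on (unit_ball T)) (\<lambda>x. (cmod (radial_lift T f x))\<^sup>2)"
    "integrable (lebesgue_on (unit_ball T)) (\<lambda>x. (cmod (radial_lift T g x))\<^sup>2)"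
    using assms unfolding square_integrable_def by simp_all
  have "L2norm2 T (\<lambda>r. f r - g r) \<le> (LINT x|lebesgue_on (unit_ball T). 2 * (cmod (radial_lift T f x))\<^sup>2 + 2 * (cmod (radial_lift T g x))\<^sup>2)"
    unfolding L2norm2_def
  proof (rule integral_mono_AE')
    show "integrable (lebesgue_on (unit_ball T)) (\<lambda>x. 2 * (cmod (radial_lift T f x))\<^sup>2 + 2 * (cmod (radial_lift T g x))\<^sup>2)"
      using i by simp
    show "AE x in lebesgue_on (unit_ball T). (cmod (radial_lift T (\<lambda>r. f r - g r) x))\<^sup>2 \<le> 2 * (cmod (radial_lift T f x))\<^sup>2 + 2 * (cmod (radial_lift T g x))\<^sup>2"
    proof (rule AE_I2)
      fix x
      have "(cmod (radial_lift T (\<lambda>r. f r - g r) x))\<^sup>2 \<le> (cmod (radial_lift T f x) + cmod (radial_lift T g x))\<^sup>2"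
        unfolding radial_lift_def by (intro power_mono norm_triangle_ineq4) auto
      also have "\<dots> \<le> 2 * (cmod (radial_lift T f x))\<^sup>2 + 2 * (cmod (radial_lift T g x))\<^sup>2"
        using zero_le_power2[of "cmod (radial_lift T f x) - cmod (radial_lift T g x)"] by (simp add: power2_eq_square algebra_simps)
      finally show "(cmod (radial_lift T (\<lambda>r. f r - g r) x))\<^sup>2 \<le> 2 * (cmod (radial_lift T f x))\<^sup>2 + 2 * (cmod (radial_lift T g x))\<^sup>2" .
    qed
  qed simp
  also have "\<dots> = 2 * L2norm2 T f + 2 * L2norm2 T g"
    unfolding L2norm2_def using i by (subst Bochner_Integration.integral_add) auto
  finally show ?thesis .
qed

text \<open>Fatou's lemma identifies the L^2 limit with the pointwise limit without extraction of a
  subsequence. The origin, where no pointwise limit is assumed, is a null set.\<close>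

lemma AE_eq_of_L2_limit:
  fixes T :: "'n::finite itself"
  assumes sq: "\<And>m. square_integrable (unit_ball T) (radial_lift T (\<lambda>r. h m r - u r))"
    and lim: "(\<lambda>m. L2norm2 T (\<lambda>r. h m r - u r)) \<longlonglongrightarrow> 0"
    and pt: "\<And>r. r \<in> {0<..<1} \<Longrightarrow> (\<lambda>m. h m r) \<longlonglongrightarrow> v r"
  shows "AE x in lebesgue_on (unit_ball T). radial_lift T u x = radial_lift T v x"
proof -
  define f where "f m x = indicator (unit_ball T) x * ennreal ((cmod (h m (norm x) - u (norm x)))\<^sup>2)" for m and x :: "real ^ 'n"
  have fm: "f m \<in> borel_measurable lebesgue" for m
  proof -
    have "radial_lift T (\<lambda>r. h m r - u r) \<in> borel_measurable (lebesgue_on (unit_ball T))"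
      using sq[of m] unfolding square_integrable_def by blast
    then have "(\<lambda>x. indicator (unit_ball T) x *\<^sub>R radial_lift T (\<lambda>r. h m r - u r) x) \<in> borel_measurable lebesgue"
      by (subst (asm) borel_measurable_restrict_space_iff) auto
    then have "(\<lambda>x. ennreal ((cmod (indicator (unit_ball T) x *\<^sub>R radial_lift T (\<lambda>r. h m r - u r) x))\<^sup>2)) \<in> borel_measurable lebesgue"
      by measurable
    moreover have "(\<lambda>x. ennreal ((cmod (indicator (unit_ball T) x *\<^sub>R radial_lift T (\<lambda>r. h m r - u r) x))\<^sup>2)) = f m"
    proof (rule ext)
      fix x show "ennreal ((cmod (indicator (unit_ball T) x *\<^sub>R radial_lift T (\<lambda>r. h m r - u r) x))\<^sup>2) = f m x"
        unfolding f_def radial_lift_def by (cases "x \<in> unit_ball T") auto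
    qed
    ultimately show ?thesis by (simp only:)
  qed
  have fi: "(\<integral>\<^sup>+x. f m x \<partial>lebesgue) = ennreal (L2norm2 T (\<lambda>r. h m r - u r))" for m
    unfolding f_def by (rule L2norm2_nn[OF sq, symmetric])
  have "(\<integral>\<^sup>+x. liminf (\<lambda>m. f m x) \<partial>lebesgue) \<le> liminf (\<lambda>m. \<integral>\<^sup>+x. f m x \<partial>lebesgue)"
    by (rule nn_integral_liminf) (rule fm)
  also have "\<dots> = 0"
  proof -
    have "(\<lambda>m. ennreal (L2norm2 T (\<lambda>r. h m r - u r))) \<longlonglongrightarrow> ennreal 0" by (intro tendsto_ennrealI lim)
    then show ?thesis unfolding fi by (simp add: lim_imp_Liminf)
  qed
  finally have "(\<integral>\<^sup>+x. liminf (\<lambda>m. f m x) \<partial>lebesgue) = 0" by simp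
  then have "AE x in lebesgue. liminf (\<lambda>m. f m x) = 0"
    by (subst (asm) nn_integral_0_iff_AE) (use fm in measurable)
  moreover have "AE x in lebesgue. x \<noteq> (0 :: real ^ 'n)"
  proof -
    have "{0 :: real ^ 'n} \<in> null_sets lebesgue" using negligible_sing[of "0 :: real ^ 'n"] by (simp add: negligible_iff_null_sets)
    from AE_not_in[OF this] show ?thesis by simp
  qed
  ultimately have "AE x in lebesgue. x \<in> unit_ball T \<longrightarrow> radial_lift T u x = radial_lift T v x"
  proof eventually_elim
    case (elim x)
    show ?case
    proof
      assume x: "x \<in> unit_ball T"
      then have "norm x \<in> {0<..<1}" using elim by auto
      then have "(\<lambda>m. ennreal ((cmod (h m (norm x) - u (norm x)))\<^sup>2)) \<longlonglongrightarrow> ennreal ((cmod (v (norm x) - u (norm x)))\<^sup>2)"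
        by (intro tendsto_intros pt)
      then have "liminf (\<lambda>m. f m x) = ennreal ((cmod (v (norm x) - u (norm x)))\<^sup>2)"
        unfolding f_def using x by (simp add: lim_imp_Liminf)
      then show "radial_lift T u x = radial_lift T v x" using elim by (simp add: radial_lift_def ennreal_eq_0_iff)
    qed
  qed
  then show ?thesis by (subst AE_restrict_space_iff) auto
qed

text \<open>A class that admits w' / r, for which 0 is not a regular point, is closed under sums and
  products, and consists of functions with square integrable lift.\<close>

definition bcont :: "(real \<Rightarrow> complex) \<Rightarrow> bool" where
  "bcont h \<longleftrightarrow> continuous_on {0<..<1} h \<and> (\<exists>B. \<forall>r\<in>{0<..<1}. cmod (h r) \<le> B)"

lemma bcont_add: "bcont f \<Longrightarrow> bcont g \<Longrightarrow> bcont (\<lambda>r. f r + g r)"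
  unfolding bcont_def
proof (elim conjE exE, intro conjI)
  fix B B' assume "\<forall>r\<in>{0<..<1}. cmod (f r) \<le> B" "\<forall>r\<in>{0<..<1}. cmod (g r) \<le> B'"
  then show "\<exists>B. \<forall>r\<in>{0<..<1}. cmod (f r + g r) \<le> B" by (intro exI[of _ "B + B'"]) (auto intro: norm_triangle_mono)
qed (intro continuous_intros)

lemma bcont_mult: "bcont f \<Longrightarrow> bcont g \<Longrightarrow> bcont (\<lambda>r. f r * g r)"
  unfolding bcont_def
proof (elim conjE exE, intro conjI)
  fix B B' assume *: "\<forall>r\<in>{0<..<1}. cmod (f r) \<le> B" "\<forall>r\<in>{0<..<1}. cmod (g r) \<le> B'"
  have "cmod (f r * g r) \<le> B * B'" if "r \<in> {0<..<1}" for r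
    unfolding norm_mult using *[rule_format, OF that] by (intro mult_mono) (auto intro: order_trans[OF norm_ge_zero])
  then show "\<exists>B. \<forall>r\<in>{0<..<1}. cmod (f r * g r) \<le> B" by blast
qed (intro continuous_intros)

lemma bcont_01: "continuous_on {0..1} f \<Longrightarrow> bcont f"
  unfolding bcont_def
proof (intro conjI)
  assume c: "continuous_on {0..1} f"
  then show "continuous_on {0<..<1} f" by (rule continuous_on_subset) auto
  have "bounded (f ` {0..1})" by (intro compact_imp_bounded compact_continuous_image c) auto
  then obtain B where "\<forall>y\<in>f ` {0..1}. norm y \<le> B" unfolding bounded_iff by (rule exE)
  then show "\<exists>B. \<forall>r\<in>{0<..<1}. cmod (f r) \<le> B" by (intro exI[of _ B]) auto
qed

lemma bcont_minus: "bcont f \<Longrightarrow> bcont g \<Longrightarrow> bcont (\<lambda>r. f r - g r)"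
  using bcont_add[of f "\<lambda>r. (-1) * g r"] bcont_mult[of "\<lambda>r. -1" g] bcont_01[of "\<lambda>r. -1"] by simp

lemma bcont_square_integrable: "bcont h \<Longrightarrow> square_integrable (unit_ball T) (radial_lift T h)"
  unfolding bcont_def using square_integrable_radial by blast

text \<open>The third claim rests on evenness: u' vanishes at 0, and the mean value inequality with
  a bound on u'' keeps u' / r bounded. So the singular coefficient (d + 1) / r of the operator does
  no harm on smooth even functions.\<close>

lemma smooth_even01_facts:
  assumes u: "u \<in> smooth_even01"
  shows "continuous_on {0..1} ((deriv01 ^^ k) u)"
    and "t \<in> {0<..<1} \<Longrightarrow> ((deriv01 ^^ k) u has_vector_derivative (deriv01 ^^ Suc k) u t) (at t)"
    and "bcont (\<lambda>r. deriv01 u r / of_real r)"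
proof -
  have d: "(deriv01 ^^ k) u differentiable (at t within {0..1})" if "t \<in> {0..1}" for t k
    using u that unfolding smooth_even01_def by blast
  have hv: "((deriv01 ^^ k) u has_vector_derivative (deriv01 ^^ Suc k) u t) (at t within {0..1})" if "t \<in> {0..1}" for t k
    proof -
    have "(deriv01 ^^ Suc k) u t = vector_derivative ((deriv01 ^^ k) u) (at t within {0..1})"
      by (simp add: deriv01_def)
    then show ?thesis using iffD1[OF vector_derivative_works d[OF that, of k]] by (simp only:)
  qed
  show c: "continuous_on {0..1} ((deriv01 ^^ k) u)" for k
    unfolding continuous_on_eq_continuous_within
  proof (rule ballI)
    show "continuous (at t within {0..1}) ((deriv01 ^^ k) u)" if "t \<in> {0..1}" for t
      by (rule differentiable_imp_continuous_within[OF d[OF that]])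
  qed
  show "((deriv01 ^^ k) u has_vector_derivative (deriv01 ^^ Suc k) u t) (at t)" if t: "t \<in> {0<..<1}"
  proof -
    have "((deriv01 ^^ k) u has_vector_derivative (deriv01 ^^ Suc k) u t) (at t within {0<..<1})"
      by (rule has_vector_derivative_within_subset[OF hv]) (use t in auto)
    then show ?thesis unfolding at_within_open[OF t open_greaterThanLessThan] .
  qed
  have z: "deriv01 u 0 = 0"
  proof -
    have "(deriv01 ^^ (2 * 0 + 1)) u 0 = 0" using u unfolding smooth_even01_def by blast
    then show ?thesis by simp
  qed
  have "bounded ((deriv01 ^^ 2) u ` {0..1})" by (intro compact_imp_bounded compact_continuous_image c) auto
  then obtain B where B: "\<forall>y\<in>(deriv01 ^^ 2) u ` {0..1}. norm y \<le> B" unfolding bounded_iff by (rule exE)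
  have q: "cmod (deriv01 u r / of_real r) \<le> B" if r: "r \<in> {0<..<1}" for r
  proof -
    have "cmod (deriv01 u r - deriv01 u 0) \<le> B * norm (r - 0)"
    proof (rule differentiable_bound[of "{0..1}" "deriv01 u" "\<lambda>t s. s *\<^sub>R (deriv01 ^^ 2) u t"])
      show "(deriv01 u has_derivative (\<lambda>s. s *\<^sub>R (deriv01 ^^ 2) u t)) (at t within {0..1})" if "t \<in> {0..1}" for t
        using hv[OF that, of 1] unfolding has_vector_derivative_def by (simp add: numeral_2_eq_2)
      show "onorm (\<lambda>s. s *\<^sub>R (deriv01 ^^ 2) u t) \<le> B" if "t \<in> {0..1}" for t
      proof (rule onorm_le)
        fix s :: real
        have "cmod ((deriv01 ^^ 2) u t) \<le> B" using bspec[OF B imageI[OF that]] .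
        then show "norm (s *\<^sub>R (deriv01 ^^ 2) u t) \<le> B * norm s" unfolding norm_scaleR real_norm_def
          by (subst mult.commute) (rule mult_right_mono, auto)
      qed
    next
      show "convex {0..1::real}" by (rule convex_real_interval)
      show "r \<in> {0..1}" "0 \<in> {0..1::real}" using r by simp_all
    qed
    then have "cmod (deriv01 u r) \<le> B * r" using r z by simp
    then have "cmod (deriv01 u r) / r \<le> B" using r by (simp add: pos_divide_le_eq)
    then show ?thesis using r by (simp add: norm_divide)
  qed
  have "continuous_on {0<..<1} (deriv01 u)"
  proof (rule continuous_on_subset)
    show "continuous_on {0..1} (deriv01 u)" using c[of 1] by (simp only: One_nat_def funpow.simps o_id)
  qed (simp add: subset_iff)
  then have "continuous_on {0<..<1} (\<lambda>r. deriv01 u r / of_real r)" by (intro continuous_intros) auto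
  then show "bcont (\<lambda>r. deriv01 u r / of_real r)" unfolding bcont_def using q by (intro conjI exI[of _ B] ballI)
qed

text \<open>The filter is left general so that sequences and, over the product filter, differences
  indexed by pairs are treated alike: the Cauchy property becomes a null statement.\<close>

definition L1null :: "real \<Rightarrow> real \<Rightarrow> 'i filter \<Rightarrow> ('i \<Rightarrow> real \<Rightarrow> complex) \<Rightarrow> bool" where
  "L1null a b F f \<longleftrightarrow> (\<forall>i. continuous_on {a..b} (f i)) \<and> ((\<lambda>i. integral {a..b} (\<lambda>r. cmod (f i r))) \<longlongrightarrow> 0) F"

lemma L1null_add:
  assumes f: "L1null a b F f" and g: "L1null a b F g"
  shows "L1null a b F (\<lambda>i r. f i r + g i r)"
  unfolding L1null_def
proof (intro conjI allI)
  have c: "continuous_on {a..b} (f i)" "continuous_on {a..b} (g i)" for i using f g unfolding L1null_def by blast+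
  show "continuous_on {a..b} (\<lambda>r. f i r + g i r)" for i by (intro continuous_intros c)
  show "((\<lambda>i. integral {a..b} (\<lambda>r. cmod (f i r + g i r))) \<longlongrightarrow> 0) F"
  proof (rule tendsto_sandwich[of "\<lambda>_. 0"])
    show "((\<lambda>i. integral {a..b} (\<lambda>r. cmod (f i r)) + integral {a..b} (\<lambda>r. cmod (g i r))) \<longlongrightarrow> 0) F"
      using f g unfolding L1null_def by (intro tendsto_add_zero) blast+
    show "eventually (\<lambda>i. integral {a..b} (\<lambda>r. cmod (f i r + g i r)) \<le> integral {a..b} (\<lambda>r. cmod (f i r)) + integral {a..b} (\<lambda>r. cmod (g i r))) F"
    proof (rule always_eventually, rule allI)
      fix i
      have "integral {a..b} (\<lambda>r. cmod (f i r + g i r)) \<le> integral {a..b} (\<lambda>r. cmod (f i r) + cmod (g i r))"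
        by (rule integral_le) (auto intro!: integrable_continuous_real continuous_intros c norm_triangle_ineq)
      also have "\<dots> = integral {a..b} (\<lambda>r. cmod (f i r)) + integral {a..b} (\<lambda>r. cmod (g i r))"
        by (rule integral_add) (auto intro!: integrable_continuous_real continuous_intros c)
      finally show "integral {a..b} (\<lambda>r. cmod (f i r + g i r)) \<le> integral {a..b} (\<lambda>r. cmod (f i r)) + integral {a..b} (\<lambda>r. cmod (g i r))" .
    qed
    show "eventually (\<lambda>i. 0 \<le> integral {a..b} (\<lambda>r. cmod (f i r + g i r))) F"
      by (intro always_eventually allI integral_nonneg integrable_continuous_real continuous_intros c) auto
  qed simp
qed

lemma L1null_mult:
  assumes f: "L1null a b F f" and g: "continuous_on {a..b} g"
  shows "L1null a b F (\<lambda>i r. g r * f i r)"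
  unfolding L1null_def
proof (intro conjI allI)
  have c: "continuous_on {a..b} (f i)" for i using f unfolding L1null_def by blast
  show "continuous_on {a..b} (\<lambda>r. g r * f i r)" for i by (intro continuous_intros c g)
  have "bounded (g ` {a..b})" by (intro compact_imp_bounded compact_continuous_image g) auto
  then obtain B where B: "\<forall>y\<in>g ` {a..b}. norm y \<le> B" unfolding bounded_iff by (rule exE)
  show "((\<lambda>i. integral {a..b} (\<lambda>r. cmod (g r * f i r))) \<longlongrightarrow> 0) F"
  proof (rule tendsto_sandwich[of "\<lambda>_. 0"])
    show "((\<lambda>i. B * integral {a..b} (\<lambda>r. cmod (f i r))) \<longlongrightarrow> 0) F"
      using f unfolding L1null_def by (intro tendsto_mult_right_zero) blast
    show "eventually (\<lambda>i. integral {a..b} (\<lambda>r. cmod (g r * f i r)) \<le> B * integral {a..b} (\<lambda>r. cmod (f i r))) F"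
    proof (rule always_eventually, rule allI)
      fix i
      have "integral {a..b} (\<lambda>r. cmod (g r * f i r)) \<le> integral {a..b} (\<lambda>r. B * cmod (f i r))"
      proof (rule integral_le)
        fix r assume "r \<in> {a..b}"
        then have "cmod (g r) \<le> B" by (rule bspec[OF B imageI])
        then show "cmod (g r * f i r) \<le> B * cmod (f i r)" unfolding norm_mult by (intro mult_right_mono) auto
      qed (auto intro!: integrable_continuous_real continuous_intros c g)
      then show "integral {a..b} (\<lambda>r. cmod (g r * f i r)) \<le> B * integral {a..b} (\<lambda>r. cmod (f i r))" by simp
    qed
    show "eventually (\<lambda>i. 0 \<le> integral {a..b} (\<lambda>r. cmod (g r * f i r))) F"
      by (intro always_eventually allI integral_nonneg integrable_continuous_real continuous_intros c g) auto
  qed simp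
qed

lemma L1null_cmult: "L1null a b F f \<Longrightarrow> L1null a b F (\<lambda>i r. c * f i r)"
  by (rule L1null_mult) auto

lemma L1null_diff: "L1null a b F f \<Longrightarrow> L1null a b F g \<Longrightarrow> L1null a b F (\<lambda>i r. f i r - g i r)"
  using L1null_add[of a b F f "\<lambda>i r. (-1) * g i r"] L1null_cmult[of a b F g "-1"] by simp

lemma L1null_cong:
  assumes "L1null a b F f" "\<And>i r. r \<in> {a..b} \<Longrightarrow> g i r = f i r"
  shows "L1null a b F g"
proof -
  have "continuous_on {a..b} (g i)" for i
    using assms by (subst continuous_on_cong[OF refl, of _ _ "f i"]) (auto simp: L1null_def)
  moreover have "integral {a..b} (\<lambda>r. cmod (g i r)) = integral {a..b} (\<lambda>r. cmod (f i r))" for i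
    by (rule integral_cong) (simp add: assms(2))
  ultimately show ?thesis using assms(1) unfolding L1null_def by simp
qed

lemma L1null_uniform:
  assumes c: "\<And>i. continuous_on {a..b} (f i)" and u: "uniform_limit {a..b} f (\<lambda>_. 0) F" and ab: "a \<le> b"
  shows "L1null a b F f"
  unfolding L1null_def
proof (intro conjI allI c)
  show "((\<lambda>i. integral {a..b} (\<lambda>r. cmod (f i r))) \<longlongrightarrow> 0) F"
  proof (rule tendstoI)
    fix e :: real assume e: "e > 0"
    define e' where "e' = e / (b - a + 1)"
    have e': "e' > 0" "e' * (b - a) < e" using e ab unfolding e'_def by (auto simp: field_simps)
    from uniform_limitD[OF u e'(1)] show "eventually (\<lambda>i. dist (integral {a..b} (\<lambda>r. cmod (f i r))) 0 < e) F"
    proof eventually_elim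
      case (elim i)
      have "integral {a..b} (\<lambda>r. cmod (f i r)) \<le> integral {a..b} (\<lambda>r. e')"
        by (rule integral_le) (use elim in \<open>auto intro!: integrable_continuous_real continuous_intros c less_imp_le\<close>)
      then have "integral {a..b} (\<lambda>r. cmod (f i r)) < e" using e'(2) ab by (simp add: mult.commute)
      moreover have "integral {a..b} (\<lambda>r. cmod (f i r)) \<ge> 0"
        by (intro integral_nonneg integrable_continuous_real continuous_intros c) auto
      ultimately show ?case by simp
    qed
  qed
qed

lemma L1null_L2:
  fixes T :: "'n::finite itself"
  assumes ab: "0 < a" "a \<le> b" "b < 1" and c: "\<And>i. continuous_on {a..b} (f i)"
    and sq: "\<And>i. square_integrable (unit_ball T) (radial_lift T (f i))"
    and lim: "((\<lambda>i. L2norm2 T (f i)) \<longlongrightarrow> 0) F"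
  shows "L1null a b F f"
  unfolding L1null_def
proof (intro conjI allI c)
  show "((\<lambda>i. integral {a..b} (\<lambda>r. cmod (f i r))) \<longlongrightarrow> 0) F"
  proof (rule tendstoI)
    fix e :: real assume e: "e > 0"
    obtain \<eta> where \<eta>: "\<eta> > 0" "\<And>h. continuous_on {a..b} h \<Longrightarrow> square_integrable (unit_ball T) (radial_lift T h) \<Longrightarrow>
       L2norm2 T h < \<eta> \<Longrightarrow> integral {a..b} (\<lambda>r. cmod (h r)) < e"
      using L1_interval_small[OF ab e] by metis
    from order_tendstoD(2)[OF lim \<eta>(1)] show "eventually (\<lambda>i. dist (integral {a..b} (\<lambda>r. cmod (f i r))) 0 < e) F"
    proof eventually_elim
      case (elim i)
      have "integral {a..b} (\<lambda>r. cmod (f i r)) \<ge> 0"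
        by (intro integral_nonneg integrable_continuous_real continuous_intros c) auto
      then show ?case using \<eta>(2)[OF c sq elim] by simp
    qed
  qed
qed

text \<open>The one-dimensional embedding of W^(1,1) into the continuous functions: |h(t)| is at
  most the mean of |h| plus the integral of |h'|.\<close>

lemma L1null_sup:
  assumes ab: "a < b" and h: "L1null a b F h" and k: "L1null a b F k"
    and d: "\<And>i t. t \<in> {a..b} \<Longrightarrow> (h i has_vector_derivative k i t) (at t within {a..b})"
  shows "uniform_limit {a..b} h (\<lambda>_. 0) F"
proof -
  have c: "continuous_on {a..b} (h i)" "continuous_on {a..b} (k i)" for i using h k unfolding L1null_def by blast+
  define H where "H i = integral {a..b} (\<lambda>r. cmod (h i r))" for i
  define K where "K i = integral {a..b} (\<lambda>r. cmod (k i r))" for i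
  have incr: "cmod (h i t) \<le> cmod (h i s) + K i" if "s \<in> {a..b}" "t \<in> {a..b}" for i s t
  proof -
    have *: "cmod (h i t - h i s) \<le> K i" if st: "s \<le> t" "s \<in> {a..b}" "t \<in> {a..b}" for s t
    proof -
      have sub: "{s..t} \<subseteq> {a..b}" using st by auto
      have "(k i has_integral (h i t - h i s)) {s..t}"
      proof (rule fundamental_theorem_of_calculus[OF st(1)])
        show "(h i has_vector_derivative k i x) (at x within {s..t})" if "x \<in> {s..t}" for x
          by (rule has_vector_derivative_within_subset[OF d sub]) (use that sub in blast)
      qed
      then have "h i t - h i s = integral {s..t} (k i)" by (simp add: integral_unique)
      also have "cmod \<dots> \<le> integral {s..t} (\<lambda>r. cmod (k i r))"
        by (rule integral_norm_bound_integral) (auto intro!: integrable_continuous_real continuous_intros continuous_on_subset[OF c(2) sub])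
      also have "\<dots> \<le> K i" unfolding K_def
        by (rule integral_subset_le[OF sub]) (auto intro!: integrable_continuous_real continuous_intros continuous_on_subset[OF c(2)] sub)
      finally show ?thesis .
    qed
    have "cmod (h i t - h i s) \<le> K i"
      using *[of s t] *[of t s] that by (cases "s \<le> t") (auto simp: norm_minus_commute)
    then show ?thesis using norm_triangle_ineq2[of "h i t" "h i s"] by linarith
  qed
  have bound: "cmod (h i t) \<le> H i / (b - a) + K i" if t: "t \<in> {a..b}" for i t
  proof -
    have "integral {a..b} (\<lambda>s. cmod (h i t)) \<le> integral {a..b} (\<lambda>s. cmod (h i s) + K i)"
      by (rule integral_le) (use incr t in \<open>auto intro!: integrable_continuous_real continuous_intros c\<close>)
    also have "\<dots> = H i + K i * (b - a)"
      unfolding H_def using ab by (subst integral_add) (auto intro!: integrable_continuous_real continuous_intros c)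
    finally have "cmod (h i t) * (b - a) \<le> H i + K i * (b - a)" using ab by (simp add: mult.commute)
    then show ?thesis using ab by (simp add: field_simps)
  qed
  have lim: "((\<lambda>i. H i / (b - a) + K i) \<longlongrightarrow> 0) F"
    using h k unfolding L1null_def H_def K_def by (intro tendsto_add_zero tendsto_divide_zero) blast+
  show ?thesis
  proof (rule uniform_limitI)
    fix e :: real assume "e > 0"
    from order_tendstoD(2)[OF lim this] show "\<forall>\<^sub>F i in F. \<forall>t\<in>{a..b}. dist (h i t) 0 < e"
    proof eventually_elim
      case (elim i)
      show ?case unfolding dist_norm diff_zero using le_less_trans[OF bound elim] by blast
    qed
  qed
qed

text \<open>The limit is taken in the integrated form h(s) = h(a) + integral of k, for which L^1
  convergence of the derivatives is sufficient; continuity of \<kappa> then allows differentiating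
  again.\<close>

lemma limit_derivative:
  assumes ab: "a \<le> b" and d: "\<And>m t. t \<in> {a..b} \<Longrightarrow> (h m has_vector_derivative k m t) (at t within {a..b})"
    and c: "continuous_on {a..b} \<kappa>" and n: "L1null a b sequentially (\<lambda>m r. k m r - \<kappa> r)"
    and lim: "\<And>t. t \<in> {a..b} \<Longrightarrow> (\<lambda>m. h m t) \<longlonglongrightarrow> h' t" and t: "t \<in> {a..b}"
  shows "(h' has_vector_derivative \<kappa> t) (at t within {a..b})"
proof -
  have ck: "continuous_on {a..b} (k m)" for m
  proof -
    have "continuous_on {a..b} (\<lambda>r. (k m r - \<kappa> r) + \<kappa> r)"
      using n unfolding L1null_def by (intro continuous_on_add c) blast
    then show ?thesis by simp
  qed
  have eq: "h' s = h' a + integral {a..s} \<kappa>" if s: "s \<in> {a..b}" for s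
  proof -
    have sub: "{a..s} \<subseteq> {a..b}" using s by auto
    have "h m s = h m a + integral {a..s} (k m)" for m
    proof -
      have "(k m has_integral (h m s - h m a)) {a..s}"
      proof (rule fundamental_theorem_of_calculus)
        show "(h m has_vector_derivative k m x) (at x within {a..s})" if "x \<in> {a..s}" for x
          by (rule has_vector_derivative_within_subset[OF d sub]) (use that sub in blast)
      qed (use s in simp)
      then show ?thesis by (simp add: integral_unique)
    qed
    moreover have "(\<lambda>m. integral {a..s} (k m)) \<longlonglongrightarrow> integral {a..s} \<kappa>"
    proof (rule LIM_zero_cancel, rule Lim_null_comparison)
      show "(\<lambda>m. integral {a..b} (\<lambda>r. cmod (k m r - \<kappa> r))) \<longlonglongrightarrow> 0" using n unfolding L1null_def by blast
      show "\<forall>\<^sub>F m in sequentially. norm (integral {a..s} (k m) - integral {a..s} \<kappa>) \<le> integral {a..b} (\<lambda>r. cmod (k m r - \<kappa> r))"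
      proof (rule always_eventually, rule allI)
        fix m
        have "integral {a..s} (k m) - integral {a..s} \<kappa> = integral {a..s} (\<lambda>r. k m r - \<kappa> r)"
          by (rule integral_diff[symmetric]) (auto intro!: integrable_continuous_real continuous_on_subset[OF ck sub] continuous_on_subset[OF c sub])
        also have "norm \<dots> \<le> integral {a..s} (\<lambda>r. cmod (k m r - \<kappa> r))"
          by (rule integral_norm_bound_integral) (auto intro!: integrable_continuous_real continuous_intros continuous_on_subset[OF ck sub] continuous_on_subset[OF c sub])
        also have "\<dots> \<le> integral {a..b} (\<lambda>r. cmod (k m r - \<kappa> r))"
          by (rule integral_subset_le[OF sub]) (auto intro!: integrable_continuous_real continuous_intros continuous_on_subset[OF ck] continuous_on_subset[OF c] sub)
        finally show "norm (integral {a..s} (k m) - integral {a..s} \<kappa>) \<le> integral {a..b} (\<lambda>r. cmod (k m r - \<kappa> r))" .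
      qed
    qed
    ultimately have "(\<lambda>m. h m s) \<longlonglongrightarrow> h' a + integral {a..s} \<kappa>" using lim[of a] ab by (auto intro: tendsto_add)
    then show ?thesis using lim[OF s] LIMSEQ_unique by blast
  qed
  have "((\<lambda>s. h' a + integral {a..s} \<kappa>) has_vector_derivative 0 + \<kappa> t) (at t within {a..b})"
    by (rule has_vector_derivative_add[OF has_vector_derivative_const integral_has_vector_derivative[OF c t]])
  then have "((\<lambda>s. h' a + integral {a..s} \<kappa>) has_vector_derivative \<kappa> t) (at t within {a..b})" by (simp only: add_0)
  then show ?thesis
    by (rule has_vector_derivative_transform[OF t, where f = "\<lambda>s. h' a + integral {a..s} \<kappa>", rotated]) (rule eq)
qed

section \<open>Passage to the limit in the closure of the operator\<close>

text \<open>The value 5/3 is attained at d = 5. It gives b \<le> 3/5 and places the singular point s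
  = -beta outside the closed unit disc.\<close>

lemma beta_pos: "d \<ge> 5 \<Longrightarrow> beta d \<ge> 5/3"
proof -
  assume d: "d \<ge> 5"
  then have r: "real d \<ge> 5" by simp
  have "(real d - 2) * (real d - 4) \<ge> 3 * 1" using r by (intro mult_mono) auto
  then have "3 * (real d - 2) * (real d - 4) \<ge> 3\<^sup>2" unfolding mult.assoc by simp
  then have "sqrt (3 * (real d - 2) * (real d - 4)) \<ge> 3" by (rule real_le_rsqrt)
  then show ?thesis unfolding beta_def using r by simp
qed

text \<open>\<open>resid1\<close> and \<open>resid2\<close> are the two components of (L - z) (w1,
  w2). Along the approximants of an eigenfunction with eigenvalue z they tend to 0 in L^2.\<close>

definition resid1 :: "complex \<Rightarrow> (real \<Rightarrow> complex) \<Rightarrow> (real \<Rightarrow> complex) \<Rightarrow> real \<Rightarrow> complex" where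
  "resid1 z w1 w2 r = w2 r - of_real r * deriv01 w1 r - 2 * w1 r - z * w1 r"

definition resid2 :: "nat \<Rightarrow> complex \<Rightarrow> (real \<Rightarrow> complex) \<Rightarrow> (real \<Rightarrow> complex) \<Rightarrow> real \<Rightarrow> complex" where
  "resid2 d z w1 w2 r = deriv01 (deriv01 w1) r + of_real ((real d + 1) / r) * deriv01 w1 r
     - of_real r * deriv01 w2 r - 3 * w2 r + of_real (V d r) * w1 r - z * w2 r"

text \<open>Unlike the derivative of \<open>w1\<close>, the flux is controlled uniformly by \<open>L\<^sup>1\<close> bounds on the residuals.\<close>

definition flux :: "complex \<Rightarrow> (real \<Rightarrow> complex) \<Rightarrow> (real \<Rightarrow> complex) \<Rightarrow> real \<Rightarrow> complex" where
  "flux z w1 w2 r = (1 - of_real r * of_real r) * deriv01 w1 r - of_real r * resid1 z w1 w2 r"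

lemma continuous_V: "d \<ge> 5 \<Longrightarrow> continuous_on A (V d)"
proof -
  assume "d \<ge> 5"
  then have "r\<^sup>2 + beta d \<noteq> 0" for r using beta_pos[of d] add_nonneg_pos[of "r\<^sup>2" "beta d"] by fastforce
  then show ?thesis unfolding V_def[abs_def] by (intro continuous_intros) auto
qed

lemma smooth_even01_continuous:
  assumes "u \<in> smooth_even01"
  shows "continuous_on {0..1} u" "continuous_on {0..1} (deriv01 u)" "continuous_on {0..1} (deriv01 (deriv01 u))"
  using smooth_even01_facts(1)[OF assms, of 0] smooth_even01_facts(1)[OF assms, of 1] smooth_even01_facts(1)[OF assms, of 2]
  by (simp_all add: numeral_2_eq_2)

lemma smooth_even01_deriv:
  assumes "u \<in> smooth_even01" "t \<in> {0<..<1}"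
  shows "(u has_vector_derivative deriv01 u t) (at t)" "(deriv01 u has_vector_derivative deriv01 (deriv01 u) t) (at t)"
  using smooth_even01_facts(2)[OF assms, of 0] smooth_even01_facts(2)[OF assms, of 1] by simp_all

lemma bcont_smooth: "u \<in> smooth_even01 \<Longrightarrow> bcont u" "u \<in> smooth_even01 \<Longrightarrow> bcont (deriv01 u)"
  "u \<in> smooth_even01 \<Longrightarrow> bcont (deriv01 (deriv01 u))"
  by (intro bcont_01 smooth_even01_continuous; assumption)+

lemma bcont_of_real: "continuous_on {0..1} f \<Longrightarrow> bcont (\<lambda>r. of_real (f r))"
  by (intro bcont_01 continuous_intros)

lemma bcont_const: "bcont (\<lambda>r. c)"
  by (intro bcont_01 continuous_intros)

lemma bcont_resid1: "w1 \<in> smooth_even01 \<Longrightarrow> w2 \<in> smooth_even01 \<Longrightarrow> bcont (resid1 z w1 w2)"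
  unfolding resid1_def[abs_def] by (intro bcont_minus bcont_mult bcont_smooth bcont_const bcont_of_real continuous_intros)

lemma bcont_L0_snd:
  assumes "w1 \<in> smooth_even01" "w2 \<in> smooth_even01"
  shows "bcont (snd (L0_tilde d (w1, w2)))"
proof -
  have "bcont (\<lambda>r. deriv01 (deriv01 w1) r + of_real (real d + 1) * (deriv01 w1 r / of_real r) - of_real r * deriv01 w2 r - 3 * w2 r)"
    by (intro bcont_minus bcont_add bcont_mult bcont_smooth bcont_const bcont_of_real continuous_intros smooth_even01_facts(3) assms)
  then show ?thesis unfolding L0_tilde_def by simp
qed

lemma bcont_resid2:
  assumes "w1 \<in> smooth_even01" "w2 \<in> smooth_even01" "d \<ge> 5"
  shows "bcont (resid2 d z w1 w2)"
proof -
  have "bcont (\<lambda>r. snd (L0_tilde d (w1, w2)) r + of_real (V d r) * w1 r - z * w2 r)"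
    by (intro bcont_minus bcont_add bcont_mult bcont_smooth bcont_const bcont_of_real bcont_L0_snd continuous_V assms)
  then show ?thesis unfolding resid2_def[abs_def] L0_tilde_def by simp
qed

lemma bcont_continuous: "bcont h \<Longrightarrow> 0 < a \<Longrightarrow> b < 1 \<Longrightarrow> continuous_on {a..b} h"
  unfolding bcont_def by (elim conjE) (erule continuous_on_subset, auto)

text \<open>Expanded, the flux is w1' - r w2 + (z + 2) r w1. Its derivative contains w1'' and w2'
  only in the combination w1'' - r w2' that \<open>resid2\<close> supplies, and w2 itself is
  eliminated by \<open>resid1\<close>; no derivative of a residual appears on the right.\<close>

lemma flux_derivative:
  assumes w: "w1 \<in> smooth_even01" "w2 \<in> smooth_even01" and t: "t \<in> {0<..<1}"
  shows "(flux z w1 w2 has_vector_derivative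
     - (of_real ((real d + 1) / t) - 2 * (z + 2) * of_real t) * deriv01 w1 t
     + ((z + 2) * (z + 3) - of_real (V d t)) * w1 t + resid2 d z w1 w2 t + (2 + z) * resid1 z w1 w2 t) (at t)"
proof -
  note d = smooth_even01_deriv[OF w(1) t] smooth_even01_deriv[OF w(2) t]
  have r: "((\<lambda>r. of_real r :: complex) has_vector_derivative 1) (at t)"
    by (auto simp: has_vector_derivative_def scaleR_conv_of_real intro!: derivative_eq_intros)
  have "(flux z w1 w2 has_vector_derivative
     ((1 - of_real t * of_real t) * deriv01 (deriv01 w1) t + (0 - (of_real t * 1 + 1 * of_real t)) * deriv01 w1 t)
      - (of_real t * (deriv01 w2 t - (of_real t * deriv01 (deriv01 w1) t + 1 * deriv01 w1 t) - 2 * deriv01 w1 t - z * deriv01 w1 t)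
         + 1 * (w2 t - of_real t * deriv01 w1 t - 2 * w1 t - z * w1 t))) (at t)"
    unfolding flux_def[abs_def] resid1_def[abs_def]
    by (intro has_vector_derivative_diff has_vector_derivative_mult has_vector_derivative_const d r
        bounded_linear.has_vector_derivative[OF bounded_linear_mult_right])
  then show ?thesis
    by (rule back_subst[of "\<lambda>x. (flux z w1 w2 has_vector_derivative x) (at t)"])
       (simp add: resid1_def resid2_def algebra_simps)
qed

lemma L1null_compose:
  "L1null a b F f \<Longrightarrow> filterlim p F G \<Longrightarrow> L1null a b G (\<lambda>i. f (p i))"
  unfolding L1null_def using filterlim_compose by blast

lemma uniform_Cauchy_of_difference:
  fixes f :: "nat \<Rightarrow> real \<Rightarrow> complex"
  assumes "uniform_limit S (\<lambda>i r. f (fst i) r - f (snd i) r) (\<lambda>_. 0) (sequentially \<times>\<^sub>F sequentially)"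
  shows "uniform_limit S f (\<lambda>r. lim (\<lambda>m. f m r)) sequentially"
proof -
  have "uniformly_Cauchy_on S f"
  proof (rule uniformly_Cauchy_onI)
    fix e :: real assume "e > 0"
    from uniform_limitD[OF assms this]
    obtain M where M: "\<And>m n. m \<ge> M \<Longrightarrow> n \<ge> M \<Longrightarrow> \<forall>r\<in>S. dist (f m r - f n r) 0 < e"
      unfolding eventually_prod_sequentially by auto
    show "\<exists>M. \<forall>x\<in>S. \<forall>m\<ge>M. \<forall>n\<ge>M. dist (f m x) (f n x) < e"
    proof (intro exI[of _ M] ballI allI impI)
      fix x m n assume "x \<in> S" "M \<le> m" "M \<le> n"
      from M[OF this(2,3)] this(1) have "dist (f m x - f n x) 0 < e" by blast
      then show "dist (f m x) (f n x) < e" by (simp add: dist_norm)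
    qed
  qed
  then show ?thesis
    using Cauchy_uniformly_convergent uniformly_convergent_uniform_limit_iff by blast
qed

text \<open>\<open>y\<close> and \<open>q\<close> are pointwise limits and hence do not depend on
  the interval [a, b] on which convergence is shown. On it w1' is Cauchy in L^1, therefore so are
  the flux and its derivative; \<open>L1null_sup\<close> makes w1 and the flux uniformly Cauchy. The
  limit of w1' is then recovered from that of the flux after division by 1 - r^2.\<close>

lemma radial_limit_ode:
  fixes T :: "'n::finite itself"
  assumes d: "d \<ge> 5" and w: "\<And>m. w1 m \<in> smooth_even01" "\<And>m. w2 m \<in> smooth_even01"
    and sq: "square_integrable (unit_ball T) (radial_lift T u1)" "square_integrable (unit_ball T) (radial_lift T u2)"
    and lim: "(\<lambda>m. L2norm2 T (\<lambda>r. w1 m r - u1 r)) \<longlonglongrightarrow> 0" "(\<lambda>m. L2norm2 T (\<lambda>r. w2 m r - u2 r)) \<longlonglongrightarrow> 0"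
    and res: "(\<lambda>m. L2norm2 T (resid1 z (w1 m) (w2 m))) \<longlonglongrightarrow> 0" "(\<lambda>m. L2norm2 T (resid2 d z (w1 m) (w2 m))) \<longlonglongrightarrow> 0"
  defines "y \<equiv> \<lambda>r. lim (\<lambda>m. w1 m r)" and "q \<equiv> \<lambda>r. lim (\<lambda>m. flux z (w1 m) (w2 m) r)"
  assumes t: "t \<in> {0<..<1}"
  shows "(\<lambda>m. w1 m t) \<longlonglongrightarrow> y t" "(\<lambda>m. flux z (w1 m) (w2 m) t) \<longlonglongrightarrow> q t"
    "(y has_vector_derivative q t / (1 - of_real t * of_real t)) (at t)"
    "(q has_vector_derivative
       - (of_real ((real d + 1) / t) - 2 * (z + 2) * of_real t) * (q t / (1 - of_real t * of_real t))
       + ((z + 2) * (z + 3) - of_real (V d t)) * y t) (at t)"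
proof -
  \<comment> \<open>A compact neighbourhood of t that avoids 0 and 1, so that 1 / r and 1 / (1 -
    r^2) are bounded on it.\<close>
  define a where "a = t / 2"
  define b where "b = (1 + t) / 2"
  have ab: "0 < a" "a < b" "b < 1" "a < t" "t < b" unfolding a_def b_def using t by auto
  have in01: "r \<in> {0<..<1}" if "r \<in> {a..b}" for r using that ab by auto
  define E1 where "E1 m = resid1 z (w1 m) (w2 m)" for m
  define E2 where "E2 m = resid2 d z (w1 m) (w2 m)" for m
  define Q where "Q m = flux z (w1 m) (w2 m)" for m
  define D where "D m = deriv01 (w1 m)" for m
  define c1 where "c1 r = - (of_real ((real d + 1) / r) - 2 * (z + 2) * of_real r)" for r
  define c0 where "c0 r = (z + 2) * (z + 3) - complex_of_real (V d r)" for r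
  define s where "s r = 1 - complex_of_real r * of_real r" for r
  have snz: "s r \<noteq> 0" if "r \<in> {a..b}" for r
  proof -
    have "r * r < 1 * 1" using in01[OF that] by (intro mult_strict_mono) auto
    then have "complex_of_real (1 - r * r) \<noteq> 0" using of_real_eq_0_iff[of "1 - r * r", where 'a = complex] by auto
    then show ?thesis unfolding s_def by simp
  qed
  have rnz: "complex_of_real r \<noteq> 0" if "r \<in> {a..b}" for r using in01[OF that] by simp
  have cs: "continuous_on {a..b} s" unfolding s_def by (intro continuous_intros)
  have csi: "continuous_on {a..b} (\<lambda>r. 1 / s r)" by (intro continuous_intros cs) (use snz in auto)
  have cc0: "continuous_on {a..b} c0" unfolding c0_def by (intro continuous_intros continuous_V[OF d])
  have cc1: "continuous_on {a..b} c1" unfolding c1_def by (intro continuous_intros) (use ab in auto)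
  have b1: "bcont (w1 m)" "bcont (w2 m)" "bcont (E1 m)" "bcont (E2 m)" "bcont (D m)" for m
    unfolding E1_def E2_def D_def by (intro bcont_smooth bcont_resid1 bcont_resid2 w d)+
  have cont: "continuous_on {a..b} (w1 m)" "continuous_on {a..b} (w2 m)" "continuous_on {a..b} (E1 m)"
     "continuous_on {a..b} (E2 m)" "continuous_on {a..b} (D m)" for m
    by (intro bcont_continuous b1 ab)+
  have QD: "Q m r = s r * D m r - of_real r * E1 m r" for m r unfolding Q_def flux_def s_def D_def E1_def ..
  have dw: "(w1 m has_vector_derivative D m r) (at r within {a..b})" if "r \<in> {a..b}" for m r
    unfolding D_def by (rule has_vector_derivative_at_within[OF smooth_even01_deriv(1)[OF w(1) in01[OF that]]])
  have dQ: "(Q m has_vector_derivative c1 r * D m r + c0 r * w1 m r + E2 m r + (2 + z) * E1 m r) (at r within {a..b})"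
    if "r \<in> {a..b}" for m r
    unfolding Q_def c1_def c0_def D_def E1_def E2_def
    by (rule has_vector_derivative_at_within[OF flux_derivative[OF w(1) w(2) in01[OF that]]])
  let ?F = "sequentially \<times>\<^sub>F sequentially :: (nat \<times> nat) filter"
  have fs: "filterlim fst sequentially ?F" "filterlim snd sequentially ?F" by (rule filterlim_fst filterlim_snd)+
  have nE: "L1null a b sequentially E1" "L1null a b sequentially E2"
    using res ab cont b1 unfolding E1_def[symmetric] E2_def[symmetric]
    by (auto intro!: L1null_L2[where T = T] bcont_square_integrable)
  have nEF: "L1null a b ?F (\<lambda>i r. E1 (fst i) r - E1 (snd i) r)" "L1null a b ?F (\<lambda>i r. E2 (fst i) r - E2 (snd i) r)"
    by (intro L1null_diff L1null_compose[OF nE(1)] L1null_compose[OF nE(2)] fs)+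
  have nw: "L1null a b ?F (\<lambda>i r. f (fst i) r - f (snd i) r)"
    if f: "\<And>m. bcont (f m)" and u: "square_integrable (unit_ball T) (radial_lift T u)"
      and l: "(\<lambda>m. L2norm2 T (\<lambda>r. f m r - u r)) \<longlonglongrightarrow> 0" for f :: "nat \<Rightarrow> real \<Rightarrow> complex" and u
  proof (rule L1null_L2[where T = T])
    have sqd: "square_integrable (unit_ball T) (radial_lift T (\<lambda>r. f m r - u r))" for m
      using square_integrable_add[OF bcont_square_integrable[OF f[of m]] square_integrable_cmult[OF u, of "-1"]]
      unfolding radial_lift_def by simp
    show "((\<lambda>i. L2norm2 T (\<lambda>r. f (fst i) r - f (snd i) r)) \<longlongrightarrow> 0) ?F"
    proof (rule tendsto_sandwich[of "\<lambda>_. 0"])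
      show "((\<lambda>i. 2 * L2norm2 T (\<lambda>r. f (fst i) r - u r) + 2 * L2norm2 T (\<lambda>r. f (snd i) r - u r)) \<longlongrightarrow> 0) ?F"
        by (intro tendsto_add_zero tendsto_mult_right_zero filterlim_compose[OF l] fs)
      show "eventually (\<lambda>i. L2norm2 T (\<lambda>r. f (fst i) r - f (snd i) r) \<le>
         2 * L2norm2 T (\<lambda>r. f (fst i) r - u r) + 2 * L2norm2 T (\<lambda>r. f (snd i) r - u r)) ?F"
      proof (rule always_eventually, rule allI)
        fix i :: "nat \<times> nat"
        show "L2norm2 T (\<lambda>r. f (fst i) r - f (snd i) r) \<le>
         2 * L2norm2 T (\<lambda>r. f (fst i) r - u r) + 2 * L2norm2 T (\<lambda>r. f (snd i) r - u r)"
          using L2norm2_triangle[OF sqd sqd, of "fst i" "snd i"] by simp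
      qed
    qed (auto intro!: always_eventually L2norm2_nonneg)
    show "continuous_on {a..b} (\<lambda>r. f (fst i) r - f (snd i) r)" for i :: "nat \<times> nat"
      by (intro continuous_intros bcont_continuous f ab)
    show "square_integrable (unit_ball T) (radial_lift T (\<lambda>r. f (fst i) r - f (snd i) r))" for i :: "nat \<times> nat"
      by (intro bcont_square_integrable bcont_minus f)
  qed (use ab in auto)
  have nw1: "L1null a b ?F (\<lambda>i r. w1 (fst i) r - w1 (snd i) r)"
    by (rule nw) (rule b1 sq lim)+
  have nw2: "L1null a b ?F (\<lambda>i r. w2 (fst i) r - w2 (snd i) r)"
    by (rule nw) (rule b1 sq lim)+
  \<comment> \<open>\<open>resid1\<close> is solved for w1', with a division by r \<ge> a > 0. This
    is the only source of control over the derivative.\<close>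
  have nD: "L1null a b ?F (\<lambda>i r. D (fst i) r - D (snd i) r)"
  proof (rule L1null_cong)
    show "L1null a b ?F (\<lambda>i r. (1 / of_real r) * ((w2 (fst i) r - w2 (snd i) r) - (E1 (fst i) r - E1 (snd i) r) - (2 + z) * (w1 (fst i) r - w1 (snd i) r)))"
      by (intro L1null_mult L1null_diff nw2 nEF nw1 continuous_intros) (use rnz in auto)
    fix i :: "nat \<times> nat" and r assume r: "r \<in> {a..b}"
    show "D (fst i) r - D (snd i) r = (1 / of_real r) * ((w2 (fst i) r - w2 (snd i) r) - (E1 (fst i) r - E1 (snd i) r) - (2 + z) * (w1 (fst i) r - w1 (snd i) r))"
      unfolding E1_def resid1_def D_def using rnz[OF r] by (simp add: field_simps)
  qed
  have nQ: "L1null a b ?F (\<lambda>i r. Q (fst i) r - Q (snd i) r)"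
  proof (rule L1null_cong)
    show "L1null a b ?F (\<lambda>i r. s r * (D (fst i) r - D (snd i) r) - of_real r * (E1 (fst i) r - E1 (snd i) r))"
      by (intro L1null_diff L1null_mult nD nEF cs continuous_intros)
  qed (simp add: QD algebra_simps)
  have U1: "uniform_limit {a..b} (\<lambda>i r. w1 (fst i) r - w1 (snd i) r) (\<lambda>_. 0) ?F"
    by (rule L1null_sup[OF ab(2) nw1 nD]) (intro has_vector_derivative_diff dw)
  have U2: "uniform_limit {a..b} (\<lambda>i r. Q (fst i) r - Q (snd i) r) (\<lambda>_. 0) ?F"
  proof (rule L1null_sup[OF ab(2) nQ])
    show "L1null a b ?F (\<lambda>i r. c1 r * (D (fst i) r - D (snd i) r) + c0 r * (w1 (fst i) r - w1 (snd i) r)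
       + (E2 (fst i) r - E2 (snd i) r) + (2 + z) * (E1 (fst i) r - E1 (snd i) r))"
      by (intro L1null_add L1null_mult nD nw1 nEF cc0 cc1 continuous_intros)
    fix i :: "nat \<times> nat" and r assume r: "r \<in> {a..b}"
    have "((\<lambda>r. Q (fst i) r - Q (snd i) r) has_vector_derivative
       (c1 r * D (fst i) r + c0 r * w1 (fst i) r + E2 (fst i) r + (2 + z) * E1 (fst i) r)
       - (c1 r * D (snd i) r + c0 r * w1 (snd i) r + E2 (snd i) r + (2 + z) * E1 (snd i) r)) (at r within {a..b})"
      by (intro has_vector_derivative_diff dQ r)
    then show "((\<lambda>r. Q (fst i) r - Q (snd i) r) has_vector_derivative c1 r * (D (fst i) r - D (snd i) r) + c0 r * (w1 (fst i) r - w1 (snd i) r)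
       + (E2 (fst i) r - E2 (snd i) r) + (2 + z) * (E1 (fst i) r - E1 (snd i) r)) (at r within {a..b})"
      by (rule back_subst[of "\<lambda>x. ((\<lambda>r. Q (fst i) r - Q (snd i) r) has_vector_derivative x) (at r within {a..b})"]) (simp add: algebra_simps)
  qed
  have ul1: "uniform_limit {a..b} w1 y sequentially" unfolding y_def by (rule uniform_Cauchy_of_difference[OF U1])
  have ul2: "uniform_limit {a..b} Q q sequentially"
    using uniform_Cauchy_of_difference[OF U2] unfolding q_def Q_def .
  have cQ: "continuous_on {a..b} (Q m)" for m unfolding QD[abs_def] by (intro continuous_intros cs cont)
  have cy: "continuous_on {a..b} y" by (rule uniform_limit_theorem[OF _ ul1]) (auto intro!: always_eventually cont)
  have cq: "continuous_on {a..b} q" by (rule uniform_limit_theorem[OF _ ul2]) (auto intro!: always_eventually cQ)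
  have pt1: "(\<lambda>m. w1 m r) \<longlonglongrightarrow> y r" if "r \<in> {a..b}" for r by (rule tendsto_uniform_limitI[OF ul1 that])
  have pt2: "(\<lambda>m. Q m r) \<longlonglongrightarrow> q r" if "r \<in> {a..b}" for r by (rule tendsto_uniform_limitI[OF ul2 that])
  have tab: "t \<in> {a..b}" using ab by simp
  show "(\<lambda>m. w1 m t) \<longlonglongrightarrow> y t" by (rule pt1[OF tab])
  show "(\<lambda>m. flux z (w1 m) (w2 m) t) \<longlonglongrightarrow> q t" using pt2[OF tab] unfolding Q_def .
  have ny: "L1null a b sequentially (\<lambda>m r. w1 m r - y r)" and nq: "L1null a b sequentially (\<lambda>m r. Q m r - q r)"
  proof -
    have "uniform_limit {a..b} (\<lambda>m r. w1 m r - y r) (\<lambda>r. y r - y r) sequentially"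
      by (intro uniform_limit_intros ul1)
    then show "L1null a b sequentially (\<lambda>m r. w1 m r - y r)"
      by (intro L1null_uniform continuous_intros cont cy) (use ab in auto)
    have "uniform_limit {a..b} (\<lambda>m r. Q m r - q r) (\<lambda>r. q r - q r) sequentially"
      by (intro uniform_limit_intros ul2)
    then show "L1null a b sequentially (\<lambda>m r. Q m r - q r)"
      by (intro L1null_uniform continuous_intros cQ cq) (use ab in auto)
  qed
  have nDk: "L1null a b sequentially (\<lambda>m r. D m r - q r / s r)"
  proof (rule L1null_cong)
    show "L1null a b sequentially (\<lambda>m r. (1 / s r) * ((Q m r - q r) + of_real r * E1 m r))"
      by (intro L1null_mult L1null_add nq nE csi continuous_intros)
    show "D m r - q r / s r = (1 / s r) * ((Q m r - q r) + of_real r * E1 m r)" if "r \<in> {a..b}" for m r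
      unfolding QD using snz[OF that] by (simp add: field_simps)
  qed
  have at: "at t within {a..b} = at t" using ab by (intro at_within_interior) auto
  have ck: "continuous_on {a..b} (\<lambda>r. q r / s r)" by (intro continuous_intros cq cs) (use snz in auto)
  have "(y has_vector_derivative q t / s t) (at t within {a..b})"
    by (rule limit_derivative[OF less_imp_le[OF ab(2)] dw ck nDk pt1 tab])
  then show "(y has_vector_derivative q t / (1 - of_real t * of_real t)) (at t)" unfolding at s_def .
  have "(q has_vector_derivative c1 t * (q t / s t) + c0 t * y t) (at t within {a..b})"
  proof (rule limit_derivative[OF less_imp_le[OF ab(2)] dQ _ _ pt2 tab])
    show "continuous_on {a..b} (\<lambda>r. c1 r * (q r / s r) + c0 r * y r)" by (intro continuous_intros cc0 cc1 ck cy)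
    show "L1null a b sequentially (\<lambda>m r. (c1 r * D m r + c0 r * w1 m r + E2 m r + (2 + z) * E1 m r) - (c1 r * (q r / s r) + c0 r * y r))"
    proof (rule L1null_cong)
      show "L1null a b sequentially (\<lambda>m r. c1 r * (D m r - q r / s r) + c0 r * (w1 m r - y r) + E2 m r + (2 + z) * E1 m r)"
        by (intro L1null_add L1null_mult nDk ny nE cc0 cc1 continuous_intros)
    qed (simp add: algebra_simps)
  qed
  then show "(q has_vector_derivative
       - (of_real ((real d + 1) / t) - 2 * (z + 2) * of_real t) * (q t / (1 - of_real t * of_real t))
       + ((z + 2) * (z + 3) - of_real (V d t)) * y t) (at t)"
    unfolding at c1_def c0_def s_def .
qed

section \<open>The radial equation\<close>

text \<open>The square root of 3 is rounded down to 17/10 and d - 2 to d - 4; then 37/30 = (2 +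
  17/10) / 3.\<close>

lemma beta_lower: "d \<ge> 5 \<Longrightarrow> beta d \<ge> 37/30 * (real d - 4)"
proof -
  assume d: "d \<ge> 5"
  then have r: "real d \<ge> 5" by simp
  have "(17/10 * (real d - 4))\<^sup>2 = 289/100 * (real d - 4) * (real d - 4)"
    unfolding power_mult_distrib by (simp add: power2_eq_square)
  also have "\<dots> \<le> 3 * (real d - 2) * (real d - 4)" using r by (intro mult_right_mono) auto
  finally have "sqrt (3 * (real d - 2) * (real d - 4)) \<ge> 17/10 * (real d - 4)" by (rule real_le_rsqrt)
  then show ?thesis unfolding beta_def using r by simp
qed

text \<open>The products 3 (d - 2) alpha and 3 (d - 2) alpha (alpha - 2) are affine in beta with
  coefficients affine in d. So alpha and all square roots disappear, and later verifications of the
  equation are polynomial identities in beta, d and r^2.\<close>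

lemma V_beta:
  assumes d: "d \<ge> 5"
  shows "(r\<^sup>2 + beta d)\<^sup>2 * V d r = (12 * (beta d)\<^sup>2 + 4 * (real d + 2) * beta d) - (12 * beta d + 16 - 4 * real d) * r\<^sup>2"
proof -
  have dr: "real d \<ge> 5" using d by simp
  define R where "R = sqrt (3 * (real d - 2) * (real d - 4))"
  have R2: "R * R = 3 * (real d - 2) * (real d - 4)" unfolding R_def using dr by simp
  have al: "alpha d = 2 + 2 * R / (3 * (real d - 2))"
  proof -
    have "(R / (3 * (real d - 2)))\<^sup>2 = (real d - 4) / (3 * (real d - 2))"
    proof -
      have "3 * p * q / ((3 * p) * (3 * p)) = q / (3 * p)" if "p \<noteq> 0" for p q :: real using that by simp
      from this[of "real d - 2" "real d - 4"] show ?thesis unfolding power2_eq_square times_divide_times_eq R2 using dr by simp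
    qed
    moreover have "R / (3 * (real d - 2)) \<ge> 0" unfolding R_def using dr by simp
    ultimately have "sqrt ((real d - 4) / (3 * (real d - 2))) = R / (3 * (real d - 2))" by (metis real_sqrt_unique)
    then show ?thesis unfolding alpha_def by simp
  qed
  have a1: "3 * (real d - 2) * alpha d = 6 * (real d - 2) + 2 * R" unfolding al using dr by (simp add: field_simps)
  have be: "3 * beta d = 2 * real d - 8 + R" unfolding beta_def R_def by simp
  have a1b: "3 * (real d - 2) * alpha d = 6 * beta d + 2 * (real d + 2)" unfolding a1 using be by simp
  have a2: "3 * (real d - 2) * alpha d * (alpha d - 2) = 12 * beta d + 16 - 4 * real d"
  proof -
    have "3 * (real d - 2) * alpha d * (alpha d - 2) = (6 * (real d - 2) + 2 * R) * (2 * R / (3 * (real d - 2)))"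
      unfolding a1 by (simp add: al)
    also have "\<dots> = 4 * R + 4 * (R * R) / (3 * (real d - 2))" using dr by (simp add: field_simps)
    also have "\<dots> = 4 * R + 4 * (real d - 4)" unfolding R2 using dr by simp
    also have "\<dots> = 12 * beta d + 16 - 4 * real d" using be by simp
    finally show ?thesis .
  qed
  have nz: "r\<^sup>2 + beta d \<noteq> 0" using beta_pos[OF d] add_nonneg_pos[of "r\<^sup>2" "beta d"] by fastforce
  have "(r\<^sup>2 + beta d)\<^sup>2 * V d r = 3 * (real d - 2) * alpha d * (2 * beta d - (alpha d - 2) * r\<^sup>2)"
    unfolding V_def using nz by simp
  also have "\<dots> = (3 * (real d - 2) * alpha d) * (2 * beta d) - (3 * (real d - 2) * alpha d * (alpha d - 2)) * r\<^sup>2"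
    by (simp add: algebra_simps)
  also have "\<dots> = (12 * (beta d)\<^sup>2 + 4 * (real d + 2) * beta d) - (12 * beta d + 16 - 4 * real d) * r\<^sup>2"
    by (subst a2, subst a1b) (simp add: algebra_simps power2_eq_square)
  finally show ?thesis .
qed

lemma ereal_less_radius: "cmod s < 1 \<Longrightarrow> fps_conv_radius G \<ge> 1 \<Longrightarrow> ereal (cmod s) < fps_conv_radius G"
  by (metis ereal_less_eq(3) less_le_trans not_less one_ereal_def)

section \<open>The solution that is regular at the origin\<close>

context perturbed_hypergeometric
begin

definition Y :: "complex \<Rightarrow> complex" where "Y = eval_fps F"
definition Y1 :: "complex \<Rightarrow> complex" where "Y1 = eval_fps (fps_deriv F)"
definition Y2 :: "complex \<Rightarrow> complex" where "Y2 = eval_fps (fps_deriv (fps_deriv F))"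

lemma radius_derivs: "fps_conv_radius (fps_deriv F) \<ge> 1" "fps_conv_radius (fps_deriv (fps_deriv F)) \<ge> 1"
  using fps_conv_radius_deriv[of F] fps_conv_radius_deriv[of "fps_deriv F"] F_radius by auto

lemma Y_derivs:
  assumes "cmod s < 1"
  shows "(Y has_field_derivative Y1 s) (at s)" "(Y1 has_field_derivative Y2 s) (at s)"
  unfolding Y_def Y1_def Y2_def
  using assms F_radius radius_derivs by (intro has_field_derivative_eval_fps ereal_less_radius; simp)+

text \<open>Evaluation of the formal identity \<open>fps_ode\<close>; every series involved
  converges on the open unit disc, which covers s = r^2 for |r| < 1.\<close>

lemma Y_ode:
  assumes s: "cmod s < 1"
  shows "poly P2 s * Y2 s + poly P1 s * Y1 s - poly P0 s * Y s = 0"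
proof -
  have rp: "fps_conv_radius (fps_of_poly p * G) \<ge> 1" if "fps_conv_radius G \<ge> 1" for p and G :: "complex fps"
    using fps_conv_radius_mult[of "fps_of_poly p" G] that by (auto simp: min_def split: if_splits)
  have F1: "fps_conv_radius F \<ge> 1" using F_radius by simp
  note r = radius_derivs F1
  have ra: "fps_conv_radius (fps_of_poly P2 * fps_deriv (fps_deriv F) + fps_of_poly P1 * fps_deriv F) \<ge> 1"
    using fps_conv_radius_add[of "fps_of_poly P2 * fps_deriv (fps_deriv F)" "fps_of_poly P1 * fps_deriv F"] rp[OF r(1)] rp[OF r(2)]
    by (meson min.boundedI order_trans)
  have "0 = eval_fps (fps_of_poly P2 * fps_deriv (fps_deriv F) + fps_of_poly P1 * fps_deriv F - fps_of_poly P0 * F) s"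
    unfolding fps_ode by simp
  also have "\<dots> = poly P2 s * Y2 s + poly P1 s * Y1 s - poly P0 s * Y s"
    using s r ra by (simp add: eval_fps_diff eval_fps_add eval_fps_mult rp ereal_less_radius Y_def Y1_def Y2_def)
  finally show ?thesis by simp
qed

end

lemma of_real_sq_derivative: "((\<lambda>r. of_real (r * r) :: complex) has_vector_derivative 2 * of_real t) (at t)"
  by (auto simp: has_vector_derivative_def scaleR_conv_of_real intro!: derivative_eq_intros)

locale mode =
  fixes d :: nat and z :: complex
  assumes odd_d: "odd d" and d5: "d \<ge> 5" and Re_z: "Re z \<ge> 0" and z1: "z \<noteq> 1"
begin

lemma params:
  "0 < 1 / beta d" "1 / beta d \<le> 3/5" "7/2 \<le> (real d + 2) / 2" "1 / beta d * ((real d + 2) / 2 - 3) \<le> 41/100"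
  "Re (z / 2) \<ge> 0" "z / 2 \<noteq> 1/2"
proof -
  have b: "beta d \<ge> 5/3" by (rule beta_pos[OF d5])
  then show "0 < 1 / beta d" "1 / beta d \<le> 3/5" by (auto simp: field_simps)
  show "7/2 \<le> (real d + 2) / 2" using d5 by simp
  \<comment> \<open>The left side is (d - 4) / 2, and 41/100 * 37/30 = 1517/3000 exceeds
    1/2.\<close>
  have "(real d + 2) / 2 - 3 \<le> 41/100 * beta d" 
  proof -
    have "41/100 * (37/30 * (real d - 4)) \<le> 41/100 * beta d" using beta_lower[OF d5] by (rule mult_left_mono) simp
    moreover have "real d \<ge> 5" using d5 by simp
    ultimately show ?thesis by (simp add: field_simps)
  qed
  then show "1 / beta d * ((real d + 2) / 2 - 3) \<le> 41/100" using b by (simp add: divide_le_eq)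
  show "Re (z / 2) \<ge> 0" "z / 2 \<noteq> 1/2" using Re_z z1 by auto
qed

sublocale perturbed_hypergeometric "1 / beta d" "(real d + 2) / 2" "z / 2"
  using params by unfold_locales

definition D :: "real \<Rightarrow> complex" where "D r = of_real (r * r + beta d)"
definition U :: "real \<Rightarrow> complex" where "U r = Y (of_real (r * r)) / (D r)\<^sup>2"
text \<open>This is (1 - r^2) U', the flux that belongs to U when the residuals vanish.\<close>

definition QU :: "real \<Rightarrow> complex" where
  "QU r = 2 * of_real r * (1 - of_real (r * r)) * (D r * Y1 (of_real (r * r)) - 2 * Y (of_real (r * r))) / (D r) ^ 3"

lemma D_nz: "D r \<noteq> 0"
proof -
  have "r * r + beta d > 0" using beta_pos[OF d5] by (intro add_nonneg_pos) auto
  then show ?thesis unfolding D_def by (metis less_irrefl of_real_eq_0_iff)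
qed

lemma sq_less_1: "r \<in> {-1<..<1} \<Longrightarrow> cmod (of_real (r * r)) < 1" for r :: real
proof -
  assume "r \<in> {-1<..<1}"
  then have "\<bar>r\<bar> * \<bar>r\<bar> < 1 * 1" by (intro mult_strict_mono') auto
  then have "\<bar>r * r\<bar> < 1" by (simp add: abs_mult)
  then show ?thesis by (simp only: norm_of_real)
qed

lemma D_derivative: "(D has_vector_derivative 2 * of_real t) (at t)"
  unfolding D_def[abs_def] by (auto simp: has_vector_derivative_def scaleR_conv_of_real intro!: derivative_eq_intros)

lemma Y_sq_derivative:
  assumes "t \<in> {-1<..<1}"
  shows "((\<lambda>r. Y (of_real (r * r))) has_vector_derivative 2 * of_real t * Y1 (of_real (t * t))) (at t)"
    "((\<lambda>r. Y1 (of_real (r * r))) has_vector_derivative 2 * of_real t * Y2 (of_real (t * t))) (at t)"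
  using field_vector_diff_chain_at[OF of_real_sq_derivative Y_derivs(1)[OF sq_less_1[OF assms]]]
    field_vector_diff_chain_at[OF of_real_sq_derivative Y_derivs(2)[OF sq_less_1[OF assms]]]
  by (simp_all add: o_def)

lemma inverse_power_D_derivative:
  "((\<lambda>r. inverse (D r) ^ n) has_vector_derivative - of_nat n * 2 * of_real t * inverse (D t) ^ (n + 1)) (at t)"
proof -
  have "((\<lambda>x. inverse x ^ n) has_field_derivative - of_nat n * inverse (D t) ^ (n + 1)) (at (D t))"
  proof -
    have "((\<lambda>x. inverse x ^ n) has_field_derivative of_nat n * (- (inverse (D t) ^ Suc (Suc 0)) * inverse (D t) ^ (n - Suc 0))) (at (D t))"
      by (rule DERIV_power[OF DERIV_inverse[OF D_nz]])
    then show ?thesis by (cases n) (simp_all add: algebra_simps)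
  qed
  from field_vector_diff_chain_at[OF D_derivative this] show ?thesis by (simp add: o_def mult_ac)
qed

lemma U_derivative:
  assumes t: "t \<in> {0<..<1}"
  shows "(U has_vector_derivative QU t / (1 - of_real t * of_real t)) (at t)"
proof -
  have t': "t \<in> {-1<..<1}" using t by auto
  have nz: "1 - complex_of_real t * of_real t \<noteq> 0"
  proof
    assume "1 - complex_of_real t * of_real t = 0"
    then have "complex_of_real (t * t) = 1" by simp
    then show False using sq_less_1[OF t'] by (simp only: norm_one less_irrefl)
  qed
  have U': "U = (\<lambda>r. Y (of_real (r * r)) * inverse (D r) ^ 2)" 
    by (rule ext) (simp only: U_def divide_inverse power_inverse)
  have "(U has_vector_derivative
     Y (of_real (t * t)) * (- of_nat 2 * 2 * of_real t * inverse (D t) ^ (2 + 1)) + 2 * of_real t * Y1 (of_real (t * t)) * inverse (D t) ^ 2) (at t)"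
    unfolding U' by (intro has_vector_derivative_mult Y_sq_derivative[OF t'] inverse_power_D_derivative)
  moreover have "Y (of_real (t * t)) * (- of_nat 2 * 2 * of_real t * inverse (D t) ^ (2 + 1)) + 2 * of_real t * Y1 (of_real (t * t)) * inverse (D t) ^ 2
     = QU t / (1 - of_real t * of_real t)"
  proof -
    define i where "i = inverse (D t)"
    have i: "D t * i = 1" unfolding i_def using D_nz[of t] by simp
    have "QU t = (1 - of_real t * of_real t) * (2 * of_real t * (D t * Y1 (of_real (t * t)) - 2 * Y (of_real (t * t))) * i ^ 3)"
      by (simp only: QU_def divide_inverse power_inverse i_def of_real_mult mult_ac)
    then have "QU t / (1 - of_real t * of_real t) = 2 * of_real t * (D t * Y1 (of_real (t * t)) - 2 * Y (of_real (t * t))) * i ^ 3"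
      using nz by simp
    also have "\<dots> = 2 * of_real t * Y1 (of_real (t * t)) * ((D t * i) * i ^ 2) - 4 * of_real t * Y (of_real (t * t)) * i ^ 3"
      by (simp add: algebra_simps power_numeral_reduce)
    finally show ?thesis unfolding i i_def[symmetric] by (simp add: algebra_simps power2_eq_square power3_eq_cube)
  qed
  ultimately show ?thesis by simp
qed

text \<open>Multiplication by 4 beta clears the denominators of the parameters. Here
  \<open>b\<close> is beta itself, whereas the parameter of \<open>perturbed_hypergeometric\<close>
  is its reciprocal.\<close>

lemma Y_ode':
  assumes t: "t \<in> {0<..<1}"
  defines "s \<equiv> complex_of_real (t * t)" and "b \<equiv> complex_of_real (beta d)" and "e \<equiv> (of_nat d :: complex)"
  shows "4 * s * (1 - s) * (s + b) * Y2 s + (4 * ((e + 2) / 2 - (z + 7/2) * s) * (s + b) - 16 * s * (1 - s)) * Y1 s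
     - (z - 1) * ((z - 2) * s + (z + 6) * b) * Y s = 0"
proof -
  have t': "t \<in> {-1<..<1}" using t by auto
  have bnz: "b \<noteq> 0" unfolding b_def using beta_pos[OF d5] by auto
  have P: "4 * b * poly P2 s = 4 * s * (1 - s) * (s + b)"
    "4 * b * poly P1 s = 4 * ((e + 2) / 2 - (z + 7/2) * s) * (s + b) - 16 * s * (1 - s)"
    "4 * b * poly P0 s = (z - 1) * ((z - 2) * s + (z + 6) * b)"
    unfolding P2_def P1_def P0_def using bnz by (simp_all add: b_def[symmetric] e_def[symmetric] field_simps)
  have "4 * b * (poly P2 s * Y2 s + poly P1 s * Y1 s - poly P0 s * Y s) = 0"
    unfolding s_def using Y_ode[OF sq_less_1[OF t']] by simp
  then have "(4 * b * poly P2 s) * Y2 s + (4 * b * poly P1 s) * Y1 s - (4 * b * poly P0 s) * Y s = 0" by (simp add: algebra_simps)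
  then show ?thesis unfolding P .
qed

lemma QU_derivative:
  assumes t: "t \<in> {0<..<1}"
  shows "(QU has_vector_derivative
       - (of_real ((real d + 1) / t) - 2 * (z + 2) * of_real t) * (QU t / (1 - of_real t * of_real t))
       + ((z + 2) * (z + 3) - of_real (V d t)) * U t) (at t)"
proof -
  have t': "t \<in> {-1<..<1}" using t by auto
  define s where "s = complex_of_real (t * t)"
  define b where "b = complex_of_real (beta d)"
  define e where "e = (of_nat d :: complex)"
  define r where "r = complex_of_real t"
  define X where "X = (s + b) * Y1 s - 2 * Y s"
  have s: "s = r * r" unfolding s_def r_def by simp
  have rnz: "r \<noteq> 0" unfolding r_def using t by simp
  have Dt: "D t = s + b" unfolding D_def s_def b_def by simp
  have Dnz: "s + b \<noteq> 0" using D_nz[of t] unfolding Dt .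
  have snz: "1 - s \<noteq> 0"
  proof
    assume "1 - s = 0"
    then have "s = 1" by simp
    then show False using sq_less_1[OF t'] unfolding s_def[symmetric] by simp
  qed
  have rd: "((\<lambda>r. complex_of_real r) has_vector_derivative 1) (at t)"
    by (auto simp: has_vector_derivative_def scaleR_conv_of_real intro!: derivative_eq_intros)
  have QU': "QU = (\<lambda>r. (2 * (of_real r * (1 - of_real (r * r)))) * (D r * Y1 (of_real (r * r)) - 2 * Y (of_real (r * r))) * inverse (D r) ^ 3)"
    by (rule ext) (simp only: QU_def divide_inverse power_inverse mult.assoc)
  have "(QU has_vector_derivative
     ((2 * (r * (1 - s))) * X * (- of_nat 3 * 2 * r * inverse (s + b) ^ (3 + 1))
     + ((2 * (r * (1 - s))) * (((s + b) * (2 * r * Y2 s) + 2 * r * Y1 s) - 2 * (2 * r * Y1 s))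
        + (2 * (r * (0 - 2 * r) + 1 * (1 - s))) * X) * inverse (s + b) ^ 3)) (at t)"
    unfolding QU' X_def Dt[symmetric] unfolding r_def s_def
    by (intro has_vector_derivative_mult has_vector_derivative_diff has_vector_derivative_const Y_sq_derivative[OF t']
      inverse_power_D_derivative D_derivative of_real_sq_derivative rd bounded_linear.has_vector_derivative[OF bounded_linear_mult_right])
  moreover have "(2 * (r * (1 - s))) * X * (- of_nat 3 * 2 * r * inverse (s + b) ^ (3 + 1))
     + ((2 * (r * (1 - s))) * (((s + b) * (2 * r * Y2 s) + 2 * r * Y1 s) - 2 * (2 * r * Y1 s))
        + (2 * (r * (0 - 2 * r) + 1 * (1 - s))) * X) * inverse (s + b) ^ 3
    = - (of_real ((real d + 1) / t) - 2 * (z + 2) * of_real t) * (QU t / (1 - of_real t * of_real t))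
       + ((z + 2) * (z + 3) - of_real (V d t)) * U t" (is "?L = ?R")
  proof -
    define v where "v = complex_of_real (V d t)"
    have VD: "(s + b) * (s + b) * v = (12 * (b * b) + 4 * (e + 2) * b) - (12 * b + 16 - 4 * e) * s"
      using arg_cong[OF V_beta[OF d5, of t], of complex_of_real]
      unfolding v_def s_def b_def e_def by (simp add: power2_eq_square)
    have ode: "4 * s * (1 - s) * (s + b) * Y2 s + (4 * ((e + 2) / 2 - (z + 7/2) * s) * (s + b) - 16 * s * (1 - s)) * Y1 s
       - (z - 1) * ((z - 2) * s + (z + 6) * b) * Y s = 0"
      using Y_ode'[OF t] unfolding s_def b_def e_def .
    have QUt: "QU t / (1 - of_real t * of_real t) = 2 * r * X * inverse (s + b) ^ 3"
    proof -
      have "1 - complex_of_real t * of_real t = 1 - s" unfolding s_def by simp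
      moreover have "QU t = (1 - s) * (2 * r * X * inverse (s + b) ^ 3)"
        unfolding QU_def Dt s_def[symmetric] r_def[symmetric] X_def[symmetric] by (simp only: divide_inverse power_inverse mult_ac)
      ultimately show ?thesis using snz by simp
    qed
    have Ut: "U t = Y s * inverse (s + b) ^ 2" by (simp only: U_def Dt s_def[symmetric] divide_inverse power_inverse)
    \<comment> \<open>All fractions are expressed by powers of i, and (s + b) i = 1 brings both
      sides to the common factor i^4. What remains is polynomial.\<close>
    define i where "i = inverse (s + b)"
    have i: "(s + b) * i = 1" unfolding i_def using Dnz by simp
    have R: "?R = (- 2 * (e + 1) + 4 * (z + 2) * s) * X * i ^ 3 + ((z + 2) * (z + 3) - v) * Y s * i ^ 2"
    proof -
      define E where "E = complex_of_real ((real d + 1) / t)"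
      have E: "E * r = e + 1" unfolding E_def e_def r_def using t by simp
      have "(E - 2 * (z + 2) * r) * (2 * r * X * i ^ 3) = (2 * (E * r) - 4 * (z + 2) * (r * r)) * X * i ^ 3"
        by (simp add: algebra_simps)
      also have "\<dots> = (2 * (e + 1) - 4 * (z + 2) * s) * X * i ^ 3" unfolding E s ..
      finally have "(E - 2 * (z + 2) * r) * (2 * r * X * i ^ 3) = (2 * (e + 1) - 4 * (z + 2) * s) * X * i ^ 3" .
      then show ?thesis unfolding QUt Ut unfolding r_def[symmetric] v_def[symmetric] i_def[symmetric] E_def[symmetric]
        by (simp add: algebra_simps)
    qed
    have L: "?L = - 12 * s * (1 - s) * X * i ^ 4 + (4 * s * (1 - s) * ((s + b) * Y2 s - Y1 s) + 2 * (1 - 3 * s) * X) * i ^ 3"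
    proof -
      have "2 * (r * (1 - s)) * X * (- of_nat 3 * 2 * r * i ^ (3 + 1))
         + (2 * (r * (1 - s)) * (E * (2 * r * y2) + 2 * r * y1 - 2 * (2 * r * y1)) + 2 * (r * (0 - 2 * r) + 1 * (1 - s)) * X) * i ^ 3
         = - 12 * s * (1 - s) * X * i ^ 4 + (4 * s * (1 - s) * (E * y2 - y1) + 2 * (1 - 3 * s) * X) * i ^ 3" for E y1 y2
        unfolding s by (simp add: algebra_simps)
      then show ?thesis unfolding i_def[symmetric] .
    qed
    \<comment> \<open>Left minus right is s + b times the equation \<open>ode\<close> of Y, once
      \<open>VD\<close> has replaced the potential.\<close>
    have key: "- 12 * s * (1 - s) * X + (4 * s * (1 - s) * ((s + b) * Y2 s - Y1 s) + 2 * (1 - 3 * s) * X) * (s + b)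
      = (- 2 * (e + 1) + 4 * (z + 2) * s) * X * (s + b) + ((z + 2) * (z + 3) * ((s + b) * (s + b)) - (s + b) * (s + b) * v) * Y s"
    proof -
      have "- 12 * s * (1 - s) * X + (4 * s * (1 - s) * ((s + b) * Y2 s - Y1 s) + 2 * (1 - 3 * s) * X) * (s + b)
        - ((- 2 * (e + 1) + 4 * (z + 2) * s) * X * (s + b) + ((z + 2) * (z + 3) * ((s + b) * (s + b)) - (s + b) * (s + b) * v) * Y s)
        = (s + b) * (4 * s * (1 - s) * (s + b) * Y2 s + (4 * ((e + 2) / 2 - (z + 7/2) * s) * (s + b) - 16 * s * (1 - s)) * Y1 s
       - (z - 1) * ((z - 2) * s + (z + 6) * b) * Y s)"
        unfolding VD X_def by (simp add: field_simps)
      then show ?thesis unfolding ode by simp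
    qed
    have "?L = (- 12 * s * (1 - s) * X + (4 * s * (1 - s) * ((s + b) * Y2 s - Y1 s) + 2 * (1 - 3 * s) * X) * (s + b)) * i ^ 4"
    proof -
      have "(s + b) * i ^ 4 = ((s + b) * i) * i ^ 3" by (simp add: power_numeral_reduce mult_ac)
      then have i3: "i ^ 3 = (s + b) * i ^ 4" unfolding i by simp
      have "A * i4 + B * (g * i4) = (A + B * g) * i4" for A B g i4 :: complex by (simp add: algebra_simps)
      then show ?thesis unfolding L i3 .
    qed
    also have "\<dots> = ?R"
    proof -
      have i3: "(s + b) * i ^ 4 = i ^ 3"
      proof -
        have "(s + b) * i ^ 4 = ((s + b) * i) * i ^ 3" by (simp add: power_numeral_reduce mult_ac)
        then show ?thesis unfolding i by simp
      qed
      have i2: "(s + b) * (s + b) * i ^ 4 = i ^ 2"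
      proof -
        have "(s + b) * (s + b) * i ^ 4 = ((s + b) * i) * ((s + b) * i) * i ^ 2" by (simp add: power_numeral_reduce mult_ac)
        then show ?thesis unfolding i by simp
      qed
      have "((- 2 * (e + 1) + 4 * (z + 2) * s) * X * (s + b) + ((z + 2) * (z + 3) * ((s + b) * (s + b)) - (s + b) * (s + b) * v) * Y s) * i ^ 4
        = (- 2 * (e + 1) + 4 * (z + 2) * s) * X * ((s + b) * i ^ 4) + ((z + 2) * (z + 3) - v) * Y s * ((s + b) * (s + b) * i ^ 4)"
        by (simp add: algebra_simps)
      then show ?thesis unfolding key R i2 i3 .
    qed
    finally show ?thesis .
  qed
  ultimately show ?thesis by simp
qed

end

section \<open>Uniqueness of the solution that is not too singular at the origin\<close>

lemma eventually_nhds_of_at: "eventually P (at a) \<Longrightarrow> P a \<Longrightarrow> eventually P (nhds a)"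
  unfolding eventually_at_filter by (erule eventually_mono) blast

lemma vector_derivative_zero_constant_01:
  fixes f :: "real \<Rightarrow> complex"
  assumes "\<And>t. t \<in> {a<..<b} \<Longrightarrow> (f has_vector_derivative 0) (at t within {a<..<b})"
  shows "\<exists>c. \<forall>t\<in>{a<..<b}. f t = c"
  using has_vector_derivative_zero_constant[of "{a<..<b}" f] assms by (metis convex_real_interval(8))

text \<open>Gronwall: (|f|^2 + |g|^2) exp (-4 M t) does not increase. The 4 arises from 2 M |f| |g|
  + 2 M (|g|^2 + |f| |g|) \<le> 4 M (|f|^2 + |g|^2).\<close>

lemma linear_system_unique:
  fixes f g :: "real \<Rightarrow> complex"
  assumes ab: "a \<le> b"
    and d: "\<And>t. t \<in> {a..b} \<Longrightarrow> (f has_vector_derivative \<alpha> t * g t) (at t)"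
      "\<And>t. t \<in> {a..b} \<Longrightarrow> (g has_vector_derivative \<beta>1 t * g t + \<beta>0 t * f t) (at t)"
    and M: "\<And>t. t \<in> {a..b} \<Longrightarrow> cmod (\<alpha> t) \<le> M \<and> cmod (\<beta>1 t) \<le> M \<and> cmod (\<beta>0 t) \<le> M"
    and z: "f a = 0" "g a = 0"
  shows "f b = 0" "g b = 0"
proof -
  define e where "e t = (f t \<bullet> f t + g t \<bullet> g t) * exp (- 4 * M * t)" for t
  have "\<exists>y. (e has_real_derivative y) (at t) \<and> y \<le> 0" if t: "a \<le> t" "t \<le> b" for t
  proof -
    have t': "t \<in> {a..b}" using t by simp
    define x where "x = cmod (f t)"
    define y where "y = cmod (g t)"
    define E where "E = f t \<bullet> f t + g t \<bullet> g t"
    define E' where "E' = (f t \<bullet> (\<alpha> t * g t) + (\<alpha> t * g t) \<bullet> f t) + (g t \<bullet> (\<beta>1 t * g t + \<beta>0 t * f t) + (\<beta>1 t * g t + \<beta>0 t * f t) \<bullet> g t)"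
    have "((\<lambda>t. f t \<bullet> f t + g t \<bullet> g t) has_vector_derivative E') (at t)"
      unfolding E'_def
      by (intro has_vector_derivative_add bounded_bilinear.has_vector_derivative[OF bounded_bilinear_inner] d t')
    then have "((\<lambda>t. f t \<bullet> f t + g t \<bullet> g t) has_real_derivative E') (at t)"
      by (simp add: has_real_derivative_iff_has_vector_derivative)
    moreover have "((\<lambda>t. exp (- 4 * M * t)) has_real_derivative exp (- 4 * M * t) * (- 4 * M)) (at t)"
      by (auto intro!: derivative_eq_intros)
    ultimately have de: "(e has_real_derivative E' * exp (- 4 * M * t) + exp (- 4 * M * t) * (- 4 * M) * E) (at t)"
      unfolding e_def[abs_def] E_def by (rule DERIV_mult)
    have Mb: "cmod (\<alpha> t) \<le> M" "cmod (\<beta>1 t) \<le> M" "cmod (\<beta>0 t) \<le> M" using M[OF t'] by auto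
    have M0: "M \<ge> 0" using Mb(1) norm_ge_zero order_trans by blast
    have xy: "x \<ge> 0" "y \<ge> 0" unfolding x_def y_def by auto
    have c1: "f t \<bullet> (\<alpha> t * g t) \<le> M * (x * y)"
    proof -
      have "f t \<bullet> (\<alpha> t * g t) \<le> x * (cmod (\<alpha> t) * y)" unfolding x_def y_def using norm_cauchy_schwarz[of "f t" "\<alpha> t * g t"] by (simp add: norm_mult)
      also have "\<dots> \<le> x * (M * y)" using Mb xy by (intro mult_left_mono mult_right_mono) auto
      finally show ?thesis by (simp add: mult_ac)
    qed
    have c2: "g t \<bullet> (\<beta>1 t * g t + \<beta>0 t * f t) \<le> M * (y * y) + M * (x * y)"
    proof -
      have "cmod (\<beta>1 t * g t + \<beta>0 t * f t) \<le> cmod (\<beta>1 t) * y + cmod (\<beta>0 t) * x"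
        unfolding x_def y_def using norm_triangle_ineq[of "\<beta>1 t * g t" "\<beta>0 t * f t"] by (simp add: norm_mult)
      also have "\<dots> \<le> M * y + M * x" using Mb xy by (intro add_mono mult_right_mono) auto
      finally have "y * cmod (\<beta>1 t * g t + \<beta>0 t * f t) \<le> y * (M * y + M * x)" using xy by (intro mult_left_mono) auto
      then show ?thesis using norm_cauchy_schwarz[of "g t" "\<beta>1 t * g t + \<beta>0 t * f t"] unfolding y_def[symmetric] by (simp add: algebra_simps)
    qed
    have "x * y \<le> (x * x + y * y) / 2" using zero_le_power2[of "x - y"] by (simp add: power2_eq_square algebra_simps)
    then have xyM: "M * (x * y) \<le> M * ((x * x + y * y) / 2)" using M0 by (rule mult_left_mono)
    have yyM: "M * (y * y) \<le> M * (x * x + y * y)" using M0 xy by (intro mult_left_mono) auto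
    have Exy: "E = x * x + y * y" unfolding E_def x_def y_def by (simp add: dot_square_norm power2_eq_square)
    have "E' \<le> 4 * M * E"
      using c1 c2 xyM yyM unfolding E'_def Exy inner_commute[of "\<alpha> t * g t" "f t"] inner_commute[of "\<beta>1 t * g t + \<beta>0 t * f t" "g t"]
      by (simp add: algebra_simps)
    then have "(E' - 4 * M * E) * exp (- 4 * M * t) \<le> 0" by (simp add: mult_nonpos_nonneg)
    then show ?thesis using de by (intro exI[of _ "E' * exp (- 4 * M * t) + exp (- 4 * M * t) * (- 4 * M) * E"]) (simp add: algebra_simps)
  qed
  then have "e b \<le> e a" by (rule DERIV_nonpos_imp_nonincreasing[OF ab])
  then have "e b \<le> 0" unfolding e_def using z by simp
  then have "f b \<bullet> f b + g b \<bullet> g b \<le> 0" unfolding e_def by (simp add: mult_le_0_iff)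
  then have "f b \<bullet> f b = 0 \<and> g b \<bullet> g b = 0" using inner_ge_zero[of "f b"] inner_ge_zero[of "g b"] by linarith
  then show "f b = 0" "g b = 0" by auto
qed

context mode
begin

lemma Y_0: "Y 0 = 1"
  unfolding Y_def by (simp add: eval_fps_at_0)

lemma U_0: "U 0 \<noteq> 0" "isCont U 0"
proof -
  show "U 0 \<noteq> 0" unfolding U_def using Y_0 D_nz[of 0] by simp
  have "isCont (\<lambda>r. Y (of_real (r * r))) 0" "isCont D 0"
    using has_vector_derivative_continuous[OF Y_sq_derivative(1)[of 0]] has_vector_derivative_continuous[OF D_derivative] by auto
  then show "isCont U 0" unfolding U_def[abs_def] using D_nz[of 0] by (intro continuous_intros) auto
qed

text \<open>U 0 is a positive real number. The sign obtained here turns the complex equation for y /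
  U near 0 into a monotonicity statement about a real part.\<close>

lemma Re_inverse_U_sq: "Re (1 / (U 0 * U 0)) > 0"
proof -
  have "U 0 = of_real (1 / (beta d)\<^sup>2)" unfolding U_def D_def by (simp add: Y_0)
  then have "1 / (U 0 * U 0) = of_real ((beta d)\<^sup>2 * (beta d)\<^sup>2)" by simp
  then show ?thesis using beta_pos[OF d5] by simp
qed

text \<open>Reduction of order. If the weighted Wronskian of y and U is not zero, then (y / U)' is
  of size r^(-d-1) and y of size r^(-d) near the origin, which \<open>nb\<close> forbids. If it is
  zero, y / U is constant near 0, and uniqueness for the first-order system extends the identity to
  all of (0,1).\<close>

lemma classification:
  fixes y q :: "real \<Rightarrow> complex"
  assumes y: "\<And>t. t \<in> {0<..<1} \<Longrightarrow> (y has_vector_derivative q t / (1 - of_real t * of_real t)) (at t)"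
    and q: "\<And>t. t \<in> {0<..<1} \<Longrightarrow> (q has_vector_derivative
       - (of_real ((real d + 1) / t) - 2 * (z + 2) * of_real t) * (q t / (1 - of_real t * of_real t))
       + ((z + 2) * (z + 3) - of_real (V d t)) * y t) (at t)"
    and nb: "\<And>c r1. c > 0 \<Longrightarrow> 0 < r1 \<Longrightarrow> r1 < 1 \<Longrightarrow> \<exists>r. 0 < r \<and> r < r1 \<and> cmod (y r) < c / r ^ d"
  shows "\<exists>\<kappa>. \<forall>r\<in>{0<..<1}. y r = \<kappa> * U r \<and> q r = \<kappa> * QU r"
proof -
  define s where "s t = 1 - complex_of_real t * of_real t" for t
  define A where "A t = - (of_real ((real d + 1) / t) - 2 * (z + 2) * complex_of_real t)" for t
  define B where "B t = (z + 2) * (z + 3) - complex_of_real (V d t)" for t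
  \<comment> \<open>The exponent that makes t^(d+1) (1 - t^2)^k an integrating factor for W; it
    comes from (d + 1) / (t (1 - t^2)) = (d + 1) / t + (d + 1) t / (1 - t^2).\<close>
  define k where "k = z + 2 - of_real ((real d + 1) / 2)"
  define \<phi> where "\<phi> t = exp (k * of_real (ln (1 - t * t)))" for t
  define p where "p t = of_real (t ^ (d + 1)) * \<phi> t" for t
  define W where "W t = y t * QU t - U t * q t" for t
  have s_real: "s t = of_real (1 - t * t)" for t unfolding s_def by simp
  have tt: "1 - t * t > 0" if "t \<in> {-1<..<1}" for t :: real
  proof -
    have "\<bar>t\<bar> * \<bar>t\<bar> < 1 * 1" using that by (intro mult_strict_mono') auto
    then show ?thesis by simp
  qed
  have snz: "s t \<noteq> 0" if "t \<in> {0<..<1}" for t using tt[of t] that unfolding s_real of_real_eq_0_iff by auto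
  have pnz: "p t \<noteq> 0" if "t \<in> {0<..<1}" for t unfolding p_def \<phi>_def using that by simp
  have dy: "(y has_vector_derivative q t / s t) (at t)" and dq: "(q has_vector_derivative A t * (q t / s t) + B t * y t) (at t)"
    and dU: "(U has_vector_derivative QU t / s t) (at t)" and dQU: "(QU has_vector_derivative A t * (QU t / s t) + B t * U t) (at t)"
    if "t \<in> {0<..<1}" for t
    using y[OF that] q[OF that] U_derivative[OF that] QU_derivative[OF that] unfolding s_def A_def B_def by (simp_all del: of_real_divide)
  have dp: "(p has_vector_derivative p t * (of_real ((real d + 1) / t) - 2 * k * of_real t / s t)) (at t)" if t: "t \<in> {0<..<1}" for t
  proof -
    have pos: "1 - t * t > 0" using tt[of t] t by simp
    have ln': "((\<lambda>t. ln (1 - t * t)) has_real_derivative - 2 * t / (1 - t * t)) (at t)"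
      using pos by (auto intro!: derivative_eq_intros)
    have "((\<lambda>t. k * complex_of_real (ln (1 - t * t))) has_vector_derivative k * of_real (- 2 * t / (1 - t * t))) (at t)"
      by (intro bounded_linear.has_vector_derivative[OF bounded_linear_mult_right]
            bounded_linear.has_vector_derivative[OF bounded_linear_of_real])
         (use ln' in \<open>simp add: has_real_derivative_iff_has_vector_derivative\<close>)
    from field_vector_diff_chain_at[OF this DERIV_exp]
    have d\<phi>: "(\<phi> has_vector_derivative k * of_real (- 2 * t / (1 - t * t)) * \<phi> t) (at t)"
      unfolding \<phi>_def[abs_def] by (simp add: o_def)
    have "((\<lambda>t. t ^ (d + 1)) has_real_derivative real (d + 1) * t ^ d) (at t)"
      using DERIV_pow[of "d + 1" t] by simp
    then have dt: "((\<lambda>t. complex_of_real (t ^ (d + 1))) has_vector_derivative of_real (real (d + 1) * t ^ d)) (at t)"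
      by (intro bounded_linear.has_vector_derivative[OF bounded_linear_of_real]) (simp add: has_real_derivative_iff_has_vector_derivative)
    have p': "(p has_vector_derivative of_real (t ^ (d + 1)) * (k * of_real (- 2 * t / (1 - t * t)) * \<phi> t) + of_real (real (d + 1) * t ^ d) * \<phi> t) (at t)"
      unfolding p_def[abs_def] by (rule has_vector_derivative_mult[OF dt d\<phi>])
    have e1: "complex_of_real (real (d + 1) * t ^ d) = of_real (t ^ (d + 1)) * of_real ((real d + 1) / t)"
      unfolding of_real_mult[symmetric] using t by simp
    have e2: "complex_of_real (- 2 * t / (1 - t * t)) = - 2 * of_real t / s t" unfolding s_def by simp
    have "X * (k * (- 2 * T / S) * P) + X * E * P = X * P * (E - 2 * k * T / S)" for X T S P E :: complex
      by (simp add: algebra_simps)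
    from this[of "of_real (t ^ (d + 1))" "of_real t" "s t" "\<phi> t" "of_real ((real d + 1) / t)"] p'
    show ?thesis unfolding e1 e2 p_def[of t] by (simp only:)
  qed
  have dW: "(W has_vector_derivative A t / s t * W t) (at t)" if t: "t \<in> {0<..<1}" for t
  proof -
    have "(W has_vector_derivative (y t * (A t * (QU t / s t) + B t * U t) + q t / s t * QU t)
       - (U t * (A t * (q t / s t) + B t * y t) + QU t / s t * q t)) (at t)"
      unfolding W_def[abs_def] by (intro has_vector_derivative_diff has_vector_derivative_mult dy dq dU dQU t)
    then show ?thesis
      by (rule back_subst[of "\<lambda>x. (W has_vector_derivative x) (at t)"]) (simp add: W_def algebra_simps diff_divide_distrib)
  qed
  have "((\<lambda>t. p t * W t) has_vector_derivative 0) (at t within {0<..<1})" if t: "t \<in> {0<..<1}" for t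
  proof -
    have "((\<lambda>t. p t * W t) has_vector_derivative p t * (A t / s t * W t) + p t * (of_real ((real d + 1) / t) - 2 * k * of_real t / s t) * W t) (at t)"
      by (intro has_vector_derivative_mult dW dp t)
    moreover have "A t / s t + (of_real ((real d + 1) / t) - 2 * k * of_real t / s t) = 0"
    proof -
      have "A t + s t * of_real ((real d + 1) / t) - 2 * k * of_real t = 0"
      proof -
        define c where "c = complex_of_real ((real d + 1) / t)"
        have c: "c * of_real t = of_nat d + 1" unfolding c_def using t by simp
        have "A t + s t * c - 2 * k * of_real t = - (c * of_real t) * of_real t + (of_nat d + 1) * of_real t"
          unfolding A_def s_def k_def c_def[symmetric] by (simp add: algebra_simps add_divide_distrib)
        then show ?thesis unfolding c c_def[symmetric] by (simp only: mult_minus_left add.left_inverse)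
      qed
      moreover have "A + S * E - K = 0 \<Longrightarrow> S \<noteq> 0 \<Longrightarrow> A / S + (E - K / S) = 0" for A S E K :: complex
        by (simp add: field_simps)
      ultimately show ?thesis using snz[OF t] by blast
    qed
    then have "p t * (A t / s t * W t) + p t * (of_real ((real d + 1) / t) - 2 * k * of_real t / s t) * W t = 0"
      by (metis (no_types, lifting) distrib_left distrib_right mult.assoc mult_zero_left mult_zero_right)
    ultimately show ?thesis by (simp add: has_vector_derivative_at_within)
  qed
  then obtain \<kappa> where \<kappa>: "\<And>t. t \<in> {0<..<1} \<Longrightarrow> p t * W t = \<kappa>"
    using vector_derivative_zero_constant_01[of 0 1 "\<lambda>t. p t * W t"] by blast
  define G where "G t = 1 / (\<phi> t * s t * (U t * U t))" for t
  have isG: "isCont G 0"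
    unfolding G_def[abs_def] \<phi>_def s_def using U_0 by (intro continuous_intros) auto
  have G0: "G 0 = 1 / (U 0 * U 0)" unfolding G_def \<phi>_def s_def by simp
  define g0 where "g0 = Re (G 0) / 2"
  have g0: "g0 > 0" unfolding g0_def G0 using Re_inverse_U_sq by simp
  have "eventually (\<lambda>t. Re (G t) > g0) (nhds 0)"
  proof -
    have "(\<lambda>t. Re (G t)) \<midarrow>0\<rightarrow> Re (G 0)" using isG unfolding isCont_def by (intro tendsto_intros)
    then have "eventually (\<lambda>t. Re (G t) > g0) (at 0)" using g0 unfolding g0_def by (intro order_tendstoD) auto
    moreover have "Re (G 0) > g0" using g0 unfolding g0_def by simp
    ultimately show ?thesis by (rule eventually_nhds_of_at)
  qed
  moreover have "eventually (\<lambda>t. cmod (U t) > cmod (U 0) / 2) (nhds 0)"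
  proof -
    have "(\<lambda>t. cmod (U t)) \<midarrow>0\<rightarrow> cmod (U 0)" using U_0 unfolding isCont_def by (intro tendsto_intros)
    then have "eventually (\<lambda>t. cmod (U t) > cmod (U 0) / 2) (at 0)" using U_0 by (intro order_tendstoD) auto
    moreover have "cmod (U 0) > cmod (U 0) / 2" using U_0 by simp
    ultimately show ?thesis by (rule eventually_nhds_of_at)
  qed
  ultimately have "eventually (\<lambda>t. Re (G t) > g0 \<and> cmod (U t) > cmod (U 0) / 2) (nhds 0)" by (rule eventually_conj)
  then obtain e where e: "e > 0" "\<And>t. dist t 0 < e \<Longrightarrow> Re (G t) > g0 \<and> cmod (U t) > cmod (U 0) / 2"
    unfolding eventually_nhds_metric by blast
  define r0 where "r0 = min e (1/2)"
  have r0: "r0 > 0" "r0 < 1" unfolding r0_def using e by auto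
  have near: "Re (G t) > g0" "cmod (U t) > cmod (U 0) / 2" "U t \<noteq> 0" if "t \<in> {0<..<r0}" for t
  proof -
    have "dist t 0 < e" using that unfolding r0_def by auto
    from e(2)[OF this] show "Re (G t) > g0" "cmod (U t) > cmod (U 0) / 2" by auto
    then show "U t \<noteq> 0" using norm_ge_zero[of "U 0"] by auto
  qed
  have in01: "t \<in> {0<..<1}" if "t \<in> {0<..<r0}" for t using that r0 by auto
  have dyU: "((\<lambda>t. y t / U t) has_vector_derivative - W t / (s t * (U t * U t))) (at t)" if t: "t \<in> {0<..<r0}" for t
  proof -
    have "((\<lambda>x. inverse x) has_field_derivative - (inverse (U t) ^ Suc (Suc 0))) (at (U t))"
      by (rule DERIV_inverse[OF near(3)[OF t]])
    from field_vector_diff_chain_at[OF dU[OF in01[OF t]] this]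
    have "((\<lambda>t. inverse (U t)) has_vector_derivative QU t / s t * - (inverse (U t) ^ Suc (Suc 0))) (at t)" by (simp add: o_def)
    from has_vector_derivative_mult[OF dy[OF in01[OF t]] this]
    have "((\<lambda>t. y t * inverse (U t)) has_vector_derivative y t * (QU t / s t * - (inverse (U t) ^ Suc (Suc 0))) + q t / s t * inverse (U t)) (at t)" .
    moreover have "y t * (QU t / s t * - (inverse (U t) ^ Suc (Suc 0))) + q t / s t * inverse (U t) = - W t / (s t * (U t * U t))"
      unfolding W_def using near(3)[OF t] snz[OF in01[OF t]] by (simp add: field_simps)
    ultimately show ?thesis by (simp add: divide_inverse)
  qed
  have "\<kappa> = 0"
  proof (rule ccontr)
    assume \<kappa>0: "\<kappa> \<noteq> 0"
    \<comment> \<open>Normalised so that h' = G / t^(d+1), where Re G > g0 > 0 near the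
      origin.\<close>
    define h where "h t = (- 1 / \<kappa>) * (y t / U t)" for t
    have dh: "(h has_vector_derivative G t / of_real (t ^ (d + 1))) (at t)" if t: "t \<in> {0<..<r0}" for t
    proof -
      have "W t = \<kappa> / p t" using \<kappa>[OF in01[OF t]] pnz[OF in01[OF t]] by (simp add: field_simps)
      then have "(- 1 / \<kappa>) * (- W t / (s t * (U t * U t))) = G t / of_real (t ^ (d + 1))"
        unfolding G_def p_def using \<kappa>0 by (simp add: mult_ac)
      moreover have "(h has_vector_derivative (- 1 / \<kappa>) * (- W t / (s t * (U t * U t)))) (at t)"
        unfolding h_def[abs_def] by (intro bounded_linear.has_vector_derivative[OF bounded_linear_mult_right] dyU t)
      ultimately show ?thesis by simp
    qed
    \<comment> \<open>The added term has derivative -g0 / t^(d+1), so H is nondecreasing and hence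
      bounded above near 0. This forces -Re h to be at least of order t^(-d).\<close>
    define H where "H t = Re (h t) + g0 / real d * inverse t ^ d" for t
    have dH: "\<exists>v. (H has_real_derivative v) (at t) \<and> v \<ge> 0" if t: "t \<in> {0<..<r0}" for t
    proof -
      have "((\<lambda>t. Re (h t)) has_vector_derivative Re (G t / of_real (t ^ (d + 1)))) (at t)"
        by (rule bounded_linear.has_vector_derivative[OF bounded_linear_Re dh[OF t]])
      then have 1: "((\<lambda>t. Re (h t)) has_real_derivative Re (G t) / t ^ (d + 1)) (at t)"
        by (simp add: has_real_derivative_iff_has_vector_derivative Re_divide_of_real flip: of_real_power of_real_mult)
      have "((\<lambda>t. inverse t ^ d) has_real_derivative real d * (- (inverse t ^ Suc (Suc 0)) * inverse t ^ (d - Suc 0))) (at t)"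
        by (rule DERIV_power[OF DERIV_inverse]) (use t in auto)
      moreover have "- (inverse t ^ Suc (Suc 0)) * inverse t ^ (d - Suc 0) = - 1 / t ^ (d + 1)"
      proof -
        obtain e where e: "d = Suc e" using d5 by (cases d) auto
        have "t \<noteq> 0" using t by simp
        then show ?thesis unfolding e by (simp add: power_inverse field_simps)
      qed
      ultimately have "((\<lambda>t. inverse t ^ d) has_real_derivative real d * (- 1 / t ^ (d + 1))) (at t)" by simp
      from DERIV_add[OF 1 DERIV_cmult[OF this, of "g0 / real d"]]
      have "(H has_real_derivative Re (G t) / t ^ (d + 1) + g0 / real d * (real d * (- 1 / t ^ (d + 1)))) (at t)"
        unfolding H_def[abs_def] .
      moreover have "Re (G t) / t ^ (d + 1) + g0 / real d * (real d * (- 1 / t ^ (d + 1))) = (Re (G t) - g0) / t ^ (d + 1)"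
        using d5 by (simp add: diff_divide_distrib)
      moreover have "(Re (G t) - g0) / t ^ (d + 1) \<ge> 0" using near(1)[OF t] t by simp
      ultimately show ?thesis by metis
    qed
    define r2 where "r2 = r0 / 2"
    define C where "C = \<bar>H r2\<bar> + 1"
    have r2: "r2 > 0" "r2 < r0" "r2 < 1" unfolding r2_def using r0 by auto
    have Hle: "H r \<le> C" if r: "0 < r" "r \<le> r2" for r
    proof -
      have "H r \<le> H r2"
        by (rule DERIV_nonneg_imp_nondecreasing[OF r(2)]) (use dH r r2 in auto)
      then show ?thesis unfolding C_def by linarith
    qed
    \<comment> \<open>Below r1 the constant C is at most half of g0 / (d r^d), so half of the
      singular term survives.\<close>
    define r1 where "r1 = min r2 (g0 / (2 * C * real d))"
    have C: "C > 0" unfolding C_def by simp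
    have d0: "real d > 0" using d5 by simp
    have r1: "0 < r1" "r1 < 1" unfolding r1_def using r2 g0 C d0 by auto
    define c where "c = g0 / (2 * real d) * cmod \<kappa> * (cmod (U 0) / 2)"
    have c: "c > 0" unfolding c_def using g0 d0 \<kappa>0 U_0 by simp
    have "cmod (y r) \<ge> c / r ^ d" if r: "0 < r" "r < r1" for r
    proof -
      have rr: "r \<le> r2" "r < 1" "r \<in> {0<..<r0}" using r r2 unfolding r1_def by auto
      define i where "i = inverse r ^ d"
      have "inverse r ^ 1 \<le> inverse r ^ d" using r rr d5 by (intro power_increasing) (auto simp: one_le_inverse)
      then have i: "i \<ge> 1 / r" unfolding i_def by (simp add: inverse_eq_divide)
      have "1 / r \<ge> 2 * C * real d / g0"
      proof -
        have "r \<le> g0 / (2 * C * real d)" using r unfolding r1_def by simp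
        then show ?thesis using r g0 C d0 by (simp add: field_simps)
      qed
      then have "2 * C * real d / g0 \<le> i" using i by linarith
      then have "g0 / (2 * real d) * (2 * C * real d / g0) \<le> g0 / (2 * real d) * i" using g0 d0 by (intro mult_left_mono) auto
      then have Ci: "C \<le> g0 / (2 * real d) * i" using g0 d0 by simp
      have "Re (h r) + g0 / real d * i \<le> C" using Hle[OF r(1) rr(1)] unfolding H_def i_def .
      moreover have "g0 / real d * i = 2 * (g0 / (2 * real d) * i)" by simp
      ultimately have "- Re (h r) \<ge> g0 / (2 * real d) * i" using Ci by linarith
      then have hr: "cmod (h r) \<ge> g0 / (2 * real d) * i" using abs_Re_le_cmod[of "h r"] by linarith
      have "y r = - \<kappa> * h r * U r" unfolding h_def using \<kappa>0 near(3)[OF rr(3)] by simp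
      then have "cmod (y r) = cmod (h r) * cmod \<kappa> * cmod (U r)" by (simp add: norm_mult)
      also have "\<dots> \<ge> (g0 / (2 * real d) * i) * cmod \<kappa> * (cmod (U 0) / 2)"
        using hr near(2)[OF rr(3)] g0 d0 r unfolding i_def by (intro mult_mono) auto
      finally have "g0 / (2 * real d) * i * cmod \<kappa> * (cmod (U 0) / 2) \<le> cmod (y r)" .
      moreover have "c / r ^ d = g0 / (2 * real d) * i * cmod \<kappa> * (cmod (U 0) / 2)"
        unfolding c_def i_def by (simp only: power_inverse divide_inverse mult_ac)
      ultimately show ?thesis by (simp only:)
    qed
    moreover obtain r where "0 < r" "r < r1" "cmod (y r) < c / r ^ d" using nb[OF c r1] by blast
    ultimately show False by (meson not_le)
  qed
  then have W0: "W t = 0" if "t \<in> {0<..<1}" for t using \<kappa>[OF that] pnz[OF that] by simp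
  have "((\<lambda>t. y t / U t) has_vector_derivative 0) (at t within {0<..<r0})" if "t \<in> {0<..<r0}" for t
    using dyU[OF that] W0[OF in01[OF that]] by (simp add: has_vector_derivative_at_within)
  then obtain k' where k': "\<And>t. t \<in> {0<..<r0} \<Longrightarrow> y t / U t = k'"
    using vector_derivative_zero_constant_01[of 0 r0 "\<lambda>t. y t / U t"] by blast
  have yk: "y t = k' * U t" if "t \<in> {0<..<r0}" for t using k'[OF that] near(3)[OF that] by (simp add: field_simps)
  have qk: "q t = k' * QU t" if t: "t \<in> {0<..<r0}" for t
  proof -
    have "((\<lambda>t. k' * U t) has_vector_derivative k' * (QU t / s t)) (at t)"
      by (intro bounded_linear.has_vector_derivative[OF bounded_linear_mult_right] dU in01 t)
    moreover have "((\<lambda>t. k' * U t) has_vector_derivative q t / s t) (at t)"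
      by (rule has_vector_derivative_transform_within_open[OF dy[OF in01[OF t]] open_greaterThanLessThan t]) (rule yk)
    ultimately have "k' * (QU t / s t) = q t / s t" by (rule vector_derivative_unique_at)
    then show ?thesis using snz[OF in01[OF t]] by simp
  qed
  have "y r = k' * U r \<and> q r = k' * QU r" if r: "r \<in> {0<..<1}" for r
  proof (cases "r < r0")
    case True
    then show ?thesis using yk qk r by simp
  next
    case False
    \<comment> \<open>A starting point at which the identity is already known. From there the system
      for y and q is continued rather than the quotient y / U, because U may have zeros further
      out.\<close>
    define a where "a = r0 / 2"
    have a: "0 < a" "a \<le> r" "a \<in> {0<..<r0}" unfolding a_def using r0 False by auto
    define f where "f t = y t - k' * U t" for t
    define g where "g t = q t - k' * QU t" for t
    have sub: "t \<in> {0<..<1}" if "t \<in> {a..r}" for t using that a r by auto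
    have "bounded ((\<lambda>t. 1 / s t) ` {a..r})" "bounded ((\<lambda>t. A t / s t) ` {a..r})" "bounded (B ` {a..r})"
    proof -
      have cs: "continuous_on {a..r} s" unfolding s_def by (intro continuous_intros)
      have cA: "continuous_on {a..r} A" unfolding A_def by (intro continuous_intros) (use a in auto)
      have cB: "continuous_on {a..r} B" unfolding B_def by (intro continuous_intros continuous_V[OF d5])
      have nz: "\<forall>t\<in>{a..r}. s t \<noteq> 0" using snz sub by blast
      show "bounded ((\<lambda>t. 1 / s t) ` {a..r})" "bounded ((\<lambda>t. A t / s t) ` {a..r})" "bounded (B ` {a..r})"
        by (intro compact_imp_bounded compact_continuous_image continuous_on_divide continuous_on_const cs cA cB nz compact_Icc)+
    qed
    then obtain M1 M2 M3 where M: "\<forall>v\<in>(\<lambda>t. 1 / s t) ` {a..r}. norm v \<le> M1" "\<forall>v\<in>(\<lambda>t. A t / s t) ` {a..r}. norm v \<le> M2" "\<forall>v\<in>B ` {a..r}. norm v \<le> M3"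
      unfolding bounded_iff by metis
    have df: "(f has_vector_derivative 1 / s t * g t) (at t)" if "t \<in> {a..r}" for t
    proof -
      have "(f has_vector_derivative q t / s t - k' * (QU t / s t)) (at t)"
        unfolding f_def[abs_def]
        by (intro has_vector_derivative_diff bounded_linear.has_vector_derivative[OF bounded_linear_mult_right] dy dU sub that)
      then show ?thesis
        by (rule back_subst[of "\<lambda>x. (f has_vector_derivative x) (at t)"]) (simp add: g_def diff_divide_distrib)
    qed
    have dg: "(g has_vector_derivative A t / s t * g t + B t * f t) (at t)" if "t \<in> {a..r}" for t
    proof -
      have "(g has_vector_derivative (A t * (q t / s t) + B t * y t) - k' * (A t * (QU t / s t) + B t * U t)) (at t)"
        unfolding g_def[abs_def]
        by (intro has_vector_derivative_diff bounded_linear.has_vector_derivative[OF bounded_linear_mult_right] dq dQU sub that)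
      moreover have "A * (q / s) + B * y - k' * (A * (Q / s) + B * u) = A / s * (q - k' * Q) + B * (y - k' * u)" for A q s B y Q u :: complex
        by (simp add: algebra_simps diff_divide_distrib)
      ultimately show ?thesis unfolding g_def f_def by (simp only:)
    qed
    have Mb: "cmod (1 / s t) \<le> max M1 (max M2 M3) \<and> cmod (A t / s t) \<le> max M1 (max M2 M3) \<and> cmod (B t) \<le> max M1 (max M2 M3)"
      if "t \<in> {a..r}" for t
      using bspec[OF M(1) imageI[OF that]] bspec[OF M(2) imageI[OF that]] bspec[OF M(3) imageI[OF that]] by auto
    have "f a = 0" "g a = 0" unfolding f_def g_def using yk[OF a(3)] qk[OF a(3)] by auto
    note linear_system_unique[where f = f and g = g, OF a(2) df dg Mb this]
    then show ?thesis unfolding f_def g_def by simp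
  qed
  then show ?thesis by blast
qed

end

section \<open>Regularity at the light cone\<close>

text \<open>Square integrability belongs to the definition because the integral in
  \<open>L2norm2\<close> is 0 by default when it does not exist.\<close>

definition L2null :: "'n::finite itself \<Rightarrow> (nat \<Rightarrow> real \<Rightarrow> complex) \<Rightarrow> bool" where
  "L2null T h \<longleftrightarrow> (\<forall>m. square_integrable (unit_ball T) (radial_lift T (h m))) \<and> (\<lambda>m. L2norm2 T (h m)) \<longlonglongrightarrow> 0"

lemma AE_radial:
  fixes T :: "'n::finite itself"
  assumes "\<And>r. r \<in> {0<..<1} \<Longrightarrow> P r"
  shows "AE x in lebesgue_on (unit_ball T). P (norm x)"
proof -
  have "AE x in lebesgue. x \<noteq> (0 :: real ^ 'n)"
    by (rule AE_not_in[where N = "{0}", simplified]) (simp add: negligible_iff_null_sets[symmetric])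
  then have "AE x in lebesgue. x \<in> unit_ball T \<longrightarrow> P (norm x)"
    by (rule AE_mp) (use assms in \<open>auto intro!: AE_I2\<close>)
  then show ?thesis by (subst AE_restrict_space_iff) auto
qed

lemma square_integrable_lift_diff:
  assumes "square_integrable \<Omega> (radial_lift T f)" "square_integrable \<Omega> (radial_lift T g)"
  shows "square_integrable \<Omega> (radial_lift T (\<lambda>r. f r - g r))"
  using square_integrable_add[OF assms(1) square_integrable_cmult[OF assms(2), of "-1"]] by (simp add: radial_lift_def[abs_def])

lemma continuous_01_bound:
  fixes c :: "real \<Rightarrow> complex"
  assumes "continuous_on {0..1} c"
  obtains B where "B \<ge> 0" "\<And>r. r \<in> {0..1} \<Longrightarrow> cmod (c r) \<le> B"
proof -
  have "bounded (c ` {0..1})" by (intro compact_imp_bounded compact_continuous_image assms) auto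
  then obtain B where B: "\<forall>v\<in>c ` {0..1}. norm v \<le> B" unfolding bounded_iff by (rule exE)
  show ?thesis
  proof
    show "0 \<le> max 0 B" by simp
    show "cmod (c r) \<le> max 0 B" if "r \<in> {0..1}" for r using bspec[OF B imageI[OF that]] by simp
  qed
qed

lemma square_integrable_lift_mult:
  assumes c: "continuous_on {0..1} c" and f: "square_integrable (unit_ball T) (radial_lift T f)"
  shows "square_integrable (unit_ball T) (radial_lift T (\<lambda>r. c r * f r))"
proof -
  obtain B where B: "B \<ge> 0" "\<And>r. r \<in> {0..1} \<Longrightarrow> cmod (c r) \<le> B" using continuous_01_bound[OF c] by blast
  have "radial_lift T c \<in> borel_measurable (lebesgue_on (unit_ball T))"
    using bcont_square_integrable[OF bcont_01[OF c]] unfolding square_integrable_def by (rule conjunct1)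
  then have "square_integrable (unit_ball T) (\<lambda>x. radial_lift T c x * radial_lift T f x)"
    by (rule square_integrable_mult[OF f, where B = B]) (use B in \<open>auto simp: radial_lift_def\<close>)
  then show ?thesis by (simp add: radial_lift_def[abs_def])
qed

lemma L2null_diff:
  assumes "L2null T f" "L2null T g"
  shows "L2null T (\<lambda>m r. f m r - g m r)"
  unfolding L2null_def
proof (intro conjI allI)
  have sf: "square_integrable (unit_ball T) (radial_lift T (f m))" and sg: "square_integrable (unit_ball T) (radial_lift T (g m))" for m
    using assms unfolding L2null_def by auto
  show "square_integrable (unit_ball T) (radial_lift T (\<lambda>r. f m r - g m r))" for m by (rule square_integrable_lift_diff[OF sf sg])
  have "(\<lambda>m. 2 * L2norm2 T (f m) + 2 * L2norm2 T (g m)) \<longlonglongrightarrow> 2 * 0 + 2 * 0"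
    using assms unfolding L2null_def by (intro tendsto_intros) auto
  then have "(\<lambda>m. 2 * L2norm2 T (f m) + 2 * L2norm2 T (g m)) \<longlonglongrightarrow> 0" by simp
  then show "(\<lambda>m. L2norm2 T (\<lambda>r. f m r - g m r)) \<longlonglongrightarrow> 0"
    by (rule Lim_null_comparison[rotated]) (simp add: abs_of_nonneg[OF L2norm2_nonneg] L2norm2_triangle[OF sf sg])
qed

lemma L2null_mult:
  assumes c: "continuous_on {0..1} c" and f: "L2null T f"
  shows "L2null T (\<lambda>m r. c r * f m r)"
  unfolding L2null_def
proof (intro conjI allI)
  have sf: "square_integrable (unit_ball T) (radial_lift T (f m))" for m
    using f unfolding L2null_def by auto
  show sm: "square_integrable (unit_ball T) (radial_lift T (\<lambda>r. c r * f m r))" for m by (rule square_integrable_lift_mult[OF c sf])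
  obtain B where B: "B \<ge> 0" "\<And>r. r \<in> {0..1} \<Longrightarrow> cmod (c r) \<le> B" using continuous_01_bound[OF c] by blast
  have "L2norm2 T (\<lambda>r. c r * f m r) \<le> B\<^sup>2 * L2norm2 T (f m)" for m
  proof -
    have "L2norm2 T (\<lambda>r. c r * f m r) \<le> (LINT x|lebesgue_on (unit_ball T). B\<^sup>2 * (cmod (radial_lift T (f m) x))\<^sup>2)"
      unfolding L2norm2_def
    proof (rule integral_mono)
      show "integrable (lebesgue_on (unit_ball T)) (\<lambda>x. (cmod (radial_lift T (\<lambda>r. c r * f m r) x))\<^sup>2)"
        using sm[of m] unfolding square_integrable_def by (rule conjunct2)
      show "integrable (lebesgue_on (unit_ball T)) (\<lambda>x. B\<^sup>2 * (cmod (radial_lift T (f m) x))\<^sup>2)"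
        using sf[of m] unfolding square_integrable_def by (intro integrable_mult_right) (rule conjunct2)
      fix x assume "x \<in> space (lebesgue_on (unit_ball T))"
      then have "cmod (c (norm x)) \<le> B" using B(2)[of "norm x"] by simp
      then have "(cmod (c (norm x)) * cmod (f m (norm x)))\<^sup>2 \<le> (B * cmod (f m (norm x)))\<^sup>2" by (intro power_mono mult_right_mono) auto
      then show "(cmod (radial_lift T (\<lambda>r. c r * f m r) x))\<^sup>2 \<le> B\<^sup>2 * (cmod (radial_lift T (f m) x))\<^sup>2"
        unfolding radial_lift_def norm_mult power_mult_distrib .
    qed
    then show ?thesis unfolding L2norm2_def by simp
  qed
  then have le: "cmod (of_real (L2norm2 T (\<lambda>r. c r * f m r))) \<le> B\<^sup>2 * L2norm2 T (f m)" for m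
    by (simp add: abs_of_nonneg[OF L2norm2_nonneg])
  have "(\<lambda>m. L2norm2 T (f m)) \<longlonglongrightarrow> 0" using f unfolding L2null_def by (rule conjunct2)
  then have "(\<lambda>m. B\<^sup>2 * L2norm2 T (f m)) \<longlonglongrightarrow> 0" by (rule tendsto_mult_right_zero)
  then show "(\<lambda>m. L2norm2 T (\<lambda>r. c r * f m r)) \<longlonglongrightarrow> 0"
    by (rule Lim_null_comparison[rotated]) (use le in simp)
qed

lemma L2null_zero:
  assumes "square_integrable (unit_ball T) (radial_lift T h)" "AE x in lebesgue_on (unit_ball T). radial_lift T h x = 0"
  shows "L2null T (\<lambda>m. h)"
proof -
  have "L2norm2 T h = 0" unfolding L2norm2_def
    by (rule integral_eq_zero_AE) (use assms(2) in \<open>auto elim!: eventually_mono\<close>)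
  then show ?thesis unfolding L2null_def using assms by simp
qed

lemma energy_space_square:
  assumes "u \<in> energy_space T d"
  shows "square_integrable (unit_ball T) (radial_lift T (fst u))" "square_integrable (unit_ball T) (radial_lift T (snd u))"
  using assms unfolding energy_space_def radial_sobolev_def by (auto dest: sobolev_square)

text \<open>Each summand of \<open>energy_dist\<close> dominates the L^2 norm of its component; in
  this form the convergence of the approximants enters the limit passage.\<close>

lemma energy_L2null:
  assumes u: "u \<in> energy_space T d" and w: "\<And>m. bcont (fst (w m))" "\<And>m. bcont (snd (w m))"
    and lim: "(\<lambda>m. energy_dist T d (w m) u) \<longlonglongrightarrow> 0"
  shows "L2null T (\<lambda>m r. fst (w m) r - fst u r)" "L2null T (\<lambda>m r. snd (w m) r - snd u r)"
proof -
  have lim2: "(\<lambda>m. (energy_dist T d (w m) u)\<^sup>2) \<longlonglongrightarrow> 0" using tendsto_power[OF lim, of 2] by simp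
  have *: "L2null T h" if sq: "\<And>m. square_integrable (unit_ball T) (radial_lift T (h m))"
    and le: "\<And>m. (radial_sobolev_norm T k (h m))\<^sup>2 \<le> (energy_dist T d (w m) u)\<^sup>2" for h k
  proof -
    have "L2norm2 T (h m) \<le> (energy_dist T d (w m) u)\<^sup>2" for m
      using order_trans[OF sobolev_norm_ge_L2[OF open_ball sq, of m k] le[of m, unfolded radial_sobolev_norm_def]]
      unfolding L2norm2_def .
    then have "(\<lambda>m. L2norm2 T (h m)) \<longlonglongrightarrow> 0"
      by (intro Lim_null_comparison[OF _ lim2]) (simp add: abs_of_nonneg[OF L2norm2_nonneg])
    then show ?thesis unfolding L2null_def using sq by simp
  qed
  have e: "(energy_dist T d (w m) u)\<^sup>2 = (radial_sobolev_norm T ((d + 1) div 2) (\<lambda>\<rho>. fst (w m) \<rho> - fst u \<rho>))\<^sup>2 +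
     (radial_sobolev_norm T ((d - 1) div 2) (\<lambda>\<rho>. snd (w m) \<rho> - snd u \<rho>))\<^sup>2" for m
    unfolding energy_dist_def by simp
  show "L2null T (\<lambda>m r. fst (w m) r - fst u r)"
    by (rule *[where k = "(d + 1) div 2"], intro square_integrable_lift_diff bcont_square_integrable w energy_space_square[OF u], unfold e, simp)
  show "L2null T (\<lambda>m r. snd (w m) r - snd u r)"
    by (rule *[where k = "(d - 1) div 2"], intro square_integrable_lift_diff bcont_square_integrable w energy_space_square[OF u], unfold e, simp)
qed

text \<open>A lower bound on a shell, squared, times the volume of the shell. It is applied near the
  origin, near the light cone, and to see that the eigenfunction for 1 is not zero.\<close>

lemma L2_shell:
  fixes T :: "'n::finite itself"
  assumes sq: "square_integrable (unit_ball T) (radial_lift T u)"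
    and ae: "AE x in lebesgue_on (unit_ball T). radial_lift T u x = radial_lift T y x"
    and ab: "0 \<le> a" "a < b" "b \<le> 1" and K: "K \<ge> 0" "\<And>r. a < r \<Longrightarrow> r < b \<Longrightarrow> cmod (y r) \<ge> K"
  shows "K\<^sup>2 * (ball_vol T * (b ^ CARD('n) - a ^ CARD('n))) \<le> L2norm2 T u"
proof -
  define S where "S = ball (0 :: real ^ 'n) b - cball 0 a"
  have "AE x in lebesgue. x \<in> unit_ball T \<longrightarrow> radial_lift T u x = radial_lift T y x"
    using ae by (subst (asm) AE_restrict_space_iff) auto
  then have le: "AE x in lebesgue. ennreal (K\<^sup>2) * indicator S x \<le> indicator (unit_ball T) x * ennreal ((cmod (u (norm x)))\<^sup>2)"
  proof (eventually_elim)
    case (elim x)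
    show ?case
    proof (cases "x \<in> S")
      case True
      then have x: "x \<in> unit_ball T" "a < norm x" "norm x < b" using ab unfolding S_def by auto
      then have "K\<^sup>2 \<le> (cmod (u (norm x)))\<^sup>2" using elim K unfolding radial_lift_def by (intro power_mono) auto
      then show ?thesis using x True by (simp add: ennreal_leI)
    qed simp
  qed
  have Sb: "S \<in> sets borel" unfolding S_def by simp
  have n: "a ^ CARD('n) \<le> b ^ CARD('n)" using ab by (intro power_mono) auto
  have "emeasure lebesgue S = emeasure lborel S" using Sb by simp
  also have "\<dots> = emeasure lborel (ball (0 :: real ^ 'n) b) - emeasure lborel (cball (0 :: real ^ 'n) a)"
    unfolding S_def using ab by (intro emeasure_Diff) (auto simp: emeasure_cball)
  also have "\<dots> = ennreal (ball_vol T * b ^ CARD('n)) - ennreal (ball_vol T * a ^ CARD('n))"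
    using ab by (simp add: emeasure_ball emeasure_cball)
  also have "\<dots> = ennreal (ball_vol T * (b ^ CARD('n) - a ^ CARD('n)))"
    using ab less_imp_le[OF ball_vol_pos[where 'n = 'n]] by (subst ennreal_minus) (auto simp: right_diff_distrib)
  finally have vol: "emeasure lebesgue S = ennreal (ball_vol T * (b ^ CARD('n) - a ^ CARD('n)))" .
  have "ennreal (K\<^sup>2 * (ball_vol T * (b ^ CARD('n) - a ^ CARD('n)))) = ennreal (K\<^sup>2) * emeasure lebesgue S"
    unfolding vol using n less_imp_le[OF ball_vol_pos[where 'n = 'n]] by (subst ennreal_mult) auto
  also have "\<dots> = (\<integral>\<^sup>+x. ennreal (K\<^sup>2) * indicator S x \<partial>lebesgue)"
    using Sb by (subst nn_integral_cmult_indicator) auto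
  also have "\<dots> \<le> (\<integral>\<^sup>+x. indicator (unit_ball T) x * ennreal ((cmod (u (norm x)))\<^sup>2) \<partial>lebesgue)"
    using le by (rule nn_integral_mono_AE)
  also have "\<dots> = ennreal (L2norm2 T u)" using L2norm2_nn[OF sq] by simp
  finally show ?thesis using L2norm2_nonneg[of T u] by (simp add: ennreal_le_iff)
qed

text \<open>In dimension d + 2 a growth of c / r^d would contribute on the shell e/2 < r < e at
  least a multiple of e^(2-d), which is unbounded as e tends to 0. The form of the conclusion is the
  one that \<open>classification\<close> asks for in \<open>nb\<close>.\<close>

lemma L2_lower_growth:
  fixes T :: "'n::finite itself"
  assumes sq: "square_integrable (unit_ball T) (radial_lift T u)"
    and ae: "AE x in lebesgue_on (unit_ball T). radial_lift T u x = radial_lift T y x"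
    and d: "d \<ge> 3" "CARD('n) = d + 2" and c: "c > 0" and r1: "0 < r1" "r1 < 1"
  shows "\<exists>r. 0 < r \<and> r < r1 \<and> cmod (y r) < c / r ^ d"
proof (rule ccontr)
  assume "\<not> ?thesis"
  then have lo: "cmod (y r) \<ge> c / r ^ d" if "0 < r" "r < r1" for r using that by (meson not_le)
  define N where "N = L2norm2 T u"
  define v where "v = ball_vol T"
  have v: "v > 0" unfolding v_def by (rule ball_vol_pos)
  have N: "N \<ge> 0" unfolding N_def by (rule L2norm2_nonneg)
  have ub: "c\<^sup>2 * v \<le> 2 * N * e" if e: "0 < e" "e < r1" for e
  proof -
    have "(c / e ^ d)\<^sup>2 * (v * (e ^ CARD('n) - (e / 2) ^ CARD('n))) \<le> N"
      unfolding v_def N_def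
    proof (rule L2_shell[OF sq ae])
      fix r assume r: "e / 2 < r" "r < e"
      then have r0: "0 < r" using e by linarith
      have "c / e ^ d \<le> c / r ^ d" using r r0 c e by (intro divide_left_mono power_mono) auto
      also have "\<dots> \<le> cmod (y r)" using lo[OF r0] r e by simp
      finally show "c / e ^ d \<le> cmod (y r)" .
    qed (use e r1 c in auto)
    moreover have "e ^ CARD('n) - (e / 2) ^ CARD('n) \<ge> e ^ (d + 2) / 2"
    proof -
      have "(1 / 2 :: real) ^ (d + 2) \<le> (1/2) ^ 1" by (rule power_decreasing) auto
      then have "e ^ (d + 2) * (1 / 2) ^ (d + 2) \<le> e ^ (d + 2) * (1/2)" using e by (intro mult_left_mono) auto
      then show ?thesis unfolding d(2) by (simp add: power_divide)
    qed
    then have "(c / e ^ d)\<^sup>2 * (v * (e ^ (d + 2) / 2)) \<le> (c / e ^ d)\<^sup>2 * (v * (e ^ CARD('n) - (e / 2) ^ CARD('n)))"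
      using v by (intro mult_left_mono) auto
    ultimately have "(c / e ^ d)\<^sup>2 * (v * (e ^ (d + 2) / 2)) \<le> N" by linarith
    moreover have "(c / e ^ d)\<^sup>2 * (v * (e ^ (d + 2) / 2)) * (2 * e ^ (d - 2)) = c\<^sup>2 * v"
    proof -
      have "d + 2 + (d - 2) = d + d" using d(1) by simp
      then have "e ^ (d + 2) * e ^ (d - 2) = e ^ d * e ^ d" by (simp only: power_add[symmetric])
      moreover have "(c / p)\<^sup>2 * (v * (x / 2)) * (2 * y) = c\<^sup>2 * v * (x * y) / (p * p)" for p x y :: real
        by (simp add: power2_eq_square)
      ultimately show ?thesis using e by simp
    qed
    ultimately have "c\<^sup>2 * v \<le> N * (2 * e ^ (d - 2))" using mult_right_mono[of _ N "2 * e ^ (d - 2)"] e by (metis less_imp_le mult_pos_pos zero_less_numeral zero_less_power)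
    also have "\<dots> \<le> N * (2 * e)"
    proof -
      have "e ^ (d - 2) \<le> e ^ 1" using d e r1 by (intro power_decreasing) auto
      then show ?thesis using N by (intro mult_left_mono) auto
    qed
    finally show ?thesis by simp
  qed
  \<comment> \<open>Small enough to contradict \<open>ub\<close>; N + 1 in place of N keeps the
    quotient meaningful when N = 0.\<close>
  define e where "e = min (r1 / 2) (c\<^sup>2 * v / (4 * (N + 1)))"
  have e: "0 < e" "e < r1" unfolding e_def using r1 c v N by auto
  have "e \<le> c\<^sup>2 * v / (4 * (N + 1))" unfolding e_def by simp
  then have "(N + 1) * e * 4 \<le> c\<^sup>2 * v" using N by (simp add: field_simps)
  moreover have "c\<^sup>2 * v > 0" using c v by simp
  moreover have "4 * (N + 1) * e = 2 * (2 * N * e) + 4 * e" by (simp add: algebra_simps)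
  ultimately show False using ub[OF e] e by (simp add: mult_ac)
qed

text \<open>On the shell 1 - e < r < 1 one has 1 - r^2 \<le> 2 e, and the volume is at least a
  multiple of e; the contribution is of order 1 / e.\<close>

lemma L2_light_cone_blowup:
  fixes T :: "'n::finite itself"
  assumes sq: "square_integrable (unit_ball T) (radial_lift T u)"
    and ae: "AE x in lebesgue_on (unit_ball T). radial_lift T u x = radial_lift T y x"
    and C: "C > 0" and r0: "0 \<le> r0" "r0 < 1" and lo: "\<And>r. r0 < r \<Longrightarrow> r < 1 \<Longrightarrow> cmod (y r) \<ge> C / (1 - r * r)"
  shows False
proof -
  define N where "N = L2norm2 T u"
  define v where "v = ball_vol T"
  have v: "v > 0" unfolding v_def by (rule ball_vol_pos)
  have N: "N \<ge> 0" unfolding N_def by (rule L2norm2_nonneg)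
  have ub: "C\<^sup>2 * v \<le> 4 * N * e" if e: "0 < e" "e < 1 - r0" for e
  proof -
    have "(C / (2 * e))\<^sup>2 * (v * (1 ^ CARD('n) - (1 - e) ^ CARD('n))) \<le> N"
      unfolding v_def N_def
    proof (rule L2_shell[OF sq ae])
      fix r assume r: "1 - e < r" "r < 1"
      have r': "r > 0" using r e r0 by linarith
      have "r * r < 1 * 1" using r r' by (intro mult_strict_mono) auto
      then have pos: "1 - r * r > 0" by simp
      have "1 - r * r \<le> 2 * (1 - r)" using zero_le_power2[of "1 - r"] by (simp add: power2_eq_square algebra_simps)
      also have "\<dots> \<le> 2 * e" using r by simp
      finally have "1 - r * r \<le> 2 * e" .
      then have "C / (2 * e) \<le> C / (1 - r * r)" using C pos e by (intro divide_left_mono) auto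
      also have "\<dots> \<le> cmod (y r)" using lo r e by simp
      finally show "C / (2 * e) \<le> cmod (y r)" .
    qed (use e r0 C in auto)
    moreover have "(1 - e) ^ CARD('n) \<le> (1 - e) ^ 1"
      using e r0 by (intro power_decreasing) (auto simp: Suc_leI)
    then have "(C / (2 * e))\<^sup>2 * (v * e) \<le> (C / (2 * e))\<^sup>2 * (v * (1 ^ CARD('n) - (1 - e) ^ CARD('n)))"
      using v by (intro mult_left_mono) auto
    ultimately have "(C / (2 * e))\<^sup>2 * (v * e) \<le> N" by linarith
    then have "(C / (2 * e))\<^sup>2 * (v * e) * (4 * e) \<le> N * (4 * e)" using e by (intro mult_right_mono) auto
    moreover have "(C / (2 * e))\<^sup>2 * (v * e) * (4 * e) = C\<^sup>2 * v" using e by (simp add: power2_eq_square)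
    ultimately have "C\<^sup>2 * v \<le> N * (4 * e)" by (simp only:)
    then show ?thesis by (simp add: mult_ac)
  qed
  define e where "e = min ((1 - r0) / 2) (C\<^sup>2 * v / (8 * (N + 1)))"
  have "e \<le> (1 - r0) / 2" unfolding e_def by (rule min.cobounded1)
  also have "(1 - r0) / 2 < 1 - r0" using r0(2) by (simp add: field_simps)
  finally have "e < 1 - r0" .
  moreover have "0 < e" using r0 C v N unfolding e_def by auto
  ultimately have e: "0 < e" "e < 1 - r0" by auto
  have "e \<le> C\<^sup>2 * v / (8 * (N + 1))" unfolding e_def by simp
  then have "(N + 1) * e * 8 \<le> C\<^sup>2 * v" using N by (simp add: field_simps)
  moreover have "C\<^sup>2 * v > 0" using C v by simp
  moreover have "8 * (N + 1) * e = 2 * (4 * N * e) + 8 * e" by (simp add: algebra_simps)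
  ultimately show False using ub[OF e] e by (simp add: mult_ac)
qed

section \<open>The Euler field acting on power series in |x|^2\<close>

lemma sum_sq_eq_norm_sq:
  fixes x :: "real ^ 'n::finite"
  shows "(\<Sum>i\<in>UNIV. x $ i * x $ i) = norm x * norm x"
proof -
  have "(\<Sum>i\<in>UNIV. x $ i * x $ i) = x \<bullet> x" by (simp only: inner_vec_def inner_real_def)
  also have "\<dots> = (norm x)\<^sup>2" by (rule power2_norm_eq_inner[symmetric])
  finally show ?thesis unfolding power2_eq_square .
qed

lemma norm_sq_derivative:
  fixes x :: "real ^ 'n::finite"
  shows "((\<lambda>t. complex_of_real (norm (x + t *\<^sub>R axis i 1) * norm (x + t *\<^sub>R axis i 1))) has_vector_derivative 2 * of_real (x $ i)) (at 0)"
proof -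
  have e: "norm (x + t *\<^sub>R axis i 1) * norm (x + t *\<^sub>R axis i 1) = norm x * norm x + 2 * t * x $ i + t * t" for t :: real
  proof -
    have "norm (x + t *\<^sub>R axis i 1) * norm (x + t *\<^sub>R axis i 1) = (x + t *\<^sub>R axis i 1) \<bullet> (x + t *\<^sub>R axis i 1)"
      by (simp add: power2_norm_eq_inner[symmetric] power2_eq_square)
    also have "\<dots> = x \<bullet> x + 2 * (t * (x \<bullet> axis i 1)) + t * t"
      by (simp add: inner_add_left inner_add_right inner_commute inner_axis_axis)
    also have "x \<bullet> axis i 1 = x $ i" by (simp add: inner_axis)
    finally show ?thesis by (simp add: power2_norm_eq_inner[symmetric] power2_eq_square)
  qed
  have "((\<lambda>t. norm x * norm x + 2 * t * x $ i + t * t) has_real_derivative 2 * x $ i) (at 0)"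
    by (auto intro!: derivative_eq_intros)
  then have "((\<lambda>t. complex_of_real (norm x * norm x + 2 * t * x $ i + t * t)) has_vector_derivative of_real (2 * x $ i)) (at 0)"
    by (intro bounded_linear.has_vector_derivative[OF bounded_linear_of_real]) (simp add: has_real_derivative_iff_has_vector_derivative)
  then show ?thesis unfolding e by simp
qed

lemma cmod_norm_sq_less_1: "x \<in> unit_ball T \<Longrightarrow> cmod (of_real (norm x * norm x)) < 1"
  using mult_strict_mono'[of "norm x" 1 "norm x" 1] by (simp only: norm_of_real) simp

lemma continuous_on_eval_fps_norm_sq:
  assumes G: "fps_conv_radius G \<ge> 1"
  shows "continuous_on (unit_ball T) (\<lambda>x. eval_fps G (complex_of_real (norm x * norm x)))"
proof -
  have "continuous_on {s. cmod s < 1} (eval_fps G)"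
    by (intro continuous_at_imp_continuous_on ballI) (blast intro: DERIV_isCont has_field_derivative_eval_fps ereal_less_radius G)
  then show ?thesis
    by (rule continuous_on_compose2) (use cmod_norm_sq_less_1 in \<open>auto intro!: continuous_intros simp del: of_real_mult\<close>)
qed

lemma borel_measurable_eval_fps_norm_sq:
  "fps_conv_radius G \<ge> 1 \<Longrightarrow>
    radial_lift T (\<lambda>r. c * eval_fps G (complex_of_real (r * r))) \<in> borel_measurable (lebesgue_on (unit_ball T))"
  unfolding radial_lift_def[abs_def]
  by (intro continuous_imp_measurable_on_sets_lebesgue continuous_on_mult continuous_on_const continuous_on_eval_fps_norm_sq) auto

text \<open>In terms of \<open>s = |x|\<^sup>2\<close> the Euler field is \<open>2 s d/ds\<close>, which multiplies the \<open>n\<close>-th coefficient of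
  a power series in \<open>s\<close> by \<open>2 n\<close>.\<close>

lemma sobolev_eval_fps_euler:
  fixes T :: "'n::finite itself"
  assumes G: "fps_conv_radius G \<ge> 1"
    and s: "sobolev (Suc k) (unit_ball T) (radial_lift T (\<lambda>r. eval_fps G (of_real (r * r))))"
  shows "sobolev k (unit_ball T) (radial_lift T (\<lambda>r. eval_fps (fps_X * fps_deriv G) (of_real (r * r))))"
proof -
  have G': "fps_conv_radius (fps_deriv G) \<ge> 1" using fps_conv_radius_deriv[of G] G by auto
  have XG': "fps_conv_radius (fps_X * fps_deriv G) \<ge> 1"
    using fps_conv_radius_mult[of fps_X "fps_deriv G"] G' by (auto simp: min_def split: if_splits)
  define D where "D i x = 2 * of_real (x $ i) * eval_fps (fps_deriv G) (complex_of_real (norm x * norm x))" for i and x :: "real ^ 'n"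
  have "sobolev k (unit_ball T) (\<lambda>x. \<Sum>i\<in>UNIV. (x $ i) *\<^sub>R D i x)"
  proof (rule sobolev_euler[OF _ _ s])
    show "continuous_on (unit_ball T) (radial_lift T (\<lambda>r. eval_fps G (of_real (r * r))))"
      unfolding radial_lift_def[abs_def] by (rule continuous_on_eval_fps_norm_sq[OF G])
    show "continuous_on (unit_ball T) (D i)" for i
      unfolding D_def[abs_def] by (intro continuous_on_mult continuous_on_eval_fps_norm_sq[OF G'] continuous_intros)
    fix i and x :: "real ^ 'n" assume x: "x \<in> unit_ball T"
    have "(eval_fps G has_field_derivative eval_fps (fps_deriv G) (of_real (norm (x + 0 *\<^sub>R axis i 1) * norm (x + 0 *\<^sub>R axis i 1))))
       (at (of_real (norm (x + 0 *\<^sub>R axis i 1) * norm (x + 0 *\<^sub>R axis i 1))))"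
      by (intro has_field_derivative_eval_fps ereal_less_radius G) (use cmod_norm_sq_less_1[OF x] in simp)
    from field_vector_diff_chain_at[OF norm_sq_derivative[of x i] this]
    show "((\<lambda>t. radial_lift T (\<lambda>r. eval_fps G (of_real (r * r))) (x + t *\<^sub>R axis i 1)) has_vector_derivative D i x) (at 0)"
      unfolding radial_lift_def D_def by (simp only: o_def scaleR_zero_left add_0_right)
  qed auto
  \<comment> \<open>The factor 1/2 leaves s d/ds, which is \<open>fps_X * fps_deriv G\<close> on the
    level of series.\<close>
  then have "sobolev k (unit_ball T) (\<lambda>x. (1/2) * (\<Sum>i\<in>UNIV. (x $ i) *\<^sub>R D i x))" by (intro sobolev_cmult) auto
  then show ?thesis
  proof (rule sobolev_cong[OF open_ball])
    show "radial_lift T (\<lambda>r. eval_fps (fps_X * fps_deriv G) (of_real (r * r))) \<in> borel_measurable (lebesgue_on (unit_ball T))"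
      using borel_measurable_eval_fps_norm_sq[OF XG', where c = 1] by simp
    have "(1/2) * (\<Sum>i\<in>UNIV. (x $ i) *\<^sub>R D i x) = radial_lift T (\<lambda>r. eval_fps (fps_X * fps_deriv G) (of_real (r * r))) x"
      if x: "x \<in> unit_ball T" for x
    proof -
      define E where "E = eval_fps (fps_deriv G) (complex_of_real (norm x * norm x))"
      have "(\<Sum>i\<in>UNIV. (x $ i) *\<^sub>R D i x) = (\<Sum>i\<in>UNIV. of_real (x $ i * x $ i) * (2 * E))"
        unfolding D_def E_def by (intro sum.cong refl) (simp add: scaleR_conv_of_real mult_ac)
      also have "\<dots> = of_real (\<Sum>i\<in>UNIV. x $ i * x $ i) * (2 * E)" by (simp only: of_real_sum sum_distrib_right)
      finally have sum: "(\<Sum>i\<in>UNIV. (x $ i) *\<^sub>R D i x) = of_real (norm x * norm x) * (2 * E)" unfolding sum_sq_eq_norm_sq .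
      have "eval_fps (fps_X * fps_deriv G) (of_real (norm x * norm x)) = of_real (norm x * norm x) * E"
        unfolding E_def using ereal_less_radius[OF cmod_norm_sq_less_1[OF x] G'] by (subst eval_fps_mult) (simp_all del: of_real_mult)
      then show ?thesis unfolding radial_lift_def sum by (simp only:) (simp del: of_real_mult)
    qed
    then show "AE x in lebesgue_on (unit_ball T). (1/2) * (\<Sum>i\<in>UNIV. (x $ i) *\<^sub>R D i x) = radial_lift T (\<lambda>r. eval_fps (fps_X * fps_deriv G) (of_real (r * r))) x"
      by (intro AE_I2) simp
  qed
qed

lemma sobolev_eval_fps_iterate:
  fixes T :: "'n::finite itself"
  assumes "fps_conv_radius G \<ge> 1" "sobolev k (unit_ball T) (radial_lift T (\<lambda>r. eval_fps G (of_real (r * r))))"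
  shows "square_integrable (unit_ball T) (radial_lift T (\<lambda>r. \<Sum>n. (of_nat n ^ k * fps_nth G n) * of_real (r * r) ^ n))"
  using assms
proof (induction k arbitrary: G)
  case 0
  then show ?case using sobolev_square[OF 0(2)] by (simp add: eval_fps_def)
next
  case (Suc k)
  have "fps_conv_radius (fps_deriv G) \<ge> 1" using fps_conv_radius_deriv[of G] Suc.prems(1) by auto
  then have "fps_conv_radius (fps_X * fps_deriv G) \<ge> 1"
    using fps_conv_radius_mult[of fps_X "fps_deriv G"] by (auto simp: min_def split: if_splits)
  from Suc.IH[OF this sobolev_eval_fps_euler[OF Suc.prems]]
  have "square_integrable (unit_ball T) (radial_lift T (\<lambda>r. \<Sum>n. (of_nat n ^ k * fps_nth (fps_X * fps_deriv G) n) * of_real (r * r) ^ n))" .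
  moreover have "fps_nth (fps_X * fps_deriv G) n = of_nat n * fps_nth G n" for n by (cases n) simp_all
  ultimately show ?case by (simp add: mult_ac)
qed

section \<open>Failure of Sobolev regularity at the light cone\<close>

context mode
begin

text \<open>Since d is odd, m = (d - 1) / 2 is an exact number of derivatives and c = m + 3/2, as
  \<open>a_asymp\<close> requires. The m Euler derivatives contribute the factor n^m there, and the
  resulting series is at least C / (1 - s) in modulus near s = 1.\<close>

lemma Y_not_sobolev:
  "\<not> sobolev ((d - 1) div 2) (unit_ball T) (radial_lift T (\<lambda>r. Y (of_real (r * r))))"
proof
  define m where "m = (d - 1) div 2"
  have dm: "d = 2 * m + 1" unfolding m_def using odd_d by (auto elim!: oddE)
  assume "sobolev ((d - 1) div 2) (unit_ball T) (radial_lift T (\<lambda>r. Y (of_real (r * r))))"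
  then have sq: "square_integrable (unit_ball T) (radial_lift T (\<lambda>r. \<Sum>n. (of_nat n ^ m * a n) * of_real (r * r) ^ n))"
    unfolding m_def[symmetric] Y_def using sobolev_eval_fps_iterate[of F m T] F_radius by simp
  have "(real d + 2) / 2 = real m + 3/2" unfolding dm by simp
  from a_asymp[OF this] obtain L where L: "L \<noteq> 0" "(\<lambda>n. of_nat n ^ m * a n / (pochhammer (z + 1) n / fact n)) \<longlonglongrightarrow> L"
    by auto
  from power_series_singular_at_1[OF Re_z L(2) L(1)] obtain C s0 where C: "C > 0" "s0 < 1"
    and lo: "\<And>s. s0 < s \<Longrightarrow> 0 \<le> s \<Longrightarrow> s < 1 \<Longrightarrow> cmod (\<Sum>n. of_nat n ^ m * a n * of_real s ^ n) \<ge> C / (1 - s)"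
    by blast
  \<comment> \<open>By r^2 \<ge> 2 r - 1 the condition r > (1 + s0) / 2 ensures r^2 > s0.\<close>
  define r0 where "r0 = max 0 ((1 + s0) / 2)"
  show False
  proof (rule L2_light_cone_blowup[OF sq AE_I2[OF refl] C(1)])
    show "0 \<le> r0" "r0 < 1" unfolding r0_def using C by auto
    fix r assume r: "r0 < r" "r < 1"
    then have r': "r > 0" unfolding r0_def by auto
    have "r * r < 1 * 1" using r r' by (intro mult_strict_mono) auto
    moreover have "r * r \<ge> 2 * r - 1" using zero_le_power2[of "1 - r"] by (simp add: power2_eq_square algebra_simps)
    then have "s0 < r * r" using r unfolding r0_def by simp
    ultimately show "C / (1 - r * r) \<le> cmod (\<Sum>n. of_nat n ^ m * a n * of_real (r * r) ^ n)" using lo[of "r * r"] r' by simp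
  qed
qed

text \<open>Multiplication by the polynomial (|x|^2 + beta)^2 / \<kappa> preserves Sobolev
  regularity and would carry that of u over to Y.\<close>

lemma U_not_sobolev:
  fixes T :: "'n::finite itself"
  assumes s: "sobolev ((d - 1) div 2) (unit_ball T) (radial_lift T u)"
    and ae: "AE x in lebesgue_on (unit_ball T). radial_lift T u x = \<kappa> * U (norm x)"
  shows "\<kappa> = 0"
proof (rule ccontr)
  assume \<kappa>: "\<kappa> \<noteq> 0"
  define f where "f x = ((\<Sum>i\<in>UNIV. x $ i * x $ i) + beta d) * ((\<Sum>i\<in>UNIV. x $ i * x $ i) + beta d)" for x :: "real ^ 'n"
  have f: "smooth f" unfolding f_def[abs_def] by (intro smooth_mult smooth_add smooth_sum smooth_const smooth_coord) auto
  have fD: "complex_of_real (f x) = (D (norm x))\<^sup>2" for x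
  proof -
    show ?thesis unfolding f_def D_def sum_sq_eq_norm_sq by (simp only: of_real_mult power2_eq_square)
  qed
  have "sobolev ((d - 1) div 2) (unit_ball T) (\<lambda>x. (1 / \<kappa>) * (f x *\<^sub>R radial_lift T u x))"
    by (intro sobolev_cmult sobolev_smooth_mult f s) auto
  then have "sobolev ((d - 1) div 2) (unit_ball T) (radial_lift T (\<lambda>r. Y (of_real (r * r))))"
  proof (rule sobolev_cong[OF open_ball])
    show "radial_lift T (\<lambda>r. Y (of_real (r * r))) \<in> borel_measurable (lebesgue_on (unit_ball T))"
      unfolding Y_def using borel_measurable_eval_fps_norm_sq[where G = F and c = 1 and T = T] F_radius by simp
    show "AE x in lebesgue_on (unit_ball T). 1 / \<kappa> * (f x *\<^sub>R radial_lift T u x) = radial_lift T (\<lambda>r. Y (of_real (r * r))) x"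
      using ae
    proof eventually_elim
      case (elim x)
      have "1 / \<kappa> * (A * (\<kappa> * (w / A))) = w" if "A \<noteq> 0" for A w :: complex using that \<kappa> by simp
      moreover have "(D (norm x))\<^sup>2 \<noteq> 0" using D_nz by simp
      ultimately show ?case unfolding elim scaleR_conv_of_real fD U_def radial_lift_def[of T "\<lambda>r. Y (of_real (r * r))"] by blast
    qed
  qed
  then show False using Y_not_sobolev by blast
qed

end

section \<open>The point spectrum\<close>

context mode
begin

text \<open>The first component is a multiple of U by \<open>classification\<close>, and Sobolev
  regularity makes the factor 0. For the second component the approximants w2 have no evident
  pointwise limit; instead (1 - r^2) w2 - resid1 is used, which equals r flux + (2 + z) (1 - r^2) w1
  and tends to 0 pointwise.\<close>

lemma no_mode:
  fixes T :: "'n::finite itself"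
  assumes n: "CARD('n) = d + 2" and uf: "(u, f) \<in> L_graph T d"
    and ev: "energy_eq T f (\<lambda>\<rho>. z * fst u \<rho>, \<lambda>\<rho>. z * snd u \<rho>)"
  shows "energy_eq T u (\<lambda>\<rho>. 0, \<lambda>\<rho>. 0)"
proof -
  obtain f0 where f0: "(u, f0) \<in> L0_graph T d"
    and f: "f = (\<lambda>\<rho>. fst f0 \<rho> + fst (L_prime d u) \<rho>, \<lambda>\<rho>. snd f0 \<rho> + snd (L_prime d u) \<rho>)"
    using uf unfolding L_graph_def by blast
  obtain w where u: "u \<in> energy_space T d" "f0 \<in> energy_space T d"
    and w: "\<And>m. w m \<in> smooth_even01 \<times> smooth_even01"
    and lim: "(\<lambda>m. energy_dist T d (w m) u) \<longlonglongrightarrow> 0" "(\<lambda>m. energy_dist T d (L0_tilde d (w m)) f0) \<longlonglongrightarrow> 0"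
    using f0 unfolding L0_graph_def by blast
  define u1 where "u1 = fst u"
  define u2 where "u2 = snd u"
  define g1 where "g1 = fst f0"
  define g2 where "g2 = snd f0"
  define w1 where "w1 m = fst (w m)" for m
  define w2 where "w2 m = snd (w m)" for m
  define v where "v r = complex_of_real (V d r)" for r
  have ww: "w1 m \<in> smooth_even01" "w2 m \<in> smooth_even01" for m
    using w[of m] unfolding w1_def w2_def by (auto simp: mem_Times_iff)
  have sq: "square_integrable (unit_ball T) (radial_lift T u1)" "square_integrable (unit_ball T) (radial_lift T u2)"
    "square_integrable (unit_ball T) (radial_lift T g1)" "square_integrable (unit_ball T) (radial_lift T g2)"
    unfolding u1_def u2_def g1_def g2_def by (rule energy_space_square[OF u(1)] energy_space_square[OF u(2)])+
  have "AE x in lebesgue_on (unit_ball T). g1 (norm x) = z * u1 (norm x) \<and> g2 (norm x) + v (norm x) * u1 (norm x) = z * u2 (norm x)"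
    using ev unfolding energy_eq_def f L_prime_def radial_lift_def u1_def u2_def g1_def g2_def v_def by (simp add: split_beta)
  then have ae: "AE x in lebesgue_on (unit_ball T). g1 (norm x) = z * u1 (norm x)"
    "AE x in lebesgue_on (unit_ball T). g2 (norm x) + v (norm x) * u1 (norm x) = z * u2 (norm x)"
    by (auto elim: eventually_mono)
  have cv: "continuous_on {0..1} v" unfolding v_def[abs_def] by (intro continuous_intros continuous_V d5)
  have cz: "continuous_on {0..1} (\<lambda>r::real. c)" for c :: complex by (intro continuous_intros)
  have n12: "L2null T (\<lambda>m r. w1 m r - u1 r)" "L2null T (\<lambda>m r. w2 m r - u2 r)"
    unfolding w1_def w2_def u1_def u2_def
    by (intro energy_L2null[OF u(1) _ _ lim(1)] bcont_smooth(1) ww[unfolded w1_def w2_def])+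
  have L0: "fst (L0_tilde d (w m)) = (\<lambda>r. w2 m r - of_real r * deriv01 (w1 m) r - 2 * w1 m r)"
    "snd (L0_tilde d (w m)) = (\<lambda>r. deriv01 (deriv01 (w1 m)) r + of_real ((real d + 1) / r) * deriv01 (w1 m) r - of_real r * deriv01 (w2 m) r - 3 * w2 m r)" for m
    unfolding L0_tilde_def w1_def w2_def by (simp_all add: split_beta)
  have bL: "bcont (fst (L0_tilde d (w m)))" "bcont (snd (L0_tilde d (w m)))" for m
  proof -
    show "bcont (fst (L0_tilde d (w m)))"
      unfolding L0 by (intro bcont_minus bcont_mult bcont_smooth bcont_const bcont_of_real continuous_intros ww)
    show "bcont (snd (L0_tilde d (w m)))" using bcont_L0_snd[OF ww(1)[of m] ww(2)[of m]] unfolding w1_def w2_def by simp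
  qed
  have n34: "L2null T (\<lambda>m r. fst (L0_tilde d (w m)) r - g1 r)" "L2null T (\<lambda>m r. snd (L0_tilde d (w m)) r - g2 r)"
    unfolding g1_def g2_def by (intro energy_L2null[OF u(2) bL lim(2)])+
  \<comment> \<open>The eigenvalue equation holds only a.e.; written as a constant null sequence it
    can be combined with the convergence of the approximants.\<close>
  have k1: "L2null T (\<lambda>m r. z * u1 r - g1 r)"
  proof (rule L2null_zero)
    show "square_integrable (unit_ball T) (radial_lift T (\<lambda>r. z * u1 r - g1 r))"
      by (intro square_integrable_lift_diff square_integrable_lift_mult cz sq)
    show "AE x in lebesgue_on (unit_ball T). radial_lift T (\<lambda>r. z * u1 r - g1 r) x = 0"
      using ae(1) by eventually_elim (simp add: radial_lift_def)
  qed
  have k2: "L2null T (\<lambda>m r. (z * u2 r - g2 r) - v r * u1 r)"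
  proof (rule L2null_zero)
    show "square_integrable (unit_ball T) (radial_lift T (\<lambda>r. (z * u2 r - g2 r) - v r * u1 r))"
      by (intro square_integrable_lift_diff square_integrable_lift_mult cz cv sq)
    show "AE x in lebesgue_on (unit_ball T). radial_lift T (\<lambda>r. (z * u2 r - g2 r) - v r * u1 r) x = 0"
      using ae(2) by eventually_elim (simp add: radial_lift_def algebra_simps)
  qed
  have "L2null T (\<lambda>m r. ((fst (L0_tilde d (w m)) r - g1 r) - z * (w1 m r - u1 r)) - (z * u1 r - g1 r))"
    by (intro L2null_diff[OF L2null_diff[OF n34(1) L2null_mult[OF cz n12(1)]] k1])
  moreover have "((fst (L0_tilde d (w m)) r - g1 r) - z * (w1 m r - u1 r)) - (z * u1 r - g1 r) = resid1 z (w1 m) (w2 m) r" for m r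
    unfolding L0 resid1_def by (simp add: algebra_simps)
  ultimately have res1: "L2null T (\<lambda>m. resid1 z (w1 m) (w2 m))" by simp
  have cv': "continuous_on {0..1} (\<lambda>r. - v r)" by (intro continuous_intros cv)
  \<comment> \<open>\<open>resid2\<close> of the approximants, telescoped through u and f0: each
    difference is a null sequence, multiplied by a coefficient continuous on [0,1].\<close>
  have "L2null T (\<lambda>m r. (((snd (L0_tilde d (w m)) r - g2 r) - z * (w2 m r - u2 r)) - ((z * u2 r - g2 r) - v r * u1 r)) - (- v r) * (w1 m r - u1 r))"
    by (intro L2null_diff[OF L2null_diff[OF L2null_diff[OF n34(2) L2null_mult[OF cz n12(2)]] k2] L2null_mult[OF cv' n12(1)]])
  moreover have "(((snd (L0_tilde d (w m)) r - g2 r) - z * (w2 m r - u2 r)) - ((z * u2 r - g2 r) - v r * u1 r)) - (- v r) * (w1 m r - u1 r) = resid2 d z (w1 m) (w2 m) r" for m r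
  proof -
    have "(((L - g) - z * (b - ub)) - ((z * ub - g) - x * ua)) - (- x) * (a - ua) = L + x * a - z * b" for L g b ub x a ua :: complex
      by (simp add: algebra_simps)
    then show ?thesis unfolding L0 resid2_def v_def .
  qed
  ultimately have res2: "L2null T (\<lambda>m. resid2 d z (w1 m) (w2 m))" by (simp only:)
  define y where "y r = lim (\<lambda>m. w1 m r)" for r
  define q where "q r = lim (\<lambda>m. flux z (w1 m) (w2 m) r)" for r
  note L2null_lim = L2null_def[THEN iffD1, THEN conjunct2]
  note ode = radial_limit_ode[OF d5 ww sq(1,2) L2null_lim[OF n12(1)] L2null_lim[OF n12(2)] L2null_lim[OF res1] L2null_lim[OF res2],
      folded y_def q_def]
  have aey: "AE x in lebesgue_on (unit_ball T). radial_lift T u1 x = radial_lift T y x"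
    by (rule AE_eq_of_L2_limit[where h = w1]) (use n12(1) ode(1) in \<open>auto simp: L2null_def\<close>)
  have "d \<ge> 3" using d5 by simp
  from classification[OF ode(3) ode(4) L2_lower_growth[OF sq(1) aey this n]]
  obtain \<kappa> where \<kappa>: "\<And>r. r \<in> {0<..<1} \<Longrightarrow> y r = \<kappa> * U r \<and> q r = \<kappa> * QU r" by blast
  have "AE x in lebesgue_on (unit_ball T). y (norm x) = \<kappa> * U (norm x)" by (rule AE_radial) (use \<kappa> in blast)
  with aey have aeU: "AE x in lebesgue_on (unit_ball T). radial_lift T u1 x = \<kappa> * U (norm x)"
    by eventually_elim (simp add: radial_lift_def)
  have "sobolev ((d + 1) div 2) (unit_ball T) (radial_lift T u1)"
    using u(1) unfolding energy_space_def radial_sobolev_def u1_def by auto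
  then have "sobolev ((d - 1) div 2) (unit_ball T) (radial_lift T u1)" by (rule sobolev_mono) auto
  from U_not_sobolev[OF this aeU] have \<kappa>0: "\<kappa> = 0" .
  have u1: "AE x in lebesgue_on (unit_ball T). radial_lift T u1 x = 0" using aeU \<kappa>0 by simp
  define s where "s r = 1 - complex_of_real r * of_real r" for r
  have cs: "continuous_on {0..1} s" unfolding s_def[abs_def] by (intro continuous_intros)
  define h where "h m r = s r * w2 m r - resid1 z (w1 m) (w2 m) r" for m r
  have h: "h m r = of_real r * flux z (w1 m) (w2 m) r + (2 + z) * s r * w1 m r" for m r
    unfolding h_def flux_def resid1_def s_def by (simp add: algebra_simps)
  have "L2null T (\<lambda>m r. s r * (w2 m r - u2 r) - resid1 z (w1 m) (w2 m) r)"
    by (intro L2null_diff L2null_mult cs n12 res1)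
  moreover have "s r * (w2 m r - u2 r) - resid1 z (w1 m) (w2 m) r = h m r - s r * u2 r" for m r
    unfolding h_def by (simp add: algebra_simps)
  ultimately have nh: "L2null T (\<lambda>m r. h m r - s r * u2 r)" by (simp only:)
  have "AE x in lebesgue_on (unit_ball T). radial_lift T (\<lambda>r. s r * u2 r) x = radial_lift T (\<lambda>r. 0) x"
  proof (rule AE_eq_of_L2_limit[where h = h])
    show "square_integrable (unit_ball T) (radial_lift T (\<lambda>r. h m r - s r * u2 r))" for m
      using nh unfolding L2null_def by blast
    show "(\<lambda>m. L2norm2 T (\<lambda>r. h m r - s r * u2 r)) \<longlonglongrightarrow> 0" by (rule L2null_lim[OF nh])
    fix r :: real assume r: "r \<in> {0<..<1}"
    have "(\<lambda>m. h m r) \<longlonglongrightarrow> of_real r * q r + (2 + z) * s r * y r"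
      unfolding h by (intro tendsto_add tendsto_mult_left ode(1)[OF r] ode(2)[OF r])
    then show "(\<lambda>m. h m r) \<longlonglongrightarrow> 0" using \<kappa>[OF r] \<kappa>0 by simp
  qed
  moreover have "AE x in lebesgue_on (unit_ball T). s (norm x) \<noteq> 0"
  proof (rule AE_radial)
    fix r :: real assume r: "r \<in> {0<..<1}"
    have "r * r < 1 * 1" using r by (intro mult_strict_mono) auto
    then have "complex_of_real (1 - r * r) \<noteq> 0" unfolding of_real_eq_0_iff by simp
    then show "s r \<noteq> 0" unfolding s_def by simp
  qed
  ultimately have "AE x in lebesgue_on (unit_ball T). radial_lift T u2 x = 0"
    by eventually_elim (simp add: radial_lift_def)
  with u1 show ?thesis unfolding energy_eq_def u1_def u2_def
    by eventually_elim (simp add: radial_lift_def)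
qed

end

section \<open>The eigenfunction for the eigenvalue 1\<close>

lemma smooth_reciprocal:
  assumes f: "smooth f" and nz: "\<And>x. f x \<noteq> 0"
  shows "smooth (\<lambda>x. 1 / f x)"
proof (rule smooth_alg_span[of "insert (\<lambda>x. 1 / f x) {g. smooth g}"])
  show "(\<lambda>x. 1 / f x) \<in> alg_span (insert (\<lambda>x. 1 / f x) {g. smooth g})" by (rule alg_span.base) simp
  fix g assume "g \<in> insert (\<lambda>x. 1 / f x) {g. smooth g}"
  then consider "g = (\<lambda>x. 1 / f x)" | "smooth g" by auto
  then show "(\<forall>x. g differentiable (at x)) \<and> (\<forall>i. partial_deriv i g \<in> alg_span (insert (\<lambda>x. 1 / f x) {g. smooth g}))"
  proof cases
    case 2
    then have "partial_deriv i g \<in> alg_span (insert (\<lambda>x. 1 / f x) {g. smooth g})" for i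
      by (intro alg_span.base) (simp add: smooth_partial_deriv)
    then show ?thesis using smooth_differentiable[OF 2] by blast
  next
    case 1
    have d: "(g has_derivative (\<lambda>h. - (frechet_derivative f (at x) h * (1 / f x * (1 / f x))))) (at x)" for x
    proof -
      have "(f has_derivative frechet_derivative f (at x)) (at x)"
        using smooth_differentiable[OF f] by (simp add: frechet_derivative_works)
      from Deriv.has_derivative_inverse[OF nz this] show ?thesis unfolding 1 by (simp add: divide_inverse mult_ac)
    qed
    \<comment> \<open>The derivative of 1 / f is a product of generators of the algebra, so the span
      argument closes.\<close>
    have "partial_deriv i g x = (- 1) * (partial_deriv i f x * (1 / f x * (1 / f x)))" for i x
      unfolding partial_deriv_eq[OF d] by (simp add: partial_deriv_def)
    then have p: "partial_deriv i g = (\<lambda>x. (- 1) * (partial_deriv i f x * (1 / f x * (1 / f x))))" for i by (rule ext)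
    have "partial_deriv i g \<in> alg_span (insert (\<lambda>x. 1 / f x) {g. smooth g})" for i
      unfolding p
      by (rule alg_span.mult alg_span.base insertI1 insertI2 CollectI smooth_const smooth_partial_deriv f)+
    then show ?thesis using d unfolding differentiable_def by blast
  qed
qed

text \<open>Derivatives on the whole line restrict to the one-sided derivatives on [0,1]. The odd
  ones vanish at 0 because differentiating h (-t) = h t alternates the parity.\<close>

lemma real_derivatives_even01:
  fixes h :: "nat \<Rightarrow> real \<Rightarrow> real"
  assumes h: "\<And>k t. (h k has_real_derivative h (Suc k) t) (at t)" and even: "\<And>t. h 0 (- t) = h 0 t"
  shows "(\<lambda>t. complex_of_real (h 0 t)) \<in> smooth_even01"
    and "t \<in> {0..1} \<Longrightarrow> (deriv01 ^^ k) (\<lambda>t. complex_of_real (h 0 t)) t = of_real (h k t)"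
proof -
  define u where "u t = complex_of_real (h 0 t)" for t
  have hv: "((\<lambda>t. complex_of_real (h k t)) has_vector_derivative of_real (h (Suc k) t)) (at t within {0..1})" for k t
    by (rule has_vector_derivative_at_within[OF bounded_linear.has_vector_derivative[OF bounded_linear_of_real
          h[of k t, unfolded has_real_derivative_iff_has_vector_derivative]]])
  have both: "(\<forall>t\<in>{0..1}. (deriv01 ^^ k) u t = of_real (h k t)) \<and>
     (\<forall>t\<in>{0..1}. ((deriv01 ^^ k) u has_vector_derivative of_real (h (Suc k) t)) (at t within {0..1}))" for k
  proof (induction k)
    case 0
    show ?case using hv[of 0] by (simp add: u_def[abs_def])
  next
    case (Suc k)
    have e: "(deriv01 ^^ Suc k) u t = of_real (h (Suc k) t)" if "t \<in> {0..1}" for t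
    proof -
      have "((deriv01 ^^ k) u has_vector_derivative of_real (h (Suc k) t)) (at t within {0..1})" using Suc.IH that by blast
      from vector_derivative_within_closed_interval[OF zero_less_one that this] show ?thesis by (simp add: deriv01_def)
    qed
    moreover have "((deriv01 ^^ Suc k) u has_vector_derivative of_real (h (Suc (Suc k)) t)) (at t within {0..1})" if "t \<in> {0..1}" for t
      by (rule has_vector_derivative_transform[OF that e hv])
    ultimately show ?case by blast
  qed
  have par: "h k (- t) = (- 1) ^ k * h k t" for k t
  proof (induction k arbitrary: t)
    case 0
    show ?case using even by simp
  next
    case (Suc k)
    have "((\<lambda>t. h k (- t)) has_real_derivative h (Suc k) (- t) * (- 1)) (at t)"
      by (rule DERIV_chain2[OF h]) (auto intro!: derivative_eq_intros)
    then have 1: "((\<lambda>t. (- 1) ^ k * h k t) has_real_derivative h (Suc k) (- t) * (- 1)) (at t)" unfolding Suc.IH .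
    have "((\<lambda>t. (- 1) ^ k * h k t) has_real_derivative (- 1) ^ k * h (Suc k) t) (at t)" by (rule DERIV_cmult[OF h])
    from DERIV_unique[OF 1 this] have "h (Suc k) (- t) = - ((- 1) ^ k * h (Suc k) t)" by simp
    then show ?case by simp
  qed
  have odd0: "h (2 * k + 1) 0 = 0" for k using par[of "2 * k + 1" 0] by simp
  show "(\<lambda>t. complex_of_real (h 0 t)) \<in> smooth_even01"
    unfolding smooth_even01_def u_def[symmetric]
  proof (intro CollectI conjI allI ballI)
    show "(deriv01 ^^ k) u differentiable at t within {0..1}" if "t \<in> {0..1}" for k t
      using both[of k] that by (blast intro: differentiableI_vector)
    show "(deriv01 ^^ (2 * k + 1)) u 0 = 0" for k
      using both[of "2 * k + 1"] odd0[of k] by simp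
  qed
  show "(deriv01 ^^ k) (\<lambda>t. complex_of_real (h 0 t)) t = of_real (h k t)" if "t \<in> {0..1}"
    unfolding u_def[symmetric] using both[of k] that by blast
qed

definition bell :: "real \<Rightarrow> real \<Rightarrow> real" where "bell b t = 1 / (t * t + b)"

context
  fixes b :: real assumes b: "b > 0"
begin

lemma bell_denominator: "t * t + b > 0" for t :: real
  using b zero_le_square[of t] by linarith

lemma bell_derivative: "(bell b has_real_derivative - 2 * t * (bell b t * bell b t)) (at t)"
proof -
  have "((\<lambda>t. t * t + b) has_real_derivative 2 * t) (at t)" by (auto intro!: derivative_eq_intros)
  then have "((\<lambda>t. inverse (t * t + b)) has_real_derivative - (inverse (t * t + b) * (2 * t) * inverse (t * t + b))) (at t)"
    by (rule DERIV_inverse') (use bell_denominator[of t] in simp)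
  then show ?thesis unfolding bell_def[abs_def] by (simp add: inverse_eq_divide mult_ac)
qed

text \<open>Over the common denominator (t^2 + b)^(n+1) the quotient rule yields a polynomial
  numerator, so every iterated derivative has the same shape.\<close>

lemma rational_derivative:
  "\<exists>q. \<forall>t. ((\<lambda>t. poly p t * bell b t ^ n) has_real_derivative poly q t * bell b t ^ Suc n) (at t)"
proof (intro exI allI)
  fix t
  have e: "bell b t ^ n = (t * t + b) * bell b t ^ Suc n" using bell_denominator[of t] by (simp add: bell_def)
  have "((\<lambda>t. bell b t ^ n) has_real_derivative of_nat n * (- 2 * t * (bell b t * bell b t) * bell b t ^ (n - Suc 0))) (at t)"
    by (rule DERIV_power[OF bell_derivative])
  moreover have "of_nat n * (- 2 * t * (bell b t * bell b t) * bell b t ^ (n - Suc 0)) = - 2 * real n * t * bell b t ^ Suc n"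
    by (cases n) (simp_all add: algebra_simps)
  ultimately have "((\<lambda>t. bell b t ^ n) has_real_derivative - 2 * real n * t * bell b t ^ Suc n) (at t)" by (simp only:)
  from DERIV_mult[OF poly_DERIV[of p] this]
  have "((\<lambda>t. poly p t * bell b t ^ n) has_real_derivative poly (pderiv p) t * bell b t ^ n + - 2 * real n * t * bell b t ^ Suc n * poly p t) (at t)" .
  moreover have "poly (pderiv p) t * ((t * t + b) * x) + - 2 * real n * t * x * poly p t = poly (pderiv p * [:b, 0, 1:] - [:0, 2 * real n:] * p) t * x" for x
    by (simp add: algebra_simps)
  ultimately show "((\<lambda>t. poly p t * bell b t ^ n) has_real_derivative poly (pderiv p * [:b, 0, 1:] - [:0, 2 * real n:] * p) t * bell b t ^ Suc n) (at t)"
    unfolding e by simp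
qed

lemma rational_even01:
  fixes p :: "real poly" and n :: nat
  assumes even: "\<And>t. poly p (- t) = poly p t"
  defines "g \<equiv> \<lambda>t. poly p t * bell b t ^ n"
  shows "(\<lambda>t. complex_of_real (g t)) \<in> smooth_even01"
    and "t \<in> {0..1} \<Longrightarrow> (deriv01 ^^ k) (\<lambda>t. complex_of_real (g t)) t = of_real ((deriv ^^ k) g t)"
proof -
  have *: "\<exists>q m. (deriv ^^ k) g = (\<lambda>t. poly q t * bell b t ^ m)" for k
  proof (induction k)
    case 0
    show ?case unfolding g_def by auto
  next
    case (Suc k)
    then obtain q m where e: "(deriv ^^ k) g = (\<lambda>t. poly q t * bell b t ^ m)" by blast
    obtain q' where "\<And>t. ((\<lambda>t. poly q t * bell b t ^ m) has_real_derivative poly q' t * bell b t ^ Suc m) (at t)"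
      using rational_derivative by blast
    then have "deriv (\<lambda>t. poly q t * bell b t ^ m) = (\<lambda>t. poly q' t * bell b t ^ Suc m)" by (intro ext DERIV_imp_deriv)
    then have "(deriv ^^ Suc k) g = (\<lambda>t. poly q' t * bell b t ^ Suc m)" by (simp add: e)
    then show ?case by blast
  qed
  have d: "((deriv ^^ k) g has_real_derivative (deriv ^^ Suc k) g t) (at t)" for k t
  proof -
    obtain q m where e: "(deriv ^^ k) g = (\<lambda>t. poly q t * bell b t ^ m)" using * by blast
    have "\<exists>D. ((deriv ^^ k) g has_real_derivative D) (at t)" unfolding e using rational_derivative by blast
    then show ?thesis by (auto simp: DERIV_deriv_iff_real_differentiable real_differentiable_def)
  qed
  have ev: "(deriv ^^ 0) g (- t) = (deriv ^^ 0) g t" for t unfolding g_def bell_def by (simp add: even)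
  from real_derivatives_even01[where h = "\<lambda>k. (deriv ^^ k) g", OF d ev]
  show "(\<lambda>t. complex_of_real (g t)) \<in> smooth_even01"
    and "t \<in> {0..1} \<Longrightarrow> (deriv01 ^^ k) (\<lambda>t. complex_of_real (g t)) t = of_real ((deriv ^^ k) g t)"
    by simp_all
qed

text \<open>The four constants cover both components of the eigenfunction as well as the second
  component of its image under L0, to which the potential contributes one more power of the
  denominator.\<close>

lemma bell_sobolev:
  fixes T :: "'n::finite itself"
  shows "sobolev k (unit_ball T) (radial_lift T (\<lambda>t. complex_of_real (((c0 + c1 * (t * t)) + (c2 + c3 * (t * t)) * bell b t) * bell b t ^ n)))"
proof -
  define s where "s x = (\<Sum>i\<in>UNIV. x $ i * x $ i)" for x :: "real ^ 'n"
  have s: "s x = norm x * norm x" for x unfolding s_def by (rule sum_sq_eq_norm_sq)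
  have sm: "smooth s" unfolding s_def[abs_def] by (intro smooth_sum smooth_mult smooth_coord) auto
  have I: "smooth (\<lambda>x. 1 / (s x + b))"
    by (rule smooth_reciprocal[OF smooth_add[OF sm smooth_const]]) (use bell_denominator in \<open>simp add: s less_imp_neq[symmetric]\<close>)
  have pw: "smooth (\<lambda>x. (1 / (s x + b)) ^ n)" by (induction n) (simp_all only: power_0 power_Suc smooth_const smooth_mult[OF I])
  have "smooth (\<lambda>x. ((c0 + c1 * s x) + (c2 + c3 * s x) * (1 / (s x + b))) * (1 / (s x + b)) ^ n)"
    by (intro smooth_mult[OF _ pw] smooth_add smooth_mult[OF _ I] smooth_mult[OF smooth_const sm] smooth_const)
  from sobolev_smooth[OF open_ball bounded_ball this]
  show ?thesis unfolding radial_lift_def[abs_def] bell_def s .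
qed

end

text \<open>The eigenvalue 1 is caused by the freedom of choosing the blowup time.\<close>

lemma one_eigenvalue:
  fixes T :: "'n::finite itself"
  assumes d: "d \<ge> 5"
  shows "1 \<in> point_spectrum T (L_graph T d)"
proof -
  define b where "b = beta d"
  have b: "b > 0" unfolding b_def using beta_pos[OF d] by simp
  define I where "I = bell b"
  have I: "(t * t + b) * I t = 1" for t unfolding I_def bell_def using bell_denominator[OF b, of t] by simp
  note dI = bell_derivative[OF b, folded I_def]
  define A where "A = 12 * b\<^sup>2 + 4 * (real d + 2) * b"
  define B where "B = 12 * b + 16 - 4 * real d"
  have V: "V d t = (A - B * (t * t)) * (I t * I t)" for t
  proof -
    have "(t * t + b) * (t * t + b) * V d t = A - B * (t * t)"
      using V_beta[OF d, of t] unfolding b_def[symmetric] A_def B_def by (simp add: power2_eq_square)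
    then have "((t * t + b) * I t) * ((t * t + b) * I t) * V d t = (A - B * (t * t)) * (I t * I t)" by (simp add: mult_ac)
    then show ?thesis unfolding I by simp
  qed
  define g1 where "g1 t = poly 1 t * I t ^ 2" for t
  \<comment> \<open>Forced by the first component of the equation at z = 1: g2 = t g1' + 3
    g1.\<close>
  define g2 where "g2 t = poly [:3 * b, 0, -1:] t * I t ^ 3" for t
  have g1: "g1 = (\<lambda>t. I t * I t)" unfolding g1_def[abs_def] by (simp add: power2_eq_square)
  have g2: "g2 = (\<lambda>t. (3 * b - t * t) * (I t * (I t * I t)))" unfolding g2_def[abs_def] by (simp add: power3_eq_cube mult.assoc)
  define u1 where "u1 t = complex_of_real (g1 t)" for t
  define u2 where "u2 t = complex_of_real (g2 t)" for t
  \<comment> \<open>The second component that L0 has to produce in order that adding V u1 gives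
    u2.\<close>
  define f2 where "f2 t = complex_of_real (g2 t - V d t * g1 t)" for t
  have even: "poly (1 :: real poly) (- t) = poly 1 t" "poly [:3 * b, 0, -1:] (- t) = poly [:3 * b, 0, -1:] t" for t by simp_all
  note r1 = rational_even01[OF b, where p = 1 and n = 2, folded I_def, folded g1_def, folded u1_def, OF even(1)]
  note r2 = rational_even01[OF b, where p = "[:3 * b, 0, -1:]" and n = 3, folded I_def, folded g2_def, folded u2_def, OF even(2)]
  have D1: "deriv g1 = (\<lambda>t. - 4 * t * (I t * (I t * I t)))"
    unfolding g1 by (intro ext DERIV_imp_deriv) (auto intro!: derivative_eq_intros dI)
  have D2: "deriv (deriv g1) = (\<lambda>t. - 4 * (I t * (I t * I t)) + 24 * (t * t) * (I t * (I t * (I t * I t))))"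
    unfolding D1 by (intro ext DERIV_imp_deriv) (auto intro!: derivative_eq_intros dI simp: algebra_simps)
  have D3: "deriv g2 = (\<lambda>t. - 2 * t * (I t * (I t * I t)) - 6 * t * (3 * b - t * t) * (I t * (I t * (I t * I t))))"
    unfolding g2 by (intro ext DERIV_imp_deriv) (auto intro!: derivative_eq_intros dI simp: algebra_simps)
  have dv: "deriv01 u1 t = of_real (deriv g1 t)" "deriv01 (deriv01 u1) t = of_real (deriv (deriv g1) t)" "deriv01 u2 t = of_real (deriv g2 t)"
    if "t \<in> {0..1}" for t
    using r1(2)[OF that, of 1] r1(2)[OF that, of 2] r2(2)[OF that, of 1] by (simp_all add: numeral_2_eq_2)
  have su: "sobolev k (unit_ball T) (radial_lift T u1)" "sobolev k (unit_ball T) (radial_lift T u2)" "sobolev k (unit_ball T) (radial_lift T f2)" for k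
  proof -
    have "u1 = (\<lambda>t. complex_of_real (((1 + 0 * (t * t)) + (0 + 0 * (t * t)) * I t) * I t ^ 2))"
      unfolding u1_def[abs_def] g1 by (simp add: power2_eq_square)
    then show "sobolev k (unit_ball T) (radial_lift T u1)" unfolding I_def by (simp only: bell_sobolev[OF b])
    have "u2 = (\<lambda>t. complex_of_real (((3 * b + (- 1) * (t * t)) + (0 + 0 * (t * t)) * I t) * I t ^ 3))"
      unfolding u2_def[abs_def] g2 by (simp add: power3_eq_cube mult.assoc)
    then show "sobolev k (unit_ball T) (radial_lift T u2)" unfolding I_def by (simp only: bell_sobolev[OF b])
    have "g2 t - V d t * g1 t = ((3 * b + (- 1) * (t * t)) + (- A + B * (t * t)) * I t) * I t ^ 3" for t
      unfolding g1 g2 V by (simp add: power3_eq_cube algebra_simps)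
    then have "f2 = (\<lambda>t. complex_of_real (((3 * b + (- 1) * (t * t)) + (- A + B * (t * t)) * I t) * I t ^ 3))"
      unfolding f2_def[abs_def] by (simp only:)
    then show "sobolev k (unit_ball T) (radial_lift T f2)" unfolding I_def by (simp only: bell_sobolev[OF b])
  qed
  have eq1: "fst (L0_tilde d (u1, u2)) t = u1 t" if "t \<in> {0<..<1}" for t
  proof -
    have t: "t \<in> {0..1}" using that by auto
    have "g2 t - t * deriv g1 t - 2 * g1 t = g1 t"
    proof -
      \<comment> \<open>Stated for arbitrary i: the difference is a multiple of (t^2 + b) i - 1,
        which vanishes for i = I t.\<close>
      have "(3 * b - t * t) * (i * (i * i)) - t * (- 4 * t * (i * (i * i))) - 2 * (i * i) - i * i = 3 * (((t * t + b) * i) * (i * i) - i * i)" for i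
        by (simp add: algebra_simps)
      from this[of "I t"] show ?thesis unfolding D1 unfolding g1 g2 I by simp
    qed
    then have "of_real (g2 t - t * deriv g1 t - 2 * g1 t) = u1 t" unfolding u1_def by simp
    then show ?thesis unfolding L0_tilde_def by (simp add: dv[OF t] u1_def u2_def)
  qed
  have eq2: "snd (L0_tilde d (u1, u2)) t = f2 t" if "t \<in> {0<..<1}" for t
  proof -
    have t: "t \<in> {0..1}" "t \<noteq> 0" using that by auto
    have "deriv (deriv g1) t + (real d + 1) / t * deriv g1 t - t * deriv g2 t - 3 * g2 t = g2 t - V d t * g1 t"
    proof -
      have c: "(real d + 1) / t * (- 4 * t * x) = - 4 * (real d + 1) * x" for x using t by (simp add: field_simps)
      have "(- 4 * (i * (i * i)) + 24 * (t * t) * (i * (i * (i * i)))) + (- 4 * (real d + 1) * (i * (i * i)))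
          - t * (- 2 * t * (i * (i * i)) - 6 * t * (3 * b - t * t) * (i * (i * (i * i)))) - 3 * ((3 * b - t * t) * (i * (i * i)))
        - ((3 * b - t * t) * (i * (i * i)) - ((A - B * (t * t)) * (i * i)) * (i * i))
        = (- 4 * (real d + 2) - 12 * b + 6 * (t * t)) * ((i * (i * i)) - ((t * t + b) * i) * (i * (i * i)))" for i
        unfolding A_def B_def by (simp add: algebra_simps power2_eq_square)
      from this[of "I t"] show ?thesis unfolding D2 D3 unfolding D1 unfolding g1 g2 V c I by simp
    qed
    moreover have "snd (L0_tilde d (u1, u2)) t = of_real (deriv (deriv g1) t + (real d + 1) / t * deriv g1 t - t * deriv g2 t - 3 * g2 t)"
      unfolding L0_tilde_def by (simp add: dv[OF t(1)] u2_def)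
    ultimately show ?thesis unfolding f2_def by (simp only:)
  qed
  have norm0: "radial_sobolev_norm T k (\<lambda>\<rho>. g \<rho> - f \<rho>) = 0"
    if "square_integrable (unit_ball T) (radial_lift T g)" "square_integrable (unit_ball T) (radial_lift T f)" "\<And>t. t \<in> {0<..<1} \<Longrightarrow> g t = f t" for k f g
    unfolding radial_sobolev_norm_def
  proof (rule sobolev_norm_zero[OF open_ball bounded_ball])
    show "radial_lift T (\<lambda>\<rho>. g \<rho> - f \<rho>) \<in> borel_measurable (lebesgue_on (unit_ball T))"
      using square_integrable_lift_diff[OF that(1,2)] unfolding square_integrable_def by (rule conjunct1)
    show "AE x in lebesgue_on (unit_ball T). radial_lift T (\<lambda>\<rho>. g \<rho> - f \<rho>) x = 0"
      unfolding radial_lift_def by (rule AE_radial) (use that(3) in simp)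
  qed
  note sq = su[THEN sobolev_square]
  have u: "(u1, u2) \<in> energy_space T d" "(u1, f2) \<in> energy_space T d"
    unfolding energy_space_def radial_sobolev_def using su by simp_all
  have d0: "energy_dist T d (u1, u2) (u1, u2) = 0"
    unfolding energy_dist_def fst_conv snd_conv norm0[OF sq(1) sq(1) refl] norm0[OF sq(2) sq(2) refl] by simp
  have sqL: "square_integrable (unit_ball T) (radial_lift T (fst (L0_tilde d (u1, u2))))"
  proof (rule bcont_square_integrable)
    have "bcont (\<lambda>r. u2 r - of_real r * deriv01 u1 r - 2 * u1 r)"
      by (intro bcont_minus bcont_mult bcont_smooth bcont_const bcont_of_real continuous_intros r1(1) r2(1))
    then show "bcont (fst (L0_tilde d (u1, u2)))" unfolding L0_tilde_def by simp
  qed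
  have nL: "radial_sobolev_norm T k (\<lambda>\<rho>. fst (L0_tilde d (u1, u2)) \<rho> - u1 \<rho>) = 0"
    "radial_sobolev_norm T k (\<lambda>\<rho>. snd (L0_tilde d (u1, u2)) \<rho> - f2 \<rho>) = 0" for k
    by (rule norm0[OF sqL sq(1)], erule eq1)
      (rule norm0[OF bcont_square_integrable[OF bcont_L0_snd[OF r1(1) r2(1)]] sq(3)], erule eq2)
  have dL: "energy_dist T d (L0_tilde d (u1, u2)) (u1, f2) = 0"
    unfolding energy_dist_def fst_conv snd_conv nL by simp
  \<comment> \<open>The eigenfunction itself is smooth and even, so a constant sequence approximates
    it. \<open>L0_tilde\<close> of it is compared with (u1, f2) on (0,1) only, which is why the
    distances, not the functions, were shown to match.\<close>
  have "((u1, u2), (u1, f2)) \<in> L0_graph T d"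
    unfolding L0_graph_def using u d0 dL r1(1) r2(1)
    by (intro CollectI case_prodI conjI exI[of _ "\<lambda>m. (u1, u2)"]) auto
  then have g: "((u1, u2), (\<lambda>\<rho>. u1 \<rho> + 0, \<lambda>\<rho>. f2 \<rho> + of_real (V d \<rho>) * u1 \<rho>)) \<in> L_graph T d"
    unfolding L_graph_def L_prime_def by force
  have e: "energy_eq T (\<lambda>\<rho>. u1 \<rho> + 0, \<lambda>\<rho>. f2 \<rho> + of_real (V d \<rho>) * u1 \<rho>) (\<lambda>\<rho>. 1 * fst (u1, u2) \<rho>, \<lambda>\<rho>. 1 * snd (u1, u2) \<rho>)"
    unfolding energy_eq_def radial_lift_def by (intro AE_I2) (simp add: f2_def u1_def u2_def)
  have "\<not> energy_eq T (u1, u2) (\<lambda>\<rho>. 0, \<lambda>\<rho>. 0)"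
  proof
    assume "energy_eq T (u1, u2) (\<lambda>\<rho>. 0, \<lambda>\<rho>. 0)"
    then have "AE x in lebesgue_on (unit_ball T). radial_lift T u1 x = radial_lift T (\<lambda>r. 0) x"
      unfolding energy_eq_def by (auto elim: eventually_mono)
    then have ae: "AE x in lebesgue_on (unit_ball T). radial_lift T (\<lambda>r. 0) x = radial_lift T u1 x"
      by (rule eventually_mono) simp
    \<comment> \<open>The infimum of u1 on (0,1), approached at the light cone.\<close>
    define K where "K = 1 / ((1 + b) * (1 + b))"
    have K: "K > 0" unfolding K_def using b by simp
    have "K\<^sup>2 * (ball_vol T * (1 ^ CARD('n) - 0 ^ CARD('n))) \<le> L2norm2 T (\<lambda>r. 0)"
    proof (rule L2_shell[OF _ ae])
      show "square_integrable (unit_ball T) (radial_lift T (\<lambda>r. 0))" by (rule bcont_square_integrable[OF bcont_const])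
      fix r :: real assume r: "0 < r" "r < 1"
      have "r * r < 1 * 1" using r by (intro mult_strict_mono) auto
      then have "K \<le> 1 / ((r * r + b) * (r * r + b))"
        unfolding K_def using b bell_denominator[OF b, of r] by (intro divide_left_mono mult_mono mult_pos_pos) auto
      then show "K \<le> cmod (u1 r)" unfolding u1_def g1 I_def bell_def norm_of_real by simp
    qed (use K in auto)
    moreover have "(0 :: real) ^ CARD('n) = 0" by (rule zero_power) (rule zero_less_card_finite)
    ultimately show False using K ball_vol_pos[where 'n = 'n] by (simp add: L2norm2_def radial_lift_def mult_le_0_iff not_le)
  qed
  then show ?thesis unfolding point_spectrum_def using g e by blast
qed

theorem proposition3p2:
  fixes d :: nat
  assumes "odd d" and "d \<ge> 5" and "CARD('n::finite) = d + 2"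
  shows "point_spectrum TYPE('n) (L_graph TYPE('n) d) \<inter> {z. Re z \<ge> 0} = {1}"
proof -
  have "z = 1" if z: "z \<in> point_spectrum TYPE('n) (L_graph TYPE('n) d)" "Re z \<ge> 0" for z
  proof (rule ccontr)
    assume "z \<noteq> 1"
    then interpret mode d z using assms(1,2) z(2) by unfold_locales
    show False using z(1) no_mode[OF assms(3)] unfolding point_spectrum_def by blast
  qed
  moreover have "1 \<in> point_spectrum TYPE('n) (L_graph TYPE('n) d)" by (rule one_eigenvalue[OF assms(2)])
  ultimately show ?thesis by auto
qed

end
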